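(* Let $\mathcal A$ be a (unital) $K$-algebra which is a direct product $\prod_{g\in\Lambda}\mathcal A_g$ of indecomposable unital rings, let $\alpha$ be a unital partial action of a group $G$ on $\mathcal A$, and let $(\mathcal B,\beta)$ be an enveloping action of $(\mathcal A,\alpha)$. Then for every $n\ge 0$ the group $H^n_{par}(G,\mathcal A)$ is isomorphic to the classical cohomology group $H^n(G,\mathcal M(\mathcal B))$ of $G$ with values in the additive group of the multiplier algebra $\mathcal M(\mathcal B)$, on which $G$ acts by $\beta^*$.
   Context: $K$ is a commutative unital ring; algebras are associative $K$-algebras, not necessarily commutative. A unital ring is indecomposable if it is nonzero and its only central idempotents are $0$ and $1$. A partial action $\alpha$ of $G$ on an algebra $\mathcal A$ is a family of two-sided ideals $\mathcal D_g$ of $\mathcal A$ and algebra isomorphisms $\alpha_g:\mathcal D_{g^{-1}}\to\mathcal D_g$ ($g\in G$) such that $\alpha_1=\mathrm{id}_{\mathcal A}$, and whenever $a\in\mathcal D_{h^{-1}}$ and $\alpha_h(a)\in\mathcal D_{g^{-1}}$, then $a\in\mathcal D_{(gh)^{-1}}$ and $\alpha_g(\alpha_h(a))=\alpha_{gh}(a)$. It is unital if $\mathcal D_g=1_g\mathcal A$ for a central idempotent $1_g$ of $\mathcal A$, for each $g\in G$. An enveloping action of $(\mathcal A,\alpha)$ is a (global) action $\beta$ of $G$ by automorphisms on an algebra $\mathcal B$ (possibly without $1$) together with an injective algebra homomorphism $\varphi:\mathcal A\to\mathcal B$ such that: $\varphi(\mathcal A)$ is a two-sided ideal of $\mathcal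 B$; $\mathcal B=\sum_{g\in G}\beta_g(\varphi(\mathcal A))$; $\varphi(\mathcal D_g)=\varphi(\mathcal A)\cap\beta_g(\varphi(\mathcal A))$; and $\varphi\circ\alpha_g=\beta_g\circ\varphi$ on $\mathcal D_{g^{-1}}$. The multiplier algebra is $\mathcal M(\mathcal B)=\{(R,L)\in\mathrm{End}({}_{\mathcal B}\mathcal B)\times\mathrm{End}(\mathcal B_{\mathcal B}) : (aR)b=a(Lb)\ \forall a,b\in\mathcal B\}$ with componentwise operations (left module maps are written on the right). $G$ acts on it by $\beta^*_g(u)=\beta_g u\beta_g^{-1}$ (conjugating both components by $\beta_g$). $\mathcal S(G)$ is the monoid generated by symbols $[g]$, $g\in G$, with relations $[g^{-1}][g][h]=[g^{-1}][gh]$, $[g][h][h^{-1}]=[gh][h^{-1}]$, $[g][1_G]=[g]$ (so $[1_G]$ is the identity); it is an inverse monoid, $s^{-1}$ denotes the inverse of $s$ and $E(\mathcal S(G))$ its semilattice of idempotents. The partial group algebra is the semigroup algebra $K_{\mathrm{par}}(G)=K\mathcal S(G)$. $B=KE(\mathcal S(G))$ is the left $K_{\mathrm{par}}(G)$-module with $s\cdot e=ses^{-1}$ for $s\in\mathcal S(G)$, $e\in E(\mathcal S(G))$. For a left $K_{\mathrm{par}}(G)$-module $M$, $H^n_{par}(G,M)=\mathrm{Ext}^n_{K_{\mathrm{par}}(G)}(B,M)$ (the cohomology of Alvares, Alves and Redondo). The algebra $\mathcal A$ is a $K_{\mathrm{par}}(G)$-module via $[g]\cdot a=\alpha_g(1_{g^{-1}}a)$.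 *)

theory Defs
  imports "HOL-Algebra.QuotRing" "HOL-Algebra.Module"
begin

section \<open>Algebras, indecomposable rings and direct products\<close>

text \<open>The unit of the record \<open>A\<close> is not constrained here, so this is an algebra possibly without
  unit; \<open>algebra\<close> of HOL-Algebra is commutative.\<close>

locale assoc_algebra = module K A for K and A (structure) +
  assumes alg_m_closed: "\<lbrakk>x \<in> carrier A; y \<in> carrier A\<rbrakk> \<Longrightarrow> x \<otimes> y \<in> carrier A"
    and alg_m_assoc: "\<lbrakk>x \<in> carrier A; y \<in> carrier A; z \<in> carrier A\<rbrakk>
      \<Longrightarrow> (x \<otimes> y) \<otimes> z = x \<otimes> (y \<otimes> z)"
    and alg_l_distr: "\<lbrakk>x \<in> carrier A; y \<in> carrier A; z \<in> carrier A\<rbrakk>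
      \<Longrightarrow> (x \<oplus> y) \<otimes> z = x \<otimes> z \<oplus> y \<otimes> z"
    and alg_r_distr: "\<lbrakk>x \<in> carrier A; y \<in> carrier A; z \<in> carrier A\<rbrakk>
      \<Longrightarrow> z \<otimes> (x \<oplus> y) = z \<otimes> x \<oplus> z \<otimes> y"
    and alg_smult_left: "\<lbrakk>k \<in> carrier K; x \<in> carrier A; y \<in> carrier A\<rbrakk>
      \<Longrightarrow> (k \<odot> x) \<otimes> y = k \<odot> (x \<otimes> y)"
    and alg_smult_right: "\<lbrakk>k \<in> carrier K; x \<in> carrier A; y \<in> carrier A\<rbrakk>
      \<Longrightarrow> x \<otimes> (k \<odot> y) = k \<odot> (x \<otimes> y)"

locale unital_assoc_algebra = assoc_algebra K A + ring A for K and A (structure)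

definition algebra_hom_on ::
  "'k ring \<Rightarrow> ('k, 'a) module \<Rightarrow> 'a set \<Rightarrow> ('k, 'b) module \<Rightarrow> ('a \<Rightarrow> 'b) \<Rightarrow> bool" where
  "algebra_hom_on K A D B f \<longleftrightarrow>
     (\<forall>x\<in>D. f x \<in> carrier B) \<and>
     (\<forall>x\<in>D. \<forall>y\<in>D. f (x \<oplus>\<^bsub>A\<^esub> y) = f x \<oplus>\<^bsub>B\<^esub> f y) \<and>
     (\<forall>x\<in>D. \<forall>y\<in>D. f (x \<otimes>\<^bsub>A\<^esub> y) = f x \<otimes>\<^bsub>B\<^esub> f y) \<and>
     (\<forall>k\<in>carrier K. \<forall>x\<in>D. f (k \<odot>\<^bsub>A\<^esub> x) = k \<odot>\<^bsub>B\<^esub> f x)"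

definition two_sided_ideal :: "'k ring \<Rightarrow> ('k, 'a) module \<Rightarrow> 'a set \<Rightarrow> bool" where
  "two_sided_ideal K A I \<longleftrightarrow>
     I \<subseteq> carrier A \<and> \<zero>\<^bsub>A\<^esub> \<in> I \<and>
     (\<forall>x\<in>I. \<forall>y\<in>I. x \<oplus>\<^bsub>A\<^esub> y \<in> I) \<and>
     (\<forall>k\<in>carrier K. \<forall>x\<in>I. k \<odot>\<^bsub>A\<^esub> x \<in> I) \<and>
     (\<forall>x\<in>I. \<forall>a\<in>carrier A. a \<otimes>\<^bsub>A\<^esub> x \<in> I \<and> x \<otimes>\<^bsub>A\<^esub> a \<in> I)"

definition central_idempotents :: "('a, 'x) ring_scheme \<Rightarrow> 'a set" where
  "central_idempotents A =
     {e \<in> carrier A. e \<otimes>\<^bsub>A\<^esub> e = e \<and> (\<forall>a\<in>carrier A. e \<otimes>\<^bsub>A\<^esub> a = a \<otimes>\<^bsub>A\<^esub> e)}"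

definition indecomposable_ring :: "('a, 'x) ring_scheme \<Rightarrow> bool" where
  "indecomposable_ring A \<longleftrightarrow>
     ring A \<and> \<one>\<^bsub>A\<^esub> \<noteq> \<zero>\<^bsub>A\<^esub> \<and> central_idempotents A = {\<zero>\<^bsub>A\<^esub>, \<one>\<^bsub>A\<^esub>}"

definition ring_product :: "'i set \<Rightarrow> ('i \<Rightarrow> ('a, 'x) ring_scheme) \<Rightarrow> ('i \<Rightarrow> 'a) ring" where
  "ring_product \<Lambda> A =
     \<lparr>carrier = (\<Pi>\<^sub>E i\<in>\<Lambda>. carrier (A i)),
      mult = (\<lambda>x y. \<lambda>i\<in>\<Lambda>. x i \<otimes>\<^bsub>A i\<^esub> y i),
      one = (\<lambda>i\<in>\<Lambda>. \<one>\<^bsub>A i\<^esub>),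
      zero = (\<lambda>i\<in>\<Lambda>. \<zero>\<^bsub>A i\<^esub>),
      add = (\<lambda>x y. \<lambda>i\<in>\<Lambda>. x i \<oplus>\<^bsub>A i\<^esub> y i)\<rparr>"


section \<open>Partial actions, enveloping actions, multipliers\<close>

locale partial_action = alg: unital_assoc_algebra K A + grp: group G
  for K :: "'k ring" and A :: "('k, 'a) module" and G :: "'g monoid" +
  fixes D :: "'g \<Rightarrow> 'a set" and \<alpha> :: "'g \<Rightarrow> 'a \<Rightarrow> 'a"
  assumes ideal_D: "g \<in> carrier G \<Longrightarrow> two_sided_ideal K A (D g)"
    and hom_\<alpha>: "g \<in> carrier G \<Longrightarrow> algebra_hom_on K A (D (inv\<^bsub>G\<^esub> g)) A (\<alpha> g)"
    and bij_\<alpha>: "g \<in> carrier G \<Longrightarrow> bij_betw (\<alpha> g) (D (inv\<^bsub>G\<^esub> g)) (D g)"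
    and D_one: "D \<one>\<^bsub>G\<^esub> = carrier A"
    and \<alpha>_one: "a \<in> carrier A \<Longrightarrow> \<alpha> \<one>\<^bsub>G\<^esub> a = a"
    and D_comp: "\<lbrakk>g \<in> carrier G; h \<in> carrier G; a \<in> D (inv\<^bsub>G\<^esub> h); \<alpha> h a \<in> D (inv\<^bsub>G\<^esub> g)\<rbrakk>
      \<Longrightarrow> a \<in> D (inv\<^bsub>G\<^esub> (g \<otimes>\<^bsub>G\<^esub> h))"
    and \<alpha>_comp: "\<lbrakk>g \<in> carrier G; h \<in> carrier G; a \<in> D (inv\<^bsub>G\<^esub> h); \<alpha> h a \<in> D (inv\<^bsub>G\<^esub> g)\<rbrakk>
      \<Longrightarrow> \<alpha> g (\<alpha> h a) = \<alpha> (g \<otimes>\<^bsub>G\<^esub> h) a"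

text \<open>\<open>u g\<close> is the central idempotent usually written \<open>1_g\<close>; it is determined by the ideal \<open>D g\<close>,
  of which it is the unit.\<close>

locale unital_partial_action = partial_action K A G D \<alpha>
  for K :: "'k ring" and A :: "('k, 'a) module" and G :: "'g monoid"
    and D :: "'g \<Rightarrow> 'a set" and \<alpha> :: "'g \<Rightarrow> 'a \<Rightarrow> 'a" +
  fixes u :: "'g \<Rightarrow> 'a"
  assumes central_u: "g \<in> carrier G \<Longrightarrow> u g \<in> central_idempotents A"
    and D_eq: "g \<in> carrier G \<Longrightarrow> D g = {u g \<otimes>\<^bsub>A\<^esub> a |a. a \<in> carrier A}"

locale global_action = alg: assoc_algebra K B + grp: group G
  for K :: "'k ring" and B :: "('k, 'b) module" and G :: "'g monoid" +
  fixes \<beta> :: "'g \<Rightarrow> 'b \<Rightarrow> 'b"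
  assumes hom_\<beta>: "g \<in> carrier G \<Longrightarrow> algebra_hom_on K B (carrier B) B (\<beta> g)"
    and bij_\<beta>: "g \<in> carrier G \<Longrightarrow> bij_betw (\<beta> g) (carrier B) (carrier B)"
    and \<beta>_one: "b \<in> carrier B \<Longrightarrow> \<beta> \<one>\<^bsub>G\<^esub> b = b"
    and \<beta>_comp: "\<lbrakk>g \<in> carrier G; h \<in> carrier G; b \<in> carrier B\<rbrakk>
      \<Longrightarrow> \<beta> g (\<beta> h b) = \<beta> (g \<otimes>\<^bsub>G\<^esub> h) b"

locale enveloping_action = pa: partial_action K A G D \<alpha> + ga: global_action K B G \<beta>
  for K :: "'k ring" and A :: "('k, 'a) module" and G :: "'g monoid"
    and D :: "'g \<Rightarrow> 'a set" and \<alpha> :: "'g \<Rightarrow> 'a \<Rightarrow> 'a"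
    and B :: "('k, 'b) module" and \<beta> :: "'g \<Rightarrow> 'b \<Rightarrow> 'b" +
  fixes \<phi> :: "'a \<Rightarrow> 'b"
  assumes hom_\<phi>: "algebra_hom_on K A (carrier A) B \<phi>"
    and inj_\<phi>: "inj_on \<phi> (carrier A)"
    and ideal_\<phi>: "two_sided_ideal K B (\<phi> ` carrier A)"
    and sum_\<phi>: "b \<in> carrier B \<Longrightarrow>
      \<exists>F c. finite F \<and> F \<subseteq> carrier G \<and> c \<in> F \<rightarrow> carrier A \<and>
        b = (\<Oplus>\<^bsub>B\<^esub>g\<in>F. \<beta> g (\<phi> (c g)))"
    and image_D: "g \<in> carrier G \<Longrightarrow> \<phi> ` D g = \<phi> ` carrier A \<inter> \<beta> g ` \<phi> ` carrier A"
    and equivariant: "\<lbrakk>g \<in> carrier G; a \<in> D (inv\<^bsub>G\<^esub> g)\<rbrakk> \<Longrightarrow> \<phi> (\<alpha> g a) = \<beta> g (\<phi> a)"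

text \<open>A multiplier is a pair \<open>(R, L)\<close>. The value \<open>b R\<close> of the left module endomorphism \<open>R\<close>,
  written on the right in the literature, is \<open>R b\<close> here; accordingly the product of \<open>R\<close> and \<open>R'\<close>
  applies \<open>R\<close> first. Endomorphisms are understood in the category of modules over a
  \<open>K\<close>-algebra, hence are \<open>K\<close>-linear.\<close>

definition linear_endos :: "'k ring \<Rightarrow> ('k, 'b) module \<Rightarrow> ('b \<Rightarrow> 'b) set" where
  "linear_endos K B = {f \<in> carrier B \<rightarrow>\<^sub>E carrier B.
     (\<forall>x\<in>carrier B. \<forall>y\<in>carrier B. f (x \<oplus>\<^bsub>B\<^esub> y) = f x \<oplus>\<^bsub>B\<^esub> f y) \<and>
     (\<forall>k\<in>carrier K. \<forall>x\<in>carrier B. f (k \<odot>\<^bsub>B\<^esub> x) = k \<odot>\<^bsub>B\<^esub> f x)}"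

definition multiplier_algebra ::
  "'k ring \<Rightarrow> ('k, 'b) module \<Rightarrow> ('k, ('b \<Rightarrow> 'b) \<times> ('b \<Rightarrow> 'b)) module" where
  "multiplier_algebra K B =
     \<lparr>carrier = {(R, L). R \<in> linear_endos K B \<and> L \<in> linear_endos K B \<and>
        (\<forall>a\<in>carrier B. \<forall>b\<in>carrier B. R (a \<otimes>\<^bsub>B\<^esub> b) = a \<otimes>\<^bsub>B\<^esub> R b) \<and>
        (\<forall>a\<in>carrier B. \<forall>b\<in>carrier B. L (a \<otimes>\<^bsub>B\<^esub> b) = L a \<otimes>\<^bsub>B\<^esub> b) \<and>
        (\<forall>a\<in>carrier B. \<forall>b\<in>carrier B. R a \<otimes>\<^bsub>B\<^esub> b = a \<otimes>\<^bsub>B\<^esub> L b)},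
      mult = (\<lambda>(R, L) (R', L'). (\<lambda>b\<in>carrier B. R' (R b), \<lambda>b\<in>carrier B. L (L' b))),
      one = (\<lambda>b\<in>carrier B. b, \<lambda>b\<in>carrier B. b),
      zero = (\<lambda>b\<in>carrier B. \<zero>\<^bsub>B\<^esub>, \<lambda>b\<in>carrier B. \<zero>\<^bsub>B\<^esub>),
      add = (\<lambda>(R, L) (R', L').
        (\<lambda>b\<in>carrier B. R b \<oplus>\<^bsub>B\<^esub> R' b, \<lambda>b\<in>carrier B. L b \<oplus>\<^bsub>B\<^esub> L' b)),
      smult = (\<lambda>k (R, L). (\<lambda>b\<in>carrier B. k \<odot>\<^bsub>B\<^esub> R b, \<lambda>b\<in>carrier B. k \<odot>\<^bsub>B\<^esub> L b))\<rparr>"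

definition multiplier_action ::
  "('k, 'b) module \<Rightarrow> ('g \<Rightarrow> 'b \<Rightarrow> 'b) \<Rightarrow> 'g \<Rightarrow>
     ('b \<Rightarrow> 'b) \<times> ('b \<Rightarrow> 'b) \<Rightarrow> ('b \<Rightarrow> 'b) \<times> ('b \<Rightarrow> 'b)" where
  "multiplier_action B \<beta> g = (\<lambda>(R, L).
     (\<lambda>b\<in>carrier B. \<beta> g (R (inv_into (carrier B) (\<beta> g) b)),
      \<lambda>b\<in>carrier B. \<beta> g (L (inv_into (carrier B) (\<beta> g) b))))"


section \<open>Cohomology of complexes; group cohomology\<close>

text \<open>\<open>d n\<close> maps \<open>C n\<close> to \<open>C (Suc n)\<close>. The groups \<open>C n\<close> are written multiplicatively, as always in
  \<^theory>\<open>HOL-Algebra.Group\<close>, although they are additive groups below.\<close>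

definition cohomology :: "(nat \<Rightarrow> 'c monoid) \<Rightarrow> (nat \<Rightarrow> 'c \<Rightarrow> 'c) \<Rightarrow> nat \<Rightarrow> 'c set monoid" where
  "cohomology C d n =
     (C n)\<lparr>carrier := kernel (C n) (C (Suc n)) (d n)\<rparr> Mod
       (case n of 0 \<Rightarrow> {\<one>\<^bsub>C 0\<^esub>} | Suc m \<Rightarrow> d m ` carrier (C m))"

text \<open>Inhomogeneous cochains; a list of length \<open>n\<close> stands for an element of \<open>G^n\<close>.\<close>

definition tuples :: "'g monoid \<Rightarrow> nat \<Rightarrow> 'g list set" where
  "tuples G n = {l \<in> lists (carrier G). length l = n}"

definition cochain_group :: "'g monoid \<Rightarrow> ('m, 'x) ring_scheme \<Rightarrow> nat \<Rightarrow> ('g list \<Rightarrow> 'm) monoid" where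
  "cochain_group G M n =
     \<lparr>carrier = tuples G n \<rightarrow>\<^sub>E carrier M,
      mult = (\<lambda>f f'. \<lambda>l\<in>tuples G n. f l \<oplus>\<^bsub>M\<^esub> f' l),
      one = (\<lambda>l\<in>tuples G n. \<zero>\<^bsub>M\<^esub>)\<rparr>"

definition merge :: "'g monoid \<Rightarrow> nat \<Rightarrow> 'g list \<Rightarrow> 'g list" where
  "merge G i l = take i l @ (l ! i \<otimes>\<^bsub>G\<^esub> l ! Suc i) # drop (i + 2) l"

definition coboundary ::
  "'g monoid \<Rightarrow> ('m, 'x) ring_scheme \<Rightarrow> ('g \<Rightarrow> 'm \<Rightarrow> 'm) \<Rightarrow> nat \<Rightarrow> ('g list \<Rightarrow> 'm) \<Rightarrow> 'g list \<Rightarrow> 'm" where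
  "coboundary G M act n f = (\<lambda>l\<in>tuples G (Suc n).
     act (hd l) (f (tl l))
     \<oplus>\<^bsub>M\<^esub> (\<Oplus>\<^bsub>M\<^esub>i\<in>{..<n}. [((-1::int) ^ Suc i)] \<cdot>\<^bsub>M\<^esub> f (merge G i l))
     \<oplus>\<^bsub>M\<^esub> [((-1::int) ^ Suc n)] \<cdot>\<^bsub>M\<^esub> f (butlast l))"

definition group_cohomology ::
  "'g monoid \<Rightarrow> ('m, 'x) ring_scheme \<Rightarrow> ('g \<Rightarrow> 'm \<Rightarrow> 'm) \<Rightarrow> nat \<Rightarrow> ('g list \<Rightarrow> 'm) set monoid" where
  "group_cohomology G M act = cohomology (cochain_group G M) (coboundary G M act)"


section \<open>Left modules over a noncommutative ring and Ext\<close>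

text \<open>Left modules are given by the records of \<^theory>\<open>HOL-Algebra.Module\<close>, whose multiplication and
  unit are not used. An element of the free module on \<open>X\<close> is its family of coefficients, extended
  by zero outside \<open>X\<close>.\<close>

definition free_module :: "('r, 'x) ring_scheme \<Rightarrow> 'c set \<Rightarrow> ('r, 'c \<Rightarrow> 'r) module" where
  "free_module R X =
     \<lparr>carrier = {f. (\<forall>x. f x \<in> carrier R) \<and> (\<forall>x. x \<notin> X \<longrightarrow> f x = \<zero>\<^bsub>R\<^esub>) \<and>
                    finite {x. f x \<noteq> \<zero>\<^bsub>R\<^esub>}},
      mult = undefined,
      one = undefined,
      zero = (\<lambda>x. \<zero>\<^bsub>R\<^esub>),
      add = (\<lambda>f f' x. f x \<oplus>\<^bsub>R\<^esub> f' x),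
      smult = (\<lambda>r f x. r \<otimes>\<^bsub>R\<^esub> f x)\<rparr>"

definition basis_vector :: "('r, 'x) ring_scheme \<Rightarrow> 'c \<Rightarrow> 'c \<Rightarrow> 'r" where
  "basis_vector R c = (\<lambda>x. if x = c then \<one>\<^bsub>R\<^esub> else \<zero>\<^bsub>R\<^esub>)"

text \<open>The linear map from a free \<open>R\<close>-module to \<open>M\<close> that sends the basis element \<open>x\<close> to \<open>t x\<close>.\<close>

definition linear_extension ::
  "('r, 'x) ring_scheme \<Rightarrow> ('r, 'm) module \<Rightarrow> ('c \<Rightarrow> 'm) \<Rightarrow> ('c \<Rightarrow> 'r) \<Rightarrow> 'm" where
  "linear_extension R M t f = (\<Oplus>\<^bsub>M\<^esub>x\<in>{x. f x \<noteq> \<zero>\<^bsub>R\<^esub>}. f x \<odot>\<^bsub>M\<^esub> t x)"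

definition hom_group ::
  "('r, 'x) ring_scheme \<Rightarrow> ('r, 'm) module \<Rightarrow> ('r, 'n) module \<Rightarrow> ('m \<Rightarrow> 'n) monoid" where
  "hom_group R M N =
     \<lparr>carrier = {f \<in> carrier M \<rightarrow>\<^sub>E carrier N.
        (\<forall>x\<in>carrier M. \<forall>y\<in>carrier M. f (x \<oplus>\<^bsub>M\<^esub> y) = f x \<oplus>\<^bsub>N\<^esub> f y) \<and>
        (\<forall>r\<in>carrier R. \<forall>x\<in>carrier M. f (r \<odot>\<^bsub>M\<^esub> x) = r \<odot>\<^bsub>N\<^esub> f x)},
      mult = (\<lambda>f f'. \<lambda>x\<in>carrier M. f x \<oplus>\<^bsub>N\<^esub> f' x),
      one = (\<lambda>x\<in>carrier M. \<zero>\<^bsub>N\<^esub>)\<rparr>"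

text \<open>Ext is computed from a canonical free resolution
  \<open>\<dots> \<longrightarrow> F_2 \<longrightarrow> F_1 \<longrightarrow> F_0 \<longrightarrow> M \<longrightarrow> 0\<close>,
  where \<open>F_0\<close> is free on the elements of \<open>M\<close>, and \<open>F_(n+1)\<close> is free on the formal linear
  combinations of generators of \<open>F_n\<close> that are sent to zero by the map leaving \<open>F_n\<close>. Every element
  of the kernel of that map is the value of such a formal combination, so the complex is exact. The
  generators in all degrees live in the single type below: \<open>Elt m\<close> is the generator of \<open>F_0\<close>
  belonging to \<open>m\<close>, and \<open>Rel l\<close> is the generator belonging to the formal linear combination \<open>l\<close>.\<close>

datatype ('r, 'm) cell = Elt (elt_of: 'm) | Rel (rel_of: "('r \<times> ('r, 'm) cell) list")

definition combination :: "('r, 'x) ring_scheme \<Rightarrow> ('r \<times> 'c) list \<Rightarrow> 'c \<Rightarrow> 'r" where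
  "combination R l = (\<lambda>x. foldr (\<lambda>(r, c) s. if c = x then r \<oplus>\<^bsub>R\<^esub> s else s) l \<zero>\<^bsub>R\<^esub>)"

definition cell_augmentation ::
  "('r, 'x) ring_scheme \<Rightarrow> ('r, 'm) module \<Rightarrow> (('r, 'm) cell \<Rightarrow> 'r) \<Rightarrow> 'm" where
  "cell_augmentation R M = linear_extension R M elt_of"

definition cell_boundary ::
  "('r, 'x) ring_scheme \<Rightarrow> ('r, 'm) cell set \<Rightarrow> (('r, 'm) cell \<Rightarrow> 'r) \<Rightarrow> ('r, 'm) cell \<Rightarrow> 'r" where
  "cell_boundary R X = linear_extension R (free_module R X) (\<lambda>c. combination R (rel_of c))"

fun cells :: "('r, 'x) ring_scheme \<Rightarrow> ('r, 'm) module \<Rightarrow> nat \<Rightarrow> ('r, 'm) cell set" where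
  "cells R M 0 = Elt ` carrier M"
| "cells R M (Suc 0) =
     {Rel l |l. set l \<subseteq> carrier R \<times> cells R M 0 \<and>
                cell_augmentation R M (combination R l) = \<zero>\<^bsub>M\<^esub>}"
| "cells R M (Suc (Suc n)) =
     {Rel l |l. set l \<subseteq> carrier R \<times> cells R M (Suc n) \<and>
                cell_boundary R (cells R M n) (combination R l) = \<zero>\<^bsub>free_module R (cells R M n)\<^esub>}"

definition resolution ::
  "('r, 'x) ring_scheme \<Rightarrow> ('r, 'm) module \<Rightarrow> nat \<Rightarrow> ('r, ('r, 'm) cell \<Rightarrow> 'r) module" where
  "resolution R M n = free_module R (cells R M n)"

definition resolution_diff ::
  "('r, 'x) ring_scheme \<Rightarrow> ('r, 'm) module \<Rightarrow> nat \<Rightarrow> (('r, 'm) cell \<Rightarrow> 'r) \<Rightarrow> ('r, 'm) cell \<Rightarrow> 'r" where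
  "resolution_diff R M n = cell_boundary R (cells R M n)"

definition Ext ::
  "('r, 'x) ring_scheme \<Rightarrow> nat \<Rightarrow> ('r, 'm) module \<Rightarrow> ('r, 'n) module \<Rightarrow>
     ((('r, 'm) cell \<Rightarrow> 'r) \<Rightarrow> 'n) set monoid" where
  "Ext R n M N =
     cohomology (\<lambda>i. hom_group R (resolution R M i) N)
       (\<lambda>i f. \<lambda>x\<in>carrier (resolution R M (Suc i)). f (resolution_diff R M i x)) n"


section \<open>The monoid \<open>S(G)\<close>, the partial group algebra, and partial cohomology\<close>

text \<open>The word \<open>[g1, ..., gn]\<close> stands for the product of the generators \<open>[g1], ..., [gn]\<close>. The
  relations present \<open>S(G)\<close> as a semigroup with identity \<open>[1]\<close>; in a presentation as a monoid, this
  identity has to be identified with the empty word by the relation \<open>unit\<close>.\<close>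

inductive_set par_rel :: "'g monoid \<Rightarrow> ('g list \<times> 'g list) set" for G (structure) where
  left: "\<lbrakk>g \<in> carrier G; h \<in> carrier G\<rbrakk> \<Longrightarrow> ([inv g, g, h], [inv g, g \<otimes> h]) \<in> par_rel G"
| right: "\<lbrakk>g \<in> carrier G; h \<in> carrier G\<rbrakk> \<Longrightarrow> ([g, h, inv h], [g \<otimes> h, inv h]) \<in> par_rel G"
| one: "g \<in> carrier G \<Longrightarrow> ([g, \<one>], [g]) \<in> par_rel G"
| unit: "([\<one>], []) \<in> par_rel G"
| refl: "v \<in> lists (carrier G) \<Longrightarrow> (v, v) \<in> par_rel G"
| sym: "(v, w) \<in> par_rel G \<Longrightarrow> (w, v) \<in> par_rel G"
| trans: "\<lbrakk>(v, w) \<in> par_rel G; (w, x) \<in> par_rel G\<rbrakk> \<Longrightarrow> (v, x) \<in> par_rel G"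
| cong: "\<lbrakk>(v, w) \<in> par_rel G; x \<in> lists (carrier G); y \<in> lists (carrier G)\<rbrakk>
    \<Longrightarrow> (x @ v @ y, x @ w @ y) \<in> par_rel G"

definition par_monoid :: "'g monoid \<Rightarrow> 'g list set monoid" where
  "par_monoid G =
     \<lparr>carrier = lists (carrier G) // par_rel G,
      mult = (\<lambda>s t. \<Union>v\<in>s. \<Union>w\<in>t. par_rel G `` {v @ w}),
      one = par_rel G `` {[]}\<rparr>"

definition semigroup_inverse :: "'s monoid \<Rightarrow> 's \<Rightarrow> 's" where
  "semigroup_inverse S s =
     (THE t. t \<in> carrier S \<and> s \<otimes>\<^bsub>S\<^esub> t \<otimes>\<^bsub>S\<^esub> s = s \<and> t \<otimes>\<^bsub>S\<^esub> s \<otimes>\<^bsub>S\<^esub> t = t)"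

definition idempotents :: "'s monoid \<Rightarrow> 's set" where
  "idempotents S = {e \<in> carrier S. e \<otimes>\<^bsub>S\<^esub> e = e}"

definition semigroup_algebra :: "'k ring \<Rightarrow> 's monoid \<Rightarrow> ('k, 's \<Rightarrow> 'k) module" where
  "semigroup_algebra K S =
     (free_module K (carrier S))
       \<lparr>mult := (\<lambda>f f'.
          linear_extension K (free_module K (carrier S))
            (\<lambda>s. linear_extension K (free_module K (carrier S))
               (\<lambda>t. basis_vector K (s \<otimes>\<^bsub>S\<^esub> t)) f') f),
        one := basis_vector K \<one>\<^bsub>S\<^esub>\<rparr>"

definition K_par :: "'k ring \<Rightarrow> 'g monoid \<Rightarrow> ('k, 'g list set \<Rightarrow> 'k) module" where
  "K_par K G = semigroup_algebra K (par_monoid G)"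

text \<open>The module \<open>K E(S(G))\<close>; scalars are elements of the partial group algebra.\<close>

definition idempotent_module ::
  "'k ring \<Rightarrow> 'g monoid \<Rightarrow> ('g list set \<Rightarrow> 'k, 'g list set \<Rightarrow> 'k) module" where
  "idempotent_module K G = (let S = par_monoid G; F = free_module K (idempotents S) in
     \<lparr>carrier = carrier F, mult = mult F, one = one F, zero = zero F, add = add F,
      smult = (\<lambda>f b.
        linear_extension K F
          (\<lambda>s. linear_extension K F
             (\<lambda>e. basis_vector K (s \<otimes>\<^bsub>S\<^esub> e \<otimes>\<^bsub>S\<^esub> semigroup_inverse S s)) b) f)\<rparr>)"

definition partial_cohomology ::
  "'k ring \<Rightarrow> 'g monoid \<Rightarrow> nat \<Rightarrow> ('g list set \<Rightarrow> 'k, 'm) module \<Rightarrow>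
    ((('g list set \<Rightarrow> 'k, 'g list set \<Rightarrow> 'k) cell \<Rightarrow> 'g list set \<Rightarrow> 'k) \<Rightarrow> 'm) set monoid" where
  "partial_cohomology K G n M = Ext (K_par K G) n (idempotent_module K G) M"

text \<open>\<open>word_action A G \<alpha> u [g1, ..., gn] a\<close> is \<open>[g1] \<cdot> (... ([gn] \<cdot> a))\<close>. An element of \<open>S(G)\<close> is a class
  of words all of which act in the same way, so \<open>the_elem\<close> picks their common value.\<close>

definition word_action ::
  "('k, 'a) module \<Rightarrow> 'g monoid \<Rightarrow> ('g \<Rightarrow> 'a \<Rightarrow> 'a) \<Rightarrow> ('g \<Rightarrow> 'a) \<Rightarrow> 'g list \<Rightarrow> 'a \<Rightarrow> 'a" where
  "word_action A G \<alpha> u = foldr (\<lambda>g a. \<alpha> g (u (inv\<^bsub>G\<^esub> g) \<otimes>\<^bsub>A\<^esub> a))"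

definition partial_action_module ::
  "'k ring \<Rightarrow> ('k, 'a) module \<Rightarrow> 'g monoid \<Rightarrow> ('g \<Rightarrow> 'a \<Rightarrow> 'a) \<Rightarrow> ('g \<Rightarrow> 'a) \<Rightarrow>
     ('g list set \<Rightarrow> 'k, 'a) module" where
  "partial_action_module K A G \<alpha> u =
     \<lparr>carrier = carrier A, mult = mult A, one = one A, zero = zero A, add = add A,
      smult = (\<lambda>f a.
        linear_extension K A (\<lambda>s. the_elem ((\<lambda>w. word_action A G \<alpha> u w a) ` s)) f)\<rparr>"

end

theory Submission
  imports Defs "HOL-Library.Poly_Mapping"
begin

text \<open>The translates \<open>x = \<beta>_g (\<phi> (\<epsilon>_i))\<close> of the minimal central idempotents of \<open>A\<close> are minimal central
  idempotents of \<open>B\<close>; call them points, and let \<open>star x\<close> be the set of all \<open>g\<close> with \<open>x \<beta>_g (\<phi> 1) = x\<close>.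
  An element \<open>a\<close> of \<open>A\<close> amounts to an arbitrary choice of components \<open>x \<phi>(a)\<close> in \<open>x B\<close> at the points with
  \<open>1 \<in> star x\<close>, and a multiplier \<open>(R, L)\<close> of \<open>B\<close> to an arbitrary choice of components \<open>L x\<close> in \<open>x B\<close> at all
  points.

  An element of \<open>S(G)\<close> is determined by its support, the finite set of prefix products of a
  representing word, and by its degree, the product of that word. The module \<open>K E(S(G))\<close> has a projective
  resolution spanned by the pairs \<open>(X, l)\<close> with \<open>X\<close> finite, \<open>1 \<in> X\<close> and \<open>l\<close> a tuple in \<open>X\<close>, whose differential is
  the simplicial boundary of \<open>l\<close>. At a point \<open>x\<close>, a cochain over this resolution with values in \<open>A\<close> is a
  homogeneous cochain on the full simplex with vertex set \<open>star x\<close>, while a group cochain with values in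
  \<open>M(B)\<close> is one on the full simplex with vertex set \<open>G\<close>; both are compatible with the action of \<open>G\<close> on the
  points. Restriction from the second to the first is an isomorphism in cohomology, because the simplices
  on \<open>G\<close> retract onto those on \<open>star x\<close>, compatibly with \<open>G\<close>, through \<open>g \<mapsto> g \<theta>(g\<^sup>-\<^sup>1 x)\<close>, where
  \<open>\<theta>(y) \<in> star y\<close> is chosen with \<open>\<theta>(y) = 1\<close> if \<open>1 \<in> star y\<close>.\<close>

section \<open>Modules over noncommutative rings\<close>

text \<open>Indecomposability makes the points minimal: a central idempotent z of B satisfies x z =
  x or x z = 0 at each point x. So an element of S(G) with support X acts as zero at x unless X lies
  in \<open>star x\<close>. This is why the sets X are carried through the resolution: at x, all X
  inside \<open>star x\<close> give the same value and all others give 0, so a cochain over the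
  resolution is the same as a cochain on \<open>star x\<close>, which may be infinite. The first
  vertex of l supplies a degree in X, which exhibits (X, l) as the translate of a tuple starting at
  1; projectivity rests on this. Without vertices, the same construction gives K E(S(G)). The
  normalisation \<theta>(y) = 1 makes the retraction the identity on \<open>star x\<close>, so
  restriction is onto already for cochains; a prism homotopy gives injectivity in cohomology. B may
  lack a unit and have infinitely many points, so a family of components is realised by a multiplier
  rather than by an element of B. That the family multiplies B into B holds because each b is a
  finite sum of elements of translates of A, and over one translate the family comes from A.\<close>

definition additive_map :: "('m, 'x) ring_scheme \<Rightarrow> ('n, 'y) ring_scheme \<Rightarrow> ('m \<Rightarrow> 'n) \<Rightarrow> bool" where
  "additive_map M N f \<longleftrightarrow> f \<in> carrier M \<rightarrow> carrier N \<and>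
     (\<forall>x\<in>carrier M. \<forall>y\<in>carrier M. f (x \<oplus>\<^bsub>M\<^esub> y) = f x \<oplus>\<^bsub>N\<^esub> f y)"

definition linear_map ::
  "('r, 'x) ring_scheme \<Rightarrow> ('r, 'm) module \<Rightarrow> ('r, 'n) module \<Rightarrow> ('m \<Rightarrow> 'n) \<Rightarrow> bool" where
  "linear_map R M N f \<longleftrightarrow> additive_map M N f \<and>
     (\<forall>r\<in>carrier R. \<forall>x\<in>carrier M. f (r \<odot>\<^bsub>M\<^esub> x) = r \<odot>\<^bsub>N\<^esub> f x)"

lemma additive_mapI:
  assumes "\<And>x. x \<in> carrier M \<Longrightarrow> f x \<in> carrier N"
    and "\<And>x y. x \<in> carrier M \<Longrightarrow> y \<in> carrier M \<Longrightarrow> f (x \<oplus>\<^bsub>M\<^esub> y) = f x \<oplus>\<^bsub>N\<^esub> f y"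
  shows "additive_map M N f"
  using assms by (auto simp: additive_map_def)

lemma additive_map_closed: "additive_map M N f \<Longrightarrow> x \<in> carrier M \<Longrightarrow> f x \<in> carrier N"
  by (auto simp: additive_map_def)

lemma additive_map_add:
  "additive_map M N f \<Longrightarrow> x \<in> carrier M \<Longrightarrow> y \<in> carrier M \<Longrightarrow> f (x \<oplus>\<^bsub>M\<^esub> y) = f x \<oplus>\<^bsub>N\<^esub> f y"
  by (auto simp: additive_map_def)

lemma additive_map_group_hom:
  assumes "abelian_group M" "abelian_group N" "additive_map M N f"
  shows "group_hom (add_monoid M) (add_monoid N) f"
  using assms abelian_group.a_group[of M] abelian_group.a_group[of N]
  by (auto simp: group_hom_def group_hom_axioms_def hom_def additive_map_def)

lemma additive_map_zero:
  assumes "abelian_group M" "abelian_group N" "additive_map M N f"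
  shows "f \<zero>\<^bsub>M\<^esub> = \<zero>\<^bsub>N\<^esub>"
  using group_hom.hom_one[OF additive_map_group_hom[OF assms]] by simp

lemma additive_map_neg:
  assumes "abelian_group M" "abelian_group N" "additive_map M N f" "x \<in> carrier M"
  shows "f (\<ominus>\<^bsub>M\<^esub> x) = \<ominus>\<^bsub>N\<^esub> f x"
  using group_hom.hom_inv[OF additive_map_group_hom[OF assms(1-3)]] assms(4) by (simp add: a_inv_def)

lemma additive_map_minus:
  assumes "abelian_group M" "abelian_group N" "additive_map M N f" "x \<in> carrier M" "y \<in> carrier M"
  shows "f (x \<ominus>\<^bsub>M\<^esub> y) = f x \<ominus>\<^bsub>N\<^esub> f y"
  using assms by (simp add: a_minus_def additive_map_add[OF assms(3)] additive_map_neg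
      abelian_group.a_inv_closed)

lemma additive_map_finsum:
  assumes M: "abelian_group M" and N: "abelian_group N" and f: "additive_map M N f"
    and t: "t \<in> X \<rightarrow> carrier M"
  shows "f (finsum M t X) = finsum N (\<lambda>x. f (t x)) X"
proof -
  interpret M: abelian_group M by fact
  interpret N: abelian_group N by fact
  show ?thesis
    using t
  proof (induction X rule: infinite_finite_induct)
    \<comment> \<open>A sum over an infinite index set is zero by convention, on both sides.\<close>
    case (infinite X) then show ?case by (simp add: additive_map_zero[OF M N f])
  next
    case empty then show ?case by (simp add: additive_map_zero[OF M N f])
  next
    case (insert x X)
    then have "(\<lambda>x. f (t x)) \<in> X \<rightarrow> carrier N" "t \<in> X \<rightarrow> carrier M"
      using additive_map_closed[OF f] by auto
    with insert show ?case
      by (simp add: additive_map_add[OF f] additive_map_closed[OF f])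
  qed
qed

lemma additive_map_int_mult:
  assumes "abelian_group M" "abelian_group N" "additive_map M N f" "x \<in> carrier M"
  shows "f ([(k::int)] \<cdot>\<^bsub>M\<^esub> x) = [k] \<cdot>\<^bsub>N\<^esub> f x"
  using group_hom.hom_int_pow[OF additive_map_group_hom[OF assms(1-3)], of x k] assms(4)
  by (simp add: add_pow_def)

lemma additive_map_comp:
  "additive_map M N f \<Longrightarrow> additive_map N Q g \<Longrightarrow> additive_map M Q (\<lambda>x. g (f x))"
  by (auto simp: additive_map_def Pi_iff)

lemma linear_map_additive: "linear_map R M N f \<Longrightarrow> additive_map M N f"
  by (simp add: linear_map_def)

lemma linear_map_smult:
  "linear_map R M N f \<Longrightarrow> r \<in> carrier R \<Longrightarrow> x \<in> carrier M \<Longrightarrow> f (r \<odot>\<^bsub>M\<^esub> x) = r \<odot>\<^bsub>N\<^esub> f x"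
  by (simp add: linear_map_def)

lemma linear_map_closed: "linear_map R M N f \<Longrightarrow> x \<in> carrier M \<Longrightarrow> f x \<in> carrier N"
  by (auto simp: linear_map_def additive_map_def)

lemma linear_map_add:
  "linear_map R M N f \<Longrightarrow> x \<in> carrier M \<Longrightarrow> y \<in> carrier M \<Longrightarrow> f (x \<oplus>\<^bsub>M\<^esub> y) = f x \<oplus>\<^bsub>N\<^esub> f y"
  by (auto simp: linear_map_def additive_map_def)

lemma linear_map_comp:
  "linear_map R M N f \<Longrightarrow> linear_map R N Q g \<Longrightarrow> linear_map R M Q (\<lambda>x. g (f x))"
  by (auto simp: linear_map_def Pi_iff intro: additive_map_comp dest: additive_map_closed)

lemma linear_map_id: "linear_map R M M (\<lambda>x. x)"
  by (auto simp: linear_map_def additive_map_def)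

text \<open>The scalars need not commute, since \<open>R\<close> will be the partial group algebra.
  The multiplication and the unit of the record \<open>M\<close> are ignored.\<close>

locale left_module = R: ring R + M: abelian_group M
  for R :: "('r, 'x) ring_scheme" and M :: "('r, 'm) module" +
  assumes smult_closed [simp, intro]:
      "\<lbrakk>r \<in> carrier R; x \<in> carrier M\<rbrakk> \<Longrightarrow> r \<odot>\<^bsub>M\<^esub> x \<in> carrier M"
    and smult_l_distr:
      "\<lbrakk>r \<in> carrier R; s \<in> carrier R; x \<in> carrier M\<rbrakk> \<Longrightarrow>
        (r \<oplus>\<^bsub>R\<^esub> s) \<odot>\<^bsub>M\<^esub> x = r \<odot>\<^bsub>M\<^esub> x \<oplus>\<^bsub>M\<^esub> s \<odot>\<^bsub>M\<^esub> x"
    and smult_r_distr: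
      "\<lbrakk>r \<in> carrier R; x \<in> carrier M; y \<in> carrier M\<rbrakk> \<Longrightarrow>
        r \<odot>\<^bsub>M\<^esub> (x \<oplus>\<^bsub>M\<^esub> y) = r \<odot>\<^bsub>M\<^esub> x \<oplus>\<^bsub>M\<^esub> r \<odot>\<^bsub>M\<^esub> y"
    and smult_assoc:
      "\<lbrakk>r \<in> carrier R; s \<in> carrier R; x \<in> carrier M\<rbrakk> \<Longrightarrow>
        (r \<otimes>\<^bsub>R\<^esub> s) \<odot>\<^bsub>M\<^esub> x = r \<odot>\<^bsub>M\<^esub> (s \<odot>\<^bsub>M\<^esub> x)"
    and smult_one [simp]: "x \<in> carrier M \<Longrightarrow> \<one>\<^bsub>R\<^esub> \<odot>\<^bsub>M\<^esub> x = x"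
begin

lemma smult_zero_left [simp]: "x \<in> carrier M \<Longrightarrow> \<zero>\<^bsub>R\<^esub> \<odot>\<^bsub>M\<^esub> x = \<zero>\<^bsub>M\<^esub>"
  by (rule additive_map_zero[of R M "\<lambda>r. r \<odot>\<^bsub>M\<^esub> x"])
    (auto simp: smult_l_distr R.is_abelian_group M.abelian_group_axioms intro!: additive_mapI)

lemma additive_smult: "r \<in> carrier R \<Longrightarrow> additive_map M M (\<lambda>x. r \<odot>\<^bsub>M\<^esub> x)"
  by (auto simp: smult_r_distr intro!: additive_mapI)

lemma smult_zero_right [simp]: "r \<in> carrier R \<Longrightarrow> r \<odot>\<^bsub>M\<^esub> \<zero>\<^bsub>M\<^esub> = \<zero>\<^bsub>M\<^esub>"
  using additive_map_zero[OF _ _ additive_smult] M.abelian_group_axioms by blast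

lemma linear_map_zero:
  "abelian_group N \<Longrightarrow> linear_map R N M f \<Longrightarrow> f \<zero>\<^bsub>N\<^esub> = \<zero>\<^bsub>M\<^esub>"
  using additive_map_zero[OF _ M.abelian_group_axioms linear_map_additive] by blast

lemma zero_linear: "linear_map R N M (\<lambda>_. \<zero>\<^bsub>M\<^esub>)"
  by (auto simp: linear_map_def additive_map_def)

lemma linear_map_diff:
  assumes N: "left_module R N" and f: "linear_map R N M f" and g: "linear_map R N M g"
  shows "linear_map R N M (\<lambda>x. f x \<ominus>\<^bsub>M\<^esub> g x)"
proof -
  interpret N: left_module R N by fact
  have neg: "r \<odot>\<^bsub>M\<^esub> (\<ominus>\<^bsub>M\<^esub> x) = \<ominus>\<^bsub>M\<^esub> (r \<odot>\<^bsub>M\<^esub> x)" if "r \<in> carrier R" "x \<in> carrier M" for r x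
    using additive_map_neg[OF M.abelian_group_axioms M.abelian_group_axioms additive_smult] that by blast
  show ?thesis
    unfolding linear_map_def additive_map_def
    by (auto simp: linear_map_closed[OF f] linear_map_closed[OF g] linear_map_add[OF f]
        linear_map_add[OF g] linear_map_smult[OF f] linear_map_smult[OF g] M.minus_eq
        smult_r_distr neg M.minus_add M.a_ac)
qed

lemma linear_map_sum:
  assumes N: "left_module R N" and f: "linear_map R N M f" and g: "linear_map R N M g"
  shows "linear_map R N M (\<lambda>x. f x \<oplus>\<^bsub>M\<^esub> g x)"
proof -
  interpret N: left_module R N by fact
  show ?thesis
    unfolding linear_map_def additive_map_def
    by (auto simp: linear_map_closed[OF f] linear_map_closed[OF g] linear_map_add[OF f]
        linear_map_add[OF g] linear_map_smult[OF f] linear_map_smult[OF g]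
        smult_r_distr M.a_ac)
qed

end

lemma left_module_of_module:
  fixes M :: "('r, 'm) module"
  assumes "module K M"
  shows "left_module K M"
proof -
  interpret module K M by fact
  show ?thesis by unfold_locales (auto simp: smult_l_distr smult_r_distr smult_assoc1)
qed

section \<open>Free modules, bases and linear extension\<close>

lemma free_module_simps:
  "carrier (free_module R X) = {f. (\<forall>x. f x \<in> carrier R) \<and> (\<forall>x. x \<notin> X \<longrightarrow> f x = \<zero>\<^bsub>R\<^esub>) \<and>
                    finite {x. f x \<noteq> \<zero>\<^bsub>R\<^esub>}}"
  "zero (free_module R X) = (\<lambda>x. \<zero>\<^bsub>R\<^esub>)"
  "add (free_module R X) = (\<lambda>f f' x. f x \<oplus>\<^bsub>R\<^esub> f' x)"
  "smult (free_module R X) = (\<lambda>r f x. r \<otimes>\<^bsub>R\<^esub> f x)"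
  by (simp_all add: free_module_def)

lemma left_module_free:
  fixes R :: "('r, 'x) ring_scheme"
  assumes "ring R"
  shows "left_module R (free_module R X)"
proof -
  interpret ring R by fact
  note free_module_simps [simp]
  have sub: "finite {x. h x \<noteq> \<zero>\<^bsub>R\<^esub>}"
    if "finite {x. f x \<noteq> \<zero>\<^bsub>R\<^esub>}" "finite {x. g x \<noteq> \<zero>\<^bsub>R\<^esub>}"
      "\<And>x. f x = \<zero>\<^bsub>R\<^esub> \<Longrightarrow> g x = \<zero>\<^bsub>R\<^esub> \<Longrightarrow> h x = \<zero>\<^bsub>R\<^esub>" for f g h :: "'c \<Rightarrow> 'r"
    using finite_subset[of "{x. h x \<noteq> \<zero>\<^bsub>R\<^esub>}" "{x. f x \<noteq> \<zero>\<^bsub>R\<^esub>} \<union> {x. g x \<noteq> \<zero>\<^bsub>R\<^esub>}"] that by blast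
  have "abelian_group (free_module R X)"
  proof (rule abelian_groupI)
    fix f assume f: "f \<in> carrier (free_module R X)"
    then show "\<exists>g\<in>carrier (free_module R X). g \<oplus>\<^bsub>free_module R X\<^esub> f = \<zero>\<^bsub>free_module R X\<^esub>"
      by (intro bexI[of _ "\<lambda>x. \<ominus>\<^bsub>R\<^esub> f x"]) (auto simp: l_neg intro: sub[of f f])
  next
    fix f g assume "f \<in> carrier (free_module R X)" "g \<in> carrier (free_module R X)"
    then show "f \<oplus>\<^bsub>free_module R X\<^esub> g \<in> carrier (free_module R X)"
      by (auto intro: sub[of f g])
  qed (auto simp: a_ac)
  moreover have "finite {x. r \<otimes>\<^bsub>R\<^esub> f x \<noteq> \<zero>\<^bsub>R\<^esub>}"
    if "finite {x. f x \<noteq> \<zero>\<^bsub>R\<^esub>}" "r \<in> carrier R" for f :: "'c \<Rightarrow> 'r" and r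
    by (rule sub[of f f]) (use that in auto)
  ultimately show ?thesis
    by (auto intro!: left_module.intro left_module_axioms.intro assms
        simp: l_distr r_distr m_assoc)
qed

lemma basis_vector_closed:
  fixes R :: "('r, 'x) ring_scheme"
  assumes "ring R" "c \<in> X" shows "basis_vector R c \<in> carrier (free_module R X)"
proof -
  interpret ring R by fact
  note free_module_simps [simp]
  have "finite {x. basis_vector R c x \<noteq> \<zero>\<^bsub>R\<^esub>}"
    by (rule finite_subset[of _ "{c}"]) (auto simp: basis_vector_def)
  then show ?thesis using assms(2) by (auto simp: basis_vector_def)
qed

text \<open>\<open>linear_extension\<close> sums over the support of f, which varies with f; terms
  outside it vanish, so several functions can be summed over one finite set. It stays inside
  \<open>X\<close> because t is controlled only there.\<close>

lemma linear_extension_superset: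
  assumes M: "left_module R M" and f: "f \<in> carrier (free_module R X)" and t: "t \<in> X \<rightarrow> carrier M"
    and S: "finite S" "{x. f x \<noteq> \<zero>\<^bsub>R\<^esub>} \<subseteq> S" "S \<subseteq> X"
  shows "linear_extension R M t f = finsum M (\<lambda>x. f x \<odot>\<^bsub>M\<^esub> t x) S"
proof -
  interpret left_module R M by fact
  show ?thesis
    unfolding linear_extension_def
    by (rule M.add.finprod_mono_neutral_cong_left) (use S f t in \<open>auto simp: Pi_iff free_module_simps\<close>)
qed

lemma linear_extension_linear:
  fixes R :: "('r, 'x) ring_scheme"
  assumes M: "left_module R M" and t: "t \<in> X \<rightarrow> carrier M"
  shows "linear_map R (free_module R X) M (linear_extension R M t)"
proof -
  interpret left_module R M by fact
  let ?F = "free_module R X"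
  let ?L = "linear_extension R M t"
  interpret F: left_module R ?F by (rule left_module_free[OF R.ring_axioms])
  let ?s = "\<lambda>f::_ \<Rightarrow> 'r. {x. f x \<noteq> \<zero>\<^bsub>R\<^esub>}"
  have fin: "finite (?s f)" "?s f \<subseteq> X" if "f \<in> carrier ?F" for f
    using that by (auto simp: free_module_simps)
  have clo: "(\<lambda>x. f x \<odot>\<^bsub>M\<^esub> t x) \<in> S \<rightarrow> carrier M" if "f \<in> carrier ?F" "S \<subseteq> X" for f S
    using that t by (auto simp: free_module_simps)
  have "?L f \<in> carrier M" if "f \<in> carrier ?F" for f
    unfolding linear_extension_def using clo[OF that fin(2)[OF that]] by (rule M.finsum_closed)
  moreover have "?L (f \<oplus>\<^bsub>?F\<^esub> g) = ?L f \<oplus>\<^bsub>M\<^esub> ?L g" if f: "f \<in> carrier ?F" and g: "g \<in> carrier ?F" for f g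
  proof -
    let ?S = "?s f \<union> ?s g"
    have S: "finite ?S" "?S \<subseteq> X" using fin[OF f] fin[OF g] by auto
    have "?L f = finsum M (\<lambda>x. f x \<odot>\<^bsub>M\<^esub> t x) ?S"
      by (rule linear_extension_superset[OF M f t S(1) _ S(2)]) auto
    moreover have "?L g = finsum M (\<lambda>x. g x \<odot>\<^bsub>M\<^esub> t x) ?S"
      by (rule linear_extension_superset[OF M g t S(1) _ S(2)]) auto
    moreover have "?L (f \<oplus>\<^bsub>?F\<^esub> g) = finsum M (\<lambda>x. (f \<oplus>\<^bsub>?F\<^esub> g) x \<odot>\<^bsub>M\<^esub> t x) ?S"
      by (rule linear_extension_superset[OF M F.M.a_closed[OF f g] t S(1) _ S(2)])
        (auto simp: free_module_simps)
    moreover have "\<dots> = finsum M (\<lambda>x. f x \<odot>\<^bsub>M\<^esub> t x \<oplus>\<^bsub>M\<^esub> g x \<odot>\<^bsub>M\<^esub> t x) ?S"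
      by (rule M.finsum_cong') (use f g t S in \<open>auto simp: free_module_simps Pi_iff smult_l_distr intro!: M.a_closed smult_closed\<close>)
    ultimately show ?thesis
      using clo[OF f S(2)] clo[OF g S(2)] by (simp add: M.finsum_addf)
  qed
  moreover have "?L (r \<odot>\<^bsub>?F\<^esub> f) = r \<odot>\<^bsub>M\<^esub> ?L f" if r: "r \<in> carrier R" and f: "f \<in> carrier ?F" for r f
  proof -
    have "?L (r \<odot>\<^bsub>?F\<^esub> f) = finsum M (\<lambda>x. (r \<odot>\<^bsub>?F\<^esub> f) x \<odot>\<^bsub>M\<^esub> t x) (?s f)"
      by (rule linear_extension_superset[OF M _ t]) (use F.smult_closed[OF r f] f r in \<open>auto simp: free_module_simps\<close>)
    also have "\<dots> = finsum M (\<lambda>x. r \<odot>\<^bsub>M\<^esub> (f x \<odot>\<^bsub>M\<^esub> t x)) (?s f)"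
      by (rule M.finsum_cong') (use r f t fin[OF f] in \<open>auto simp: free_module_simps Pi_iff subset_iff smult_assoc\<close>)
    also have "\<dots> = r \<odot>\<^bsub>M\<^esub> finsum M (\<lambda>x. f x \<odot>\<^bsub>M\<^esub> t x) (?s f)"
      using additive_map_finsum[OF M.abelian_group_axioms M.abelian_group_axioms additive_smult[OF r]
          clo[OF f fin(2)[OF f]]] by simp
    finally show ?thesis by (simp add: linear_extension_def)
  qed
  ultimately show ?thesis
    unfolding linear_map_def additive_map_def by (simp)
qed

lemma linear_extension_basis:
  assumes M: "left_module R M" and "t c \<in> carrier M"
  shows "linear_extension R M t (basis_vector R c) = t c"
proof -
  interpret left_module R M by fact
  have "linear_extension R M t (basis_vector R c) = finsum M (\<lambda>x. basis_vector R c x \<odot>\<^bsub>M\<^esub> t x) {c}"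
    by (rule linear_extension_superset[OF M basis_vector_closed[OF R.ring_axioms], of _ "{c}"])
      (use assms(2) in \<open>auto simp: basis_vector_def\<close>)
  then show ?thesis using assms(2) by (simp add: basis_vector_def)
qed

lemma basis_expansion:
  fixes R :: "('r, 'x) ring_scheme"
  assumes R: "ring R" and f: "f \<in> carrier (free_module R X)"
  shows "f = finsum (free_module R X) (\<lambda>x. f x \<odot>\<^bsub>free_module R X\<^esub> basis_vector R x) {x. f x \<noteq> \<zero>\<^bsub>R\<^esub>}"
proof -
  let ?F = "free_module R X"
  interpret F: left_module R ?F by (rule left_module_free[OF R])
  let ?S = "{x. f x \<noteq> \<zero>\<^bsub>R\<^esub>}"
  have S: "?S \<subseteq> X" "finite ?S" and fR: "\<And>x. f x \<in> carrier R" using f by (auto simp: free_module_simps)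
  have cl: "(\<lambda>x. f x \<odot>\<^bsub>?F\<^esub> basis_vector R x) \<in> ?S \<rightarrow> carrier ?F"
    by (intro Pi_I F.smult_closed fR basis_vector_closed[OF R]) (use S in auto)
  have "finsum ?F (\<lambda>x. f x \<odot>\<^bsub>?F\<^esub> basis_vector R x) ?S y = f y" for y
  proof -
    have *: "finsum ?F (\<lambda>x. f x \<odot>\<^bsub>?F\<^esub> basis_vector R x) ?S y =
        finsum R (\<lambda>x. (f x \<odot>\<^bsub>?F\<^esub> basis_vector R x) y) ?S"
      by (rule additive_map_finsum[of ?F R "\<lambda>f. f y", OF F.M.abelian_group_axioms F.R.is_abelian_group _ cl])
        (auto simp: free_module_simps intro!: additive_mapI)
    also have "\<dots> = finsum R (\<lambda>x. if y = x then f x else \<zero>\<^bsub>R\<^esub>) ?S"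
      by (rule F.R.finsum_cong') (use fR in \<open>auto simp: basis_vector_def free_module_simps\<close>)
    also have "\<dots> = f y"
    proof (cases "y \<in> ?S")
      case True
      then show ?thesis using F.R.finsum_singleton[of y ?S f] S fR by simp
    next
      case False
      then have "finsum R (\<lambda>x. if y = x then f x else \<zero>\<^bsub>R\<^esub>) ?S = finsum R (\<lambda>x. \<zero>\<^bsub>R\<^esub>) ?S"
        by (intro F.R.finsum_cong') auto
      with False show ?thesis by simp
    qed
    finally show ?thesis .
  qed
  note pointwise = this
  show ?thesis by (rule ext) (rule pointwise[symmetric])
qed

text \<open>The uniqueness half of freeness. Most identities between linear maps below are reduced
  by it to basis vectors.\<close>

lemma linear_map_eq_on_basis:
  fixes R :: "('r, 'x) ring_scheme"
  assumes M: "left_module R M" and f: "linear_map R (free_module R X) M f"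
    and g: "linear_map R (free_module R X) M g"
    and eq: "\<And>x. x \<in> X \<Longrightarrow> f (basis_vector R x) = g (basis_vector R x)"
    and y: "y \<in> carrier (free_module R X)"
  shows "f y = g y"
proof -
  interpret left_module R M by fact
  let ?F = "free_module R X"
  interpret F: left_module R ?F by (rule left_module_free[OF R.ring_axioms])
  have S: "{x. y x \<noteq> \<zero>\<^bsub>R\<^esub>} \<subseteq> X" and yR: "\<And>x. y x \<in> carrier R" using y by (auto simp: free_module_simps)
  have bv: "basis_vector R x \<in> carrier ?F" if "y x \<noteq> \<zero>\<^bsub>R\<^esub>" for x
    using S that by (intro basis_vector_closed[OF R.ring_axioms]) auto
  have expand: "h y = finsum M (\<lambda>x. y x \<odot>\<^bsub>M\<^esub> h (basis_vector R x)) {x. y x \<noteq> \<zero>\<^bsub>R\<^esub>}"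
    if h: "linear_map R ?F M h" for h
  proof -
    have cl: "(\<lambda>x. y x \<odot>\<^bsub>?F\<^esub> basis_vector R x) \<in> {x. y x \<noteq> \<zero>\<^bsub>R\<^esub>} \<rightarrow> carrier ?F"
      by (intro Pi_I F.smult_closed yR basis_vector_closed[OF R.ring_axioms]) (use S in auto)
    have "h y = h (finsum ?F (\<lambda>x. y x \<odot>\<^bsub>?F\<^esub> basis_vector R x) {x. y x \<noteq> \<zero>\<^bsub>R\<^esub>})"
      using basis_expansion[OF R.ring_axioms y] by simp
    also have "\<dots> = finsum M (\<lambda>x. h (y x \<odot>\<^bsub>?F\<^esub> basis_vector R x)) {x. y x \<noteq> \<zero>\<^bsub>R\<^esub>}"
      by (rule additive_map_finsum[OF F.M.abelian_group_axioms M.abelian_group_axioms linear_map_additive[OF h] cl])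
    also have "\<dots> = finsum M (\<lambda>x. y x \<odot>\<^bsub>M\<^esub> h (basis_vector R x)) {x. y x \<noteq> \<zero>\<^bsub>R\<^esub>}"
    proof (rule M.finsum_cong')
      show "(\<lambda>x. y x \<odot>\<^bsub>M\<^esub> h (basis_vector R x)) \<in> {x. y x \<noteq> \<zero>\<^bsub>R\<^esub>} \<rightarrow> carrier M"
        by (intro Pi_I smult_closed yR linear_map_closed[OF h] bv) simp
    qed (auto intro!: linear_map_smult[OF h] yR bv)
    finally show ?thesis .
  qed
  have "finsum M (\<lambda>x. y x \<odot>\<^bsub>M\<^esub> f (basis_vector R x)) {x. y x \<noteq> \<zero>\<^bsub>R\<^esub>} =
        finsum M (\<lambda>x. y x \<odot>\<^bsub>M\<^esub> g (basis_vector R x)) {x. y x \<noteq> \<zero>\<^bsub>R\<^esub>}"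
  proof (rule M.finsum_cong')
    show "(\<lambda>x. y x \<odot>\<^bsub>M\<^esub> g (basis_vector R x)) \<in> {x. y x \<noteq> \<zero>\<^bsub>R\<^esub>} \<rightarrow> carrier M"
      by (intro Pi_I smult_closed yR linear_map_closed[OF g] bv) simp
    show "y x \<odot>\<^bsub>M\<^esub> f (basis_vector R x) = y x \<odot>\<^bsub>M\<^esub> g (basis_vector R x)"
      if "x \<in> {x. y x \<noteq> \<zero>\<^bsub>R\<^esub>}" for x
      using eq[of x] S that by auto
  qed simp
  then show ?thesis using expand[OF f] expand[OF g] by simp
qed

section \<open>Cohomology and the comparison of projective resolutions\<close>

definition cochain_complex :: "(nat \<Rightarrow> 'c monoid) \<Rightarrow> (nat \<Rightarrow> 'c \<Rightarrow> 'c) \<Rightarrow> bool" where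
  "cochain_complex C d \<longleftrightarrow> (\<forall>n. comm_group (C n)) \<and> (\<forall>n. d n \<in> hom (C n) (C (Suc n))) \<and>
     (\<forall>n. \<forall>x\<in>carrier (C n). d (Suc n) (d n x) = \<one>\<^bsub>C (Suc (Suc n))\<^esub>)"

text \<open>This and \<open>coboundaries\<close> name the two groups whose quotient is formed inside
  \<open>cohomology\<close>, so that unfolding them matches that definition literally.\<close>

definition cocycles :: "(nat \<Rightarrow> 'c monoid) \<Rightarrow> (nat \<Rightarrow> 'c \<Rightarrow> 'c) \<Rightarrow> nat \<Rightarrow> 'c set" where
  "cocycles C d n = kernel (C n) (C (Suc n)) (d n)"

definition coboundaries :: "(nat \<Rightarrow> 'c monoid) \<Rightarrow> (nat \<Rightarrow> 'c \<Rightarrow> 'c) \<Rightarrow> nat \<Rightarrow> 'c set" where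
  "coboundaries C d n = (case n of 0 \<Rightarrow> {\<one>\<^bsub>C 0\<^esub>} | Suc m \<Rightarrow> d m ` carrier (C m))"

lemma cocycles_iff:
  "z \<in> cocycles C d n \<longleftrightarrow> z \<in> carrier (C n) \<and> d n z = \<one>\<^bsub>C (Suc n)\<^esub>"
  by (auto simp: cocycles_def kernel_def)

lemma cocycles_subgroup:
  assumes "cochain_complex C d" shows "subgroup (cocycles C d n) (C n)"
  using assms group_hom.subgroup_kernel[of "C n" "C (Suc n)" "d n"]
  by (auto simp: cochain_complex_def cocycles_def group_hom_def group_hom_axioms_def comm_group_def)

lemma coboundaries_subgroup:
  assumes "cochain_complex C d" shows "subgroup (coboundaries C d n) (C n)"
proof (cases n)
  case 0
  have "group (C 0)" using assms by (auto simp: cochain_complex_def comm_group_def)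
  then show ?thesis using 0 group.triv_subgroup by (auto simp: coboundaries_def)
next
  case (Suc m)
  have "group_hom (C m) (C (Suc m)) (d m)"
    using assms by (auto simp: cochain_complex_def group_hom_def group_hom_axioms_def comm_group_def)
  then show ?thesis using Suc group_hom.img_is_subgroup by (auto simp: coboundaries_def)
qed

lemma coboundaries_cocycles:
  assumes "cochain_complex C d" shows "coboundaries C d n \<subseteq> cocycles C d n"
proof -
  have *: "comm_group (C n)" "d n \<in> hom (C n) (C (Suc n))" for n
    using assms by (auto simp: cochain_complex_def)
  then have "d n \<one>\<^bsub>C n\<^esub> = \<one>\<^bsub>C (Suc n)\<^esub>" for n
    using hom_one[of "d n" "C n" "C (Suc n)"] by (auto simp: comm_group_def)
  then show ?thesis
    using assms * hom_in_carrier[OF *(2)]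
    by (auto simp: coboundaries_def cocycles_iff cochain_complex_def comm_group_def group_def
        split: nat.splits)
qed

lemma comm_group_subgroup:
  assumes "comm_group G" "subgroup H G" shows "comm_group (G\<lparr>carrier := H\<rparr>)"
proof -
  interpret comm_group G by fact
  interpret H: group "G\<lparr>carrier := H\<rparr>" using subgroup.subgroup_is_group[OF assms(2)] is_group by blast
  show ?thesis using subgroup.subset[OF assms(2)] by unfold_locales (auto simp: subset_iff intro: m_comm)
qed

text \<open>The map sending z to the coset of \<Phi> z is defined on cocycles; the assumptions say
  that its kernel is the group of coboundaries and that it is onto, so the first isomorphism theorem
  applies. Only degree n is mentioned, and surjectivity is asked for up to coboundaries.\<close>

lemma cohomology_iso:
  fixes C :: "nat \<Rightarrow> 'c monoid" and C' :: "nat \<Rightarrow> 'd monoid"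
  assumes C: "cochain_complex C d" and C': "cochain_complex C' d'"
    and hom: "\<Phi> \<in> hom (C n) (C' n)"
    and cocycle: "\<And>z. z \<in> cocycles C d n \<Longrightarrow> \<Phi> z \<in> cocycles C' d' n"
    and coboundary: "\<And>z. z \<in> coboundaries C d n \<Longrightarrow> \<Phi> z \<in> coboundaries C' d' n"
    and inj: "\<And>z. z \<in> cocycles C d n \<Longrightarrow> \<Phi> z \<in> coboundaries C' d' n \<Longrightarrow> z \<in> coboundaries C d n"
    and surj: "\<And>y. y \<in> cocycles C' d' n \<Longrightarrow>
      \<exists>z\<in>cocycles C d n. \<exists>b\<in>coboundaries C' d' n. y = b \<otimes>\<^bsub>C' n\<^esub> \<Phi> z"
  shows "cohomology C d n \<cong> cohomology C' d' n"
proof -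
  interpret C: comm_group "C n" using C by (simp add: cochain_complex_def)
  interpret C': comm_group "C' n" using C' by (simp add: cochain_complex_def)
  let ?Z = "(C n)\<lparr>carrier := cocycles C d n\<rparr>" and ?Z' = "(C' n)\<lparr>carrier := cocycles C' d' n\<rparr>"
  let ?B = "coboundaries C d n" and ?B' = "coboundaries C' d' n"
  interpret Z: comm_group ?Z
    using comm_group_subgroup[OF C.comm_group_axioms cocycles_subgroup[OF C]] .
  interpret Z': comm_group ?Z'
    using comm_group_subgroup[OF C'.comm_group_axioms cocycles_subgroup[OF C']] .
  have B': "subgroup ?B' ?Z'"
    using C'.subgroup_incl[OF coboundaries_subgroup[OF C'] cocycles_subgroup[OF C']
        coboundaries_cocycles[OF C']] .
  then interpret B': normal ?B' ?Z' by (rule Z'.subgroup_imp_normal)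
  let ?h = "\<lambda>z. ?B' #>\<^bsub>?Z'\<^esub> \<Phi> z"
  interpret H: group "?Z' Mod ?B'" by (rule B'.factorgroup_is_group)
  have h: "?h \<in> hom ?Z (?Z' Mod ?B')"
    using cocycle cocycles_iff[of _ C d n] B'.rcos_sum hom
    by (auto simp: hom_def FactGroup_def RCOSETS_def)
  interpret h: group_hom ?Z "?Z' Mod ?B'" ?h
    using h by unfold_locales
  have "kernel ?Z (?Z' Mod ?B') ?h = ?B"
  proof (intro equalityI subsetI)
    fix z assume "z \<in> kernel ?Z (?Z' Mod ?B') ?h"
    then have z: "z \<in> cocycles C d n" and "?B' #>\<^bsub>?Z'\<^esub> \<Phi> z = ?B'"
      by (auto simp: kernel_def FactGroup_def)
    then have "\<Phi> z \<in> ?B'"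
      using Z'.rcos_self[OF _ B', of "\<Phi> z"] cocycle by simp
    then show "z \<in> ?B" using inj z by blast
  next
    fix z assume z: "z \<in> ?B"
    then have "?B' #>\<^bsub>?Z'\<^esub> \<Phi> z = ?B'"
      using Z'.coset_join2[OF _ B', of "\<Phi> z"] coboundary cocycle coboundaries_cocycles[OF C] by auto
    then show "z \<in> kernel ?Z (?Z' Mod ?B') ?h"
      using z coboundaries_cocycles[OF C] by (auto simp: kernel_def FactGroup_def)
  qed
  moreover have "?h ` carrier ?Z = carrier (?Z' Mod ?B')"
  proof (intro equalityI subsetI)
    fix c assume "c \<in> carrier (?Z' Mod ?B')"
    then obtain y where y: "y \<in> cocycles C' d' n" "c = ?B' #>\<^bsub>?Z'\<^esub> y"
      by (auto simp: FactGroup_def RCOSETS_def)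
    then obtain z b where zb: "z \<in> cocycles C d n" "b \<in> ?B'" "y = b \<otimes>\<^bsub>C' n\<^esub> \<Phi> z" using surj by blast
    then have "c = ?h z"
      using Z'.repr_independence[of y ?B' "\<Phi> z"] B' y cocycle zb
      by (auto simp: r_coset_def)
    then show "c \<in> ?h ` carrier ?Z" using zb by auto
  qed (use h in \<open>auto simp: hom_def\<close>)
  ultimately show ?thesis
    using h.FactGroup_iso by (simp add: cohomology_def cocycles_def coboundaries_def)
qed

section \<open>Projective modules and projective resolutions\<close>

text \<open>Projectivity as a retract of a free module. The basis \<open>Z\<close> is a parameter because its type cannot be
  quantified over.\<close>

definition projective_over ::
  "('r, 'x) ring_scheme \<Rightarrow> 'z set \<Rightarrow> ('r, 'm) module \<Rightarrow> bool" where
  "projective_over R Z P \<longleftrightarrow> left_module R P \<and>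
     (\<exists>i p. linear_map R P (free_module R Z) i \<and> linear_map R (free_module R Z) P p \<and>
        (\<forall>y\<in>carrier P. p (i y) = y))"

text \<open>On the free module, of which P is a retract, preimages under q of the values
  \<open>t (p z)\<close> are chosen on the basis and extended linearly; composing with the inclusion
  of P gives the lift. It is enough that the values of t lie in the image of q, which is the form in
  which exactness provides it.\<close>

lemma projective_lifting:
  fixes R :: "('r, 'x) ring_scheme"
  assumes P: "projective_over R Z P" and N': "left_module R N'" and N: "left_module R N"
    and q: "linear_map R N' N q" and t: "linear_map R P N t"
    and img: "\<And>y. y \<in> carrier P \<Longrightarrow> t y \<in> q ` carrier N'"
  shows "\<exists>s. linear_map R P N' s \<and> (\<forall>y\<in>carrier P. q (s y) = t y)"
proof -
  obtain i p where i: "linear_map R P (free_module R Z) i" and p: "linear_map R (free_module R Z) P p"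
    and pi: "\<And>y. y \<in> carrier P \<Longrightarrow> p (i y) = y" and "left_module R P"
    using P unfolding projective_over_def by blast
  interpret N: left_module R N by fact
  have "\<exists>x\<in>carrier N'. q x = t (p (basis_vector R z))" if "z \<in> Z" for z
    using img[OF linear_map_closed[OF p basis_vector_closed[OF N.R.ring_axioms that]]] by force
  then obtain t' where t': "\<And>z. z \<in> Z \<Longrightarrow> t' z \<in> carrier N' \<and> q (t' z) = t (p (basis_vector R z))"
    by metis
  let ?s = "linear_extension R N' t'"
  have s: "linear_map R (free_module R Z) N' ?s"
    by (rule linear_extension_linear[OF N']) (use t' in auto)
  have "q (?s y) = t (p y)" if "y \<in> carrier (free_module R Z)" for y
  proof (rule linear_map_eq_on_basis[OF N linear_map_comp[OF s q] linear_map_comp[OF p t] _ that])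
    show "q (?s (basis_vector R z)) = t (p (basis_vector R z))" if "z \<in> Z" for z
      using t'[OF that] linear_extension_basis[OF N', of t' z] by simp
  qed
  then have "\<forall>y\<in>carrier P. q (?s (i y)) = t y"
    using linear_map_closed[OF i] pi by auto
  with linear_map_comp[OF i s] show ?thesis by blast
qed

text \<open>\<open>Z n\<close> is a basis of a free module that has \<open>P n\<close> as a
  retract.\<close>

locale projective_resolution = M: left_module R M
  for R :: "('r, 'x) ring_scheme" and M :: "('r, 'm) module" +
  fixes P :: "nat \<Rightarrow> ('r, 'p) module" and d :: "nat \<Rightarrow> 'p \<Rightarrow> 'p" and \<epsilon> :: "'p \<Rightarrow> 'm" and Z :: "nat \<Rightarrow> 'z set"
  assumes projective: "projective_over R (Z n) (P n)"
    and linear_d: "linear_map R (P (Suc n)) (P n) (d n)"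
    and linear_\<epsilon>: "linear_map R (P 0) M \<epsilon>"
    and surj_\<epsilon>: "\<epsilon> ` carrier (P 0) = carrier M"
    and exact_0: "d 0 ` carrier (P (Suc 0)) = {y \<in> carrier (P 0). \<epsilon> y = \<zero>\<^bsub>M\<^esub>}"
    and exact_Suc: "d (Suc n) ` carrier (P (Suc (Suc n))) = {y \<in> carrier (P (Suc n)). d n y = \<zero>\<^bsub>P n\<^esub>}"
begin

text \<open>In degree 0 the augmentation stands in for the missing differential, so that the
  inductions below treat all degrees alike.\<close>

definition cycles :: "nat \<Rightarrow> 'p set" where
  "cycles n = {y \<in> carrier (P n). case n of 0 \<Rightarrow> \<epsilon> y = \<zero>\<^bsub>M\<^esub> | Suc m \<Rightarrow> d m y = \<zero>\<^bsub>P m\<^esub>}"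

lemma exact: "d n ` carrier (P (Suc n)) = cycles n"
  using exact_0 exact_Suc by (cases n) (auto simp: cycles_def)

lemma left_module_P: "left_module R (P n)"
  using projective by (simp add: projective_over_def)

lemma abelian_group_P: "abelian_group (P n)"
  using left_module_P by (rule left_module.axioms)

lemma d_cycles: "y \<in> carrier (P (Suc n)) \<Longrightarrow> d n y \<in> cycles n"
  using exact by blast

lemma d_d: "y \<in> carrier (P (Suc (Suc n))) \<Longrightarrow> d n (d (Suc n) y) = \<zero>\<^bsub>P n\<^esub>"
  using d_cycles[of y "Suc n"] by (simp add: cycles_def)

lemma cycles_SucI: "y \<in> carrier (P (Suc n)) \<Longrightarrow> d n y = \<zero>\<^bsub>P n\<^esub> \<Longrightarrow> y \<in> cycles (Suc n)"
  by (simp add: cycles_def)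

end

text \<open>The comparison theorem: each lift is chosen from the previous one. Besides being linear,
  a lift must send cycles to cycles; this invariant makes \<open>f (d n y)\<close> a cycle of Q,
  hence a boundary, so that the next lift exists.\<close>

lemma chain_lift:
  assumes P: "projective_resolution R M P d \<epsilon> Z" and Q: "projective_resolution R M Q d' \<epsilon>' Z'"
  shows "\<exists>f. (\<forall>n. linear_map R (P n) (Q n) (f n)) \<and> (\<forall>y\<in>carrier (P 0). \<epsilon>' (f 0 y) = \<epsilon> y) \<and>
     (\<forall>n. \<forall>y\<in>carrier (P (Suc n)). d' n (f (Suc n) y) = f n (d n y))"
proof -
  interpret P: projective_resolution R M P d \<epsilon> Z by fact
  interpret Q: projective_resolution R M Q d' \<epsilon>' Z' by fact
  let ?A = "\<lambda>n f. linear_map R (P n) (Q n) f \<and> f ` P.cycles n \<subseteq> Q.cycles n \<and>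
    (n = 0 \<longrightarrow> (\<forall>y\<in>carrier (P 0). \<epsilon>' (f y) = \<epsilon> y))"
  have "\<exists>f. \<forall>n. ?A n (f n) \<and> (\<forall>y\<in>carrier (P (Suc n)). d' n (f (Suc n) y) = f n (d n y))"
  proof (rule dependent_nat_choice)
    obtain s where s: "linear_map R (P 0) (Q 0) s" "\<forall>y\<in>carrier (P 0). \<epsilon>' (s y) = \<epsilon> y"
      using projective_lifting[OF P.projective[of 0] Q.left_module_P[of 0] P.M.left_module_axioms
          Q.linear_\<epsilon> P.linear_\<epsilon>] linear_map_closed[OF P.linear_\<epsilon>] Q.surj_\<epsilon> by auto
    then have "?A 0 s" using linear_map_closed[OF s(1)] by (auto simp: P.cycles_def Q.cycles_def)
    then show "\<exists>f. ?A 0 f" by (rule exI[of _ s])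
  next
    fix f n assume f: "?A n f"
    have t: "linear_map R (P (Suc n)) (Q n) (\<lambda>y. f (d n y))"
      using linear_map_comp[OF P.linear_d] f by blast
    have "f (d n y) \<in> d' n ` carrier (Q (Suc n))" if "y \<in> carrier (P (Suc n))" for y
      using f P.d_cycles[OF that] by (auto simp: Q.exact)
    then obtain s where s: "linear_map R (P (Suc n)) (Q (Suc n)) s"
        "\<forall>y\<in>carrier (P (Suc n)). d' n (s y) = f (d n y)"
      using projective_lifting[OF P.projective Q.left_module_P Q.left_module_P Q.linear_d t] by blast
    have "s ` P.cycles (Suc n) \<subseteq> Q.cycles (Suc n)"
    proof
      fix z assume "z \<in> s ` P.cycles (Suc n)"
      then obtain y where y: "z = s y" "y \<in> carrier (P (Suc n))" "d n y = \<zero>\<^bsub>P n\<^esub>"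
        by (auto simp: P.cycles_def)
      then have "d' n z = \<zero>\<^bsub>Q n\<^esub>"
        using s(2) f left_module.linear_map_zero[OF Q.left_module_P P.abelian_group_P] by auto
      then show "z \<in> Q.cycles (Suc n)" using y linear_map_closed[OF s(1)] by (auto intro: Q.cycles_SucI)
    qed
    with s show "\<exists>g. ?A (Suc n) g \<and> (\<forall>y\<in>carrier (P (Suc n)). d' n (g y) = f (d n y))"
      by (intro exI[of _ s]) simp
  qed
  then obtain f where
    "\<forall>n. ?A n (f n) \<and> (\<forall>y\<in>carrier (P (Suc n)). d' n (f (Suc n) y) = f n (d n y))" ..
  then show ?thesis by (intro exI[of _ f]) simp
qed

text \<open>A chain map that covers the zero map is contracted degree by degree: what remains of f
  after subtracting \<open>s n (d n y)\<close> is a cycle of Q, hence a boundary, and projectivity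
  chooses the preimage linearly.\<close>

lemma chain_null_homotopy:
  assumes P: "projective_resolution R M P d \<epsilon> Z" and Q: "projective_resolution R M Q d' \<epsilon>' Z'"
    and lin: "\<And>n. linear_map R (P n) (Q n) (f n)"
    and aug: "\<And>y. y \<in> carrier (P 0) \<Longrightarrow> \<epsilon>' (f 0 y) = \<zero>\<^bsub>M\<^esub>"
    and chain: "\<And>n y. y \<in> carrier (P (Suc n)) \<Longrightarrow> d' n (f (Suc n) y) = f n (d n y)"
  shows "\<exists>s. (\<forall>n. linear_map R (P n) (Q (Suc n)) (s n)) \<and> (\<forall>y\<in>carrier (P 0). d' 0 (s 0 y) = f 0 y) \<and>
     (\<forall>n. \<forall>y\<in>carrier (P (Suc n)). d' (Suc n) (s (Suc n) y) = f (Suc n) y \<ominus>\<^bsub>Q (Suc n)\<^esub> s n (d n y))"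
proof -
  interpret P: projective_resolution R M P d \<epsilon> Z by fact
  interpret Q: projective_resolution R M Q d' \<epsilon>' Z' by fact
  \<comment> \<open>On cycles the homotopy identity loses its correction term. Only this part of it
    is needed for the next step, where it is applied to the cycle \<open>d n y\<close>.\<close>
  let ?A = "\<lambda>n s. linear_map R (P n) (Q (Suc n)) s \<and> (\<forall>y\<in>P.cycles n. d' n (s y) = f n y) \<and>
    (n = 0 \<longrightarrow> (\<forall>y\<in>carrier (P 0). d' 0 (s y) = f 0 y))"
  have "\<exists>s. \<forall>n. ?A n (s n) \<and> (\<forall>y\<in>carrier (P (Suc n)).
      d' (Suc n) (s (Suc n) y) = f (Suc n) y \<ominus>\<^bsub>Q (Suc n)\<^esub> s n (d n y))"
  proof (rule dependent_nat_choice)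
    have "f 0 y \<in> d' 0 ` carrier (Q (Suc 0))" if "y \<in> carrier (P 0)" for y
      using aug[OF that] linear_map_closed[OF lin that] by (simp add: Q.exact Q.cycles_def)
    then obtain s where s: "linear_map R (P 0) (Q (Suc 0)) s" "\<forall>y\<in>carrier (P 0). d' 0 (s y) = f 0 y"
      using projective_lifting[OF P.projective Q.left_module_P Q.left_module_P Q.linear_d lin, of 0] by blast
    then have "?A 0 s" by (auto simp: P.cycles_def)
    then show "\<exists>s. ?A 0 s" by (rule exI[of _ s])
  next
    fix s n assume s: "?A n s"
    interpret Qn: left_module R "Q n" by (rule Q.left_module_P)
    interpret Q1: left_module R "Q (Suc n)" by (rule Q.left_module_P)
    let ?t = "\<lambda>y. f (Suc n) y \<ominus>\<^bsub>Q (Suc n)\<^esub> s (d n y)"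
    have t: "linear_map R (P (Suc n)) (Q (Suc n)) ?t"
      using s by (intro Q1.linear_map_diff[OF P.left_module_P lin] linear_map_comp[OF P.linear_d]) blast
    have "?t y \<in> d' (Suc n) ` carrier (Q (Suc (Suc n)))" if y: "y \<in> carrier (P (Suc n))" for y
    proof -
      have dy: "d n y \<in> carrier (P n)" using linear_map_closed[OF P.linear_d y] .
      have "d' n (?t y) = d' n (f (Suc n) y) \<ominus>\<^bsub>Q n\<^esub> d' n (s (d n y))"
        by (rule additive_map_minus[OF Q.abelian_group_P Q.abelian_group_P linear_map_additive[OF Q.linear_d]])
          (use linear_map_closed[OF lin y] linear_map_closed[OF _ dy] s in auto)
      also have "\<dots> = f n (d n y) \<ominus>\<^bsub>Q n\<^esub> f n (d n y)"
        using s chain[OF y] P.d_cycles[OF y] by simp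
      also have "\<dots> = \<zero>\<^bsub>Q n\<^esub>"
        using linear_map_closed[OF lin dy] by (simp add: Qn.M.minus_eq Qn.M.r_neg)
      finally show ?thesis
        using linear_map_closed[OF t y] by (simp add: Q.exact Q.cycles_def)
    qed
    then obtain s' where s': "linear_map R (P (Suc n)) (Q (Suc (Suc n))) s'"
        "\<forall>y\<in>carrier (P (Suc n)). d' (Suc n) (s' y) = ?t y"
      using projective_lifting[OF P.projective Q.left_module_P Q.left_module_P Q.linear_d t] by blast
    have "d' (Suc n) (s' y) = f (Suc n) y" if y: "y \<in> P.cycles (Suc n)" for y
    proof -
      have "y \<in> carrier (P (Suc n))" "d n y = \<zero>\<^bsub>P n\<^esub>" using y by (auto simp: P.cycles_def)
      moreover have "s \<zero>\<^bsub>P n\<^esub> = \<zero>\<^bsub>Q (Suc n)\<^esub>"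
        using left_module.linear_map_zero[OF Q.left_module_P P.abelian_group_P] s by blast
      ultimately show ?thesis
        using s'(2) linear_map_closed[OF lin] by (simp add: Q1.M.minus_eq)
    qed
    with s' show "\<exists>s'. ?A (Suc n) s' \<and> (\<forall>y\<in>carrier (P (Suc n)). d' (Suc n) (s' y) = ?t y)"
      by (intro exI[of _ s']) simp
  qed
  then obtain s where "\<forall>n. ?A n (s n) \<and> (\<forall>y\<in>carrier (P (Suc n)).
      d' (Suc n) (s (Suc n) y) = f (Suc n) y \<ominus>\<^bsub>Q (Suc n)\<^esub> s n (d n y))" ..
  then show ?thesis by (intro exI[of _ s]) simp
qed

section \<open>The complex of homomorphisms and its independence of the resolution\<close>

lemma hom_group_carrier:
  "f \<in> carrier (hom_group R M N) \<longleftrightarrow> linear_map R M N f \<and> f \<in> extensional (carrier M)"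
  by (auto simp: hom_group_def linear_map_def additive_map_def PiE_def)

lemma hom_group_simps:
  "f \<otimes>\<^bsub>hom_group R M N\<^esub> g = (\<lambda>x\<in>carrier M. f x \<oplus>\<^bsub>N\<^esub> g x)"
  "\<one>\<^bsub>hom_group R M N\<^esub> = (\<lambda>x\<in>carrier M. \<zero>\<^bsub>N\<^esub>)"
  by (simp_all add: hom_group_def)

text \<open>Members of \<open>hom_group\<close> are extensional, so a linear map enters it only
  after being cut off outside the carrier.\<close>

lemma linear_map_restrict:
  assumes M: "left_module R M" and f: "linear_map R M N f"
  shows "restrict f (carrier M) \<in> carrier (hom_group R M N)"
proof -
  interpret left_module R M by fact
  show ?thesis using f by (auto simp: hom_group_carrier linear_map_def additive_map_def)
qed

lemma hom_group_comm_group: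
  assumes M: "left_module R M" and N: "left_module R N"
  shows "comm_group (hom_group R M N)"
proof -
  interpret M: left_module R M by fact
  interpret N: left_module R N by fact
  let ?H = "hom_group R M N"
  have zero: "linear_map R M N (\<lambda>x. \<zero>\<^bsub>N\<^esub>)"
    by (auto simp: linear_map_def additive_map_def)
  have eq: "f = g" if "f \<in> carrier ?H" "g \<in> extensional (carrier M)" "\<And>x. x \<in> carrier M \<Longrightarrow> f x = g x" for f g
    using that by (auto simp: hom_group_carrier intro: extensionalityI)
  show ?thesis
  proof (rule comm_groupI)
    fix f g assume f: "f \<in> carrier ?H" and g: "g \<in> carrier ?H"
    then show fg: "f \<otimes>\<^bsub>?H\<^esub> g \<in> carrier ?H"
      unfolding hom_group_simps hom_group_carrier[of f] hom_group_carrier[of g]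
      by (intro linear_map_restrict[OF M] N.linear_map_sum[OF M]) auto
    show "f \<otimes>\<^bsub>?H\<^esub> g = g \<otimes>\<^bsub>?H\<^esub> f"
      using f g unfolding hom_group_simps
      by (intro restrict_ext) (auto simp: hom_group_carrier linear_map_closed N.M.a_comm)
  next
    show "\<one>\<^bsub>?H\<^esub> \<in> carrier ?H"
      unfolding hom_group_simps by (rule linear_map_restrict[OF M zero])
  next
    fix f g h assume "f \<in> carrier ?H" "g \<in> carrier ?H" "h \<in> carrier ?H"
    then show "f \<otimes>\<^bsub>?H\<^esub> g \<otimes>\<^bsub>?H\<^esub> h = f \<otimes>\<^bsub>?H\<^esub> (g \<otimes>\<^bsub>?H\<^esub> h)"
      unfolding hom_group_simps
      by (intro restrict_ext) (auto simp: hom_group_carrier linear_map_closed N.M.a_assoc)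
  next
    fix f assume f: "f \<in> carrier ?H"
    then show "\<one>\<^bsub>?H\<^esub> \<otimes>\<^bsub>?H\<^esub> f = f"
      by (intro eq[OF f, symmetric]) (auto simp: hom_group_simps hom_group_carrier linear_map_closed)
    have lin: "linear_map R M N f" using f by (simp add: hom_group_carrier)
    let ?g = "restrict (\<lambda>x. \<zero>\<^bsub>N\<^esub> \<ominus>\<^bsub>N\<^esub> f x) (carrier M)"
    have "?g \<in> carrier ?H"
      by (intro linear_map_restrict[OF M] N.linear_map_diff[OF M] zero lin)
    moreover have "?g \<otimes>\<^bsub>?H\<^esub> f = \<one>\<^bsub>?H\<^esub>"
      unfolding hom_group_simps
      by (intro restrict_ext) (simp add: linear_map_closed[OF lin] N.M.minus_eq N.M.l_neg)
    ultimately show "\<exists>g\<in>carrier ?H. g \<otimes>\<^bsub>?H\<^esub> f = \<one>\<^bsub>?H\<^esub>" by blast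
  qed
qed

lemma cochain_complex_hom:
  assumes P: "projective_resolution R M P d \<epsilon> Z" and N: "left_module R N"
  shows "cochain_complex (\<lambda>i. hom_group R (P i) N) (\<lambda>i f. \<lambda>x\<in>carrier (P (Suc i)). f (d i x))"
proof -
  interpret P: projective_resolution R M P d \<epsilon> Z by fact
  have closed: "d i x \<in> carrier (P i)" if "x \<in> carrier (P (Suc i))" for i x
    by (rule linear_map_closed[OF P.linear_d that])
  have "(\<lambda>f. \<lambda>x\<in>carrier (P (Suc i)). f (d i x)) \<in> hom (hom_group R (P i) N) (hom_group R (P (Suc i)) N)" for i
  proof (rule homI)
    fix f assume "f \<in> carrier (hom_group R (P i) N)"
    then show "(\<lambda>x\<in>carrier (P (Suc i)). f (d i x)) \<in> carrier (hom_group R (P (Suc i)) N)"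
      by (intro linear_map_restrict[OF P.left_module_P] linear_map_comp[OF P.linear_d])
        (simp add: hom_group_carrier)
  qed (auto simp: hom_group_simps closed intro!: restrict_ext)
  moreover have "(\<lambda>x\<in>carrier (P (Suc (Suc i))). (\<lambda>x\<in>carrier (P (Suc i)). f (d i x)) (d (Suc i) x)) =
      \<one>\<^bsub>hom_group R (P (Suc (Suc i))) N\<^esub>" if "f \<in> carrier (hom_group R (P i) N)" for i f
    unfolding hom_group_simps
    using that left_module.linear_map_zero[OF N P.abelian_group_P, where f=f]
    by (intro restrict_ext) (simp add: closed P.d_d hom_group_carrier)
  ultimately show ?thesis
    using hom_group_comm_group[OF P.left_module_P N] by (simp add: cochain_complex_def)
qed

text \<open>The difference of two lifts of the same map covers zero, so it is
  null-homotopic.\<close>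

lemma chain_homotopy:
  assumes P: "projective_resolution R M P d \<epsilon> Z" and Q: "projective_resolution R M Q d' \<epsilon>' Z'"
    and f: "\<And>n. linear_map R (P n) (Q n) (f n)" "\<And>y. y \<in> carrier (P 0) \<Longrightarrow> \<epsilon>' (f 0 y) = \<epsilon> y"
      "\<And>n y. y \<in> carrier (P (Suc n)) \<Longrightarrow> d' n (f (Suc n) y) = f n (d n y)"
    and g: "\<And>n. linear_map R (P n) (Q n) (g n)" "\<And>y. y \<in> carrier (P 0) \<Longrightarrow> \<epsilon>' (g 0 y) = \<epsilon> y"
      "\<And>n y. y \<in> carrier (P (Suc n)) \<Longrightarrow> d' n (g (Suc n) y) = g n (d n y)"
  shows "\<exists>s. (\<forall>n. linear_map R (P n) (Q (Suc n)) (s n)) \<and>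
     (\<forall>y\<in>carrier (P 0). d' 0 (s 0 y) = f 0 y \<ominus>\<^bsub>Q 0\<^esub> g 0 y) \<and>
     (\<forall>n. \<forall>y\<in>carrier (P (Suc n)). d' (Suc n) (s (Suc n) y) =
       (f (Suc n) y \<ominus>\<^bsub>Q (Suc n)\<^esub> g (Suc n) y) \<ominus>\<^bsub>Q (Suc n)\<^esub> s n (d n y))"
proof (rule chain_null_homotopy[OF P Q])
  interpret P: projective_resolution R M P d \<epsilon> Z by fact
  interpret Q: projective_resolution R M Q d' \<epsilon>' Z' by fact
  show "linear_map R (P n) (Q n) (\<lambda>y. f n y \<ominus>\<^bsub>Q n\<^esub> g n y)" for n
    by (rule left_module.linear_map_diff[OF Q.left_module_P P.left_module_P f(1) g(1)])
  show "\<epsilon>' (f 0 y \<ominus>\<^bsub>Q 0\<^esub> g 0 y) = \<zero>\<^bsub>M\<^esub>" if y: "y \<in> carrier (P 0)" for y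
    using additive_map_minus[OF Q.abelian_group_P P.M.M.abelian_group_axioms
        linear_map_additive[OF Q.linear_\<epsilon>] linear_map_closed[OF f(1) y] linear_map_closed[OF g(1) y]]
      linear_map_closed[OF P.linear_\<epsilon> y]
    by (simp add: f(2) g(2) y P.M.M.minus_eq P.M.M.r_neg)
  show "d' n (f (Suc n) y \<ominus>\<^bsub>Q (Suc n)\<^esub> g (Suc n) y) = f n (d n y) \<ominus>\<^bsub>Q n\<^esub> g n (d n y)"
    if y: "y \<in> carrier (P (Suc n))" for n y
    using additive_map_minus[OF Q.abelian_group_P Q.abelian_group_P
        linear_map_additive[OF Q.linear_d] linear_map_closed[OF f(1) y] linear_map_closed[OF g(1) y]]
    by (simp add: f(3) g(3) y)
qed

lemma (in abelian_group) minus_zero_imp_eq: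
  "\<lbrakk>x \<in> carrier G; y \<in> carrier G; x \<ominus> y = \<zero>\<rbrakk> \<Longrightarrow> x = y"
  by (metis a_inv_closed minus_eq minus_equality minus_minus)

text \<open>The homotopy identity solved for its middle term: p, q and r will be the values of a
  cocycle at the image of y under the composite chain map, at y itself, and at the homotopy applied
  to the boundary of y.\<close>

lemma (in abelian_group) minus_minus_zero_imp_eq:
  assumes "p \<in> carrier G" "q \<in> carrier G" "r \<in> carrier G" "(p \<ominus> q) \<ominus> r = \<zero>"
  shows "q = p \<ominus> r"
proof -
  have "p \<ominus> q = r"
    by (rule minus_zero_imp_eq[OF minus_closed[OF assms(1,2)] assms(3,4)])
  then have "p \<ominus> r = p \<ominus> (p \<ominus> q)" by simp
  also have "\<dots> = p \<oplus> (\<ominus> p \<oplus> q)" using assms(1,2) by (simp add: minus_eq minus_add)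
  finally show ?thesis using assms by (simp add: r_neg2)
qed

text \<open>Chain maps f and g exist in both directions, and both composites are homotopic to the
  identity, by s on Q and by t on P. The isomorphism is composition with f; injectivity uses s,
  surjectivity uses t together with composition with g.\<close>

theorem hom_cohomology_iso:
  fixes R :: "('r, 'x) ring_scheme"
  assumes P: "projective_resolution R M P d \<epsilon> Z" and Q: "projective_resolution R M Q d' \<epsilon>' Z'"
    and N: "left_module R N"
  shows "cohomology (\<lambda>i. hom_group R (Q i) N) (\<lambda>i f. \<lambda>x\<in>carrier (Q (Suc i)). f (d' i x)) n \<cong>
         cohomology (\<lambda>i. hom_group R (P i) N) (\<lambda>i f. \<lambda>x\<in>carrier (P (Suc i)). f (d i x)) n"
proof -
  interpret P: projective_resolution R M P d \<epsilon> Z by fact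
  interpret Q: projective_resolution R M Q d' \<epsilon>' Z' by fact
  interpret N: left_module R N by fact
  obtain f where f: "\<And>n. linear_map R (P n) (Q n) (f n)" "\<And>y. y \<in> carrier (P 0) \<Longrightarrow> \<epsilon>' (f 0 y) = \<epsilon> y"
     "\<And>n y. y \<in> carrier (P (Suc n)) \<Longrightarrow> d' n (f (Suc n) y) = f n (d n y)"
    using chain_lift[OF P Q] by metis
  obtain g where g: "\<And>n. linear_map R (Q n) (P n) (g n)" "\<And>y. y \<in> carrier (Q 0) \<Longrightarrow> \<epsilon> (g 0 y) = \<epsilon>' y"
     "\<And>n y. y \<in> carrier (Q (Suc n)) \<Longrightarrow> d n (g (Suc n) y) = g n (d' n y)"
    using chain_lift[OF Q P] by metis
  note fc = linear_map_closed[OF f(1)] and gc = linear_map_closed[OF g(1)]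
    and dc = linear_map_closed[OF P.linear_d] and dc' = linear_map_closed[OF Q.linear_d]
  have "\<exists>s. (\<forall>n. linear_map R (Q n) (Q (Suc n)) (s n)) \<and>
     (\<forall>y\<in>carrier (Q 0). d' 0 (s 0 y) = f 0 (g 0 y) \<ominus>\<^bsub>Q 0\<^esub> y) \<and>
     (\<forall>n. \<forall>y\<in>carrier (Q (Suc n)). d' (Suc n) (s (Suc n) y) =
       (f (Suc n) (g (Suc n) y) \<ominus>\<^bsub>Q (Suc n)\<^esub> y) \<ominus>\<^bsub>Q (Suc n)\<^esub> s n (d' n y))"
    by (rule chain_homotopy[OF Q Q, of "\<lambda>n y. f n (g n y)" "\<lambda>n y. y"])
      (simp_all add: f g gc linear_map_comp[OF g(1) f(1)] linear_map_id)
  then obtain s where s: "\<And>n. linear_map R (Q n) (Q (Suc n)) (s n)"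
     "\<And>y. y \<in> carrier (Q 0) \<Longrightarrow> d' 0 (s 0 y) = f 0 (g 0 y) \<ominus>\<^bsub>Q 0\<^esub> y"
     "\<And>n y. y \<in> carrier (Q (Suc n)) \<Longrightarrow> d' (Suc n) (s (Suc n) y) =
       (f (Suc n) (g (Suc n) y) \<ominus>\<^bsub>Q (Suc n)\<^esub> y) \<ominus>\<^bsub>Q (Suc n)\<^esub> s n (d' n y)"
    by metis
  have "\<exists>t. (\<forall>n. linear_map R (P n) (P (Suc n)) (t n)) \<and>
     (\<forall>y\<in>carrier (P 0). d 0 (t 0 y) = g 0 (f 0 y) \<ominus>\<^bsub>P 0\<^esub> y) \<and>
     (\<forall>n. \<forall>y\<in>carrier (P (Suc n)). d (Suc n) (t (Suc n) y) =
       (g (Suc n) (f (Suc n) y) \<ominus>\<^bsub>P (Suc n)\<^esub> y) \<ominus>\<^bsub>P (Suc n)\<^esub> t n (d n y))"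
    by (rule chain_homotopy[OF P P, of "\<lambda>n y. g n (f n y)" "\<lambda>n y. y"])
      (simp_all add: f g fc linear_map_comp[OF f(1) g(1)] linear_map_id)
  then obtain t where t: "\<And>n. linear_map R (P n) (P (Suc n)) (t n)"
     "\<And>y. y \<in> carrier (P 0) \<Longrightarrow> d 0 (t 0 y) = g 0 (f 0 y) \<ominus>\<^bsub>P 0\<^esub> y"
     "\<And>n y. y \<in> carrier (P (Suc n)) \<Longrightarrow> d (Suc n) (t (Suc n) y) =
       (g (Suc n) (f (Suc n) y) \<ominus>\<^bsub>P (Suc n)\<^esub> y) \<ominus>\<^bsub>P (Suc n)\<^esub> t n (d n y)"
    by metis
  let ?C = "\<lambda>i. hom_group R (Q i) N" and ?D = "\<lambda>i f. \<lambda>x\<in>carrier (Q (Suc i)). f (d' i x)"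
  let ?C' = "\<lambda>i. hom_group R (P i) N" and ?D' = "\<lambda>i f. \<lambda>x\<in>carrier (P (Suc i)). f (d i x)"
  let ?\<Phi> = "\<lambda>n a. \<lambda>x\<in>carrier (P n). a (f n x)"
  have Phi_chain: "\<And>i a. ?\<Phi> (Suc i) (?D i a) = ?D' i (?\<Phi> i a)"
    by (rule ext) (auto simp: restrict_def f(3) fc dc)
  have Phi_closed: "?\<Phi> i a \<in> carrier (?C' i)" if "a \<in> carrier (?C i)" for i a
    using that by (intro linear_map_restrict[OF P.left_module_P] linear_map_comp[OF f(1)])
      (simp add: hom_group_carrier)
  have Phi_one: "?\<Phi> i \<one>\<^bsub>?C i\<^esub> = \<one>\<^bsub>?C' i\<^esub>" for i
    by (auto simp: hom_group_simps fc intro!: restrict_ext)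
  have cocycle_Q: "a (d' n x) = \<zero>\<^bsub>N\<^esub>" if "a \<in> cocycles ?C ?D n" "x \<in> carrier (Q (Suc n))" for a n x
    using that by (auto simp: cocycles_iff hom_group_simps dest!: fun_cong[where x=x])
  have cocycle_P: "a (d n x) = \<zero>\<^bsub>N\<^esub>" if "a \<in> cocycles ?C' ?D' n" "x \<in> carrier (P (Suc n))" for a n x
    using that by (auto simp: cocycles_iff hom_group_simps dest!: fun_cong[where x=x])
  \<comment> \<open>Used with p the value of the composite chain map at y and r the homotopy applied
    to the boundary of y. The argument of a is then a boundary, on which a cocycle vanishes.\<close>
  have split: "a y = a p \<ominus>\<^bsub>N\<^esub> a r"
    if "abelian_group X" "linear_map R X N a" "p \<in> carrier X" "y \<in> carrier X" "r \<in> carrier X"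
      "a ((p \<ominus>\<^bsub>X\<^esub> y) \<ominus>\<^bsub>X\<^esub> r) = \<zero>\<^bsub>N\<^esub>" for X :: "('r, 'y) module" and a p y r
  proof (rule N.M.minus_minus_zero_imp_eq)
    note min = additive_map_minus[OF that(1) N.M.abelian_group_axioms linear_map_additive[OF that(2)]]
    interpret X: abelian_group X by fact
    show "(a p \<ominus>\<^bsub>N\<^esub> a y) \<ominus>\<^bsub>N\<^esub> a r = \<zero>\<^bsub>N\<^esub>" using that by (simp add: min)
  qed (use that linear_map_closed[OF that(2)] in auto)
  have split0: "a y = a p"
    if "abelian_group X" "linear_map R X N a" "p \<in> carrier X" "y \<in> carrier X"
      "a (p \<ominus>\<^bsub>X\<^esub> y) = \<zero>\<^bsub>N\<^esub>" for X :: "('r, 'y) module" and a p y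
  proof (rule N.M.minus_zero_imp_eq[symmetric])
    show "a p \<ominus>\<^bsub>N\<^esub> a y = \<zero>\<^bsub>N\<^esub>"
      using additive_map_minus[OF that(1) N.M.abelian_group_axioms linear_map_additive[OF that(2)]] that by simp
  qed (use that linear_map_closed[OF that(2)] in auto)
  show ?thesis
  proof (rule cohomology_iso[OF cochain_complex_hom[OF Q N] cochain_complex_hom[OF P N], of "?\<Phi> n"])
    show "?\<Phi> n \<in> hom (?C n) (?C' n)"
      by (rule homI[OF Phi_closed]) (auto simp: hom_group_simps fc intro!: restrict_ext)
    show "?\<Phi> n a \<in> cocycles ?C' ?D' n" if "a \<in> cocycles ?C ?D n" for a
      using that Phi_closed Phi_chain[of a n] Phi_one[of "Suc n"] by (simp add: cocycles_iff)
    show "?\<Phi> n a \<in> coboundaries ?C' ?D' n" if a: "a \<in> coboundaries ?C ?D n" for a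
    proof (cases n)
      case 0 then show ?thesis using a Phi_one[of 0] by (simp add: coboundaries_def)
    next
      case (Suc m)
      then obtain b where "b \<in> carrier (?C m)" "a = ?D m b" using a by (auto simp: coboundaries_def)
      then have "?\<Phi> n a = ?D' m (?\<Phi> m b)" using Suc Phi_chain[of b m] by (simp only:)
      then show ?thesis
        unfolding Suc coboundaries_def nat.case using imageI[OF Phi_closed[OF \<open>b \<in> carrier (?C m)\<close>], of "?D' m"]
        by (simp only:)
    qed
    show "a \<in> coboundaries ?C ?D n"
      if a: "a \<in> cocycles ?C ?D n" and b: "?\<Phi> n a \<in> coboundaries ?C' ?D' n" for a
    proof -
      have lin: "linear_map R (Q n) N a" and ext: "a \<in> extensional (carrier (Q n))"
        using a by (auto simp: cocycles_iff hom_group_carrier)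
      show ?thesis
      proof (cases n)
        case 0
        have "a y = \<zero>\<^bsub>N\<^esub>" if y: "y \<in> carrier (Q 0)" for y
        proof -
          have "a y = a (f 0 (g 0 y))"
            by (rule split0[OF Q.abelian_group_P[of 0]])
              (use 0 lin y fc gc cocycle_Q[OF a[unfolded 0] linear_map_closed[OF s(1) y]] s(2)[OF y] in auto)
          also have "\<dots> = ?\<Phi> 0 a (g 0 y)" using gc[OF y] by simp
          also have "\<dots> = \<zero>\<^bsub>N\<^esub>" using b 0 gc[OF y] by (simp add: coboundaries_def hom_group_simps)
          finally show ?thesis .
        qed
        then have "a = \<one>\<^bsub>?C 0\<^esub>"
          using ext 0 by (intro extensionalityI[of _ "carrier (Q 0)"]) (auto simp: hom_group_simps)
        then show ?thesis using 0 by (simp add: coboundaries_def)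
      next
        case (Suc m)
        obtain b where b: "b \<in> carrier (?C' m)" "?\<Phi> n a = ?D' m b"
          using b Suc by (auto simp: coboundaries_def)
        have blin: "linear_map R (P m) N b" using b by (simp add: hom_group_carrier)
        \<comment> \<open>If a composed with f is b composed with d, the homotopy identity gives a =
          a f g - a s d' = (b g - a s) d', so b g - a s is the required cochain.\<close>
        let ?b = "restrict (\<lambda>y. b (g m y) \<ominus>\<^bsub>N\<^esub> a (s m y)) (carrier (Q m))"
        have "linear_map R (Q m) N (\<lambda>y. a (s m y))"
          using linear_map_comp[OF s(1)[of m]] lin Suc by blast
        then have b': "?b \<in> carrier (?C m)"
          by (intro linear_map_restrict N.linear_map_diff Q.left_module_P linear_map_comp[OF g(1) blin])
        have "a y = ?b (d' m y)" if y: "y \<in> carrier (Q (Suc m))" for y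
        proof -
          have "a y = a (f (Suc m) (g (Suc m) y)) \<ominus>\<^bsub>N\<^esub> a (s m (d' m y))"
            by (rule split[OF Q.abelian_group_P[of "Suc m"]])
              (use Suc lin y fc gc cocycle_Q[OF a[unfolded Suc] linear_map_closed[OF s(1) y]] s(3)[OF y]
                linear_map_closed[OF s(1) dc'[OF y]] in auto)
          also have "a (f (Suc m) (g (Suc m) y)) = ?\<Phi> n a (g (Suc m) y)" using Suc gc[OF y] by simp
          also have "\<dots> = b (g m (d' m y))" unfolding b(2) using gc[OF y] g(3)[OF y] by simp
          finally show ?thesis using dc'[OF y] by simp
        qed
        then have "a = ?D m ?b"
          using ext Suc by (intro extensionalityI[of _ "carrier (Q n)"]) auto
        then show ?thesis
          unfolding Suc coboundaries_def nat.case using imageI[OF b', of "?D m"] by (simp only:)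
      qed
    qed
    show "\<exists>a\<in>cocycles ?C ?D n. \<exists>c\<in>coboundaries ?C' ?D' n. b = c \<otimes>\<^bsub>?C' n\<^esub> ?\<Phi> n a"
      if b: "b \<in> cocycles ?C' ?D' n" for b
    proof -
      have lin: "linear_map R (P n) N b" and ext: "b \<in> extensional (carrier (P n))"
        using b by (auto simp: cocycles_iff hom_group_carrier)
      let ?a = "restrict (\<lambda>y. b (g n y)) (carrier (Q n))"
      have "?a \<in> carrier (?C n)"
        by (intro linear_map_restrict Q.left_module_P linear_map_comp[OF g(1) lin])
      moreover have "?D n ?a = \<one>\<^bsub>?C (Suc n)\<^esub>"
        using cocycle_P[OF b] by (auto simp: hom_group_simps dc' gc simp flip: g(3) intro!: restrict_ext)
      ultimately have a: "?a \<in> cocycles ?C ?D n" by (simp add: cocycles_iff)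
      have "\<exists>c\<in>coboundaries ?C' ?D' n. \<forall>y\<in>carrier (P n). b y = c y \<oplus>\<^bsub>N\<^esub> b (g n (f n y))"
      proof (cases n)
        case 0
        have "b y = \<one>\<^bsub>?C' 0\<^esub> y \<oplus>\<^bsub>N\<^esub> b (g 0 (f 0 y))" if y: "y \<in> carrier (P 0)" for y
        proof -
          have "b y = b (g 0 (f 0 y))"
            by (rule split0[OF P.abelian_group_P[of 0]])
              (use 0 lin y fc gc cocycle_P[OF b[unfolded 0] linear_map_closed[OF t(1) y]] t(2)[OF y] in auto)
          then show ?thesis using y linear_map_closed[OF lin] 0 gc[OF fc[OF y]] by (simp add: hom_group_simps)
        qed
        then show ?thesis using 0 by (auto simp: coboundaries_def)
      next
        case (Suc m)
        have lin': "linear_map R (P m) N (\<lambda>y. b (t m y))"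
          using linear_map_comp[OF t(1)[of m]] lin Suc by blast
        have zero: "linear_map R (P m) N (\<lambda>y. \<zero>\<^bsub>N\<^esub>)" by (auto simp: linear_map_def additive_map_def)
        \<comment> \<open>For a cocycle b on P the homotopy identity reads b = b g f - b t d, so b
          differs from the image of b g by the coboundary of -b t.\<close>
        let ?c = "restrict (\<lambda>y. \<zero>\<^bsub>N\<^esub> \<ominus>\<^bsub>N\<^esub> b (t m y)) (carrier (P m))"
        have c: "?c \<in> carrier (?C' m)"
          by (intro linear_map_restrict N.linear_map_diff P.left_module_P zero lin')
        have "b y = ?D' m ?c y \<oplus>\<^bsub>N\<^esub> b (g (Suc m) (f (Suc m) y))" if y: "y \<in> carrier (P (Suc m))" for y
        proof -
          have "b y = b (g (Suc m) (f (Suc m) y)) \<ominus>\<^bsub>N\<^esub> b (t m (d m y))"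
            by (rule split[OF P.abelian_group_P[of "Suc m"]])
              (use Suc lin y fc gc cocycle_P[OF b[unfolded Suc] linear_map_closed[OF t(1) y]] t(3)[OF y]
                linear_map_closed[OF t(1) dc[OF y]] in auto)
          moreover have "b (g (Suc m) (f (Suc m) y)) \<in> carrier N" "b (t m (d m y)) \<in> carrier N"
            using linear_map_closed[OF lin[unfolded Suc]] gc[OF fc[OF y]]
              linear_map_closed[OF t(1) dc[OF y]] by auto
          ultimately show ?thesis using y dc[OF y] by (simp add: N.M.minus_eq N.M.a_comm)
        qed
        then show ?thesis
          unfolding Suc coboundaries_def nat.case using imageI[OF c, of "?D' m"] by blast
      qed
      then obtain c where c: "c \<in> coboundaries ?C' ?D' n"
        "\<And>y. y \<in> carrier (P n) \<Longrightarrow> b y = c y \<oplus>\<^bsub>N\<^esub> b (g n (f n y))" by blast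
      have "b = c \<otimes>\<^bsub>?C' n\<^esub> ?\<Phi> n ?a"
        using ext by (intro extensionalityI[of _ "carrier (P n)"]) (auto simp: hom_group_simps c(2) fc)
      with a c(1) show ?thesis by blast
    qed
  qed
qed

section \<open>The canonical resolution by cells is a projective resolution\<close>

lemma combination_closed:
  fixes R :: "('r, 'x) ring_scheme"
  assumes "ring R" "set l \<subseteq> carrier R \<times> X"
  shows "combination R l \<in> carrier (free_module R X)"
proof -
  interpret ring R by fact
  have "combination R l x \<in> carrier R" for x
    using assms(2) by (induction l) (auto simp: combination_def)
  moreover have "combination R l x = \<zero>\<^bsub>R\<^esub>" if "x \<notin> snd ` set l" for x
    using that by (induction l) (auto simp: combination_def)
  moreover have "finite {x. combination R l x \<noteq> \<zero>\<^bsub>R\<^esub>}"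
    by (rule finite_subset[of _ "snd ` set l"]) (use calculation(2) in auto)
  moreover have "snd ` set l \<subseteq> X" using assms(2) by auto
  ultimately show ?thesis
    unfolding free_module_simps by blast
qed

text \<open>The support is listed without repetition, since repeated entries would add up their
  coefficients. This is why the generators \<open>Rel l\<close>, though indexed by lists, reach
  every element of a kernel.\<close>

lemma combination_surj:
  fixes R :: "('r, 'x) ring_scheme"
  assumes "ring R" and f: "f \<in> carrier (free_module R X)"
  obtains l where "set l \<subseteq> carrier R \<times> X" "combination R l = f"
proof -
  interpret ring R by fact
  have f': "finite {x. f x \<noteq> \<zero>\<^bsub>R\<^esub>}" "{x. f x \<noteq> \<zero>\<^bsub>R\<^esub>} \<subseteq> X" "\<And>x. f x \<in> carrier R"
    using f by (auto simp: free_module_simps)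
  obtain xs where xs: "set xs = {x. f x \<noteq> \<zero>\<^bsub>R\<^esub>}" "distinct xs"
    using finite_distinct_list[OF f'(1)] by blast
  have "combination R (map (\<lambda>x. (f x, x)) ys) y = (if y \<in> set ys then f y else \<zero>\<^bsub>R\<^esub>)"
    if "distinct ys" for ys y
    using that by (induction ys) (auto simp: combination_def f'(3))
  with xs have "combination R (map (\<lambda>x. (f x, x)) xs) = f" by (intro ext) auto
  moreover have "set (map (\<lambda>x. (f x, x)) xs) \<subseteq> carrier R \<times> X" using xs(1) f'(2,3) by auto
  ultimately show ?thesis using that by blast
qed

lemma projective_over_free:
  assumes "ring R" shows "projective_over R X (free_module R X)"
  using left_module_free[OF assms] linear_map_id unfolding projective_over_def by blast

text \<open>One step of the resolution for an arbitrary linear map f out of a free module: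
  \<open>Y\<close> contains a generator for every relation, hence its boundary map covers the kernel
  of f. The augmentation is the case of degree 0, and the previous boundary map that of all later
  degrees.\<close>

lemma free_cover_image:
  fixes R :: "('r, 'x) ring_scheme"
  assumes R: "ring R" and N: "left_module R N" and f: "linear_map R (free_module R X) N f"
    and Y: "Y = {Rel l |l. set l \<subseteq> carrier R \<times> X \<and> f (combination R l) = \<zero>\<^bsub>N\<^esub>}"
  shows "cell_boundary R X ` carrier (free_module R Y) = {y \<in> carrier (free_module R X). f y = \<zero>\<^bsub>N\<^esub>}"
    and "linear_map R (free_module R Y) (free_module R X) (cell_boundary R X)"
proof -
  interpret N: left_module R N by fact
  have F: "left_module R (free_module R X)" "left_module R (free_module R Y)"
    by (simp_all add: left_module_free R)
  have t: "(\<lambda>c. combination R (rel_of c)) \<in> Y \<rightarrow> carrier (free_module R X)"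
    using combination_closed[OF R] by (auto simp: Y)
  show lin: "linear_map R (free_module R Y) (free_module R X) (cell_boundary R X)"
    unfolding cell_boundary_def by (rule linear_extension_linear[OF F(1) t])
  have basis: "cell_boundary R X (basis_vector R (Rel l)) = combination R l"
    if "set l \<subseteq> carrier R \<times> X" for l
    unfolding cell_boundary_def using linear_extension_basis[OF F(1), of "\<lambda>c. combination R (rel_of c)" "Rel l"]
      combination_closed[OF R that] by simp
  have zero: "linear_map R (free_module R Y) N (\<lambda>y. \<zero>\<^bsub>N\<^esub>)"
    by (auto simp: linear_map_def additive_map_def)
  have "f (cell_boundary R X y) = \<zero>\<^bsub>N\<^esub>" if "y \<in> carrier (free_module R Y)" for y
    by (rule linear_map_eq_on_basis[OF N linear_map_comp[OF lin f] zero _ that]) (auto simp: Y basis)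
  moreover have "y \<in> cell_boundary R X ` carrier (free_module R Y)"
    if y: "y \<in> carrier (free_module R X)" "f y = \<zero>\<^bsub>N\<^esub>" for y
  proof -
    obtain l where l: "set l \<subseteq> carrier R \<times> X" "combination R l = y"
      by (rule combination_surj[OF R y(1)])
    then have "Rel l \<in> Y" using y(2) by (auto simp: Y)
    then have "basis_vector R (Rel l) \<in> carrier (free_module R Y)" by (rule basis_vector_closed[OF R])
    then show ?thesis using basis[OF l(1)] l(2) by (intro image_eqI[of _ _ "basis_vector R (Rel l)"]) auto
  qed
  ultimately show "cell_boundary R X ` carrier (free_module R Y) = {y \<in> carrier (free_module R X). f y = \<zero>\<^bsub>N\<^esub>}"
    using linear_map_closed[OF lin] by blast
qed

lemma projective_resolution_cells:
  assumes M: "left_module R M"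
  shows "projective_resolution R M (resolution R M) (resolution_diff R M) (cell_augmentation R M) (cells R M)"
proof -
  interpret M: left_module R M by fact
  note R = M.R.ring_axioms
  have t: "elt_of \<in> cells R M 0 \<rightarrow> carrier M" by auto
  have aug: "linear_map R (free_module R (cells R M 0)) M (cell_augmentation R M)"
    unfolding cell_augmentation_def by (rule linear_extension_linear[OF M t])
  have aug_surj: "cell_augmentation R M ` carrier (free_module R (cells R M 0)) = carrier M"
  proof (intro equalityI subsetI)
    fix x assume "x \<in> carrier M"
    then have "cell_augmentation R M (basis_vector R (Elt x)) = x"
      unfolding cell_augmentation_def using linear_extension_basis[OF M, of elt_of "Elt x"] by simp
    moreover have "basis_vector R (Elt x) \<in> carrier (free_module R (cells R M 0))"
      by (rule basis_vector_closed[OF R]) (simp add: \<open>x \<in> carrier M\<close>)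
    ultimately show "x \<in> cell_augmentation R M ` carrier (free_module R (cells R M 0))"
      by (metis image_eqI)
  qed (use linear_map_closed[OF aug] in auto)
  note 1 = free_cover_image[OF R M aug cells.simps(2)]
  have lin: "linear_map R (free_module R (cells R M (Suc n))) (free_module R (cells R M n))
      (cell_boundary R (cells R M n))" for n
  proof (induction n)
    case 0 show ?case by (rule 1(2))
  next
    case (Suc n) show ?case by (rule free_cover_image(2)[OF R left_module_free[OF R] Suc cells.simps(3)])
  qed
  note 2 = free_cover_image(1)[OF R left_module_free[OF R] lin cells.simps(3)]
  show ?thesis
    by unfold_locales
      (simp_all only: resolution_def resolution_diff_def projective_over_free[OF R] lin aug aug_surj 1(1) 2)
qed

corollary Ext_iso_projective_resolution:
  assumes P: "projective_resolution R M P d \<epsilon> Z" and N: "left_module R N"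
  shows "Ext R n M N \<cong>
    cohomology (\<lambda>i. hom_group R (P i) N) (\<lambda>i f. \<lambda>x\<in>carrier (P (Suc i)). f (d i x)) n"
proof -
  interpret projective_resolution R M P d \<epsilon> Z by fact
  show ?thesis
    unfolding Ext_def
    by (rule hom_cohomology_iso[OF P projective_resolution_cells[OF M.left_module_axioms] N])
qed

section \<open>Normal forms in \<open>S(G)\<close>\<close>

primrec word_deg :: "'g monoid \<Rightarrow> 'g list \<Rightarrow> 'g" where
  "word_deg G [] = \<one>\<^bsub>G\<^esub>"
| "word_deg G (g # w) = g \<otimes>\<^bsub>G\<^esub> word_deg G w"

definition translate :: "'g monoid \<Rightarrow> 'g \<Rightarrow> 'g set \<Rightarrow> 'g set" where
  "translate G g X = (\<lambda>x. g \<otimes>\<^bsub>G\<^esub> x) ` X"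

primrec word_support :: "'g monoid \<Rightarrow> 'g list \<Rightarrow> 'g set" where
  "word_support G [] = {\<one>\<^bsub>G\<^esub>}"
| "word_support G (g # w) = insert \<one>\<^bsub>G\<^esub> (translate G g (word_support G w))"

text \<open>A product of the basic idempotents \<open>[a][inv a]\<close> of S(G). Every element of
  S(G) will be such a product times a single generator.\<close>

definition idem_word :: "'g monoid \<Rightarrow> 'g list \<Rightarrow> 'g list" where
  "idem_word G as = concat (map (\<lambda>a. [a, inv\<^bsub>G\<^esub> a]) as)"

lemma idem_word_simps [simp]:
  "idem_word G [] = []"
  "idem_word G (a # as) = a # inv\<^bsub>G\<^esub> a # idem_word G as"
  "idem_word G (as @ bs) = idem_word G as @ idem_word G bs"
  by (simp_all add: idem_word_def)

locale word_group = group G for G :: "'g monoid" (structure)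
begin

lemma translate_closed: "\<lbrakk>g \<in> carrier G; X \<subseteq> carrier G\<rbrakk> \<Longrightarrow> translate G g X \<subseteq> carrier G"
  by (auto simp: translate_def)

lemma translate_one [simp]: "X \<subseteq> carrier G \<Longrightarrow> translate G \<one> X = X"
  by (force simp: translate_def)

lemma translate_translate:
  "\<lbrakk>g \<in> carrier G; h \<in> carrier G; X \<subseteq> carrier G\<rbrakk> \<Longrightarrow> translate G g (translate G h X) = translate G (g \<otimes> h) X"
  by (force simp: translate_def image_image m_assoc intro!: image_cong)

lemma translate_Un: "translate G g (X \<union> Y) = translate G g X \<union> translate G g Y"
  by (auto simp: translate_def)

lemma translate_insert: "translate G g (insert x X) = insert (g \<otimes> x) (translate G g X)"
  by (auto simp: translate_def)

lemma translate_empty: "translate G g {} = {}"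
  by (auto simp: translate_def)

lemma finite_translate: "finite X \<Longrightarrow> finite (translate G g X)"
  by (simp add: translate_def)

lemma word_deg_closed [simp]: "w \<in> lists (carrier G) \<Longrightarrow> word_deg G w \<in> carrier G"
  by (induction w) auto

lemma word_support_closed: "w \<in> lists (carrier G) \<Longrightarrow> word_support G w \<subseteq> carrier G"
  by (induction w) (use translate_closed in auto)

lemma word_support_finite: "finite (word_support G w)"
  by (induction w) (auto simp: finite_translate)

lemma one_in_word_support [simp]: "\<one> \<in> word_support G w"
  by (cases w) auto

lemma word_deg_in_support: "w \<in> lists (carrier G) \<Longrightarrow> word_deg G w \<in> word_support G w"
  by (induction w) (auto simp: translate_def)

lemma word_deg_append:
  "\<lbrakk>v \<in> lists (carrier G); w \<in> lists (carrier G)\<rbrakk> \<Longrightarrow> word_deg G (v @ w) = word_deg G v \<otimes> word_deg G w"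
  by (induction v) (auto simp: m_assoc)

text \<open>Together with \<open>word_deg_append\<close> this is the multiplication (X, g)(Y, h) =
  (X \<union> gY, gh) of the Szendrei expansion of G, to which S(G) is isomorphic.\<close>

lemma word_support_append:
  assumes "v \<in> lists (carrier G)" "w \<in> lists (carrier G)"
  shows "word_support G (v @ w) = word_support G v \<union> translate G (word_deg G v) (word_support G w)"
  using assms(1)
proof (induction v)
  case Nil
  then show ?case
    using word_support_closed[OF assms(2)] by (auto simp: insert_absorb)
next
  case (Cons a v)
  then show ?case
    using word_support_closed[OF assms(2)] by (simp add: translate_Un translate_translate)
qed

text \<open>A defining relation drops only a prefix product that occurs elsewhere in the word: 1 in
  the left relation, g in the right one.\<close>

lemma par_rel_sound:
  "(v, w) \<in> par_rel G \<Longrightarrow> v \<in> lists (carrier G) \<and> w \<in> lists (carrier G) \<and>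
     word_support G v = word_support G w \<and> word_deg G v = word_deg G w"
proof (induction rule: par_rel.induct)
  case (left g h)
  then have "inv g \<otimes> (g \<otimes> h) = h" by (simp flip: m_assoc)
  with left show ?case by (auto simp: translate_insert translate_empty)
next
  case (right g h)
  then have "g \<otimes> (h \<otimes> inv h) = g" "g \<otimes> h \<otimes> inv h = g" by (simp_all add: m_assoc)
  with right show ?case by (auto simp: translate_insert translate_empty)
next
  case (cong v w x y)
  then show ?case by (simp add: word_support_append word_deg_append)
qed (auto simp: translate_insert translate_empty)

lemma par_rel_lists: "(v, w) \<in> par_rel G \<Longrightarrow> v \<in> lists (carrier G)" "(v, w) \<in> par_rel G \<Longrightarrow> w \<in> lists (carrier G)"
  using par_rel_sound by auto

lemma par_rel_append:
  assumes "(v, v') \<in> par_rel G" "(w, w') \<in> par_rel G" shows "(v @ w, v' @ w') \<in> par_rel G"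
  using par_rel.cong[OF assms(1), of "[]" w] par_rel.cong[OF assms(2), of v' "[]"] par_rel_lists assms
  by (auto intro: par_rel.trans)

text \<open>Both words equal \<open>[g \<otimes> h, inv h]\<close>. Reading e(h) for
  \<open>[h][inv h]\<close>, the rule says [g] e(h) = e(gh) [g]: idempotents can be moved to the
  left past a generator.\<close>

lemma par_rel_shift_idem:
  assumes "g \<in> carrier G" "h \<in> carrier G"
  shows "([g, h, inv h], [g \<otimes> h, inv (g \<otimes> h), g]) \<in> par_rel G"
proof -
  have "inv (g \<otimes> h) \<otimes> g = inv h" using assms by (simp add: inv_mult_group m_assoc)
  then have "([g \<otimes> h, inv (g \<otimes> h), g], [g \<otimes> h, inv h]) \<in> par_rel G"
    using par_rel.left[of "inv (g \<otimes> h)" G g] assms by simp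
  with par_rel.right[OF assms] show ?thesis by (blast intro: par_rel.intros)
qed

text \<open>Shifting twice: e(b) passes \<open>[inv a]\<close> as the idempotent of
  \<open>inv a \<otimes> b\<close>, and this passes \<open>[a]\<close> as e(b) again.\<close>

lemma par_rel_idem_commute:
  assumes a: "a \<in> carrier G" and b: "b \<in> carrier G"
  shows "([a, inv a, b, inv b], [b, inv b, a, inv a]) \<in> par_rel G"
proof -
  have 1: "([inv a, b, inv b], [inv a \<otimes> b, inv (inv a \<otimes> b), inv a]) \<in> par_rel G"
    using par_rel_shift_idem[of "inv a" b] a b by simp
  have 2: "([a, inv a \<otimes> b, inv (inv a \<otimes> b)], [b, inv b, a]) \<in> par_rel G"
    using par_rel_shift_idem[of a "inv a \<otimes> b"] a b by (simp flip: m_assoc)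
  have "([a] @ [inv a, b, inv b], [a] @ [inv a \<otimes> b, inv (inv a \<otimes> b), inv a]) \<in> par_rel G"
    using a by (intro par_rel_append 1 par_rel.refl) auto
  moreover have "([a, inv a \<otimes> b, inv (inv a \<otimes> b)] @ [inv a], [b, inv b, a] @ [inv a]) \<in> par_rel G"
    using a by (intro par_rel_append 2 par_rel.refl) auto
  ultimately show ?thesis by (auto intro: par_rel.trans)
qed

lemma par_rel_idem_square:
  assumes "a \<in> carrier G" shows "([a, inv a, a, inv a], [a, inv a]) \<in> par_rel G"
proof -
  have "([a] @ [inv a, a, inv a], [a] @ [inv a, \<one>]) \<in> par_rel G"
    using par_rel.left[of a G "inv a"] assms by (intro par_rel_append[OF par_rel.refl]) auto
  moreover have "([a] @ [inv a, \<one>], [a] @ [inv a]) \<in> par_rel G"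
    using par_rel.one[of "inv a"] assms by (intro par_rel_append[OF par_rel.refl]) auto
  ultimately show ?thesis by (auto intro: par_rel.trans)
qed

lemma idem_word_lists: "as \<in> lists (carrier G) \<Longrightarrow> idem_word G as \<in> lists (carrier G)"
  by (induction as) auto

lemma par_rel_idem_word_move:
  assumes "a \<in> carrier G" "as \<in> lists (carrier G)"
  shows "([a, inv a] @ idem_word G as, idem_word G as @ [a, inv a]) \<in> par_rel G"
  using assms(2)
proof (induction as)
  case Nil
  then show ?case using assms(1) by (simp add: par_rel.refl)
next
  case (Cons b as)
  have "([a, inv a, b, inv b] @ idem_word G as, [b, inv b, a, inv a] @ idem_word G as) \<in> par_rel G"
    using Cons by (intro par_rel_append par_rel_idem_commute assms(1) par_rel.refl idem_word_lists) auto
  moreover have "([b, inv b] @ ([a, inv a] @ idem_word G as), [b, inv b] @ (idem_word G as @ [a, inv a])) \<in> par_rel G"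
    using Cons by (intro par_rel_append[OF par_rel.refl]) auto
  ultimately show ?case by (auto intro: par_rel.trans)
qed

lemma par_rel_idem_word_absorb:
  assumes "a \<in> set as" "as \<in> lists (carrier G)"
  shows "([a, inv a] @ idem_word G as, idem_word G as) \<in> par_rel G"
  using assms
proof (induction as)
  case (Cons b as)
  show ?case
  proof (cases "a = b")
    case True
    have "([a, inv a, a, inv a] @ idem_word G as, [a, inv a] @ idem_word G as) \<in> par_rel G"
      using Cons True by (intro par_rel_append par_rel_idem_square par_rel.refl idem_word_lists) auto
    with True show ?thesis by simp
  next
    case False
    then have a: "a \<in> set as" "a \<in> carrier G" using Cons by auto
    have "([a, inv a, b, inv b] @ idem_word G as, [b, inv b, a, inv a] @ idem_word G as) \<in> par_rel G"
      using Cons a by (intro par_rel_append par_rel_idem_commute par_rel.refl idem_word_lists) auto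
    moreover have "([b, inv b] @ ([a, inv a] @ idem_word G as), [b, inv b] @ idem_word G as) \<in> par_rel G"
      using Cons a by (intro par_rel_append[OF par_rel.refl]) auto
    ultimately show ?thesis by (auto intro: par_rel.trans)
  qed
qed simp

lemma par_rel_idem_word_absorb_list:
  assumes "set bs \<subseteq> set as" "as \<in> lists (carrier G)"
  shows "(idem_word G bs @ idem_word G as, idem_word G as) \<in> par_rel G"
  using assms(1)
proof (induction bs)
  case Nil
  then show ?case using assms(2) idem_word_lists by (auto intro: par_rel.refl)
next
  case (Cons b bs)
  then have "([b, inv b] @ (idem_word G bs @ idem_word G as), [b, inv b] @ idem_word G as) \<in> par_rel G"
    using assms(2) by (intro par_rel_append[OF par_rel.refl]) auto
  with par_rel_idem_word_absorb[of b as] Cons assms(2) show ?case by (auto intro: par_rel.trans)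
qed

lemma par_rel_idem_word_commute:
  assumes "as \<in> lists (carrier G)" "bs \<in> lists (carrier G)"
  shows "(idem_word G as @ idem_word G bs, idem_word G bs @ idem_word G as) \<in> par_rel G"
  using assms(1)
proof (induction as)
  case Nil
  then show ?case using assms(2) idem_word_lists by (auto intro: par_rel.refl)
next
  case (Cons a as)
  have "([a, inv a] @ (idem_word G as @ idem_word G bs), [a, inv a] @ (idem_word G bs @ idem_word G as)) \<in> par_rel G"
    using Cons by (intro par_rel_append[OF par_rel.refl]) auto
  moreover have "(([a, inv a] @ idem_word G bs) @ idem_word G as, (idem_word G bs @ [a, inv a]) @ idem_word G as) \<in> par_rel G"
    using Cons assms by (intro par_rel_append par_rel_idem_word_move par_rel.refl idem_word_lists) auto
  ultimately show ?case by (auto intro: par_rel.trans)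
qed

text \<open>Each of two words with the same letters absorbs the other, and the two commute; so the
  order and the multiplicity of the letters do not matter.\<close>

lemma par_rel_idem_word_set:
  assumes "as \<in> lists (carrier G)" "set as = set bs"
  shows "(idem_word G as, idem_word G bs) \<in> par_rel G"
proof -
  have bs: "bs \<in> lists (carrier G)" using assms by auto
  have "(idem_word G bs @ idem_word G as, idem_word G as) \<in> par_rel G"
    "(idem_word G as @ idem_word G bs, idem_word G bs) \<in> par_rel G"
    using assms bs by (auto intro!: par_rel_idem_word_absorb_list)
  with par_rel_idem_word_commute[OF assms(1) bs] show ?thesis by (meson par_rel.sym par_rel.trans)
qed

lemma par_rel_shift_idem_word:
  assumes "g \<in> carrier G" "as \<in> lists (carrier G)"
  shows "(g # idem_word G as, idem_word G (map (\<lambda>x. g \<otimes> x) as) @ [g]) \<in> par_rel G"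
  using assms(2)
proof (induction as)
  case Nil
  then show ?case using assms(1) by (simp add: par_rel.refl)
next
  case (Cons a as)
  have "([g, a, inv a] @ idem_word G as, [g \<otimes> a, inv (g \<otimes> a), g] @ idem_word G as) \<in> par_rel G"
    using Cons by (intro par_rel_append par_rel_shift_idem assms(1) par_rel.refl idem_word_lists) auto
  moreover have "([g \<otimes> a, inv (g \<otimes> a)] @ (g # idem_word G as),
      [g \<otimes> a, inv (g \<otimes> a)] @ (idem_word G (map (\<lambda>x. g \<otimes> x) as) @ [g])) \<in> par_rel G"
    using Cons assms by (intro par_rel_append[OF par_rel.refl]) auto
  ultimately show ?case by (auto intro: par_rel.trans)
qed

text \<open>Reading a word from the right, the idempotents collected so far are shifted past the
  next generator, which translates their letters; the new generator then contributes one more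
  idempotent.\<close>

lemma par_rel_normal_form:
  assumes "w \<in> lists (carrier G)"
  shows "\<exists>as. as \<in> lists (carrier G) \<and> set as = word_support G w \<and> (w, idem_word G as @ [word_deg G w]) \<in> par_rel G"
  using assms
proof (induction w)
  case Nil
  \<comment> \<open>The normal form of the empty word consists of three letters 1: two from the
    idempotent of 1, which is needed because the support contains 1, and one for the degree.\<close>
  have "([] @ [], [\<one>] @ [\<one>]) \<in> par_rel G"
    by (intro par_rel_append par_rel.sym[OF par_rel.unit])
  then have "([] @ [], ([\<one>] @ [\<one>]) @ [\<one>]) \<in> par_rel G"
    using par_rel_append[OF _ par_rel.sym[OF par_rel.unit]] by force
  then show ?case by (intro exI[of _ "[\<one>]"]) auto
next
  case (Cons g w)
  then obtain as where as: "as \<in> lists (carrier G)" "set as = word_support G w"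
    "(w, idem_word G as @ [word_deg G w]) \<in> par_rel G" and g: "g \<in> carrier G" by auto
  let ?d = "word_deg G w"
  let ?bs = "map (\<lambda>x. g \<otimes> x) as"
  have d: "?d \<in> carrier G" using Cons by auto
  have bs: "?bs \<in> lists (carrier G)" using as g by auto
  have "([g] @ w, [g] @ (idem_word G as @ [?d])) \<in> par_rel G"
    using g as by (intro par_rel_append[OF par_rel.refl]) auto
  moreover have "((g # idem_word G as) @ [?d], (idem_word G ?bs @ [g]) @ [?d]) \<in> par_rel G"
    using g d as by (intro par_rel_append par_rel_shift_idem_word par_rel.refl) auto
  \<comment> \<open>The left relation read backwards: [g][h] = [g][inv g][g h]. It merges the two
    generators into one at the cost of the idempotent of g.\<close>
  moreover have "(idem_word G ?bs @ [g, ?d], idem_word G ?bs @ [g, inv g, g \<otimes> ?d]) \<in> par_rel G"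
  proof (intro par_rel_append par_rel.refl idem_word_lists bs)
    have "inv g \<otimes> (g \<otimes> ?d) = ?d" using g d by (simp flip: m_assoc)
    then show "([g, ?d], [g, inv g, g \<otimes> ?d]) \<in> par_rel G"
      using par_rel.left[of "inv g" G "g \<otimes> ?d"] g d by (auto intro: par_rel.sym)
  qed
  \<comment> \<open>The prefix 1 belongs to every support, so its idempotent, which is trivial, is
    put in front.\<close>
  moreover have "(idem_word G ?bs @ [g, inv g], [\<one>, \<one>] @ (idem_word G ?bs @ [g, inv g])) \<in> par_rel G"
    using par_rel_append[OF par_rel_append[OF par_rel.sym[OF par_rel.unit] par_rel.sym[OF par_rel.unit]]
        par_rel.refl[of "idem_word G ?bs @ [g, inv g]" G]] idem_word_lists[OF bs] g by auto
  then have "((idem_word G ?bs @ [g, inv g]) @ [g \<otimes> ?d], ([\<one>, \<one>] @ (idem_word G ?bs @ [g, inv g])) @ [g \<otimes> ?d]) \<in> par_rel G"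
    using g d by (intro par_rel_append[OF _ par_rel.refl]) auto
  ultimately have "(g # w, idem_word G (\<one> # ?bs @ [g]) @ [word_deg G (g # w)]) \<in> par_rel G"
    by (auto intro: par_rel.trans)
  moreover have "g = g \<otimes> \<one>" using g by simp
  then have "g \<in> translate G g (word_support G w)"
    unfolding translate_def using one_in_word_support by (rule image_eqI)
  then have "set (\<one> # ?bs @ [g]) = word_support G (g # w)"
    using as(2) by (auto simp: translate_def)
  moreover have "\<one> # ?bs @ [g] \<in> lists (carrier G)" using bs g by auto
  ultimately show ?case by blast
qed

text \<open>Solves the word problem of S(G). Words with equal support and degree have normal forms
  that differ only in the listing of the idempotents.\<close>

theorem par_rel_iff:
  "(v, w) \<in> par_rel G \<longleftrightarrow> v \<in> lists (carrier G) \<and> w \<in> lists (carrier G) \<and>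
     word_support G v = word_support G w \<and> word_deg G v = word_deg G w"
proof (intro iffI; (elim conjE)?)
  assume v: "v \<in> lists (carrier G)" and w: "w \<in> lists (carrier G)"
    and eq: "word_support G v = word_support G w" "word_deg G v = word_deg G w"
  obtain as where as: "as \<in> lists (carrier G)" "set as = word_support G v"
    "(v, idem_word G as @ [word_deg G v]) \<in> par_rel G" using par_rel_normal_form[OF v] by blast
  obtain bs where bs: "bs \<in> lists (carrier G)" "set bs = word_support G w"
    "(w, idem_word G bs @ [word_deg G w]) \<in> par_rel G" using par_rel_normal_form[OF w] by blast
  have "(idem_word G as @ [word_deg G v], idem_word G bs @ [word_deg G w]) \<in> par_rel G"
    unfolding eq(2) using as bs eq w
    by (intro par_rel_append par_rel_idem_word_set par_rel.refl) auto
  with as(3) bs(3) show "(v, w) \<in> par_rel G" by (meson par_rel.sym par_rel.trans)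
qed (use par_rel_sound in blast)

end

section \<open>Modules over semigroup algebras\<close>

text \<open>The modules below share their additive groups and differ in their scalars; the type of
  the scalars is part of the record type, so the group axioms have to be transferred.\<close>

lemma abelian_group_cong:
  fixes M :: "('m, 'x) ring_scheme" and N :: "('m, 'y) ring_scheme"
  assumes "abelian_group M" "carrier N = carrier M" "add N = add M" "zero N = zero M"
  shows "abelian_group N"
proof -
  interpret abelian_group M by fact
  show ?thesis
  proof (rule abelian_groupI)
    fix x assume "x \<in> carrier N"
    then show "\<exists>y\<in>carrier N. y \<oplus>\<^bsub>N\<^esub> x = \<zero>\<^bsub>N\<^esub>"
      using assms by (intro bexI[of _ "\<ominus>\<^bsub>M\<^esub> x"]) (auto simp: l_neg)
  qed (use assms in \<open>auto simp: a_ac\<close>)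
qed

text \<open>The module over the semigroup algebra given by a linear representation of the monoid.
  The module of the partial action and K E(S(G)) are both of this form.\<close>

definition rep_module :: "'k ring \<Rightarrow> 's monoid \<Rightarrow> ('k, 'v) module \<Rightarrow> ('s \<Rightarrow> 'v \<Rightarrow> 'v) \<Rightarrow> ('s \<Rightarrow> 'k, 'v) module" where
  "rep_module K S V \<rho> =
     \<lparr>carrier = carrier V, mult = mult V, one = one V, zero = zero V, add = add V,
      smult = (\<lambda>f v. linear_extension K V (\<lambda>s. \<rho> s v) f)\<rparr>"

text \<open>K acts through the multiples of the unit of the semigroup algebra. Over K the modules in
  question are free on a set, so maps out of them can be defined and compared on basis
  vectors.\<close>

definition restrict_scalars ::
  "'k ring \<Rightarrow> 's monoid \<Rightarrow> ('s \<Rightarrow> 'k, 'm) module \<Rightarrow> ('k, 'm) module" where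
  "restrict_scalars K S N =
     \<lparr>carrier = carrier N, mult = mult N, one = one N, zero = zero N, add = add N,
      smult = (\<lambda>k x. (k \<odot>\<^bsub>semigroup_algebra K S\<^esub> \<one>\<^bsub>semigroup_algebra K S\<^esub>) \<odot>\<^bsub>N\<^esub> x)\<rparr>"

definition perm_rep :: "'k ring \<Rightarrow> 'y set \<Rightarrow> ('s \<Rightarrow> 'y \<Rightarrow> 'y) \<Rightarrow> 's \<Rightarrow> ('y \<Rightarrow> 'k) \<Rightarrow> 'y \<Rightarrow> 'k" where
  "perm_rep K Y op s = linear_extension K (free_module K Y) (\<lambda>y. basis_vector K (op s y))"

definition perm_module ::
  "'k ring \<Rightarrow> 's monoid \<Rightarrow> 'y set \<Rightarrow> ('s \<Rightarrow> 'y \<Rightarrow> 'y) \<Rightarrow> ('s \<Rightarrow> 'k, 'y \<Rightarrow> 'k) module" where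
  "perm_module K S Y op = rep_module K S (free_module K Y) (perm_rep K Y op)"

lemma rep_module_simps [simp]:
  "carrier (rep_module K S V \<rho>) = carrier V"
  "zero (rep_module K S V \<rho>) = zero V"
  "add (rep_module K S V \<rho>) = add V"
  "smult (rep_module K S V \<rho>) f v = linear_extension K V (\<lambda>s. \<rho> s v) f"
  by (simp_all add: rep_module_def)

lemma restrict_scalars_simps [simp]:
  "carrier (restrict_scalars K S N) = carrier N"
  "zero (restrict_scalars K S N) = zero N"
  "add (restrict_scalars K S N) = add N"
  by (simp_all add: restrict_scalars_def)

locale monoid_rep = S: monoid S + K: cring K + V: left_module K V
  for K :: "'k ring" and S :: "'s monoid" and V :: "('k, 'v) module" and \<rho> :: "'s \<Rightarrow> 'v \<Rightarrow> 'v" +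
  assumes linear_rep: "s \<in> carrier S \<Longrightarrow> linear_map K V V (\<rho> s)"
    and rep_one: "v \<in> carrier V \<Longrightarrow> \<rho> \<one>\<^bsub>S\<^esub> v = v"
    and rep_mult: "\<lbrakk>s \<in> carrier S; t \<in> carrier S; v \<in> carrier V\<rbrakk> \<Longrightarrow> \<rho> (s \<otimes>\<^bsub>S\<^esub> t) v = \<rho> s (\<rho> t v)"

locale set_action = S: monoid S + K: cring K for K :: "'k ring" and S :: "'s monoid" +
  fixes Y :: "'y set" and op :: "'s \<Rightarrow> 'y \<Rightarrow> 'y"
  assumes op_closed: "\<lbrakk>s \<in> carrier S; y \<in> Y\<rbrakk> \<Longrightarrow> op s y \<in> Y"
    and op_one: "y \<in> Y \<Longrightarrow> op \<one>\<^bsub>S\<^esub> y = y"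
    and op_mult: "\<lbrakk>s \<in> carrier S; t \<in> carrier S; y \<in> Y\<rbrakk> \<Longrightarrow> op (s \<otimes>\<^bsub>S\<^esub> t) y = op s (op t y)"

sublocale set_action \<subseteq> monoid_rep K S "free_module K Y" "perm_rep K Y op"
proof -
  note F = left_module_free[OF K.ring_axioms, of Y]
  have bv: "basis_vector K y \<in> carrier (free_module K Y)" if "y \<in> Y" for y
    by (rule basis_vector_closed[OF K.ring_axioms that])
  have lin: "linear_map K (free_module K Y) (free_module K Y) (perm_rep K Y op s)" if "s \<in> carrier S" for s
    unfolding perm_rep_def by (rule linear_extension_linear[OF F]) (use bv op_closed that in auto)
  have basis: "perm_rep K Y op s (basis_vector K y) = basis_vector K (op s y)"
    if "s \<in> carrier S" "y \<in> Y" for s y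
    unfolding perm_rep_def
    by (rule linear_extension_basis[OF F, of "\<lambda>y. basis_vector K (op s y)"]) (use bv op_closed that in auto)
  have one: "perm_rep K Y op \<one>\<^bsub>S\<^esub> v = v" if "v \<in> carrier (free_module K Y)" for v
    by (rule linear_map_eq_on_basis[OF F lin linear_map_id _ that]) (auto simp: basis op_one)
  have mult: "perm_rep K Y op (s \<otimes>\<^bsub>S\<^esub> t) v = perm_rep K Y op s (perm_rep K Y op t v)"
    if "s \<in> carrier S" "t \<in> carrier S" "v \<in> carrier (free_module K Y)" for s t v
    by (rule linear_map_eq_on_basis[OF F lin linear_map_comp[OF lin lin] _ that(3)])
      (use that in \<open>auto simp: basis op_mult op_closed\<close>)
  show "monoid_rep K S (free_module K Y) (perm_rep K Y op)"
    by (intro monoid_rep.intro monoid_rep_axioms.intro S.monoid_axioms K.is_cring F lin one mult)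
qed

lemma (in set_action) perm_rep_basis:
  "\<lbrakk>s \<in> carrier S; y \<in> Y\<rbrakk> \<Longrightarrow> perm_rep K Y op s (basis_vector K y) = basis_vector K (op s y)"
  unfolding perm_rep_def
  by (rule linear_extension_basis[OF left_module_free[OF K.ring_axioms], of "\<lambda>y. basis_vector K (op s y)"])
    (simp add: op_closed basis_vector_closed[OF K.ring_axioms])

context monoid_rep
begin

abbreviation "R \<equiv> semigroup_algebra K S"
abbreviation "F \<equiv> free_module K (carrier S)"
abbreviation "act f v \<equiv> linear_extension K V (\<lambda>s. \<rho> s v) f"

lemma left_module_F: "left_module K F"
  by (rule left_module_free[OF K.ring_axioms])

lemma basis_F: "s \<in> carrier S \<Longrightarrow> basis_vector K s \<in> carrier F"
  by (rule basis_vector_closed[OF K.ring_axioms])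

lemma rep_closed: "\<lbrakk>s \<in> carrier S; v \<in> carrier V\<rbrakk> \<Longrightarrow> \<rho> s v \<in> carrier V"
  by (rule linear_map_closed[OF linear_rep])

lemma act_linear: "v \<in> carrier V \<Longrightarrow> linear_map K F V (\<lambda>f. act f v)"
  by (rule linear_extension_linear[OF V.left_module_axioms]) (simp add: rep_closed)

lemma act_closed: "\<lbrakk>f \<in> carrier F; v \<in> carrier V\<rbrakk> \<Longrightarrow> act f v \<in> carrier V"
  by (rule linear_map_closed[OF act_linear])

lemma act_basis: "\<lbrakk>s \<in> carrier S; v \<in> carrier V\<rbrakk> \<Longrightarrow> act (basis_vector K s) v = \<rho> s v"
  by (rule linear_extension_basis[OF V.left_module_axioms]) (simp add: rep_closed)

lemma act_add:
  assumes f: "f \<in> carrier F" and v: "v \<in> carrier V" and w: "w \<in> carrier V"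
  shows "act f (v \<oplus>\<^bsub>V\<^esub> w) = act f v \<oplus>\<^bsub>V\<^esub> act f w"
proof (rule linear_map_eq_on_basis[OF V.left_module_axioms act_linear _ _ f])
  show "linear_map K F V (\<lambda>f. act f v \<oplus>\<^bsub>V\<^esub> act f w)"
    by (rule V.linear_map_sum[OF left_module_F act_linear[OF v] act_linear[OF w]])
qed (use v w in \<open>auto simp: act_basis linear_map_add[OF linear_rep]\<close>)

lemma act_linear_right:
  assumes f: "f \<in> carrier F"
  shows "linear_map K V V (\<lambda>v. act f v)"
proof -
  have "act f (k \<odot>\<^bsub>V\<^esub> v) = k \<odot>\<^bsub>V\<^esub> act f v" if k: "k \<in> carrier K" and v: "v \<in> carrier V" for k v
  proof (rule linear_map_eq_on_basis[OF V.left_module_axioms act_linear _ _ f])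
    have "linear_map K V V (\<lambda>v. k \<odot>\<^bsub>V\<^esub> v)"
      using k V.additive_smult by (auto simp: linear_map_def K.m_comm simp flip: V.smult_assoc)
    then show "linear_map K F V (\<lambda>f. k \<odot>\<^bsub>V\<^esub> act f v)"
      by (rule linear_map_comp[OF act_linear[OF v]])
  qed (use k v in \<open>auto simp: act_basis linear_map_smult[OF linear_rep]\<close>)
  then show ?thesis
    unfolding linear_map_def by (auto intro!: additive_mapI simp: act_closed[OF f] act_add[OF f])
qed

end

lemma semigroup_algebra_simps:
  "carrier (semigroup_algebra K S) = carrier (free_module K (carrier S))"
  "zero (semigroup_algebra K S) = zero (free_module K (carrier S))"
  "add (semigroup_algebra K S) = add (free_module K (carrier S))"
  "smult (semigroup_algebra K S) = smult (free_module K (carrier S))"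
  "one (semigroup_algebra K S) = basis_vector K \<one>\<^bsub>S\<^esub>"
  "f \<otimes>\<^bsub>semigroup_algebra K S\<^esub> g =
     linear_extension K (free_module K (carrier S)) (\<lambda>s. perm_rep K (carrier S) (mult S) s g) f"
  by (simp_all add: semigroup_algebra_def perm_rep_def)

context monoid_rep
begin

text \<open>The product of the semigroup algebra is the linearised action of S on itself, so its
  ring laws are instances of the laws for representations.\<close>

lemma regular: "set_action K S (carrier S) (mult S)"
  by unfold_locales (auto simp: S.m_assoc)

interpretation regular: set_action K S "carrier S" "mult S"
  by (rule regular)

lemma mult_linear_left: "g \<in> carrier F \<Longrightarrow> linear_map K F F (\<lambda>f. f \<otimes>\<^bsub>R\<^esub> g)"
  using regular.act_linear by (simp add: semigroup_algebra_simps)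

lemma mult_linear_right: "f \<in> carrier F \<Longrightarrow> linear_map K F F (\<lambda>g. f \<otimes>\<^bsub>R\<^esub> g)"
  using regular.act_linear_right by (simp add: semigroup_algebra_simps)

lemma basis_mult_basis:
  "\<lbrakk>s \<in> carrier S; t \<in> carrier S\<rbrakk> \<Longrightarrow> basis_vector K s \<otimes>\<^bsub>R\<^esub> basis_vector K t = basis_vector K (s \<otimes>\<^bsub>S\<^esub> t)"
  by (simp add: semigroup_algebra_simps regular.act_basis basis_F regular.perm_rep_basis)

text \<open>Both sides are linear in f and in g; on basis vectors the claim is multiplicativity of
  the representation.\<close>

lemma act_mult:
  assumes f: "f \<in> carrier F" and g: "g \<in> carrier F" and v: "v \<in> carrier V"
  shows "act (f \<otimes>\<^bsub>R\<^esub> g) v = act f (act g v)"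
proof (rule linear_map_eq_on_basis[OF V.left_module_axioms _ _ _ f])
  show "linear_map K F V (\<lambda>f. act (f \<otimes>\<^bsub>R\<^esub> g) v)"
    by (rule linear_map_comp[OF mult_linear_left[OF g] act_linear[OF v]])
  show "linear_map K F V (\<lambda>f. act f (act g v))"
    by (rule act_linear[OF act_closed[OF g v]])
  fix s assume s: "s \<in> carrier S"
  show "act (basis_vector K s \<otimes>\<^bsub>R\<^esub> g) v = act (basis_vector K s) (act g v)"
  proof (rule linear_map_eq_on_basis[OF V.left_module_axioms _ _ _ g])
    show "linear_map K F V (\<lambda>g. act (basis_vector K s \<otimes>\<^bsub>R\<^esub> g) v)"
      by (rule linear_map_comp[OF mult_linear_right[OF basis_F[OF s]] act_linear[OF v]])
    show "linear_map K F V (\<lambda>g. act (basis_vector K s) (act g v))"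
      by (rule linear_map_comp[OF act_linear[OF v] act_linear_right[OF basis_F[OF s]]])
  qed (use s v in \<open>auto simp: basis_mult_basis act_basis rep_mult rep_closed\<close>)
qed

lemma act_one: "v \<in> carrier V \<Longrightarrow> act \<one>\<^bsub>R\<^esub> v = v"
  by (simp add: semigroup_algebra_simps act_basis rep_one)

end

lemma ring_semigroup_algebra:
  assumes "monoid S" "cring K" shows "ring (semigroup_algebra K S)"
proof -
  interpret S: monoid S by fact
  interpret K: cring K by fact
  interpret set_action K S "carrier S" "mult S"
    by unfold_locales (auto simp: S.m_assoc)
  have act_mult': "act f g = f \<otimes>\<^bsub>R\<^esub> g" for f g by (simp add: semigroup_algebra_simps)
  show ?thesis
  proof (rule ringI)
    show "abelian_group R"
      by (rule abelian_group_cong[OF V.M.abelian_group_axioms]) (simp_all add: semigroup_algebra_simps)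
    show "monoid R"
    proof (rule monoidI)
      fix f assume f: "f \<in> carrier R"
      then show "\<one>\<^bsub>R\<^esub> \<otimes>\<^bsub>R\<^esub> f = f" unfolding semigroup_algebra_simps(1) by (rule act_one[unfolded act_mult'])
      have "f \<otimes>\<^bsub>R\<^esub> \<one>\<^bsub>R\<^esub> = (\<lambda>f. f) f"
        by (rule linear_map_eq_on_basis[OF left_module_F mult_linear_left linear_map_id])
          (use f in \<open>auto simp: semigroup_algebra_simps(1,5) basis_mult_basis basis_F\<close>)
      then show "f \<otimes>\<^bsub>R\<^esub> \<one>\<^bsub>R\<^esub> = f" .
    next
      fix f g assume "f \<in> carrier R" "g \<in> carrier R"
      then show "f \<otimes>\<^bsub>R\<^esub> g \<in> carrier R" unfolding semigroup_algebra_simps(1) by (rule act_closed[unfolded act_mult'])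
    next
      fix f g h assume "f \<in> carrier R" "g \<in> carrier R" "h \<in> carrier R"
      then show "f \<otimes>\<^bsub>R\<^esub> g \<otimes>\<^bsub>R\<^esub> h = f \<otimes>\<^bsub>R\<^esub> (g \<otimes>\<^bsub>R\<^esub> h)"
        unfolding semigroup_algebra_simps(1) by (rule act_mult[unfolded act_mult'])
    qed (simp add: semigroup_algebra_simps basis_F)
    fix f g h assume "f \<in> carrier R" "g \<in> carrier R" "h \<in> carrier R"
    then show "(f \<oplus>\<^bsub>R\<^esub> g) \<otimes>\<^bsub>R\<^esub> h = f \<otimes>\<^bsub>R\<^esub> h \<oplus>\<^bsub>R\<^esub> g \<otimes>\<^bsub>R\<^esub> h"
      "h \<otimes>\<^bsub>R\<^esub> (f \<oplus>\<^bsub>R\<^esub> g) = h \<otimes>\<^bsub>R\<^esub> f \<oplus>\<^bsub>R\<^esub> h \<otimes>\<^bsub>R\<^esub> g"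
      unfolding semigroup_algebra_simps(1,3)
      by (simp_all only: linear_map_add[OF mult_linear_left] linear_map_add[OF mult_linear_right])
  qed
qed

context monoid_rep
begin

lemma ring_R: "ring R"
  by (rule ring_semigroup_algebra[OF S.monoid_axioms K.is_cring])

lemma left_module_rep: "left_module R (rep_module K S V \<rho>)"
proof -
  have "abelian_group (rep_module K S V \<rho>)"
    by (rule abelian_group_cong[OF V.M.abelian_group_axioms]) simp_all
  then show ?thesis
    by (intro left_module.intro left_module_axioms.intro ring_R)
      (simp_all only: rep_module_simps semigroup_algebra_simps(1,3) act_closed act_add act_mult act_one
        linear_map_add[OF act_linear])
qed

lemma smult_mult: "\<lbrakk>k \<in> carrier K; f \<in> carrier F\<rbrakk> \<Longrightarrow> (k \<odot>\<^bsub>R\<^esub> \<one>\<^bsub>R\<^esub>) \<otimes>\<^bsub>R\<^esub> f = k \<odot>\<^bsub>F\<^esub> f"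
  using linear_map_smult[OF mult_linear_left, of f k "\<one>\<^bsub>R\<^esub>"] monoid.l_one[OF ring.is_monoid[OF ring_R], of f]
  by (simp add: semigroup_algebra_simps(1,4,5) basis_F)

lemma left_module_restrict_scalars:
  assumes N: "left_module R N"
  shows "left_module K (restrict_scalars K S N)"
proof -
  interpret N: left_module R N by fact
  interpret F: left_module K F by (rule left_module_F)
  have one: "\<one>\<^bsub>R\<^esub> \<in> carrier F" by (simp add: semigroup_algebra_simps(5) basis_F)
  then have c: "k \<odot>\<^bsub>R\<^esub> \<one>\<^bsub>R\<^esub> \<in> carrier R" if "k \<in> carrier K" for k
    using that F.smult_closed by (simp add: semigroup_algebra_simps(1,4))
  have mult: "(k \<otimes>\<^bsub>K\<^esub> l) \<odot>\<^bsub>R\<^esub> \<one>\<^bsub>R\<^esub> = (k \<odot>\<^bsub>R\<^esub> \<one>\<^bsub>R\<^esub>) \<otimes>\<^bsub>R\<^esub> (l \<odot>\<^bsub>R\<^esub> \<one>\<^bsub>R\<^esub>)"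
    if "k \<in> carrier K" "l \<in> carrier K" for k l
    using that one F.smult_closed[OF that(2) one] smult_mult[OF that(1), of "l \<odot>\<^bsub>F\<^esub> \<one>\<^bsub>R\<^esub>"]
    by (simp only: semigroup_algebra_simps(4) F.smult_assoc)
  have add: "(k \<oplus>\<^bsub>K\<^esub> l) \<odot>\<^bsub>R\<^esub> \<one>\<^bsub>R\<^esub> = (k \<odot>\<^bsub>R\<^esub> \<one>\<^bsub>R\<^esub>) \<oplus>\<^bsub>R\<^esub> (l \<odot>\<^bsub>R\<^esub> \<one>\<^bsub>R\<^esub>)"
    if "k \<in> carrier K" "l \<in> carrier K" for k l
    using that one by (simp only: semigroup_algebra_simps(3,4) F.smult_l_distr)
  have id: "\<one>\<^bsub>K\<^esub> \<odot>\<^bsub>R\<^esub> \<one>\<^bsub>R\<^esub> = \<one>\<^bsub>R\<^esub>"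
    using one by (simp only: semigroup_algebra_simps(4) F.smult_one)
  show ?thesis
  proof (intro left_module.intro left_module_axioms.intro K.ring_axioms)
    show "abelian_group (restrict_scalars K S N)"
      by (rule abelian_group_cong[OF N.M.abelian_group_axioms]) simp_all
  qed (simp_all add: restrict_scalars_def c mult add id N.smult_assoc N.smult_l_distr N.smult_r_distr)
qed

lemma linear_map_restrict_scalars:
  assumes N: "left_module R N" and x: "x \<in> carrier N"
  shows "linear_map K F (restrict_scalars K S N) (\<lambda>f. f \<odot>\<^bsub>N\<^esub> x)"
proof -
  interpret N: left_module R N by fact
  interpret F: left_module K F by (rule left_module_F)
  have one: "\<one>\<^bsub>R\<^esub> \<in> carrier F" by (simp add: semigroup_algebra_simps(5) basis_F)
  then have c: "k \<odot>\<^bsub>R\<^esub> \<one>\<^bsub>R\<^esub> \<in> carrier R" if "k \<in> carrier K" for k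
    using that F.smult_closed by (simp add: semigroup_algebra_simps(1,4))
  have "(k \<odot>\<^bsub>F\<^esub> f) \<odot>\<^bsub>N\<^esub> x = k \<odot>\<^bsub>restrict_scalars K S N\<^esub> (f \<odot>\<^bsub>N\<^esub> x)"
    if "k \<in> carrier K" "f \<in> carrier F" for k f
    using that x N.smult_assoc[OF c, of k f x]
    by (simp add: restrict_scalars_def smult_mult semigroup_algebra_simps(1))
  then show ?thesis
    using x N.smult_l_distr N.smult_closed
    by (simp add: linear_map_def additive_map_def Pi_iff semigroup_algebra_simps(1,3))
qed

text \<open>Linearity over the semigroup algebra amounts to linearity over K and compatibility with
  the elements of S, as these span the algebra. \<open>linear_map_rep_imp\<close> is the
  converse.\<close>

lemma linear_map_from_rep:
  assumes N: "left_module R N" and f: "linear_map K V (restrict_scalars K S N) f"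
    and equi: "\<And>s v. \<lbrakk>s \<in> carrier S; v \<in> carrier V\<rbrakk> \<Longrightarrow> f (\<rho> s v) = basis_vector K s \<odot>\<^bsub>N\<^esub> f v"
  shows "linear_map R (rep_module K S V \<rho>) N f"
proof -
  have "f (act r v) = r \<odot>\<^bsub>N\<^esub> f v" if r: "r \<in> carrier F" and v: "v \<in> carrier V" for r v
  proof (rule linear_map_eq_on_basis[OF left_module_restrict_scalars[OF N] _ _ _ r])
    show "linear_map K F (restrict_scalars K S N) (\<lambda>r. f (act r v))"
      by (rule linear_map_comp[OF act_linear[OF v] f])
    show "linear_map K F (restrict_scalars K S N) (\<lambda>r. r \<odot>\<^bsub>N\<^esub> f v)"
      using linear_map_closed[OF f v] by (intro linear_map_restrict_scalars[OF N]) simp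
  qed (use v equi act_basis in auto)
  then show ?thesis
    using f by (simp add: linear_map_def additive_map_def semigroup_algebra_simps(1))
qed

lemma linear_map_rep_imp:
  assumes N: "left_module R N" and f: "linear_map R (rep_module K S V \<rho>) N f"
  shows "linear_map K V (restrict_scalars K S N) f"
    and "\<lbrakk>s \<in> carrier S; v \<in> carrier V\<rbrakk> \<Longrightarrow> f (\<rho> s v) = basis_vector K s \<odot>\<^bsub>N\<^esub> f v"
proof -
  interpret F: left_module K F by (rule left_module_F)
  have one: "\<one>\<^bsub>R\<^esub> \<in> carrier F" by (simp add: semigroup_algebra_simps(5) basis_F)
  have lin: "f (act r v) = r \<odot>\<^bsub>N\<^esub> f v" if "r \<in> carrier F" "v \<in> carrier V" for r v
    using linear_map_smult[OF f, of r v] that by (simp add: semigroup_algebra_simps(1))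
  then show "f (\<rho> s v) = basis_vector K s \<odot>\<^bsub>N\<^esub> f v" if "s \<in> carrier S" "v \<in> carrier V"
    using that basis_F by (simp flip: act_basis)
  have "f (k \<odot>\<^bsub>V\<^esub> v) = k \<odot>\<^bsub>restrict_scalars K S N\<^esub> f v" if "k \<in> carrier K" "v \<in> carrier V" for k v
    using lin[OF F.smult_closed[OF that(1) one] that(2)] linear_map_smult[OF act_linear[OF that(2)] that(1) one]
      act_one[OF that(2)] by (simp add: restrict_scalars_def semigroup_algebra_simps(4))
  then show "linear_map K V (restrict_scalars K S N) f"
    using f by (simp add: linear_map_def additive_map_def)
qed

text \<open>On a representation the multiples of the unit act as the original scalars do, so
  restricting scalars gives back the module V.\<close>

lemma linear_map_from_restrict_scalars:
  assumes "linear_map K W (restrict_scalars K S (rep_module K S V \<rho>)) f"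
  shows "linear_map K W V f"
proof -
  have one: "\<one>\<^bsub>R\<^esub> \<in> carrier F" by (simp add: semigroup_algebra_simps(5) basis_F)
  have "k \<odot>\<^bsub>restrict_scalars K S (rep_module K S V \<rho>)\<^esub> v = k \<odot>\<^bsub>V\<^esub> v" if "k \<in> carrier K" "v \<in> carrier V" for k v
    using linear_map_smult[OF act_linear[OF that(2)] that(1) one] act_one[OF that(2)]
    by (simp add: restrict_scalars_def semigroup_algebra_simps(4))
  then show ?thesis
    using assms linear_map_closed[OF assms] by (simp add: linear_map_def additive_map_def)
qed

lemma rep_smult_basis:
  "\<lbrakk>s \<in> carrier S; v \<in> carrier V\<rbrakk> \<Longrightarrow> basis_vector K s \<odot>\<^bsub>rep_module K S V \<rho>\<^esub> v = \<rho> s v"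
  by (simp add: act_basis)

end

context set_action
begin

lemma left_module_perm: "left_module R (perm_module K S Y op)"
  unfolding perm_module_def by (rule left_module_rep)

lemma perm_module_carrier: "carrier (perm_module K S Y op) = carrier (free_module K Y)"
  by (simp add: perm_module_def)

lemma basis_perm: "y \<in> Y \<Longrightarrow> basis_vector K y \<in> carrier (free_module K Y)"
  by (rule basis_vector_closed[OF K.ring_axioms])

lemma perm_smult_basis:
  "\<lbrakk>s \<in> carrier S; y \<in> Y\<rbrakk> \<Longrightarrow> basis_vector K s \<odot>\<^bsub>perm_module K S Y op\<^esub> basis_vector K y = basis_vector K (op s y)"
  unfolding perm_module_def by (simp only: rep_smult_basis basis_perm perm_rep_basis)

text \<open>An equivariant map on the set \<open>Y\<close> extends to a map over the semigroup
  algebra. All module maps out of the simplex modules and out of K E(S(G)) are produced in this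
  way.\<close>

lemma linear_map_from_perm:
  assumes N: "left_module R N" and t: "t \<in> Y \<rightarrow> carrier N"
    and equi: "\<And>s y. \<lbrakk>s \<in> carrier S; y \<in> Y\<rbrakk> \<Longrightarrow> t (op s y) = basis_vector K s \<odot>\<^bsub>N\<^esub> t y"
  shows "linear_map R (perm_module K S Y op) N (linear_extension K (restrict_scalars K S N) t)"
    and "y \<in> Y \<Longrightarrow> linear_extension K (restrict_scalars K S N) t (basis_vector K y) = t y"
proof -
  interpret N: left_module R N by fact
  let ?N = "restrict_scalars K S N"
  note N' = left_module_restrict_scalars[OF N]
  have t': "t \<in> Y \<rightarrow> carrier ?N" using t by simp
  have basis: "linear_extension K ?N t (basis_vector K y) = t y" if "y \<in> Y" for y
    using linear_extension_basis[OF N', of t y] t that by auto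
  then show "y \<in> Y \<Longrightarrow> linear_extension K ?N t (basis_vector K y) = t y" .
  note lin = linear_extension_linear[OF N' t']
  show "linear_map R (perm_module K S Y op) N (linear_extension K ?N t)"
    unfolding perm_module_def
  proof (rule linear_map_from_rep[OF N lin])
    fix s v assume s: "s \<in> carrier S" and v: "v \<in> carrier (free_module K Y)"
    have b: "basis_vector K s \<in> carrier R" using basis_F[OF s] by (simp add: semigroup_algebra_simps(1))
    interpret N': left_module K ?N by (rule N')
    \<comment> \<open>Multiples of the unit commute with basis vectors, so multiplication by a basis
      vector is K-linear and the claim can be tested on the basis of
      \<open>free_module K Y\<close>.\<close>
    have kc: "(k \<odot>\<^bsub>R\<^esub> \<one>\<^bsub>R\<^esub>) \<otimes>\<^bsub>R\<^esub> basis_vector K s = basis_vector K s \<otimes>\<^bsub>R\<^esub> (k \<odot>\<^bsub>R\<^esub> \<one>\<^bsub>R\<^esub>)"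
      "k \<odot>\<^bsub>R\<^esub> \<one>\<^bsub>R\<^esub> \<in> carrier R" if k: "k \<in> carrier K" for k
    proof -
      have one: "\<one>\<^bsub>R\<^esub> \<in> carrier F" by (simp add: semigroup_algebra_simps(5) basis_F)
      have "basis_vector K s \<otimes>\<^bsub>R\<^esub> (k \<odot>\<^bsub>R\<^esub> \<one>\<^bsub>R\<^esub>) = k \<odot>\<^bsub>F\<^esub> (basis_vector K s \<otimes>\<^bsub>R\<^esub> \<one>\<^bsub>R\<^esub>)"
        using linear_map_smult[OF mult_linear_right[OF basis_F[OF s]] k one] by (simp add: semigroup_algebra_simps(4))
      also have "basis_vector K s \<otimes>\<^bsub>R\<^esub> \<one>\<^bsub>R\<^esub> = basis_vector K s"
        using monoid.r_one[OF ring.is_monoid[OF ring_R] b] .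
      finally show "(k \<odot>\<^bsub>R\<^esub> \<one>\<^bsub>R\<^esub>) \<otimes>\<^bsub>R\<^esub> basis_vector K s = basis_vector K s \<otimes>\<^bsub>R\<^esub> (k \<odot>\<^bsub>R\<^esub> \<one>\<^bsub>R\<^esub>)"
        using smult_mult[OF k basis_F[OF s]] by simp
      show "k \<odot>\<^bsub>R\<^esub> \<one>\<^bsub>R\<^esub> \<in> carrier R"
        using left_module.smult_closed[OF left_module_F k one] by (simp add: semigroup_algebra_simps(1,4))
    qed
    have "linear_map K ?N ?N (\<lambda>x. basis_vector K s \<odot>\<^bsub>N\<^esub> x)"
      using N.additive_smult[OF b] kc b
      by (auto simp: linear_map_def additive_map_def restrict_scalars_def simp flip: N.smult_assoc)
    then have lin': "linear_map K (free_module K Y) ?N (\<lambda>v. basis_vector K s \<odot>\<^bsub>N\<^esub> linear_extension K ?N t v)"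
      by (rule linear_map_comp[OF lin])
    show "linear_extension K ?N t (perm_rep K Y op s v) = basis_vector K s \<odot>\<^bsub>N\<^esub> linear_extension K ?N t v"
      by (rule linear_map_eq_on_basis[OF N' linear_map_comp[OF linear_rep[OF s] lin] lin' _ v])
        (simp add: basis equi s op_closed perm_rep_basis)
  qed
qed

lemma linear_map_perm_eq:
  assumes N: "left_module R N" and f: "linear_map R (perm_module K S Y op) N f"
    and g: "linear_map R (perm_module K S Y op) N g"
    and eq: "\<And>y. y \<in> Y \<Longrightarrow> f (basis_vector K y) = g (basis_vector K y)"
    and v: "v \<in> carrier (free_module K Y)"
  shows "f v = g v"
  using f g unfolding perm_module_def
  by (intro linear_map_eq_on_basis[where f=f and g=g, OF left_module_restrict_scalars[OF N] _ _ eq v]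
      linear_map_rep_imp(1)[OF N])

end

section \<open>Simplicial chains\<close>

definition cone :: "'g \<Rightarrow> ('g list \<Rightarrow>\<^sub>0 int) \<Rightarrow> ('g list \<Rightarrow>\<^sub>0 int)" where
  "cone g = frag_extend (\<lambda>l. frag_of (g # l))"

text \<open>A list of length n is an ordered simplex of dimension n - 1. The boundary of a single
  vertex is the empty simplex, not 0: this is the augmented complex.\<close>

primrec simplex_boundary :: "'g list \<Rightarrow> ('g list \<Rightarrow>\<^sub>0 int)" where
  "simplex_boundary [] = 0"
| "simplex_boundary (g # l) = frag_of l - cone g (simplex_boundary l)"

text \<open>The classical prism operator, the alternating sum of the simplices (v0, ..., vi, r vi,
  ..., r vn), written recursively. It joins the identity to the vertex map r.\<close>

primrec prism :: "('g \<Rightarrow> 'g) \<Rightarrow> 'g list \<Rightarrow> ('g list \<Rightarrow>\<^sub>0 int)" where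
  "prism r [] = 0"
| "prism r (g # l) = frag_of (g # r g # map r l) - cone g (prism r l)"

definition chain_map :: "('g \<Rightarrow> 'h) \<Rightarrow> ('g list \<Rightarrow>\<^sub>0 int) \<Rightarrow> ('h list \<Rightarrow>\<^sub>0 int)" where
  "chain_map r = frag_extend (\<lambda>l. frag_of (map r l))"

lemma frag_extend_cone: "frag_extend f (cone g c) = frag_extend (\<lambda>l. f (g # l)) c"
  unfolding cone_def using frag_extend_compose[of f "\<lambda>l. g # l" c] by (simp add: o_def)

lemma frag_extend_minus_fun: "frag_extend (\<lambda>l. f l - g l) c = frag_extend f c - frag_extend g c"
  using subset_UNIV by (induction c rule: frag_induction) (auto simp: frag_extend_diff)

lemma frag_extend_cone_fun: "frag_extend (\<lambda>l. cone g (f l)) c = cone g (frag_extend f c)"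
  using subset_UNIV by (induction c rule: frag_induction) (auto simp: cone_def frag_extend_diff)

lemma chain_map_cone: "chain_map r (cone g c) = cone (r g) (chain_map r c)"
  using subset_UNIV
  by (induction c rule: frag_induction) (auto simp: cone_def chain_map_def frag_extend_diff)

lemma cone_diff: "cone g (a - b) = cone g a - cone g b"
  by (simp add: cone_def frag_extend_diff)

lemma cone_zero: "cone g 0 = 0"
  by (simp add: cone_def)

lemma chain_map_diff: "chain_map r (a - b) = chain_map r a - chain_map r b"
  by (simp add: chain_map_def frag_extend_diff)

lemma boundary_map: "simplex_boundary (map r l) = chain_map r (simplex_boundary l)"
proof (induction l)
  case (Cons g l)
  then show ?case by (simp add: chain_map_diff chain_map_cone) (simp add: chain_map_def)
qed (simp add: chain_map_def)

lemma boundary_boundary: "frag_extend simplex_boundary (simplex_boundary l) = 0"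
proof (induction l)
  case (Cons g l)
  have "frag_extend simplex_boundary (simplex_boundary (g # l)) =
      simplex_boundary l - frag_extend (\<lambda>l. frag_of l - cone g (simplex_boundary l)) (simplex_boundary l)"
    by (simp add: frag_extend_diff frag_extend_cone)
  then show ?case
    by (simp add: frag_extend_minus_fun frag_extend_cone_fun Cons cone_zero flip: frag_expansion)
qed simp

text \<open>Induction along the recursions: in the two sums computed as 1 and 2, the terms with the
  double cone over g, r g and those with \<open>prism r l\<close> cancel, and what remains is the
  cone over the induction hypothesis.\<close>

lemma prism_homotopy:
  "frag_extend simplex_boundary (prism r l) + frag_extend (prism r) (simplex_boundary l) =
     frag_of (map r l) - frag_of l"
proof (induction l)
  case (Cons g l)
  have 1: "frag_extend simplex_boundary (prism r (g # l)) =
      frag_of (map r (g # l)) - frag_of (g # map r l) + cone g (cone (r g) (simplex_boundary (map r l))) -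
      prism r l + cone g (frag_extend simplex_boundary (prism r l))"
    by (simp add: frag_extend_diff frag_extend_cone frag_extend_minus_fun frag_extend_cone_fun cone_diff
        flip: frag_expansion) (simp add: cone_def)
  have 2: "frag_extend (prism r) (simplex_boundary (g # l)) =
      prism r l - (cone g (cone (r g) (simplex_boundary (map r l))) - cone g (frag_extend (prism r) (simplex_boundary l)))"
  proof -
    have "frag_extend (\<lambda>l. frag_of (g # r g # map r l)) c = cone g (cone (r g) (chain_map r c))" for c
      using subset_UNIV
      by (induction c rule: frag_induction) (auto simp: cone_def chain_map_def frag_extend_diff)
    then show ?thesis
      by (simp add: frag_extend_diff frag_extend_cone frag_extend_minus_fun frag_extend_cone_fun boundary_map)
  qed
  have 3: "cone g (frag_extend simplex_boundary (prism r l)) + cone g (frag_extend (prism r) (simplex_boundary l)) =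
      frag_of (g # map r l) - frag_of (g # l)"
  proof -
    have "cone g (a + b) = cone g a + cone g b" for a b by (simp add: cone_def frag_extend_add)
    then have "cone g (frag_extend simplex_boundary (prism r l)) + cone g (frag_extend (prism r) (simplex_boundary l)) =
        cone g (frag_of (map r l) - frag_of l)" by (simp flip: Cons)
    also have "\<dots> = frag_of (g # map r l) - frag_of (g # l)" by (simp add: cone_diff) (simp add: cone_def)
    finally show ?thesis .
  qed
  show ?case unfolding 1 2 using 3 by (simp add: algebra_simps)
qed simp

text \<open>Two retractions r and r' occur because the retraction depends on the point: h will be
  translation by a group element, which moves the point as well.\<close>

lemma prism_map:
  assumes "\<And>g. g \<in> set l \<Longrightarrow> r' (h g) = h (r g)"
  shows "prism r' (map h l) = chain_map h (prism r l)"
  using assms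
proof (induction l)
  case (Cons g l)
  then show ?case
    by (simp add: chain_map_diff chain_map_cone o_def cong: map_cong) (simp add: chain_map_def o_def)
qed (simp add: chain_map_def)

lemma keys_cone: "Poly_Mapping.keys (cone g c) \<subseteq> (\<lambda>l. g # l) ` Poly_Mapping.keys c"
  unfolding cone_def using keys_frag_extend[of "\<lambda>l. frag_of (g # l)" c] by auto

lemma keys_simplex_boundary:
  "m \<in> Poly_Mapping.keys (simplex_boundary l) \<Longrightarrow> set m \<subseteq> set l \<and> Suc (length m) = length l"
proof (induction l arbitrary: m)
  case (Cons g l)
  then have "m = l \<or> m \<in> (\<lambda>l. g # l) ` Poly_Mapping.keys (simplex_boundary l)"
    using keys_diff[of "frag_of l" "cone g (simplex_boundary l)"] keys_cone[of g "simplex_boundary l"] by auto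
  with Cons.IH show ?case by fastforce
qed simp

lemma keys_prism:
  "m \<in> Poly_Mapping.keys (prism r l) \<Longrightarrow> set m \<subseteq> set l \<union> r ` set l \<and> length m = Suc (length l)"
proof (induction l arbitrary: m)
  case (Cons g l)
  then have "m = g # r g # map r l \<or> m \<in> (\<lambda>l. g # l) ` Poly_Mapping.keys (prism r l)"
    using keys_diff[of "frag_of (g # r g # map r l)" "cone g (prism r l)"] keys_cone[of g "prism r l"] by auto
  with Cons.IH show ?case by fastforce
qed simp

text \<open>The closed form is needed once, to meet the inhomogeneous coboundary, which is given as
  a sum over positions.\<close>

lemma simplex_boundary_sum:
  "simplex_boundary l = (\<Sum>i<length l. frag_cmul ((-1) ^ i) (frag_of (take i l @ drop (Suc i) l)))"
proof (induction l)
  case (Cons g l)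
  have "cone g (frag_cmul k (frag_of m)) = frag_cmul k (frag_of (g # m))" for k m
    by (simp add: cone_def frag_extend_cmul)
  moreover have "cone g (sum f {..<n}) = (\<Sum>i<n. cone g (f i))" for f and n :: nat
    unfolding cone_def by (simp add: frag_extend_sum o_def)
  ultimately have "cone g (simplex_boundary l) =
      (\<Sum>i<length l. frag_cmul ((-1) ^ i) (frag_of (g # take i l @ drop (Suc i) l)))"
    by (subst Cons) simp
  then show ?case
    by (simp add: sum.lessThan_Suc_shift sum_negf del: sum.lessThan_Suc flip: minus_frag_cmul)
qed simp

section \<open>Evaluating functions of simplices on integral chains\<close>

definition eval_chain :: "('m, 'x) ring_scheme \<Rightarrow> ('c \<Rightarrow> 'm) \<Rightarrow> ('c \<Rightarrow>\<^sub>0 int) \<Rightarrow> 'm" where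
  "eval_chain M w c = (\<Oplus>\<^bsub>M\<^esub>m\<in>Poly_Mapping.keys c. [Poly_Mapping.lookup c m] \<cdot>\<^bsub>M\<^esub> w m)"

context abelian_group
begin

lemma int_mult_closed [simp, intro]: "x \<in> carrier G \<Longrightarrow> [(k::int)] \<cdot> x \<in> carrier G"
  by (rule add.int_pow_closed)

lemma int_mult_zero [simp]: "[(0::int)] \<cdot> x = \<zero>"
  by (simp add: add_pow_def)

lemma int_mult_diff:
  "x \<in> carrier G \<Longrightarrow> [(k - l::int)] \<cdot> x = [k] \<cdot> x \<ominus> [l] \<cdot> x"
  unfolding minus_eq by (rule add.int_pow_diff)

lemma finsum_minus:
  assumes "f \<in> A \<rightarrow> carrier G" "g \<in> A \<rightarrow> carrier G"
  shows "(\<Oplus>i\<in>A. f i \<ominus> g i) = finsum G f A \<ominus> finsum G g A"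
proof -
  have neg: "additive_map G G (\<lambda>x. \<ominus> x)"
    by (rule additive_mapI) (auto simp: minus_add a_comm)
  have "(\<Oplus>i\<in>A. f i \<ominus> g i) = finsum G f A \<oplus> (\<Oplus>i\<in>A. \<ominus> g i)"
    using assms unfolding minus_eq by (intro finsum_addf) auto
  also have "(\<Oplus>i\<in>A. \<ominus> g i) = \<ominus> finsum G g A"
    using additive_map_finsum[OF abelian_group_axioms abelian_group_axioms neg assms(2)] by simp
  finally show ?thesis by (simp add: minus_eq)
qed

lemma eval_chain_superset:
  assumes "finite S" "Poly_Mapping.keys c \<subseteq> S" "w \<in> S \<rightarrow> carrier G"
  shows "eval_chain G w c = (\<Oplus>m\<in>S. [Poly_Mapping.lookup c m] \<cdot> w m)"
  unfolding eval_chain_def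
  by (rule add.finprod_mono_neutral_cong_left) (use assms in \<open>auto simp: in_keys_iff Pi_iff\<close>)

lemma eval_chain_closed:
  "w \<in> Poly_Mapping.keys c \<rightarrow> carrier G \<Longrightarrow> eval_chain G w c \<in> carrier G"
  unfolding eval_chain_def by (rule finsum_closed) auto

lemma eval_chain_zero [simp]: "eval_chain G w 0 = \<zero>"
  by (simp add: eval_chain_def)

lemma eval_chain_of [simp]: "w l \<in> carrier G \<Longrightarrow> eval_chain G w (frag_of l) = w l"
  by (simp add: eval_chain_def)

lemma eval_chain_cmul_of:
  assumes "w l \<in> carrier G"
  shows "eval_chain G w (frag_cmul k (frag_of l)) = [k] \<cdot> w l"
proof -
  have "eval_chain G w (frag_cmul k (frag_of l)) = (\<Oplus>m\<in>{l}. [Poly_Mapping.lookup (frag_cmul k (frag_of l)) m] \<cdot> w m)"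
    by (rule eval_chain_superset) (use assms in auto)
  with assms show ?thesis by simp
qed

lemma eval_chain_diff:
  assumes "w \<in> Poly_Mapping.keys a \<rightarrow> carrier G" "w \<in> Poly_Mapping.keys b \<rightarrow> carrier G"
  shows "eval_chain G w (a - b) = eval_chain G w a \<ominus> eval_chain G w b"
proof -
  let ?S = "Poly_Mapping.keys a \<union> Poly_Mapping.keys b"
  have w: "w \<in> ?S \<rightarrow> carrier G" using assms by auto
  have "eval_chain G w (a - b) = (\<Oplus>m\<in>?S. [Poly_Mapping.lookup (a - b) m] \<cdot> w m)"
    by (rule eval_chain_superset) (use w keys_diff[of a b] in auto)
  also have "\<dots> = (\<Oplus>m\<in>?S. [Poly_Mapping.lookup a m] \<cdot> w m \<ominus> [Poly_Mapping.lookup b m] \<cdot> w m)"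
    by (rule finsum_cong') (use w in \<open>auto simp: lookup_minus int_mult_diff Pi_iff intro!: minus_closed\<close>)
  also have "\<dots> = (\<Oplus>m\<in>?S. [Poly_Mapping.lookup a m] \<cdot> w m) \<ominus> (\<Oplus>m\<in>?S. [Poly_Mapping.lookup b m] \<cdot> w m)"
    by (rule finsum_minus) (use w in auto)
  also have "\<dots> = eval_chain G w a \<ominus> eval_chain G w b"
    using eval_chain_superset[of ?S a w] eval_chain_superset[of ?S b w] w by simp
  finally show ?thesis .
qed

lemma eval_chain_minus_fun:
  assumes "v \<in> Poly_Mapping.keys c \<rightarrow> carrier G" "w \<in> Poly_Mapping.keys c \<rightarrow> carrier G"
  shows "eval_chain G (\<lambda>l. v l \<ominus> w l) c = eval_chain G v c \<ominus> eval_chain G w c"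
proof -
  have dist: "[(k::int)] \<cdot> (x \<ominus> y) = [k] \<cdot> x \<ominus> [k] \<cdot> y" if "x \<in> carrier G" "y \<in> carrier G" for k x y
  proof -
    have "additive_map G G (\<lambda>x. [k] \<cdot> x)"
      by (rule additive_mapI) (use add.int_pow_mult_distrib[OF a_comm] in auto)
    then show ?thesis
      using additive_map_minus[OF abelian_group_axioms abelian_group_axioms] that by blast
  qed
  have "eval_chain G (\<lambda>l. v l \<ominus> w l) c =
      (\<Oplus>m\<in>Poly_Mapping.keys c. [Poly_Mapping.lookup c m] \<cdot> v m \<ominus> [Poly_Mapping.lookup c m] \<cdot> w m)"
    unfolding eval_chain_def
    by (rule finsum_cong') (use assms in \<open>auto simp: dist Pi_iff intro!: minus_closed\<close>)
  also have "\<dots> = eval_chain G v c \<ominus> eval_chain G w c"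
    unfolding eval_chain_def by (rule finsum_minus) (use assms in auto)
  finally show ?thesis .
qed

lemma eval_chain_add_fun:
  assumes "v \<in> Poly_Mapping.keys c \<rightarrow> carrier G" "w \<in> Poly_Mapping.keys c \<rightarrow> carrier G"
  shows "eval_chain G (\<lambda>l. v l \<oplus> w l) c = eval_chain G v c \<oplus> eval_chain G w c"
proof -
  have "eval_chain G (\<lambda>l. v l \<oplus> w l) c =
      (\<Oplus>m\<in>Poly_Mapping.keys c. [Poly_Mapping.lookup c m] \<cdot> v m \<oplus> [Poly_Mapping.lookup c m] \<cdot> w m)"
    unfolding eval_chain_def
    by (rule finsum_cong') (use assms in \<open>auto simp: add.int_pow_mult_distrib a_comm Pi_iff intro!: a_closed\<close>)
  also have "\<dots> = eval_chain G v c \<oplus> eval_chain G w c"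
    unfolding eval_chain_def by (rule finsum_addf) (use assms in auto)
  finally show ?thesis .
qed

lemma eval_chain_cong:
  assumes "\<And>l. l \<in> Poly_Mapping.keys c \<Longrightarrow> v l = w l" "w \<in> Poly_Mapping.keys c \<rightarrow> carrier G"
  shows "eval_chain G v c = eval_chain G w c"
  unfolding eval_chain_def by (rule finsum_cong') (use assms in auto)

lemma eval_chain_zero_fun: "eval_chain G (\<lambda>_. \<zero>) c = \<zero>"
  using eval_chain_minus_fun[of "\<lambda>_. \<zero>" c "\<lambda>_. \<zero>"] eval_chain_closed[of "\<lambda>_. \<zero>" c]
  by (simp add: minus_eq r_neg)

text \<open>Turns an operator on chains into an operator on cochains, so that identities between
  boundaries and prisms carry over to values in any abelian group. \<open>S\<close> delimits the
  simplices on which w is known to have values in the group.\<close>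

lemma eval_chain_frag_extend:
  assumes "\<And>l. l \<in> Poly_Mapping.keys c \<Longrightarrow> Poly_Mapping.keys (b l) \<subseteq> S" "w \<in> S \<rightarrow> carrier G"
  shows "eval_chain G w (frag_extend b c) = eval_chain G (\<lambda>l. eval_chain G w (b l)) c"
proof -
  let ?T = "{l. Poly_Mapping.keys (b l) \<subseteq> S}"
  have cl: "(\<lambda>l. eval_chain G w (b l)) \<in> ?T \<rightarrow> carrier G"
    using assms(2) by (auto intro!: eval_chain_closed)
  have "Poly_Mapping.keys c \<subseteq> ?T" using assms(1) by auto
  \<comment> \<open>The bounds on the supports are carried through the induction so that
    \<open>eval_chain_diff\<close> applies to differences.\<close>
  then have "Poly_Mapping.keys c \<subseteq> ?T \<and> Poly_Mapping.keys (frag_extend b c) \<subseteq> S \<and>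
     eval_chain G w (frag_extend b c) = eval_chain G (\<lambda>l. eval_chain G w (b l)) c"
  proof (induction c rule: frag_induction)
    case zero show ?case by simp
  next
    case (one l)
    then have "eval_chain G w (b l) \<in> carrier G" using cl by blast
    with one show ?case using eval_chain_of[of "\<lambda>l. eval_chain G w (b l)" l] by simp
  next
    case (diff x y)
    have "eval_chain G w (frag_extend b (x - y)) =
        eval_chain G w (frag_extend b x) \<ominus> eval_chain G w (frag_extend b y)"
      unfolding frag_extend_diff by (rule eval_chain_diff) (use diff assms(2) in auto)
    moreover have "eval_chain G (\<lambda>l. eval_chain G w (b l)) (x - y) =
        eval_chain G (\<lambda>l. eval_chain G w (b l)) x \<ominus> eval_chain G (\<lambda>l. eval_chain G w (b l)) y"
      by (rule eval_chain_diff) (use diff cl in auto)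
    moreover have "Poly_Mapping.keys (x - y) \<subseteq> ?T"
      by (rule order.trans[OF keys_diff]) (use diff in blast)
    moreover have "Poly_Mapping.keys (frag_extend b (x - y)) \<subseteq> S"
      unfolding frag_extend_diff by (rule order.trans[OF keys_diff]) (use diff in blast)
    ultimately show ?case using diff by simp
  qed
  then show ?thesis by blast
qed

lemma eval_chain_add:
  assumes "w \<in> Poly_Mapping.keys a \<rightarrow> carrier G" "w \<in> Poly_Mapping.keys b \<rightarrow> carrier G"
  shows "eval_chain G w (a + b) = eval_chain G w a \<oplus> eval_chain G w b"
proof -
  have "eval_chain G w (a - (0 - b)) = eval_chain G w a \<ominus> (\<zero> \<ominus> eval_chain G w b)"
    using eval_chain_diff[of w a "0 - b"] eval_chain_diff[of w 0 b] assms by simp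
  then show ?thesis
    using eval_chain_closed[OF assms(1)] eval_chain_closed[OF assms(2)] by (simp add: minus_eq)
qed

lemma eval_simplex_boundary:
  assumes "\<And>i. i < length l \<Longrightarrow> w (take i l @ drop (Suc i) l) \<in> carrier G"
  shows "eval_chain G w (simplex_boundary l) =
    (\<Oplus>i\<in>{..<length l}. [((-1::int) ^ i)] \<cdot> w (take i l @ drop (Suc i) l))"
proof -
  let ?f = "\<lambda>i. take i l @ drop (Suc i) l"
  have "eval_chain G w (\<Sum>i<n. frag_cmul ((-1) ^ i) (frag_of (?f i))) =
      (\<Oplus>i\<in>{..<n}. [((-1::int) ^ i)] \<cdot> w (?f i)) \<and>
      Poly_Mapping.keys (\<Sum>i<n. frag_cmul ((-1) ^ i) (frag_of (?f i))) \<subseteq> ?f ` {..<n}"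
    if "n \<le> length l" for n
    using that
  proof (induction n)
    case (Suc n)
    let ?a = "\<Sum>i<n. frag_cmul ((-1) ^ i) (frag_of (?f i))" and ?b = "frag_cmul ((-1) ^ n) (frag_of (?f n))"
    have IH: "eval_chain G w ?a = (\<Oplus>i\<in>{..<n}. [((-1::int) ^ i)] \<cdot> w (?f i))"
        "Poly_Mapping.keys ?a \<subseteq> ?f ` {..<n}" using Suc by auto
    have b: "eval_chain G w ?b = [((-1::int) ^ n)] \<cdot> w (?f n)" "Poly_Mapping.keys ?b = {?f n}"
      using assms[of n] Suc.prems by (auto simp: eval_chain_cmul_of)
    have "eval_chain G w (?a + ?b) = eval_chain G w ?a \<oplus> eval_chain G w ?b"
      by (rule eval_chain_add) (use IH(2) b(2) assms Suc.prems in \<open>auto simp: subset_iff image_iff\<close>)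
    moreover have "(\<Oplus>i\<in>{..<Suc n}. [((-1::int) ^ i)] \<cdot> w (?f i)) =
        [((-1::int) ^ n)] \<cdot> w (?f n) \<oplus> (\<Oplus>i\<in>{..<n}. [((-1::int) ^ i)] \<cdot> w (?f i))"
      unfolding lessThan_Suc using assms Suc.prems by (intro finsum_insert) auto
    moreover have "(\<Oplus>i\<in>{..<n}. [((-1::int) ^ i)] \<cdot> w (?f i)) \<in> carrier G" "[((-1::int) ^ n)] \<cdot> w (?f n) \<in> carrier G"
      using assms Suc.prems by (auto intro!: finsum_closed)
    moreover have "Poly_Mapping.keys (?a + ?b) \<subseteq> ?f ` {..<Suc n}"
      by (rule order.trans[OF keys_add]) (use IH(2) b(2) in \<open>auto simp: lessThan_Suc\<close>)
    ultimately show ?case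
      unfolding sum.lessThan_Suc using IH(1) b(1) by (simp only: a_comm simp_thms)
  qed simp
  from this[of "length l"] show ?thesis by (simp add: simplex_boundary_sum)
qed

end

lemma additive_map_eval_chain:
  assumes M: "abelian_group M" and N: "abelian_group N" and f: "additive_map M N f"
    and w: "w \<in> Poly_Mapping.keys c \<rightarrow> carrier M"
  shows "f (eval_chain M w c) = eval_chain N (\<lambda>l. f (w l)) c"
proof -
  interpret M: abelian_group M by fact
  interpret N: abelian_group N by fact
  have "f (eval_chain M w c) = finsum N (\<lambda>m. f ([Poly_Mapping.lookup c m] \<cdot>\<^bsub>M\<^esub> w m)) (Poly_Mapping.keys c)"
    unfolding eval_chain_def by (rule additive_map_finsum[OF M N f]) (use w in auto)
  also have "\<dots> = eval_chain N (\<lambda>l. f (w l)) c"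
    unfolding eval_chain_def
  proof (rule N.finsum_cong')
    show "(\<lambda>m. [Poly_Mapping.lookup c m] \<cdot>\<^bsub>N\<^esub> f (w m)) \<in> Poly_Mapping.keys c \<rightarrow> carrier N"
      using w additive_map_closed[OF f] by auto
    show "f ([Poly_Mapping.lookup c m] \<cdot>\<^bsub>M\<^esub> w m) = [Poly_Mapping.lookup c m] \<cdot>\<^bsub>N\<^esub> f (w m)"
      if "m \<in> Poly_Mapping.keys c" for m
      using w that by (intro additive_map_int_mult[OF M N f]) auto
  qed simp
  finally show ?thesis .
qed

section \<open>The monoid \<open>S(G)\<close>\<close>

definition par_class :: "'g monoid \<Rightarrow> 'g list \<Rightarrow> 'g list set" where
  "par_class G w = par_rel G `` {w}"

definition par_support :: "'g monoid \<Rightarrow> 'g list set \<Rightarrow> 'g set" where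
  "par_support G s = the_elem (word_support G ` s)"

definition par_degree :: "'g monoid \<Rightarrow> 'g list set \<Rightarrow> 'g" where
  "par_degree G s = the_elem (word_deg G ` s)"

text \<open>Inverse to taking support and degree, for finite X containing 1 and g. The choice of the
  enumeration of X has no influence on the class.\<close>

definition par_elem :: "'g monoid \<Rightarrow> 'g set \<Rightarrow> 'g \<Rightarrow> 'g list set" where
  "par_elem G X g = par_class G (idem_word G (SOME l. set l = X) @ [g])"

context word_group
begin

abbreviation "S \<equiv> par_monoid G"

lemma par_class_eq: "w \<in> lists (carrier G) \<Longrightarrow>
  par_class G w = {v \<in> lists (carrier G). word_support G v = word_support G w \<and> word_deg G v = word_deg G w}"
  by (auto simp: par_class_def par_rel_iff)

lemma par_class_closed: "w \<in> lists (carrier G) \<Longrightarrow> par_class G w \<in> carrier S"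
  by (auto simp: par_monoid_def par_class_def quotient_def)

lemma par_class_cases:
  assumes "s \<in> carrier S" obtains w where "w \<in> lists (carrier G)" "s = par_class G w"
  using assms by (auto simp: par_monoid_def par_class_def quotient_def)

lemma par_support_class: "w \<in> lists (carrier G) \<Longrightarrow> par_support G (par_class G w) = word_support G w"
proof -
  assume "w \<in> lists (carrier G)"
  then have "word_support G ` par_class G w = {word_support G w}" by (auto simp: par_class_eq)
  then show ?thesis by (simp add: par_support_def)
qed

lemma par_degree_class: "w \<in> lists (carrier G) \<Longrightarrow> par_degree G (par_class G w) = word_deg G w"
proof -
  assume "w \<in> lists (carrier G)"
  then have "word_deg G ` par_class G w = {word_deg G w}" by (auto simp: par_class_eq)
  then show ?thesis by (simp add: par_degree_def)
qed

lemma par_class_mult: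
  assumes "v \<in> lists (carrier G)" "w \<in> lists (carrier G)"
  shows "par_class G v \<otimes>\<^bsub>S\<^esub> par_class G w = par_class G (v @ w)"
proof -
  have "par_rel G `` {v' @ w'} = par_class G (v @ w)" if "v' \<in> par_class G v" "w' \<in> par_class G w" for v' w'
    using that assms unfolding par_class_def[symmetric]
    by (auto simp: par_class_eq word_support_append word_deg_append)
  moreover have "v \<in> par_class G v" "w \<in> par_class G w" using assms by (auto simp: par_class_eq)
  ultimately show ?thesis by (auto simp: par_monoid_def)
qed

lemma par_one: "\<one>\<^bsub>S\<^esub> = par_class G []"
  by (simp add: par_monoid_def par_class_def)

lemma par_mult_closed [simp]: "\<lbrakk>s \<in> carrier S; t \<in> carrier S\<rbrakk> \<Longrightarrow> s \<otimes>\<^bsub>S\<^esub> t \<in> carrier S"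
  by (elim par_class_cases) (simp add: par_class_mult par_class_closed)

lemma par_one_closed [simp]: "\<one>\<^bsub>S\<^esub> \<in> carrier S"
  by (simp add: par_one par_class_closed)

lemma par_support_closed: "s \<in> carrier S \<Longrightarrow> par_support G s \<subseteq> carrier G"
  by (elim par_class_cases) (simp add: par_support_class word_support_closed)

lemma par_support_finite: "s \<in> carrier S \<Longrightarrow> finite (par_support G s)"
  by (elim par_class_cases) (simp add: par_support_class word_support_finite)

lemma one_in_par_support [simp]: "s \<in> carrier S \<Longrightarrow> \<one> \<in> par_support G s"
  by (elim par_class_cases) (simp add: par_support_class)

lemma par_degree_closed [simp]: "s \<in> carrier S \<Longrightarrow> par_degree G s \<in> carrier G"
  by (elim par_class_cases) (simp add: par_degree_class)

lemma par_degree_in_support: "s \<in> carrier S \<Longrightarrow> par_degree G s \<in> par_support G s"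
  by (elim par_class_cases) (simp add: par_degree_class par_support_class word_deg_in_support)

lemma par_support_mult:
  "\<lbrakk>s \<in> carrier S; t \<in> carrier S\<rbrakk> \<Longrightarrow>
    par_support G (s \<otimes>\<^bsub>S\<^esub> t) = par_support G s \<union> translate G (par_degree G s) (par_support G t)"
  by (elim par_class_cases)
    (simp add: par_class_mult par_support_class par_degree_class word_support_append)

lemma par_degree_mult:
  "\<lbrakk>s \<in> carrier S; t \<in> carrier S\<rbrakk> \<Longrightarrow> par_degree G (s \<otimes>\<^bsub>S\<^esub> t) = par_degree G s \<otimes> par_degree G t"
  by (elim par_class_cases) (simp add: par_class_mult par_degree_class word_deg_append)

lemma par_support_one [simp]: "par_support G \<one>\<^bsub>S\<^esub> = {\<one>}"
  by (simp add: par_one par_support_class)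

lemma par_degree_one [simp]: "par_degree G \<one>\<^bsub>S\<^esub> = \<one>"
  by (simp add: par_one par_degree_class)

lemma par_eqI:
  "\<lbrakk>s \<in> carrier S; t \<in> carrier S; par_support G s = par_support G t; par_degree G s = par_degree G t\<rbrakk> \<Longrightarrow> s = t"
proof (elim par_class_cases)
  fix v w assume "v \<in> lists (carrier G)" "w \<in> lists (carrier G)" "s = par_class G v" "t = par_class G w"
    and "par_support G s = par_support G t" "par_degree G s = par_degree G t"
  then have "word_support G v = word_support G w" "word_deg G v = word_deg G w"
    by (simp_all add: par_support_class par_degree_class)
  then show "s = t"
    using \<open>v \<in> lists (carrier G)\<close> \<open>w \<in> lists (carrier G)\<close> \<open>s = _\<close> \<open>t = _\<close> by (simp add: par_class_eq)
qed

lemma monoid_S: "monoid S"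
proof (rule monoidI)
  fix s t u assume stu: "s \<in> carrier S" "t \<in> carrier S" "u \<in> carrier S"
  then obtain v w x where "v \<in> lists (carrier G)" "w \<in> lists (carrier G)" "x \<in> lists (carrier G)"
    "s = par_class G v" "t = par_class G w" "u = par_class G x" by (metis par_class_cases)
  then show "s \<otimes>\<^bsub>S\<^esub> t \<otimes>\<^bsub>S\<^esub> u = s \<otimes>\<^bsub>S\<^esub> (t \<otimes>\<^bsub>S\<^esub> u)" by (simp add: par_class_mult)
next
  fix s assume "s \<in> carrier S"
  then obtain v where "v \<in> lists (carrier G)" "s = par_class G v" by (rule par_class_cases)
  then show "\<one>\<^bsub>S\<^esub> \<otimes>\<^bsub>S\<^esub> s = s" "s \<otimes>\<^bsub>S\<^esub> \<one>\<^bsub>S\<^esub> = s"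
    using par_class_mult[of "[]" v] par_class_mult[of v "[]"] by (simp_all add: par_one)
qed simp_all

lemma word_support_idem_word:
  assumes "as \<in> lists (carrier G)" "w \<in> lists (carrier G)"
  shows "word_support G (idem_word G as @ w) = set as \<union> word_support G w"
    and "word_deg G (idem_word G as @ w) = word_deg G w"
proof -
  have "word_support G (idem_word G as @ w) = set as \<union> word_support G w \<and>
    word_deg G (idem_word G as @ w) = word_deg G w"
    using assms(1)
  proof (induction as)
    case (Cons a as)
    have cl: "idem_word G as @ w \<in> lists (carrier G)" using idem_word_lists[of as] Cons assms(2) by auto
    have "a \<otimes> (inv a \<otimes> word_deg G (idem_word G as @ w)) = word_deg G (idem_word G as @ w)"
      using Cons word_deg_closed[OF cl] by (simp flip: m_assoc)
    moreover have "translate G a (translate G (inv a) (word_support G (idem_word G as @ w))) =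
        word_support G (idem_word G as @ w)"
      using Cons word_support_closed[OF cl] by (simp add: translate_translate)
    moreover have "\<one> \<in> word_support G (idem_word G as @ w)" by simp
    ultimately show ?case using Cons by (auto simp: translate_insert)
  qed simp
  then show "word_support G (idem_word G as @ w) = set as \<union> word_support G w"
    "word_deg G (idem_word G as @ w) = word_deg G w" by auto
qed

lemma par_elem:
  assumes "finite X" "X \<subseteq> carrier G" "\<one> \<in> X" "g \<in> X"
  shows "par_elem G X g \<in> carrier S" "par_support G (par_elem G X g) = X" "par_degree G (par_elem G X g) = g"
proof -
  define as where "as = (SOME l. set l = X)"
  have as: "set as = X" unfolding as_def using someI_ex[OF finite_list[OF assms(1)]] .
  then have as': "as \<in> lists (carrier G)" and g: "g \<in> carrier G" using assms by auto
  then have w: "idem_word G as @ [g] \<in> lists (carrier G)" using idem_word_lists by auto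
  have eq: "par_elem G X g = par_class G (idem_word G as @ [g])" by (simp add: par_elem_def as_def)
  show "par_elem G X g \<in> carrier S" unfolding eq by (rule par_class_closed[OF w])
  show "par_support G (par_elem G X g) = X"
    unfolding eq par_support_class[OF w] using word_support_idem_word(1)[OF as', of "[g]"] g as assms(3,4)
    by (auto simp: translate_def)
  show "par_degree G (par_elem G X g) = g"
    unfolding eq par_degree_class[OF w] using word_support_idem_word(2)[OF as', of "[g]"] g by simp
qed

lemma par_elem_eq: "s \<in> carrier S \<Longrightarrow> par_elem G (par_support G s) (par_degree G s) = s"
  by (rule par_eqI)
    (simp_all add: par_elem par_support_finite par_support_closed par_degree_in_support)

text \<open>The degree is multiplicative with values in a group, whose only idempotent is 1;
  conversely (X, 1)(X, 1) = (X, 1).\<close>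

lemma idempotents_iff: "e \<in> idempotents S \<longleftrightarrow> e \<in> carrier S \<and> par_degree G e = \<one>"
proof
  assume "e \<in> idempotents S"
  then have e: "e \<in> carrier S" "e \<otimes>\<^bsub>S\<^esub> e = e" by (auto simp: idempotents_def)
  then have "par_degree G e \<otimes> par_degree G e = par_degree G e" using par_degree_mult[of e e] by simp
  then show "e \<in> carrier S \<and> par_degree G e = \<one>" using e l_cancel_one'[of "par_degree G e"] by simp
next
  assume e: "e \<in> carrier S \<and> par_degree G e = \<one>"
  then have "e \<otimes>\<^bsub>S\<^esub> e = e"
    by (intro par_eqI) (auto simp: par_support_mult par_degree_mult par_support_closed)
  with e show "e \<in> idempotents S" by (simp add: idempotents_def)
qed

lemma par_support_mult_subset:
  "\<lbrakk>s \<in> carrier S; t \<in> carrier S; u \<in> carrier S\<rbrakk> \<Longrightarrow>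
    translate G (par_degree G s) (par_support G t) \<subseteq> par_support G (s \<otimes>\<^bsub>S\<^esub> t \<otimes>\<^bsub>S\<^esub> u)"
  by (auto simp: par_support_mult)

text \<open>The inverse of (X, g) is (g^-1 X, g^-1). For uniqueness, s r s = s forces the degree of
  r and bounds its support from above, and r s r = r bounds it from below.\<close>

lemma semigroup_inverse:
  assumes s: "s \<in> carrier S"
  shows "semigroup_inverse S s \<in> carrier S"
    "par_support G (semigroup_inverse S s) = translate G (inv par_degree G s) (par_support G s)"
    "par_degree G (semigroup_inverse S s) = inv par_degree G s"
proof -
  let ?g = "par_degree G s" and ?X = "par_support G s"
  have g: "?g \<in> carrier G" and X: "?X \<subseteq> carrier G" using s par_support_closed by auto
  have t': "inv ?g \<in> translate G (inv ?g) ?X"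
    unfolding translate_def by (rule image_eqI[of _ _ \<one>]) (use s g in auto)
  moreover have "\<one> \<in> translate G (inv ?g) ?X"
    unfolding translate_def by (rule image_eqI[of _ _ ?g]) (use s g par_degree_in_support in auto)
  moreover define t where "t = par_elem G (translate G (inv ?g) ?X) (inv ?g)"
  ultimately have t: "t \<in> carrier S" "par_support G t = translate G (inv ?g) ?X" "par_degree G t = inv ?g"
    using par_elem[of "translate G (inv ?g) ?X" "inv ?g"] finite_translate par_support_finite[OF s]
      translate_closed[OF _ X] g by auto
  have "semigroup_inverse S s = t"
    unfolding semigroup_inverse_def
  proof (rule the_equality)
    have "s \<otimes>\<^bsub>S\<^esub> t \<otimes>\<^bsub>S\<^esub> s = s"
      by (rule par_eqI) (use s t g X in \<open>auto simp: par_support_mult par_degree_mult translate_translate\<close>)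
    moreover have "t \<otimes>\<^bsub>S\<^esub> s \<otimes>\<^bsub>S\<^esub> t = t"
      by (rule par_eqI) (use s t g X in \<open>auto simp: par_support_mult par_degree_mult translate_translate\<close>)
    ultimately show "t \<in> carrier S \<and> s \<otimes>\<^bsub>S\<^esub> t \<otimes>\<^bsub>S\<^esub> s = s \<and> t \<otimes>\<^bsub>S\<^esub> s \<otimes>\<^bsub>S\<^esub> t = t"
      using t by blast
    fix r assume r: "r \<in> carrier S \<and> s \<otimes>\<^bsub>S\<^esub> r \<otimes>\<^bsub>S\<^esub> s = s \<and> r \<otimes>\<^bsub>S\<^esub> s \<otimes>\<^bsub>S\<^esub> r = r"
    let ?h = "par_degree G r" and ?Y = "par_support G r"
    have h: "?h \<in> carrier G" and Y: "?Y \<subseteq> carrier G" using r par_support_closed by auto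
    have deg: "?g \<otimes> ?h \<otimes> ?g = ?g" using r s par_degree_mult[of "s \<otimes>\<^bsub>S\<^esub> r" s] par_degree_mult[of s r] by simp
    then have "?h = inv ?g" using g h
      by (metis inv_equality inv_solve_right l_cancel_one' m_closed r_inv inv_comm)
    moreover have "?Y = translate G (inv ?g) ?X"
    proof
      have "translate G ?g ?Y \<subseteq> par_support G (s \<otimes>\<^bsub>S\<^esub> r \<otimes>\<^bsub>S\<^esub> s)"
        using r s by (intro par_support_mult_subset) auto
      then have "translate G ?g ?Y \<subseteq> ?X" using r by simp
      then have "translate G (inv ?g) (translate G ?g ?Y) \<subseteq> translate G (inv ?g) ?X"
        unfolding translate_def by blast
      then show "?Y \<subseteq> translate G (inv ?g) ?X" using g Y by (simp add: translate_translate)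
      have "translate G ?h ?X \<subseteq> par_support G (r \<otimes>\<^bsub>S\<^esub> s \<otimes>\<^bsub>S\<^esub> r)"
        using r s by (intro par_support_mult_subset) auto
      then show "translate G (inv ?g) ?X \<subseteq> ?Y" using r \<open>?h = inv ?g\<close> by simp
    qed
    ultimately show "r = t" using r t by (intro par_eqI) auto
  qed
  with t show "semigroup_inverse S s \<in> carrier S"
    "par_support G (semigroup_inverse S s) = translate G (inv par_degree G s) (par_support G s)"
    "par_degree G (semigroup_inverse S s) = inv par_degree G s" by auto
qed

definition conj_idem :: "'g list set \<Rightarrow> 'g list set \<Rightarrow> 'g list set" where
  "conj_idem s e = s \<otimes>\<^bsub>S\<^esub> e \<otimes>\<^bsub>S\<^esub> semigroup_inverse S s"

text \<open>In terms of pairs, (X, g)(Y, 1)(g^-1 X, g^-1) = (X \<union> gY, 1): the last factor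
  contributes g g^-1 X = X, which is already present.\<close>

lemma conj_idem:
  assumes s: "s \<in> carrier S" and e: "e \<in> idempotents S"
  shows "conj_idem s e \<in> carrier S" "par_degree G (conj_idem s e) = \<one>"
    "par_support G (conj_idem s e) = par_support G s \<union> translate G (par_degree G s) (par_support G e)"
proof -
  have e': "e \<in> carrier S" "par_degree G e = \<one>" using e by (auto simp: idempotents_iff)
  note inv = semigroup_inverse[OF s]
  show "conj_idem s e \<in> carrier S" using s e' inv by (simp add: conj_idem_def)
  show "par_degree G (conj_idem s e) = \<one>" using s e' inv by (simp add: conj_idem_def par_degree_mult)
  show "par_support G (conj_idem s e) = par_support G s \<union> translate G (par_degree G s) (par_support G e)"
    using s e' inv par_support_closed[OF s]
    by (auto simp: conj_idem_def par_degree_mult par_support_mult translate_translate)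
qed

end

section \<open>A projective resolution by pointed simplices\<close>

text \<open>n counts vertices, not dimension. The case n = 0, a set X with no vertices, corresponds
  to K E(S(G)), and the term of degree i in the resolution has n = i + 1.\<close>

definition simplices :: "'g monoid \<Rightarrow> nat \<Rightarrow> ('g set \<times> 'g list) set" where
  "simplices G n = {(X, l). finite X \<and> X \<subseteq> carrier G \<and> \<one>\<^bsub>G\<^esub> \<in> X \<and> set l \<subseteq> X \<and> length l = n}"

text \<open>On X this is conjugation of the idempotent with support X, on l it is translation by the
  degree. The union leaves room for the translated vertices.\<close>

definition simplex_op :: "'g monoid \<Rightarrow> 'g list set \<Rightarrow> 'g set \<times> 'g list \<Rightarrow> 'g set \<times> 'g list" where
  "simplex_op G s = (\<lambda>(X, l). (par_support G s \<union> translate G (par_degree G s) X,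
     map (\<lambda>x. par_degree G s \<otimes>\<^bsub>G\<^esub> x) l))"

definition simplex_module :: "'k ring \<Rightarrow> 'g monoid \<Rightarrow> nat \<Rightarrow> ('g list set \<Rightarrow> 'k, 'g set \<times> 'g list \<Rightarrow> 'k) module" where
  "simplex_module K G n = perm_module K (par_monoid G) (simplices G n) (simplex_op G)"

definition simplex_face :: "'k ring \<Rightarrow> 'g monoid \<Rightarrow> nat \<Rightarrow> 'g set \<times> 'g list \<Rightarrow> 'g set \<times> 'g list \<Rightarrow> 'k" where
  "simplex_face K G n = (\<lambda>(X, l).
     eval_chain (free_module K (simplices G n)) (\<lambda>m. basis_vector K (X, m)) (simplex_boundary l))"

definition simplex_diff ::
  "'k ring \<Rightarrow> 'g monoid \<Rightarrow> nat \<Rightarrow> ('g set \<times> 'g list \<Rightarrow> 'k) \<Rightarrow> 'g set \<times> 'g list \<Rightarrow> 'k" where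
  "simplex_diff K G n = linear_extension K
     (restrict_scalars K (par_monoid G) (simplex_module K G n)) (simplex_face K G n)"

locale partial_group_ring = word_group G + K: cring K for G :: "'g monoid" (structure) and K :: "'k ring"
begin

lemma set_action_simplices: "set_action K S (simplices G n) (simplex_op G)"
proof (intro set_action.intro monoid_S set_action_axioms.intro K.is_cring)
  fix s y assume s: "s \<in> carrier S" and y: "y \<in> simplices G n"
  obtain X l where "y = (X, l)" by (cases y)
  with s y show "simplex_op G s y \<in> simplices G n"
    using par_support_finite[OF s] par_support_closed[OF s] translate_closed[of "par_degree G s" X]
    by (auto simp: simplices_def simplex_op_def finite_translate translate_def)
next
  fix y assume "y \<in> simplices G n"
  then show "simplex_op G \<one>\<^bsub>S\<^esub> y = y"
    by (auto simp: simplices_def simplex_op_def subset_iff intro!: map_idI)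
next
  fix s t y assume st: "s \<in> carrier S" "t \<in> carrier S" and y: "y \<in> simplices G n"
  obtain X l where Xl: "y = (X, l)" by (cases y)
  then have "X \<subseteq> carrier G" "set l \<subseteq> carrier G" using y by (auto simp: simplices_def)
  with st show "simplex_op G (s \<otimes>\<^bsub>S\<^esub> t) y = simplex_op G s (simplex_op G t y)"
    using par_support_closed[OF st(2)]
    by (auto simp: Xl simplex_op_def par_support_mult par_degree_mult translate_Un translate_translate
        m_assoc subset_iff)
qed

sublocale Y: set_action K S "simplices G n" "simplex_op G" for n
  by (rule set_action_simplices)

abbreviation "R \<equiv> semigroup_algebra K S"
abbreviation "F n \<equiv> free_module K (simplices G n)"

lemma ring_R: "ring R"
  by (rule ring_semigroup_algebra[OF monoid_S K.is_cring])

lemma left_module_simplex: "left_module R (simplex_module K G n)"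
  unfolding simplex_module_def by (rule Y.left_module_perm)

lemma simplex_module_simps [simp]:
  "carrier (simplex_module K G n) = carrier (F n)"
  "zero (simplex_module K G n) = zero (F n)"
  "add (simplex_module K G n) = add (F n)"
  by (simp_all add: simplex_module_def perm_module_def)

lemma left_module_F: "left_module K (F n)"
  by (rule left_module_free[OF K.ring_axioms])

lemma abelian_group_F: "abelian_group (F n)"
  using left_module_F by (rule left_module.axioms)

lemma basis_F: "y \<in> simplices G n \<Longrightarrow> basis_vector K y \<in> carrier (F n)"
  by (rule basis_vector_closed[OF K.ring_axioms])

lemma simplex_face_mem:
  "\<lbrakk>(X, l) \<in> simplices G (Suc n); m \<in> Poly_Mapping.keys (simplex_boundary l)\<rbrakk> \<Longrightarrow> (X, m) \<in> simplices G n"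
  by (auto simp: simplices_def dest!: keys_simplex_boundary)

lemma simplex_face_closed:
  assumes "y \<in> simplices G (Suc n)" shows "simplex_face K G n y \<in> carrier (F n)"
proof -
  obtain X l where y: "y = (X, l)" by (cases y)
  show ?thesis
    unfolding y simplex_face_def prod.case
    by (rule Y.V.M.eval_chain_closed) (use simplex_face_mem assms y basis_F in blast)
qed

text \<open>Faces keep the set X and only lose a vertex, and translating vertices commutes with the
  boundary; so the differential respects the action of S(G).\<close>

lemma simplex_face_op:
  assumes s: "s \<in> carrier S" and y: "y \<in> simplices G (Suc n)"
  shows "simplex_face K G n (simplex_op G s y) = basis_vector K s \<odot>\<^bsub>simplex_module K G n\<^esub> simplex_face K G n y"
proof -
  obtain X l where Xl: "y = (X, l)" by (cases y)
  interpret P: left_module R "simplex_module K G n" by (rule left_module_simplex)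
  let ?g = "par_degree G s" and ?X = "par_support G s \<union> translate G (par_degree G s) X"
  have b: "basis_vector K s \<in> carrier R" using Y.basis_F[OF s] by (simp add: semigroup_algebra_simps(1))
  have m: "(X, m) \<in> simplices G n" if "m \<in> Poly_Mapping.keys (simplex_boundary l)" for m
    using keys_simplex_boundary[OF that] y by (auto simp: Xl simplices_def)
  have add: "additive_map (F n) (F n) (\<lambda>v. basis_vector K s \<odot>\<^bsub>simplex_module K G n\<^esub> v)"
    using P.additive_smult[OF b] by (simp add: additive_map_def)
  have "basis_vector K s \<odot>\<^bsub>simplex_module K G n\<^esub> simplex_face K G n y =
      eval_chain (F n) (\<lambda>m. basis_vector K s \<odot>\<^bsub>simplex_module K G n\<^esub> basis_vector K (X, m)) (simplex_boundary l)"
    unfolding Xl simplex_face_def prod.case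
    by (rule additive_map_eval_chain[OF abelian_group_F abelian_group_F add]) (use m basis_F in auto)
  also have "\<dots> = eval_chain (F n) (\<lambda>m. basis_vector K (?X, map (\<lambda>x. ?g \<otimes> x) m)) (simplex_boundary l)"
  proof (rule Y.V.M.eval_chain_cong)
    fix m assume "m \<in> Poly_Mapping.keys (simplex_boundary l)"
    from Y.perm_smult_basis[OF s m[OF this]]
    show "basis_vector K s \<odot>\<^bsub>simplex_module K G n\<^esub> basis_vector K (X, m) = basis_vector K (?X, map (\<lambda>x. ?g \<otimes> x) m)"
      by (simp add: simplex_module_def simplex_op_def)
  next
    show "(\<lambda>m. basis_vector K (?X, map (\<lambda>x. ?g \<otimes> x) m)) \<in> Poly_Mapping.keys (simplex_boundary l) \<rightarrow> carrier (F n)"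
      using Y.op_closed[OF s m] basis_F by (auto simp: simplex_op_def)
  qed
  also have "\<dots> = eval_chain (F n) (\<lambda>l. eval_chain (F n) (\<lambda>m. basis_vector K (?X, m)) (frag_of (map (\<lambda>x. ?g \<otimes> x) l)))
      (simplex_boundary l)"
    by (rule Y.V.M.eval_chain_cong[symmetric])
      (use Y.op_closed[OF s m] basis_F in \<open>auto simp: simplex_op_def intro!: Y.V.M.eval_chain_of\<close>)
  also have "\<dots> = eval_chain (F n) (\<lambda>m. basis_vector K (?X, m)) (chain_map (\<lambda>x. ?g \<otimes> x) (simplex_boundary l))"
    unfolding chain_map_def
    by (rule Y.V.M.eval_chain_frag_extend[symmetric, where S = "{m. (?X, m) \<in> simplices G n}"])
      (use Y.op_closed[OF s m] basis_F in \<open>auto simp: simplex_op_def\<close>)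
  finally show ?thesis
    by (simp add: simplex_face_def Xl simplex_op_def boundary_map)
qed

lemma simplex_diff_linear:
  "linear_map R (simplex_module K G (Suc n)) (simplex_module K G n) (simplex_diff K G n)"
  unfolding simplex_diff_def simplex_module_def[of K G "Suc n"]
  by (rule Y.linear_map_from_perm(1)[OF left_module_simplex])
    (auto simp: simplex_face_closed simplex_face_op)

lemma simplex_diff_basis:
  "y \<in> simplices G (Suc n) \<Longrightarrow> simplex_diff K G n (basis_vector K y) = simplex_face K G n y"
  unfolding simplex_diff_def
  by (rule Y.linear_map_from_perm(2)[OF left_module_simplex])
    (auto simp: simplex_face_closed simplex_face_op)

text \<open>Linearity over K is recorded separately because exactness is proved over K, by a
  contraction that S(G) does not respect.\<close>

lemma simplex_diff_linear_K: "linear_map K (F (Suc n)) (F n) (simplex_diff K G n)"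
proof (rule Y.linear_map_from_restrict_scalars)
  have "linear_map R (rep_module K S (F (Suc n)) (perm_rep K (simplices G (Suc n)) (simplex_op G)))
      (simplex_module K G n) (simplex_diff K G n)"
    using simplex_diff_linear[of n] by (simp add: simplex_module_def[of K G "Suc n"] perm_module_def)
  from Y.linear_map_rep_imp(1)[OF left_module_simplex this]
  show "linear_map K (F (Suc n)) (restrict_scalars K S (rep_module K S (F n) (perm_rep K (simplices G n) (simplex_op G))))
      (simplex_diff K G n)"
    by (simp add: simplex_module_def perm_module_def)
qed

lemma simplex_diff_diff:
  assumes y: "y \<in> carrier (F (Suc (Suc n)))"
  shows "simplex_diff K G n (simplex_diff K G (Suc n) y) = \<zero>\<^bsub>F n\<^esub>"
proof -
  have zero: "linear_map K (F (Suc (Suc n))) (F n) (\<lambda>y. \<zero>\<^bsub>F n\<^esub>)"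
    by (rule Y.V.zero_linear)
  show ?thesis
  proof (rule linear_map_eq_on_basis[OF left_module_F
        linear_map_comp[OF simplex_diff_linear_K simplex_diff_linear_K] zero _ y])
    fix y assume y: "y \<in> simplices G (Suc (Suc n))"
    obtain X l where Xl: "y = (X, l)" by (cases y)
    have m: "(X, m) \<in> simplices G (Suc n)" if "m \<in> Poly_Mapping.keys (simplex_boundary l)" for m
      using keys_simplex_boundary[OF that] y by (auto simp: Xl simplices_def)
    have m': "(X, m') \<in> simplices G n" if "m \<in> Poly_Mapping.keys (simplex_boundary l)"
      "m' \<in> Poly_Mapping.keys (simplex_boundary m)" for m m'
      using keys_simplex_boundary[OF that(2)] m[OF that(1)] by (auto simp: simplices_def)
    have "simplex_diff K G n (simplex_diff K G (Suc n) (basis_vector K y)) =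
        eval_chain (F n) (\<lambda>m. simplex_diff K G n (basis_vector K (X, m))) (simplex_boundary l)"
      unfolding simplex_diff_basis[OF y] unfolding Xl simplex_face_def prod.case
      by (rule additive_map_eval_chain[OF abelian_group_F abelian_group_F linear_map_additive[OF simplex_diff_linear_K]])
        (use m basis_F in auto)
    also have "\<dots> = eval_chain (F n) (\<lambda>m. eval_chain (F n) (\<lambda>m. basis_vector K (X, m)) (simplex_boundary m)) (simplex_boundary l)"
    proof (rule Y.V.M.eval_chain_cong)
      show "simplex_diff K G n (basis_vector K (X, m)) = eval_chain (F n) (\<lambda>m. basis_vector K (X, m)) (simplex_boundary m)"
        if "m \<in> Poly_Mapping.keys (simplex_boundary l)" for m
        using simplex_diff_basis[OF m[OF that]] by (simp add: simplex_face_def)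
      then show "(\<lambda>m. eval_chain (F n) (\<lambda>m. basis_vector K (X, m)) (simplex_boundary m))
          \<in> Poly_Mapping.keys (simplex_boundary l) \<rightarrow> carrier (F n)"
        using m simplex_face_closed[of "(X, _)" n] by (auto simp: simplex_face_def)
    qed
    also have "\<dots> = eval_chain (F n) (\<lambda>m. basis_vector K (X, m)) (frag_extend simplex_boundary (simplex_boundary l))"
      by (rule Y.V.M.eval_chain_frag_extend[symmetric, where S = "{m. (X, m) \<in> simplices G n}"])
        (use m' basis_F in auto)
    finally show "simplex_diff K G n (simplex_diff K G (Suc n) (basis_vector K y)) = \<zero>\<^bsub>F n\<^esub>"
      by (simp add: boundary_boundary)
  qed
qed

text \<open>The cone with apex 1, available because every X contains 1. It is K-linear but not
  equivariant, since elements of S(G) move the apex.\<close>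

definition contraction :: "nat \<Rightarrow> ('g set \<times> 'g list \<Rightarrow> 'k) \<Rightarrow> 'g set \<times> 'g list \<Rightarrow> 'k" where
  "contraction n = linear_extension K (F (Suc n)) (\<lambda>(X, l). basis_vector K (X, \<one> # l))"

lemma contraction:
  shows contraction_linear: "linear_map K (F n) (F (Suc n)) (contraction n)"
    and contraction_basis: "(X, l) \<in> simplices G n \<Longrightarrow> contraction n (basis_vector K (X, l)) = basis_vector K (X, \<one> # l)"
proof -
  have t: "(\<lambda>(X, l). basis_vector K (X, \<one> # l)) \<in> simplices G n \<rightarrow> carrier (F (Suc n))"
    using basis_F[of "(_, \<one> # _)" "Suc n"] by (auto simp: simplices_def[of G n] simplices_def[of G "Suc n"])
  show "linear_map K (F n) (F (Suc n)) (contraction n)"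
    unfolding contraction_def by (rule linear_extension_linear[OF left_module_F t])
  show "contraction n (basis_vector K (X, l)) = basis_vector K (X, \<one> # l)" if "(X, l) \<in> simplices G n"
    unfolding contraction_def
    using linear_extension_basis[OF left_module_F, of "\<lambda>(X, l). basis_vector K (X, \<one> # l)" "(X, l)" "Suc n"]
      funcset_mem[OF t that] by simp
qed

lemma contraction_0:
  assumes y: "y \<in> carrier (F 0)" shows "simplex_diff K G 0 (contraction 0 y) = y"
proof (rule linear_map_eq_on_basis[OF left_module_F
      linear_map_comp[OF contraction_linear simplex_diff_linear_K] linear_map_id _ y])
  fix y assume y: "y \<in> simplices G 0"
  then obtain X where X: "y = (X, [])" by (auto simp: simplices_def)
  have "(X, [\<one>]) \<in> simplices G (Suc 0)" using y X by (auto simp: simplices_def)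
  then show "simplex_diff K G 0 (contraction 0 (basis_vector K y)) = basis_vector K y"
    using y X basis_F[OF y] by (simp add: contraction_basis simplex_diff_basis simplex_face_def cone_zero)
qed

text \<open>The boundary of a cone is its base minus the cone over the boundary of the base, which
  is the recursion for the boundary of \<open>\<one> # l\<close>.\<close>

lemma contraction_Suc:
  assumes y: "y \<in> carrier (F (Suc n))"
  shows "simplex_diff K G (Suc n) (contraction (Suc n) y) = y \<ominus>\<^bsub>F (Suc n)\<^esub> contraction n (simplex_diff K G n y)"
proof -
  show ?thesis
  proof (rule linear_map_eq_on_basis[OF left_module_F linear_map_comp[OF contraction_linear simplex_diff_linear_K] _ _ y])
    show "linear_map K (F (Suc n)) (F (Suc n)) (\<lambda>y. y \<ominus>\<^bsub>F (Suc n)\<^esub> contraction n (simplex_diff K G n y))"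
      by (rule Y.V.linear_map_diff[OF left_module_F linear_map_id linear_map_comp[OF simplex_diff_linear_K contraction_linear]])
    fix y assume y: "y \<in> simplices G (Suc n)"
    obtain X l where Xl: "y = (X, l)" by (cases y)
    have Xl': "(X, \<one> # l) \<in> simplices G (Suc (Suc n))" using y by (auto simp: Xl simplices_def)
    have m: "(X, m) \<in> simplices G n" "(X, \<one> # m) \<in> simplices G (Suc n)"
      if "m \<in> Poly_Mapping.keys (simplex_boundary l)" for m
      using keys_simplex_boundary[OF that] y by (auto simp: Xl simplices_def)
    have keys: "m \<in> {m. (X, m) \<in> simplices G (Suc n)}" if "m \<in> Poly_Mapping.keys (cone \<one> (simplex_boundary l))" for m
      using that keys_cone[of \<one> "simplex_boundary l"] m by auto
    have "simplex_diff K G (Suc n) (contraction (Suc n) (basis_vector K y)) =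
        eval_chain (F (Suc n)) (\<lambda>m. basis_vector K (X, m)) (frag_of l - cone \<one> (simplex_boundary l))"
      using y Xl' by (simp add: Xl contraction_basis simplex_diff_basis simplex_face_def)
    also have "\<dots> = eval_chain (F (Suc n)) (\<lambda>m. basis_vector K (X, m)) (frag_of l) \<ominus>\<^bsub>F (Suc n)\<^esub>
        eval_chain (F (Suc n)) (\<lambda>m. basis_vector K (X, m)) (cone \<one> (simplex_boundary l))"
      by (rule Y.V.M.eval_chain_diff) (use y Xl keys basis_F in auto)
    also have "eval_chain (F (Suc n)) (\<lambda>m. basis_vector K (X, m)) (frag_of l) = basis_vector K y"
      using basis_F[OF y] Xl by (simp add: Y.V.M.eval_chain_of)
    also have "eval_chain (F (Suc n)) (\<lambda>m. basis_vector K (X, m)) (cone \<one> (simplex_boundary l)) =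
        eval_chain (F (Suc n)) (\<lambda>m. eval_chain (F (Suc n)) (\<lambda>m. basis_vector K (X, m)) (frag_of (\<one> # m))) (simplex_boundary l)"
      unfolding cone_def
      by (rule Y.V.M.eval_chain_frag_extend[where S = "{m. (X, m) \<in> simplices G (Suc n)}"]) (use m basis_F in auto)
    also have "\<dots> = eval_chain (F (Suc n)) (\<lambda>m. contraction n (basis_vector K (X, m))) (simplex_boundary l)"
      by (rule Y.V.M.eval_chain_cong) (use m basis_F in \<open>auto simp: contraction_basis Y.V.M.eval_chain_of\<close>)
    also have "\<dots> = contraction n (simplex_diff K G n (basis_vector K y))"
      unfolding simplex_diff_basis[OF y] unfolding Xl simplex_face_def prod.case
      by (rule additive_map_eval_chain[symmetric, OF abelian_group_F abelian_group_F linear_map_additive[OF contraction_linear]])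
        (use m basis_F in auto)
    finally show "simplex_diff K G (Suc n) (contraction (Suc n) (basis_vector K y)) =
        basis_vector K y \<ominus>\<^bsub>F (Suc n)\<^esub> contraction n (simplex_diff K G n (basis_vector K y))" .
  qed
qed

text \<open>A cycle is the boundary of its cone. Exactness concerns sets only, so a homotopy over K
  suffices.\<close>

lemma simplex_exact:
  "simplex_diff K G (Suc n) ` carrier (F (Suc (Suc n))) = {y \<in> carrier (F (Suc n)). simplex_diff K G n y = \<zero>\<^bsub>F n\<^esub>}"
proof (intro equalityI subsetI)
  fix y assume "y \<in> simplex_diff K G (Suc n) ` carrier (F (Suc (Suc n)))"
  then show "y \<in> {y \<in> carrier (F (Suc n)). simplex_diff K G n y = \<zero>\<^bsub>F n\<^esub>}"
    using simplex_diff_diff linear_map_closed[OF simplex_diff_linear_K] by blast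
next
  fix y assume y: "y \<in> {y \<in> carrier (F (Suc n)). simplex_diff K G n y = \<zero>\<^bsub>F n\<^esub>}"
  have "contraction n \<zero>\<^bsub>F n\<^esub> = \<zero>\<^bsub>F (Suc n)\<^esub>"
    by (rule additive_map_zero[OF abelian_group_F abelian_group_F linear_map_additive[OF contraction_linear]])
  then have "y = simplex_diff K G (Suc n) (contraction (Suc n) y)"
    using contraction_Suc[of y n] y by (simp add: Y.V.M.minus_eq)
  then show "y \<in> simplex_diff K G (Suc n) ` carrier (F (Suc (Suc n)))"
    using linear_map_closed[OF contraction_linear] y by blast
qed

end

section \<open>Projectivity of the simplex modules\<close>

context partial_group_ring
begin

text \<open>A simplex \<open>(X, l)\<close> is obtained in exactly one way from a rooted tuple by an element of \<open>S(G)\<close> with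
  support \<open>X\<close> and degree \<open>hd l\<close>. This makes the simplex modules retracts of free modules on the rooted tuples.\<close>

definition rooted :: "nat \<Rightarrow> 'g list set" where
  "rooted n = {l. set l \<subseteq> carrier G \<and> length l = Suc n \<and> hd l = \<one>}"

abbreviation "root_translate l \<equiv> map (\<lambda>x. inv hd l \<otimes> x) l"

lemma root_translate:
  assumes "set l \<subseteq> carrier G" "l \<noteq> []"
  shows "set (root_translate l) \<subseteq> carrier G" "hd (root_translate l) = \<one>" "\<one> \<in> set (root_translate l)"
    "map (\<lambda>x. hd l \<otimes> x) (root_translate l) = l"
    "translate G (hd l) (set (root_translate l)) = set l"
proof -
  have hd: "hd l \<in> carrier G" using assms hd_in_set by blast
  then show "set (root_translate l) \<subseteq> carrier G" using assms by auto
  show h: "hd (root_translate l) = \<one>" using hd assms(2) by (simp add: hd_map)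
  have "hd (root_translate l) \<in> set (root_translate l)" using assms(2) by (intro hd_in_set) simp
  then show "\<one> \<in> set (root_translate l)" unfolding h .
  show m: "map (\<lambda>x. hd l \<otimes> x) (root_translate l) = l"
    using assms hd by (auto simp: m_assoc[symmetric] intro!: map_idI)
  then show "translate G (hd l) (set (root_translate l)) = set l"
    unfolding translate_def by (metis set_map)
qed

lemma root_translate_op:
  assumes "g \<in> carrier G" "set l \<subseteq> carrier G" "l \<noteq> []"
  shows "root_translate (map (\<lambda>x. g \<otimes> x) l) = root_translate l"
proof -
  have "hd l \<in> carrier G" using assms hd_in_set by blast
  then have "inv (g \<otimes> hd l) \<otimes> (g \<otimes> x) = inv hd l \<otimes> x" if "x \<in> carrier G" for x
    using assms(1) that by (simp add: inv_mult_group m_assoc) (simp flip: m_assoc)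
  with assms show ?thesis by (simp add: hd_map subset_iff)
qed

text \<open>\<open>?i\<close> writes (X, l) as the element (X, hd l) of S(G) times a rooted tuple;
  \<open>?p\<close> gives a rooted tuple its vertex set as support. Applying both enlarges X by the
  vertices of l, which it contains already, so the composite is the identity. A first vertex is
  indispensable for the construction.\<close>

lemma projective_simplex: "projective_over R (rooted n) (simplex_module K G (Suc n))"
proof -
  let ?P = "simplex_module K G (Suc n)" and ?L = "free_module R (rooted n)"
  interpret P: left_module R ?P by (rule left_module_simplex)
  interpret L: left_module R ?L by (rule left_module_free[OF ring_R])
  let ?t = "\<lambda>(X, l). basis_vector K (par_elem G X (hd l)) \<odot>\<^bsub>?L\<^esub> basis_vector R (root_translate l)"
  let ?i = "linear_extension K (restrict_scalars K S ?L) ?t"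
  let ?p = "linear_extension R ?P (\<lambda>l. basis_vector K (set l, l))"
  have bR: "basis_vector K s \<in> carrier R" if "s \<in> carrier S" for s
    using Y.basis_F[OF that] by (simp add: semigroup_algebra_simps(1))
  have mem: "finite X" "X \<subseteq> carrier G" "\<one> \<in> X" "set l \<subseteq> X" "length l = Suc n" "l \<noteq> []" "hd l \<in> X"
      "set l \<subseteq> carrier G" "root_translate l \<in> rooted n"
    if "(X, l) \<in> simplices G (Suc n)" for X l
  proof -
    show *: "finite X" "X \<subseteq> carrier G" "\<one> \<in> X" "set l \<subseteq> X" "length l = Suc n" "l \<noteq> []" "set l \<subseteq> carrier G"
      using that by (auto simp: simplices_def)
    show "hd l \<in> X" using * hd_in_set by blast
    show "root_translate l \<in> rooted n" using root_translate[of l] * by (auto simp: rooted_def)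
  qed
  have t: "?t \<in> simplices G (Suc n) \<rightarrow> carrier ?L"
  proof
    fix y assume y: "y \<in> simplices G (Suc n)"
    obtain X l where Xl: "y = (X, l)" by (cases y)
    note m = mem[OF y[unfolded Xl]]
    show "?t y \<in> carrier ?L"
      unfolding Xl prod.case
      by (intro L.smult_closed bR basis_vector_closed[OF ring_R] m par_elem)
  qed
  have equi: "?t (simplex_op G s y) = basis_vector K s \<odot>\<^bsub>?L\<^esub> ?t y"
    if s: "s \<in> carrier S" and y: "y \<in> simplices G (Suc n)" for s y
  proof -
    obtain X l where Xl: "y = (X, l)" by (cases y)
    note m = mem[OF y[unfolded Xl]]
    let ?g = "par_degree G s" and ?X = "par_support G s \<union> translate G (par_degree G s) X"
    have g: "?g \<in> carrier G" using s by simp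
    have op: "simplex_op G s y = (?X, map (\<lambda>x. ?g \<otimes> x) l)" by (simp add: simplex_op_def Xl)
    note m' = mem[OF Y.op_closed[OF s y, unfolded op]]
    \<comment> \<open>Supports and degrees agree by the product law for pairs.\<close>
    have "par_elem G ?X (?g \<otimes> hd l) = s \<otimes>\<^bsub>S\<^esub> par_elem G X (hd l)"
      by (rule par_eqI) (use s par_elem[OF m(1-3,7)] par_elem[OF m'(1-3,7)] m in
          \<open>auto simp: par_support_mult par_degree_mult hd_map\<close>)
    moreover have "basis_vector K (s \<otimes>\<^bsub>S\<^esub> par_elem G X (hd l)) = basis_vector K s \<otimes>\<^bsub>R\<^esub> basis_vector K (par_elem G X (hd l))"
      using Y.basis_mult_basis[OF s par_elem(1)[OF m(1-3,7)]] by simp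
    moreover have "(basis_vector K s \<otimes>\<^bsub>R\<^esub> basis_vector K (par_elem G X (hd l))) \<odot>\<^bsub>?L\<^esub> basis_vector R (root_translate l) =
        basis_vector K s \<odot>\<^bsub>?L\<^esub> (basis_vector K (par_elem G X (hd l)) \<odot>\<^bsub>?L\<^esub> basis_vector R (root_translate l))"
      by (intro L.smult_assoc bR s par_elem m basis_vector_closed[OF ring_R])
    moreover have "hd (map (\<lambda>x. ?g \<otimes> x) l) = ?g \<otimes> hd l" using m by (simp add: hd_map)
    ultimately show ?thesis
      unfolding op unfolding Xl prod.case root_translate_op[OF g m(8,6)] by (simp only:)
  qed
  note i = Y.linear_map_from_perm[OF L.left_module_axioms t equi]
  have pt: "(\<lambda>l. basis_vector K (set l, l)) \<in> rooted n \<rightarrow> carrier ?P"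
  proof
    fix l assume "l \<in> rooted n"
    then have "\<one> \<in> set l" using hd_in_set[of l] by (cases l) (auto simp: rooted_def)
    then have "(set l, l) \<in> simplices G (Suc n)" using \<open>l \<in> rooted n\<close> by (auto simp: rooted_def simplices_def)
    then show "basis_vector K (set l, l) \<in> carrier ?P" using basis_F by simp
  qed
  have i_lin: "linear_map R ?P ?L ?i" using i(1) by (simp only: simplex_module_def)
  have p_lin: "linear_map R ?L ?P ?p" by (rule linear_extension_linear[OF left_module_simplex pt])
  have "?p (?i y) = y" if y: "y \<in> carrier ?P" for y
  proof (rule Y.linear_map_perm_eq[OF left_module_simplex, where f = "\<lambda>y. ?p (?i y)" and g = "\<lambda>y. y"])
    show "linear_map R (perm_module K S (simplices G (Suc n)) (simplex_op G)) ?P (\<lambda>y. ?p (?i y))"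
      using linear_map_comp[OF i_lin p_lin] by (simp only: simplex_module_def)
    show "linear_map R (perm_module K S (simplices G (Suc n)) (simplex_op G)) ?P (\<lambda>y. y)"
      using linear_map_id by (simp only: simplex_module_def)
    fix y assume y: "y \<in> simplices G (Suc n)"
    obtain X l where Xl: "y = (X, l)" by (cases y)
    note m = mem[OF y[unfolded Xl]]
    note r = root_translate[OF m(8,6)]
    have "?p (?i (basis_vector K y)) = ?p (?t y)" using i(2)[OF _ _ y] by simp
    also have "\<dots> = basis_vector K (par_elem G X (hd l)) \<odot>\<^bsub>?P\<^esub> ?p (basis_vector R (root_translate l))"
      unfolding Xl prod.case
      by (rule linear_map_smult[OF p_lin bR basis_vector_closed[OF ring_R m(9)]]) (intro par_elem m)
    also have "?p (basis_vector R (root_translate l)) = basis_vector K (set (root_translate l), root_translate l)"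
      by (rule linear_extension_basis[OF left_module_simplex]) (use funcset_mem[OF pt m(9)] in simp)
    also have "basis_vector K (par_elem G X (hd l)) \<odot>\<^bsub>?P\<^esub> basis_vector K (set (root_translate l), root_translate l) =
        basis_vector K (simplex_op G (par_elem G X (hd l)) (set (root_translate l), root_translate l))"
      unfolding simplex_module_def
      by (rule Y.perm_smult_basis) (use par_elem[OF m(1-3,7)] m r in \<open>auto simp: simplices_def\<close>)
    \<comment> \<open>The vertices are translated back to those of l, and the support becomes the
      union of X and the vertices of l, which is X.\<close>
    also have "simplex_op G (par_elem G X (hd l)) (set (root_translate l), root_translate l) = y"
      using par_elem[OF m(1-3,7)] r(4,5) m(4) by (auto simp: simplex_op_def Xl)
    finally show "?p (?i (basis_vector K y)) = basis_vector K y" .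
  qed (use y in simp)
  with i_lin p_lin left_module_simplex show ?thesis
    unfolding projective_over_def by blast
qed

section \<open>The augmentation onto K E(S(G))\<close>

lemma idempotent_module_eq: "idempotent_module K G = perm_module K S (idempotents S) conj_idem"
  by (simp add: idempotent_module_def perm_module_def rep_module_def perm_rep_def Let_def
      conj_idem_def[abs_def])

lemma set_action_idempotents: "set_action K S (idempotents S) conj_idem"
proof (intro set_action.intro monoid_S set_action_axioms.intro K.is_cring)
  fix s e assume "s \<in> carrier S" "e \<in> idempotents S"
  then show "conj_idem s e \<in> idempotents S" using conj_idem by (simp add: idempotents_iff)
next
  fix e assume e: "e \<in> idempotents S"
  then show "conj_idem \<one>\<^bsub>S\<^esub> e = e"
    by (intro par_eqI) (auto simp: conj_idem idempotents_iff par_support_closed)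
next
  fix s t e assume st: "s \<in> carrier S" "t \<in> carrier S" and e: "e \<in> idempotents S"
  then have te: "conj_idem t e \<in> idempotents S" using conj_idem by (simp add: idempotents_iff)
  show "conj_idem (s \<otimes>\<^bsub>S\<^esub> t) e = conj_idem s (conj_idem t e)"
    by (rule par_eqI)
      (use st e te in \<open>auto simp: conj_idem idempotents_iff par_support_closed par_support_mult par_degree_mult
        translate_Un translate_translate\<close>)
qed

sublocale E: set_action K S "idempotents S" conj_idem
  by (rule set_action_idempotents)

lemma left_module_idempotent: "left_module R (idempotent_module K G)"
  unfolding idempotent_module_eq by (rule E.left_module_perm)

definition idem_elem :: "'g set \<times> 'g list \<Rightarrow> 'g list set" where
  "idem_elem = (\<lambda>(X, l). par_elem G X \<one>)"

definition idem_iso :: "('g set \<times> 'g list \<Rightarrow> 'k) \<Rightarrow> 'g list set \<Rightarrow> 'k" where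
  "idem_iso = linear_extension K (restrict_scalars K S (idempotent_module K G)) (\<lambda>y. basis_vector K (idem_elem y))"

text \<open>An idempotent is determined by its support, so sets X without vertices and idempotents
  correspond bijectively and equivariantly. The two linear extensions are inverse to each other on
  basis vectors.\<close>

lemma idem_iso:
  shows idem_iso_linear: "linear_map R (simplex_module K G 0) (idempotent_module K G) idem_iso"
    and idem_iso_bij: "bij_betw idem_iso (carrier (F 0)) (carrier (idempotent_module K G))"
proof -
  let ?B = "idempotent_module K G"
  have mem: "idem_elem y \<in> idempotents S" "par_support G (idem_elem y) = fst y" if "y \<in> simplices G 0" for y
    using that par_elem[of "fst y" \<one>] by (auto simp: simplices_def idem_elem_def idempotents_iff)
  have t: "(\<lambda>y. basis_vector K (idem_elem y)) \<in> simplices G 0 \<rightarrow> carrier ?B"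
    using mem E.basis_perm by (auto simp: idempotent_module_eq E.perm_module_carrier)
  have equi: "basis_vector K (idem_elem (simplex_op G s y)) = basis_vector K s \<odot>\<^bsub>?B\<^esub> basis_vector K (idem_elem y)"
    if s: "s \<in> carrier S" and y: "y \<in> simplices G 0" for s y
  proof -
    have "idem_elem (simplex_op G s y) = conj_idem s (idem_elem y)"
      by (rule par_eqI)
        (use mem[OF y] mem[OF Y.op_closed[OF s y]] conj_idem[OF s mem(1)[OF y]] in
          \<open>auto simp: idempotents_iff simplex_op_def split: prod.splits\<close>)
    then show ?thesis
      unfolding idempotent_module_eq using E.perm_smult_basis[OF s mem(1)[OF y]] by simp
  qed
  have lin: "linear_map R (perm_module K S (simplices G 0) (simplex_op G)) ?B idem_iso"
    unfolding idem_iso_def by (rule Y.linear_map_from_perm(1)[OF left_module_idempotent t equi])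
  have basis: "idem_iso (basis_vector K y) = basis_vector K (idem_elem y)" if "y \<in> simplices G 0" for y
    unfolding idem_iso_def by (rule Y.linear_map_from_perm(2)[OF left_module_idempotent t equi that])
  let ?j = "linear_extension K (restrict_scalars K S (simplex_module K G 0)) (\<lambda>e. basis_vector K (par_support G e, []))"
  have mem': "(par_support G e, []) \<in> simplices G 0" "e \<in> carrier S" if "e \<in> idempotents S" for e
    using that by (auto simp: simplices_def idempotents_iff par_support_finite dest: par_support_closed)
  have t': "(\<lambda>e. basis_vector K (par_support G e, [])) \<in> idempotents S \<rightarrow> carrier (simplex_module K G 0)"
    using mem' basis_F by auto
  have equi': "basis_vector K (par_support G (conj_idem s e), []) =
      basis_vector K s \<odot>\<^bsub>simplex_module K G 0\<^esub> basis_vector K (par_support G e, [])"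
    if s: "s \<in> carrier S" and e: "e \<in> idempotents S" for s e
    unfolding simplex_module_def using Y.perm_smult_basis[OF s mem'(1)[OF e]] conj_idem[OF s e]
    by (simp add: simplex_op_def)
  have lin': "linear_map R (perm_module K S (idempotents S) conj_idem) (simplex_module K G 0) ?j"
    by (rule E.linear_map_from_perm(1)[OF left_module_simplex t' equi'])
  have basis': "?j (basis_vector K e) = basis_vector K (par_support G e, [])" if "e \<in> idempotents S" for e
    by (rule E.linear_map_from_perm(2)[OF left_module_simplex t' equi' that])
  have ji: "?j (idem_iso y) = y" if "y \<in> carrier (F 0)" for y
  proof (rule Y.linear_map_perm_eq[OF left_module_simplex, where f = "\<lambda>y. ?j (idem_iso y)" and g = "\<lambda>y. y"])
    show "linear_map R (perm_module K S (simplices G 0) (simplex_op G)) (simplex_module K G 0) (\<lambda>y. ?j (idem_iso y))"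
      using linear_map_comp[OF lin[unfolded idempotent_module_eq] lin'] .
    show "linear_map R (perm_module K S (simplices G 0) (simplex_op G)) (simplex_module K G 0) (\<lambda>y. y)"
      using linear_map_id by (simp only: simplex_module_def)
    show "?j (idem_iso (basis_vector K y)) = basis_vector K y" if y: "y \<in> simplices G 0" for y
    proof -
      have "(par_support G (idem_elem y), []) = y" using mem(2)[OF y] y by (auto simp: simplices_def)
      then show ?thesis using basis[OF y] basis'[OF mem(1)[OF y]] by simp
    qed
  qed (use that in simp)
  have ij: "idem_iso (?j y) = y" if "y \<in> carrier (free_module K (idempotents S))" for y
  proof (rule E.linear_map_perm_eq[OF left_module_idempotent, where f = "\<lambda>y. idem_iso (?j y)" and g = "\<lambda>y. y"])
    show "linear_map R (perm_module K S (idempotents S) conj_idem) ?B (\<lambda>y. idem_iso (?j y))"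
      using linear_map_comp[OF lin'[unfolded simplex_module_def[of K G 0]] lin]
      by (simp only: simplex_module_def[of K G 0])
    show "linear_map R (perm_module K S (idempotents S) conj_idem) ?B (\<lambda>y. y)"
      using linear_map_id by (simp only: idempotent_module_eq)
    show "idem_iso (?j (basis_vector K e)) = basis_vector K e" if e: "e \<in> idempotents S" for e
    proof -
      have "idem_elem (par_support G e, []) = e"
        using par_elem_eq[of e] e by (simp add: idem_elem_def idempotents_iff)
      then show ?thesis using basis'[OF e] basis[OF mem'(1)[OF e]] by simp
    qed
  qed (use that in simp)
  show "linear_map R (simplex_module K G 0) ?B idem_iso" using lin by (simp only: simplex_module_def)
  show "bij_betw idem_iso (carrier (F 0)) (carrier ?B)"
  proof (rule bij_betwI[where g = ?j])
    show "idem_iso \<in> carrier (F 0) \<rightarrow> carrier ?B" "?j \<in> carrier ?B \<rightarrow> carrier (F 0)"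
      using linear_map_closed[OF lin] linear_map_closed[OF lin']
      by (auto simp: Y.perm_module_carrier idempotent_module_eq)
  qed (use ji ij in \<open>auto simp: idempotent_module_eq E.perm_module_carrier\<close>)
qed

text \<open>The simplicial complex is shifted by one: its last term, the one without vertices, is
  replaced by K E(S(G)) through \<open>idem_iso\<close>, and the remaining terms are
  projective.\<close>

theorem simplex_resolution:
  "projective_resolution R (idempotent_module K G) (\<lambda>n. simplex_module K G (Suc n))
     (\<lambda>n. simplex_diff K G (Suc n)) (\<lambda>y. idem_iso (simplex_diff K G 0 y)) rooted"
proof (intro projective_resolution.intro left_module_idempotent projective_resolution_axioms.intro)
  fix n
  show "projective_over R (rooted n) (simplex_module K G (Suc n))" by (rule projective_simplex)
  show "linear_map R (simplex_module K G (Suc (Suc n))) (simplex_module K G (Suc n)) (simplex_diff K G (Suc n))"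
    by (rule simplex_diff_linear)
  show "simplex_diff K G (Suc (Suc n)) ` carrier (simplex_module K G (Suc (Suc (Suc n)))) =
      {y \<in> carrier (simplex_module K G (Suc (Suc n))). simplex_diff K G (Suc n) y = \<zero>\<^bsub>simplex_module K G (Suc n)\<^esub>}"
    using simplex_exact[of "Suc n"] by simp
next
  show "linear_map R (simplex_module K G (Suc 0)) (idempotent_module K G) (\<lambda>y. idem_iso (simplex_diff K G 0 y))"
    by (rule linear_map_comp[OF simplex_diff_linear idem_iso_linear])
  have "simplex_diff K G 0 ` carrier (F (Suc 0)) = carrier (F 0)"
    using contraction_0 linear_map_closed[OF simplex_diff_linear_K] linear_map_closed[OF contraction_linear]
    by (intro equalityI subsetI) (auto, metis image_eqI)
  then show "(\<lambda>y. idem_iso (simplex_diff K G 0 y)) ` carrier (simplex_module K G (Suc 0)) = carrier (idempotent_module K G)"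
    using idem_iso_bij by (simp add: bij_betw_def flip: image_image)
  have zero: "idem_iso \<zero>\<^bsub>F 0\<^esub> = \<zero>\<^bsub>idempotent_module K G\<^esub>"
    using left_module.linear_map_zero[OF left_module_idempotent _ idem_iso_linear] left_module.axioms(2)[OF left_module_simplex]
    by simp
  \<comment> \<open>\<open>idem_iso\<close> is injective, so the augmentation has the same kernel as
    the simplicial differential.\<close>
  have "idem_iso (simplex_diff K G 0 y) = \<zero>\<^bsub>idempotent_module K G\<^esub> \<longleftrightarrow> simplex_diff K G 0 y = \<zero>\<^bsub>F 0\<^esub>"
    if "y \<in> carrier (F (Suc 0))" for y
    using idem_iso_bij zero linear_map_closed[OF simplex_diff_linear_K that] Y.V.M.zero_closed[of 0]
    by (metis bij_betw_imp_inj_on inj_on_eq_iff)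
  then show "simplex_diff K G (Suc 0) ` carrier (simplex_module K G (Suc (Suc 0))) =
      {y \<in> carrier (simplex_module K G (Suc 0)). idem_iso (simplex_diff K G 0 y) = \<zero>\<^bsub>idempotent_module K G\<^esub>}"
    using simplex_exact[of 0] by auto
qed

corollary partial_cohomology_iso:
  assumes "left_module R N"
  shows "partial_cohomology K G n N \<cong>
    cohomology (\<lambda>i. hom_group R (simplex_module K G (Suc i)) N)
      (\<lambda>i f. \<lambda>x\<in>carrier (simplex_module K G (Suc (Suc i))). f (simplex_diff K G (Suc i) x)) n"
  unfolding partial_cohomology_def K_par_def
  by (rule Ext_iso_projective_resolution[OF simplex_resolution assms])

end

section \<open>Group cochains in pointwise coordinates\<close>

text \<open>The passage from homogeneous to inhomogeneous coordinates: (g0, ..., gn) becomes the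
  list of the products g_i^-1 g_(i+1). \<open>path\<close> is its inverse once the first vertex is
  given.\<close>

fun differences :: "'g monoid \<Rightarrow> 'g list \<Rightarrow> 'g list" where
  "differences G (a # b # l) = (inv\<^bsub>G\<^esub> a \<otimes>\<^bsub>G\<^esub> b) # differences G (b # l)"
| "differences G l = []"

primrec path :: "'g monoid \<Rightarrow> 'g \<Rightarrow> 'g list \<Rightarrow> 'g list" where
  "path G g [] = [g]"
| "path G g (h # l) = g # path G (g \<otimes>\<^bsub>G\<^esub> h) l"

definition vertices :: "'g monoid \<Rightarrow> nat \<Rightarrow> 'g list set" where
  "vertices G n = {l. set l \<subseteq> carrier G \<and> length l = n}"

lemma tuples_vertices: "tuples G n = vertices G n"
  by (auto simp: tuples_def vertices_def)

lemma length_differences: "length (differences G l) = length l - 1"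
  by (induction l rule: differences.induct) auto

lemma length_path [simp]: "length (path G g l) = Suc (length l)"
  by (induction l arbitrary: g) auto

lemma hd_path [simp]: "hd (path G g l) = g"
  by (cases l) auto

lemma differences_butlast: "differences G (butlast l) = butlast (differences G l)"
proof (induction l rule: differences.induct)
  case (1 G a b l)
  then show ?case by (cases l) auto
qed auto

lemma differences_tl: "differences G (tl l) = tl (differences G l)"
proof (cases l)
  case (Cons a m)
  then show ?thesis by (cases m) auto
qed simp

lemma merge_Suc: "merge G (Suc i) (a # l) = a # merge G i l"
  by (simp add: merge_def)

context word_group
begin

lemma differences_closed: "set l \<subseteq> carrier G \<Longrightarrow> set (differences G l) \<subseteq> carrier G"
proof (induction l)
  case (Cons a l)
  then show ?case by (cases l) auto
qed simp

lemma differences_vertices: "l \<in> vertices G (Suc n) \<Longrightarrow> differences G l \<in> vertices G n"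
  by (auto simp: vertices_def length_differences dest: differences_closed)

lemma path_closed: "\<lbrakk>g \<in> carrier G; set l \<subseteq> carrier G\<rbrakk> \<Longrightarrow> set (path G g l) \<subseteq> carrier G"
  by (induction l arbitrary: g) auto

lemma path_vertices: "\<lbrakk>g \<in> carrier G; l \<in> vertices G n\<rbrakk> \<Longrightarrow> path G g l \<in> vertices G (Suc n)"
  using path_closed by (auto simp: vertices_def)

lemma differences_path: "\<lbrakk>g \<in> carrier G; set l \<subseteq> carrier G\<rbrakk> \<Longrightarrow> differences G (path G g l) = l"
proof (induction l arbitrary: g)
  case (Cons h l)
  then obtain m where "path G (g \<otimes> h) l = (g \<otimes> h) # m" by (cases l) auto
  moreover have "inv g \<otimes> (g \<otimes> h) = h" using Cons by (simp flip: m_assoc)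
  ultimately show ?case using Cons.IH[of "g \<otimes> h"] Cons.prems by auto
qed simp

lemma path_differences: "\<lbrakk>set l \<subseteq> carrier G; l \<noteq> []\<rbrakk> \<Longrightarrow> path G (hd l) (differences G l) = l"
proof (induction l)
  case (Cons a l)
  show ?case
  proof (cases l)
    case (Cons b m)
    then have "a \<otimes> (inv a \<otimes> b) = b" using Cons.prems by (simp flip: m_assoc)
    with Cons Cons.IH Cons.prems show ?thesis by simp
  qed simp
qed simp

lemma path_mult: "\<lbrakk>g \<in> carrier G; h \<in> carrier G; set l \<subseteq> carrier G\<rbrakk> \<Longrightarrow> path G (h \<otimes> g) l = map (\<lambda>x. h \<otimes> x) (path G g l)"
  by (induction l arbitrary: g) (auto simp: m_assoc)

lemma differences_mult:
  "\<lbrakk>h \<in> carrier G; set l \<subseteq> carrier G\<rbrakk> \<Longrightarrow> differences G (map (\<lambda>x. h \<otimes> x) l) = differences G l"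
proof (induction l)
  case (Cons a l)
  show ?case
  proof (cases l)
    case (Cons b m)
    have "inv (h \<otimes> a) \<otimes> (h \<otimes> b) = inv a \<otimes> b"
      using Cons Cons.prems by (simp add: inv_mult_group m_assoc) (simp flip: m_assoc)
    with Cons Cons.IH Cons.prems show ?thesis by simp
  qed simp
qed simp

text \<open>Deleting an inner vertex b between a and c multiplies the two differences that meet
  there: (a^-1 b)(b^-1 c) = a^-1 c. Deleting an end vertex drops a difference, as in
  \<open>differences_tl\<close> and \<open>differences_butlast\<close>.\<close>

lemma differences_delete:
  assumes "set l \<subseteq> carrier G" "Suc (Suc i) < length l"
  shows "differences G (take (Suc i) l @ drop (Suc (Suc i)) l) = merge G i (differences G l)"
  using assms
proof (induction i arbitrary: l)
  case 0
  then obtain a b c m where l: "l = a # b # c # m"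
    by (cases l; cases "tl l"; cases "tl (tl l)") auto
  have "b \<otimes> (inv b \<otimes> c) = c" using 0 l by (simp flip: m_assoc)
  then have "inv a \<otimes> b \<otimes> (inv b \<otimes> c) = inv a \<otimes> c" using 0 l by (simp add: m_assoc)
  with 0 l show ?case by (simp add: merge_def)
next
  case (Suc i)
  then obtain a b m where l: "l = a # b # m"
    by (cases l; cases "tl l") auto
  have "differences G (take (Suc i) (b # m) @ drop (Suc (Suc i)) (b # m)) = merge G i (differences G (b # m))"
    using Suc l by (intro Suc.IH) auto
  with l show ?case by (simp add: merge_Suc)
qed

end

text \<open>\<open>pA a x\<close> and \<open>pM m x\<close> are the components of \<open>a\<close> and \<open>m\<close> at \<open>x\<close>, with values in \<open>V x\<close>; those of \<open>a\<close> are
  meaningful only if \<open>\<one> \<in> star x\<close>.\<close>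

locale point_coordinates = partial_group_ring G K + B: abelian_group B + A: monoid_rep K "par_monoid G" A \<rho> +
    M: abelian_group M
  for G :: "'g monoid" (structure) and K :: "'k ring" and B :: "('b, 'x) ring_scheme"
    and A :: "('k, 'a) module" and \<rho> :: "'g list set \<Rightarrow> 'a \<Rightarrow> 'a" and M :: "('m, 'y) ring_scheme" +
  fixes points :: "'p set" and V :: "'p \<Rightarrow> 'b set" and \<tau> :: "'g \<Rightarrow> 'p \<Rightarrow> 'p" and \<beta> :: "'g \<Rightarrow> 'b \<Rightarrow> 'b"
    and star :: "'p \<Rightarrow> 'g set" and pA :: "'a \<Rightarrow> 'p \<Rightarrow> 'b" and act :: "'g \<Rightarrow> 'm \<Rightarrow> 'm" and pM :: "'m \<Rightarrow> 'p \<Rightarrow> 'b"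
  assumes V_closed: "x \<in> points \<Longrightarrow> V x \<subseteq> carrier B"
    and V_zero: "x \<in> points \<Longrightarrow> \<zero>\<^bsub>B\<^esub> \<in> V x"
    and V_minus: "\<lbrakk>x \<in> points; v \<in> V x; v' \<in> V x\<rbrakk> \<Longrightarrow> v \<ominus>\<^bsub>B\<^esub> v' \<in> V x"
    and \<tau>_closed: "\<lbrakk>g \<in> carrier G; x \<in> points\<rbrakk> \<Longrightarrow> \<tau> g x \<in> points"
    and \<tau>_one: "x \<in> points \<Longrightarrow> \<tau> \<one> x = x"
    and \<tau>_mult: "\<lbrakk>g \<in> carrier G; h \<in> carrier G; x \<in> points\<rbrakk> \<Longrightarrow> \<tau> (g \<otimes> h) x = \<tau> g (\<tau> h x)"
    and \<beta>_additive: "g \<in> carrier G \<Longrightarrow> additive_map B B (\<beta> g)"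
    and \<beta>_one: "v \<in> carrier B \<Longrightarrow> \<beta> \<one> v = v"
    and \<beta>_mult: "\<lbrakk>g \<in> carrier G; h \<in> carrier G; v \<in> carrier B\<rbrakk> \<Longrightarrow> \<beta> (g \<otimes> h) v = \<beta> g (\<beta> h v)"
    and \<beta>_V: "\<lbrakk>g \<in> carrier G; x \<in> points; v \<in> V x\<rbrakk> \<Longrightarrow> \<beta> g v \<in> V (\<tau> g x)"
    and star_closed: "x \<in> points \<Longrightarrow> star x \<subseteq> carrier G"
    and star_nonempty: "x \<in> points \<Longrightarrow> star x \<noteq> {}"
    and star_mult: "\<lbrakk>g \<in> carrier G; h \<in> carrier G; x \<in> points\<rbrakk> \<Longrightarrow> h \<otimes> g \<in> star (\<tau> h x) \<longleftrightarrow> g \<in> star x"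
    and pA_V: "\<lbrakk>a \<in> carrier A; x \<in> points; \<one> \<in> star x\<rbrakk> \<Longrightarrow> pA a x \<in> V x"
    and pA_add: "\<lbrakk>a \<in> carrier A; b \<in> carrier A; x \<in> points; \<one> \<in> star x\<rbrakk> \<Longrightarrow>
      pA (a \<oplus>\<^bsub>A\<^esub> b) x = pA a x \<oplus>\<^bsub>B\<^esub> pA b x"
    and pA_inj: "\<lbrakk>a \<in> carrier A; b \<in> carrier A; \<And>x. x \<in> points \<Longrightarrow> \<one> \<in> star x \<Longrightarrow> pA a x = pA b x\<rbrakk> \<Longrightarrow> a = b"
    and pA_surj: "(\<And>x. x \<in> points \<Longrightarrow> \<one> \<in> star x \<Longrightarrow> f x \<in> V x) \<Longrightarrow>
      \<exists>a\<in>carrier A. \<forall>x\<in>points. \<one> \<in> star x \<longrightarrow> pA a x = f x"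
    and pA_rep: "\<lbrakk>s \<in> carrier (par_monoid G); a \<in> carrier A; x \<in> points; \<one> \<in> star x\<rbrakk> \<Longrightarrow>
      pA (\<rho> s a) x = (if par_support G s \<subseteq> star x
        then \<beta> (par_degree G s) (pA a (\<tau> (inv par_degree G s) x)) else \<zero>\<^bsub>B\<^esub>)"
    and act_additive: "g \<in> carrier G \<Longrightarrow> additive_map M M (act g)"
    and pM_V: "\<lbrakk>m \<in> carrier M; x \<in> points\<rbrakk> \<Longrightarrow> pM m x \<in> V x"
    and pM_add: "\<lbrakk>m \<in> carrier M; m' \<in> carrier M; x \<in> points\<rbrakk> \<Longrightarrow> pM (m \<oplus>\<^bsub>M\<^esub> m') x = pM m x \<oplus>\<^bsub>B\<^esub> pM m' x"
    and pM_inj: "\<lbrakk>m \<in> carrier M; m' \<in> carrier M; \<And>x. x \<in> points \<Longrightarrow> pM m x = pM m' x\<rbrakk> \<Longrightarrow> m = m'"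
    and pM_surj: "(\<And>x. x \<in> points \<Longrightarrow> f x \<in> V x) \<Longrightarrow> \<exists>m\<in>carrier M. \<forall>x\<in>points. pM m x = f x"
    and pM_act: "\<lbrakk>g \<in> carrier G; m \<in> carrier M; x \<in> points\<rbrakk> \<Longrightarrow> pM (act g m) x = \<beta> g (pM m (\<tau> (inv g) x))"
begin

lemma \<beta>_closed: "\<lbrakk>g \<in> carrier G; b \<in> carrier B\<rbrakk> \<Longrightarrow> \<beta> g b \<in> carrier B"
  by (rule additive_map_closed[OF \<beta>_additive])

lemma V_carrier: "\<lbrakk>x \<in> points; b \<in> V x\<rbrakk> \<Longrightarrow> b \<in> carrier B"
  using V_closed by blast

lemma pM_carrier: "\<lbrakk>m \<in> carrier M; x \<in> points\<rbrakk> \<Longrightarrow> pM m x \<in> carrier B"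
  by (rule V_carrier[OF _ pM_V])

lemma pM_additive: "x \<in> points \<Longrightarrow> additive_map M B (\<lambda>m. pM m x)"
  by (rule additive_mapI) (auto simp: pM_carrier pM_add)

lemma \<tau>_inv: "\<lbrakk>g \<in> carrier G; x \<in> points\<rbrakk> \<Longrightarrow> \<tau> (inv g) (\<tau> g x) = x" "\<lbrakk>g \<in> carrier G; x \<in> points\<rbrakk> \<Longrightarrow> \<tau> g (\<tau> (inv g) x) = x"
  using \<tau>_mult[of "inv g" g x] \<tau>_mult[of g "inv g" x] \<tau>_one by auto

lemma star_one: "\<lbrakk>g \<in> carrier G; x \<in> points\<rbrakk> \<Longrightarrow> \<one> \<in> star (\<tau> (inv g) x) \<longleftrightarrow> g \<in> star x"
  using star_mult[of g "inv g" x] by simp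

lemma star_translate:
  assumes "g \<in> carrier G" "x \<in> points" "X \<subseteq> carrier G"
  shows "translate G g X \<subseteq> star x \<longleftrightarrow> X \<subseteq> star (\<tau> (inv g) x)"
proof -
  have "g \<otimes> h \<in> star x \<longleftrightarrow> h \<in> star (\<tau> (inv g) x)" if "h \<in> carrier G" for h
    using star_mult[of h g "\<tau> (inv g) x"] \<tau>_inv(2) \<tau>_closed assms that by simp
  then show ?thesis using assms(3) by (auto simp: translate_def)
qed

lemma V_eval_chain:
  assumes "x \<in> points" "w \<in> Poly_Mapping.keys c \<rightarrow> V x"
  shows "eval_chain B w c \<in> V x"
proof -
  \<comment> \<open>Extended by zero, w takes all its values in \<open>V x\<close>, so the induction
    over chains has no supports to keep track of.\<close>
  define w' where "w' = (\<lambda>l. if l \<in> Poly_Mapping.keys c then w l else \<zero>\<^bsub>B\<^esub>)"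
  have w': "w' l \<in> V x" "w' l \<in> carrier B" for l
    using V_carrier[OF assms(1)] funcset_mem[OF assms(2)] V_zero[OF assms(1)] by (auto simp: w'_def)
  have "eval_chain B w' c \<in> V x"
    using subset_UNIV
  proof (induction c rule: frag_induction)
    case (diff a b)
    then show ?case using B.eval_chain_diff[of w' a b] w'(2) V_minus[OF assms(1)] by auto
  qed (use V_zero assms w' in \<open>auto simp: B.eval_chain_of\<close>)
  moreover have "eval_chain B w' c = eval_chain B w c"
    by (rule B.eval_chain_cong) (use V_carrier[OF assms(1) funcset_mem[OF assms(2)]] in \<open>auto simp: w'_def\<close>)
  ultimately show ?thesis by simp
qed

text \<open>Passes from inhomogeneous to homogeneous cochains, one point at a time.\<close>

definition hom_val :: "('g list \<Rightarrow> 'm) \<Rightarrow> 'g list \<Rightarrow> 'p \<Rightarrow> 'b" where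
  "hom_val w l x = \<beta> (hd l) (pM (w (differences G l)) (\<tau> (inv hd l) x))"

abbreviation "C \<equiv> cochain_group G M"
abbreviation "\<delta> \<equiv> coboundary G M act"

lemma C_carrier: "w \<in> carrier (C n) \<longleftrightarrow> w \<in> vertices G n \<rightarrow>\<^sub>E carrier M"
  by (simp add: cochain_group_def tuples_vertices)

lemma C_closed: "\<lbrakk>w \<in> carrier (C n); l \<in> vertices G n\<rbrakk> \<Longrightarrow> w l \<in> carrier M"
  by (auto simp: C_carrier)

lemma vertices_hd: "l \<in> vertices G (Suc n) \<Longrightarrow> hd l \<in> carrier G"
  by (cases l) (auto simp: vertices_def)

lemma vertices_map: "\<lbrakk>g \<in> carrier G; l \<in> vertices G n\<rbrakk> \<Longrightarrow> map (\<lambda>x. g \<otimes> x) l \<in> vertices G n"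
  by (auto simp: vertices_def)

lemma hom_val_V: "\<lbrakk>w \<in> carrier (C n); l \<in> vertices G (Suc n); x \<in> points\<rbrakk> \<Longrightarrow> hom_val w l x \<in> V x"
  unfolding hom_val_def
  using \<beta>_V[of "hd l" "\<tau> (inv hd l) x" "pM (w (differences G l)) (\<tau> (inv hd l) x)"] pM_V C_closed
    differences_vertices[of l n] \<tau>_closed \<tau>_inv(2) vertices_hd by simp

lemma hom_val_closed: "\<lbrakk>w \<in> carrier (C n); l \<in> vertices G (Suc n); x \<in> points\<rbrakk> \<Longrightarrow> hom_val w l x \<in> carrier B"
  by (rule V_carrier[OF _ hom_val_V])

lemma hom_val_path:
  assumes "w \<in> carrier (C n)" "l \<in> vertices G n" "x \<in> points"
  shows "hom_val w (path G \<one> l) x = pM (w l) x"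
  using assms differences_path[of \<one> l] \<beta>_one[OF pM_carrier[OF C_closed]] \<tau>_one
  by (simp add: hom_val_def vertices_def)

text \<open>Left translation does not change the differences, and the point at which w is evaluated
  is the same on both sides; only the factor \<open>\<beta> g\<close> remains.\<close>

lemma hom_val_mult:
  assumes w: "w \<in> carrier (C n)" and l: "l \<in> vertices G (Suc n)" and g: "g \<in> carrier G" and x: "x \<in> points"
  shows "hom_val w (map (\<lambda>y. g \<otimes> y) l) (\<tau> g x) = \<beta> g (hom_val w l x)"
proof -
  have hd: "hd l \<in> carrier G" "hd (map (\<lambda>y. g \<otimes> y) l) = g \<otimes> hd l"
    using vertices_hd[OF l] l by (cases l; auto simp: vertices_def)+
  have "\<tau> (inv (g \<otimes> hd l)) (\<tau> g x) = \<tau> (inv hd l) x"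
    using hd g x \<tau>_mult[of "inv hd l" "inv g" "\<tau> g x"] \<tau>_inv \<tau>_closed by (simp add: inv_mult_group)
  moreover have "pM (w (differences G l)) (\<tau> (inv hd l) x) \<in> carrier B"
    using pM_carrier C_closed[OF w differences_vertices[OF l]] \<tau>_closed hd x by simp
  moreover have "differences G (map (\<lambda>y. g \<otimes> y) l) = differences G l"
    using l g by (intro differences_mult) (auto simp: vertices_def)
  ultimately show ?thesis
    unfolding hom_val_def hd(2) using g hd(1) by (simp add: \<beta>_mult)
qed

text \<open>The inhomogeneous value at l reappears as the homogeneous value along the path that
  starts at 1 with differences l.\<close>

lemma hom_val_eqI:
  assumes "w \<in> carrier (C n)" "w' \<in> carrier (C n)"
    and "\<And>l x. l \<in> vertices G (Suc n) \<Longrightarrow> x \<in> points \<Longrightarrow> hom_val w l x = hom_val w' l x"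
  shows "w = w'"
proof (rule extensionalityI[of _ "vertices G n"])
  show "w l = w' l" if l: "l \<in> vertices G n" for l
  proof (rule pM_inj)
    show "pM (w l) x = pM (w' l) x" if "x \<in> points" for x
      using hom_val_path[OF assms(1) l that] hom_val_path[OF assms(2) l that]
        assms(3)[OF path_vertices[OF one_closed l] that] by simp
  qed (use assms l C_closed in auto)
qed (use assms in \<open>auto simp: C_carrier PiE_def\<close>)

text \<open>The values at tuples starting with 1 are glued over all points to elements of M;
  equivariance then fixes the values at all other tuples. Homogeneous families satisfying
  \<open>V\<close> and \<open>mult\<close> are thus the same as cochains.\<close>

lemma ex_cochain:
  assumes V: "\<And>l x. l \<in> vertices G (Suc n) \<Longrightarrow> x \<in> points \<Longrightarrow> W l x \<in> V x"
    and mult: "\<And>g l x. g \<in> carrier G \<Longrightarrow> l \<in> vertices G (Suc n) \<Longrightarrow> x \<in> points \<Longrightarrow>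
      W (map (\<lambda>y. g \<otimes> y) l) (\<tau> g x) = \<beta> g (W l x)"
  obtains w where "w \<in> carrier (C n)"
    "\<And>l x. l \<in> vertices G (Suc n) \<Longrightarrow> x \<in> points \<Longrightarrow> hom_val w l x = W l x"
proof -
  have "\<exists>m\<in>carrier M. \<forall>x\<in>points. pM m x = W (path G \<one> l) x" if "l \<in> vertices G n" for l
    using V[OF path_vertices[OF one_closed that]] by (intro pM_surj)
  then obtain w where w: "\<And>l. l \<in> vertices G n \<Longrightarrow> w l \<in> carrier M \<and> (\<forall>x\<in>points. pM (w l) x = W (path G \<one> l) x)"
    by metis
  let ?w = "restrict w (vertices G n)"
  have "?w \<in> carrier (C n)" using w by (auto simp: C_carrier)
  moreover have "hom_val ?w l x = W l x" if l: "l \<in> vertices G (Suc n)" and x: "x \<in> points" for l x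
  proof -
    note hd = vertices_hd[OF l] and d = differences_vertices[OF l]
    have x': "\<tau> (inv hd l) x \<in> points" using \<tau>_closed hd x by simp
    have "hom_val ?w l x = \<beta> (hd l) (W (path G \<one> (differences G l)) (\<tau> (inv hd l) x))"
      using w[OF d] d x' by (simp add: hom_val_def)
    also have "\<dots> = W (map (\<lambda>y. hd l \<otimes> y) (path G \<one> (differences G l))) (\<tau> (hd l) (\<tau> (inv hd l) x))"
      using mult[OF hd path_vertices[OF one_closed d] x'] by simp
    also have "map (\<lambda>y. hd l \<otimes> y) (path G \<one> (differences G l)) = path G (hd l) (differences G l)"
      using path_mult[of \<one> "hd l" "differences G l"] hd d by (simp add: vertices_def)
    also have "\<dots> = l" using l by (intro path_differences) (auto simp: vertices_def)
    finally show ?thesis unfolding \<tau>_inv(2)[OF hd x] .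
  qed
  ultimately show ?thesis using that by blast
qed

end

text \<open>The inhomogeneous coboundary treats the first and the last summand separately; here the
  uniform boundary sum is split accordingly.\<close>

lemma (in abelian_monoid) finsum_lessThan_ends:
  assumes "\<And>i. i < Suc (Suc n) \<Longrightarrow> f i \<in> carrier G"
  shows "(\<Oplus>i\<in>{..<Suc (Suc n)}. f i) = f 0 \<oplus> (\<Oplus>i\<in>{..<n}. f (Suc i)) \<oplus> f (Suc n)"
proof -
  have "{..<Suc (Suc n)} = insert (Suc n) (insert 0 (Suc ` {..<n}))"
    by (simp only: lessThan_Suc[of "Suc n"] lessThan_Suc_eq_insert_0[of n])
  moreover have "(\<Oplus>i\<in>insert (Suc n) (insert 0 (Suc ` {..<n})). f i) = f (Suc n) \<oplus> (f 0 \<oplus> (\<Oplus>i\<in>Suc ` {..<n}. f i))"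
    using assms by (subst finsum_insert; (subst finsum_insert)?) auto
  moreover have "(\<Oplus>i\<in>Suc ` {..<n}. f i) = (\<Oplus>i\<in>{..<n}. f (Suc i))"
    by (rule finsum_reindex) (use assms in auto)
  moreover have "(\<Oplus>i\<in>{..<n}. f (Suc i)) \<in> carrier G" using assms by (intro finsum_closed) auto
  ultimately show ?thesis using assms[of 0] assms[of "Suc n"] by (simp add: a_ac)
qed

context point_coordinates
begin

lemma merge_vertices: "\<lbrakk>l \<in> vertices G (Suc n); i < n\<rbrakk> \<Longrightarrow> merge G i l \<in> vertices G n"
  using set_take_subset[of i l] set_drop_subset[of "i + 2" l] nth_mem[of i l] nth_mem[of "Suc i" l]
  by (auto simp: vertices_def merge_def subset_iff)

lemma coboundary_terms:
  assumes w: "w \<in> carrier (C n)" and l: "l \<in> vertices G (Suc n)"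
  shows "act (hd l) (w (tl l)) \<in> carrier M"
    "(\<Oplus>\<^bsub>M\<^esub>i\<in>{..<n}. [((-1::int) ^ Suc i)] \<cdot>\<^bsub>M\<^esub> w (merge G i l)) \<in> carrier M"
    "[((-1::int) ^ Suc n)] \<cdot>\<^bsub>M\<^esub> w (butlast l) \<in> carrier M"
    "\<delta> n w l \<in> carrier M"
proof -
  have tl: "tl l \<in> vertices G n" using l by (cases l) (auto simp: vertices_def)
  show 1: "act (hd l) (w (tl l)) \<in> carrier M"
    by (rule additive_map_closed[OF act_additive[OF vertices_hd[OF l]] C_closed[OF w tl]])
  show 2: "(\<Oplus>\<^bsub>M\<^esub>i\<in>{..<n}. [((-1::int) ^ Suc i)] \<cdot>\<^bsub>M\<^esub> w (merge G i l)) \<in> carrier M"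
    by (intro M.finsum_closed Pi_I M.int_mult_closed C_closed[OF w] merge_vertices[OF l]) simp
  have "butlast l \<in> vertices G n" using l by (auto simp: vertices_def dest: in_set_butlastD)
  then show 3: "[((-1::int) ^ Suc n)] \<cdot>\<^bsub>M\<^esub> w (butlast l) \<in> carrier M"
    by (intro M.int_mult_closed C_closed[OF w])
  show "\<delta> n w l \<in> carrier M"
    using l 1 2 3 by (simp add: coboundary_def tuples_vertices)
qed

lemma coboundary_closed: "w \<in> carrier (C n) \<Longrightarrow> \<delta> n w \<in> carrier (C (Suc n))"
  using coboundary_terms(4) by (auto simp: C_carrier coboundary_def tuples_vertices)

lemma delete_vertices:
  assumes "l \<in> vertices G (Suc n)" "i < Suc n" shows "take i l @ drop (Suc i) l \<in> vertices G n"
  using assms set_take_subset[of i l] set_drop_subset[of "Suc i" l] by (auto simp: vertices_def)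

lemma boundary_vertices: "\<lbrakk>l \<in> vertices G (Suc n); m \<in> Poly_Mapping.keys (simplex_boundary l)\<rbrakk> \<Longrightarrow> m \<in> vertices G n"
  by (auto simp: vertices_def dest!: keys_simplex_boundary)

text \<open>In homogeneous form the coboundary is evaluation on the simplicial boundary: the term
  with the action corresponds to deleting the first vertex, the merged terms to the inner vertices,
  the final term to the last one.\<close>

lemma hom_val_coboundary:
  assumes w: "w \<in> carrier (C n)" and l: "l \<in> vertices G (Suc (Suc n))" and x: "x \<in> points"
  shows "hom_val (\<delta> n w) l x = eval_chain B (\<lambda>m. hom_val w m x) (simplex_boundary l)"
proof -
  define g where "g = hd l"
  define y where "y = \<tau> (inv g) x"
  define d where "d = differences G l"
  have g: "g \<in> carrier G" unfolding g_def by (rule vertices_hd[OF l])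
  have y: "y \<in> points" unfolding y_def using g x \<tau>_closed by simp
  have d: "d \<in> vertices G (Suc n)" unfolding d_def by (rule differences_vertices[OF l])
  obtain b l' where ll: "l = g # b # l'" and b: "b \<in> carrier G"
    using l by (cases l; cases "tl l") (auto simp: vertices_def g_def)
  have bl: "butlast d \<in> vertices G n" and tld: "tl d \<in> vertices G n"
    using d by (cases d, auto simp: vertices_def dest: in_set_butlastD)+
  let ?f = "\<lambda>m. \<beta> g (pM m y)"
  have add: "additive_map M B ?f"
    by (rule additive_map_comp[OF pM_additive[OF y] \<beta>_additive[OF g]])
  note ab = M.abelian_group_axioms B.abelian_group_axioms
  let ?del = "\<lambda>i. take i l @ drop (Suc i) l"
  have del: "hom_val w (?del i) x \<in> carrier B" if "i < Suc (Suc n)" for i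
    by (rule hom_val_closed[OF w delete_vertices[OF l that] x])
  have "hom_val (\<delta> n w) l x = ?f (\<delta> n w d)"
    by (simp add: hom_val_def g_def y_def d_def)
  also have "\<dots> = ?f (act (hd d) (w (tl d)))
      \<oplus>\<^bsub>B\<^esub> ?f (\<Oplus>\<^bsub>M\<^esub>i\<in>{..<n}. [((-1::int) ^ Suc i)] \<cdot>\<^bsub>M\<^esub> w (merge G i d))
      \<oplus>\<^bsub>B\<^esub> ?f ([((-1::int) ^ Suc n)] \<cdot>\<^bsub>M\<^esub> w (butlast d))"
    using d coboundary_terms[OF w d]
    by (simp add: coboundary_def tuples_vertices additive_map_add[OF add])
  \<comment> \<open>The action by \<open>inv g \<otimes> b\<close> followed by
    \<open>\<beta> g\<close> amounts to \<open>\<beta> b\<close>, and the base point moves to that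
    of b: b is the first vertex once g is deleted.\<close>
  also have "?f (act (hd d) (w (tl d))) = [((-1::int) ^ 0)] \<cdot>\<^bsub>B\<^esub> hom_val w (?del 0) x"
  proof -
    have hdd: "hd d = inv g \<otimes> b" "?del 0 = b # l'" by (simp_all add: d_def ll)
    have "tl d = differences G (b # l')" using differences_tl[of G l] by (simp add: d_def ll)
    then have "pM (act (hd d) (w (tl d))) y = \<beta> (inv g \<otimes> b) (pM (w (differences G (b # l'))) (\<tau> (inv (inv g \<otimes> b)) y))"
      using pM_act[of "inv g \<otimes> b" "w (tl d)" y] g b y C_closed[OF w tld] by (simp add: hdd)
    moreover have "\<tau> (inv (inv g \<otimes> b)) y = \<tau> (inv b) x"
      using g b x \<tau>_mult[of "inv b" g y] y \<tau>_inv(2)[OF g x] by (simp add: inv_mult_group y_def)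
    moreover have "pM (w (differences G (b # l'))) (\<tau> (inv b) x) \<in> carrier B"
      using pM_carrier C_closed[OF w tld] \<open>tl d = _\<close> \<tau>_closed b x by simp
    moreover have "g \<otimes> (inv g \<otimes> b) = b" using g b by (simp flip: m_assoc)
    ultimately have "?f (act (hd d) (w (tl d))) = \<beta> b (pM (w (differences G (b # l'))) (\<tau> (inv b) x))"
      using g b \<beta>_mult[of g "inv g \<otimes> b"] by simp
    also have "\<dots> = hom_val w (?del 0) x" by (simp only: hom_val_def hdd(2) list.sel)
    finally show ?thesis using del[of 0] by simp
  qed
  also have "?f (\<Oplus>\<^bsub>M\<^esub>i\<in>{..<n}. [((-1::int) ^ Suc i)] \<cdot>\<^bsub>M\<^esub> w (merge G i d)) =
      (\<Oplus>\<^bsub>B\<^esub>i\<in>{..<n}. [((-1::int) ^ Suc i)] \<cdot>\<^bsub>B\<^esub> hom_val w (?del (Suc i)) x)"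
  proof -
    have "?f (\<Oplus>\<^bsub>M\<^esub>i\<in>{..<n}. [((-1::int) ^ Suc i)] \<cdot>\<^bsub>M\<^esub> w (merge G i d)) =
      (\<Oplus>\<^bsub>B\<^esub>i\<in>{..<n}. ?f ([((-1::int) ^ Suc i)] \<cdot>\<^bsub>M\<^esub> w (merge G i d)))"
      by (rule additive_map_finsum[OF ab add])
        (intro Pi_I M.int_mult_closed C_closed[OF w] merge_vertices[OF d], simp)
    also have "\<dots> = (\<Oplus>\<^bsub>B\<^esub>i\<in>{..<n}. [((-1::int) ^ Suc i)] \<cdot>\<^bsub>B\<^esub> hom_val w (?del (Suc i)) x)"
    proof (rule B.finsum_cong')
      show "(\<lambda>i. [((-1::int) ^ Suc i)] \<cdot>\<^bsub>B\<^esub> hom_val w (?del (Suc i)) x) \<in> {..<n} \<rightarrow> carrier B"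
        by (intro Pi_I B.int_mult_closed del) simp
      fix i assume i: "i \<in> {..<n}"
      \<comment> \<open>The first vertex survives, so the base point is unchanged.\<close>
      have "differences G (?del (Suc i)) = merge G i d"
        unfolding d_def using l i by (intro differences_delete) (auto simp: vertices_def)
      then have "hom_val w (?del (Suc i)) x = ?f (w (merge G i d))"
        by (simp add: hom_val_def ll y_def)
      then show "?f ([((-1::int) ^ Suc i)] \<cdot>\<^bsub>M\<^esub> w (merge G i d)) = [((-1::int) ^ Suc i)] \<cdot>\<^bsub>B\<^esub> hom_val w (?del (Suc i)) x"
        using additive_map_int_mult[OF ab add C_closed[OF w merge_vertices[OF d]], of i "(-1) ^ Suc i"] i by simp
    qed simp
    finally show ?thesis .
  qed
  also have "?f ([((-1::int) ^ Suc n)] \<cdot>\<^bsub>M\<^esub> w (butlast d)) = [((-1::int) ^ Suc n)] \<cdot>\<^bsub>B\<^esub> hom_val w (?del (Suc n)) x"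
  proof -
    have del_last: "?del (Suc n) = butlast l" using l by (simp add: vertices_def butlast_conv_take)
    have "hom_val w (butlast l) x = ?f (w (butlast d))"
      using differences_butlast[of G l] by (simp add: hom_val_def d_def ll y_def)
    then show ?thesis
      unfolding del_last using additive_map_int_mult[OF ab add C_closed[OF w bl], of "(-1) ^ Suc n"] by simp
  qed
  also have "[((-1::int) ^ 0)] \<cdot>\<^bsub>B\<^esub> hom_val w (?del 0) x
      \<oplus>\<^bsub>B\<^esub> (\<Oplus>\<^bsub>B\<^esub>i\<in>{..<n}. [((-1::int) ^ Suc i)] \<cdot>\<^bsub>B\<^esub> hom_val w (?del (Suc i)) x)
      \<oplus>\<^bsub>B\<^esub> [((-1::int) ^ Suc n)] \<cdot>\<^bsub>B\<^esub> hom_val w (?del (Suc n)) x =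
      (\<Oplus>\<^bsub>B\<^esub>i\<in>{..<Suc (Suc n)}. [((-1::int) ^ i)] \<cdot>\<^bsub>B\<^esub> hom_val w (?del i) x)"
    by (rule B.finsum_lessThan_ends[symmetric]) (intro B.int_mult_closed del)
  also have "\<dots> = eval_chain B (\<lambda>m. hom_val w m x) (simplex_boundary l)"
    using B.eval_simplex_boundary[of l "\<lambda>m. hom_val w m x"] del l by (simp add: vertices_def)
  finally show ?thesis .
qed

lemma C_mult: "f \<otimes>\<^bsub>C n\<^esub> g = (\<lambda>l\<in>vertices G n. f l \<oplus>\<^bsub>M\<^esub> g l)"
  by (simp add: cochain_group_def tuples_vertices)

lemma C_one: "\<one>\<^bsub>C n\<^esub> = (\<lambda>l\<in>vertices G n. \<zero>\<^bsub>M\<^esub>)"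
  by (simp add: cochain_group_def tuples_vertices)

lemma C_comm_group: "comm_group (C n)"
proof (rule comm_groupI)
  fix f assume f: "f \<in> carrier (C n)"
  show "\<exists>g\<in>carrier (C n). g \<otimes>\<^bsub>C n\<^esub> f = \<one>\<^bsub>C n\<^esub>"
    by (rule bexI[of _ "\<lambda>l\<in>vertices G n. \<ominus>\<^bsub>M\<^esub> f l"])
      (use C_closed[OF f] in \<open>auto simp: C_mult C_one C_carrier M.l_neg intro!: restrict_ext\<close>)
  show "\<one>\<^bsub>C n\<^esub> \<otimes>\<^bsub>C n\<^esub> f = f"
    by (rule extensionalityI[of _ "vertices G n"])
      (use f C_closed[OF f] in \<open>auto simp: C_mult C_one C_carrier PiE_def\<close>)
qed (auto simp: C_mult C_one C_carrier M.a_ac dest!: PiE_mem intro!: restrict_ext)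

lemma hom_val_add:
  assumes "w \<in> carrier (C n)" "w' \<in> carrier (C n)" "l \<in> vertices G (Suc n)" "x \<in> points"
  shows "hom_val (w \<otimes>\<^bsub>C n\<^esub> w') l x = hom_val w l x \<oplus>\<^bsub>B\<^esub> hom_val w' l x"
proof -
  note d = differences_vertices[OF assms(3)] and hd = vertices_hd[OF assms(3)]
  have y: "\<tau> (inv hd l) x \<in> points" using \<tau>_closed hd assms(4) by simp
  then show ?thesis
    using d C_closed[OF assms(1) d] C_closed[OF assms(2) d]
    by (simp add: hom_val_def C_mult pM_add pM_carrier additive_map_add[OF \<beta>_additive[OF hd]])
qed

lemma hom_val_one:
  assumes "l \<in> vertices G (Suc n)" "x \<in> points"
  shows "hom_val \<one>\<^bsub>C n\<^esub> l x = \<zero>\<^bsub>B\<^esub>"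
proof -
  note d = differences_vertices[OF assms(1)] and hd = vertices_hd[OF assms(1)]
  have y: "\<tau> (inv hd l) x \<in> points" using \<tau>_closed hd assms(2) by simp
  show ?thesis
    using d additive_map_zero[OF M.abelian_group_axioms B.abelian_group_axioms pM_additive[OF y]]
      additive_map_zero[OF B.abelian_group_axioms B.abelian_group_axioms \<beta>_additive[OF hd]]
    by (simp add: hom_val_def C_one)
qed

lemma boundary_funcset:
  assumes "w \<in> carrier (C n)" "l \<in> vertices G (Suc (Suc n))" "x \<in> points"
  shows "(\<lambda>m. hom_val w m x) \<in> Poly_Mapping.keys (simplex_boundary l) \<rightarrow> carrier B"
  by (intro Pi_I hom_val_closed[OF assms(1) boundary_vertices[OF assms(2)] assms(3)])

text \<open>Checked on homogeneous values, where additivity is that of evaluation on chains and the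
  square of the differential vanishes by \<open>boundary_boundary\<close>.\<close>

lemma cochain_complex_C: "cochain_complex C \<delta>"
proof -
  have hom: "\<delta> n \<in> hom (C n) (C (Suc n))" for n
  proof (rule homI[OF coboundary_closed])
    fix w w' assume w: "w \<in> carrier (C n)" "w' \<in> carrier (C n)"
    interpret Cn: comm_group "C n" by (rule C_comm_group)
    interpret Cn1: comm_group "C (Suc n)" by (rule C_comm_group)
    show "\<delta> n (w \<otimes>\<^bsub>C n\<^esub> w') = \<delta> n w \<otimes>\<^bsub>C (Suc n)\<^esub> \<delta> n w'"
    proof (rule hom_val_eqI)
      fix l x assume l: "l \<in> vertices G (Suc (Suc n))" and x: "x \<in> points"
      have "hom_val (\<delta> n (w \<otimes>\<^bsub>C n\<^esub> w')) l x =
          eval_chain B (\<lambda>m. hom_val w m x \<oplus>\<^bsub>B\<^esub> hom_val w' m x) (simplex_boundary l)"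
        unfolding hom_val_coboundary[OF Cn.m_closed[OF w] l x]
        by (rule B.eval_chain_cong)
          (use hom_val_add[OF w boundary_vertices[OF l] x] hom_val_closed[OF w(1) boundary_vertices[OF l] x]
            hom_val_closed[OF w(2) boundary_vertices[OF l] x] in auto)
      also have "\<dots> = hom_val (\<delta> n w) l x \<oplus>\<^bsub>B\<^esub> hom_val (\<delta> n w') l x"
        unfolding hom_val_coboundary[OF w(1) l x] hom_val_coboundary[OF w(2) l x]
        by (rule B.eval_chain_add_fun[OF boundary_funcset[OF w(1) l x] boundary_funcset[OF w(2) l x]])
      also have "\<dots> = hom_val (\<delta> n w \<otimes>\<^bsub>C (Suc n)\<^esub> \<delta> n w') l x"
        using hom_val_add[OF coboundary_closed[OF w(1)] coboundary_closed[OF w(2)] l x] by simp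
      finally show "hom_val (\<delta> n (w \<otimes>\<^bsub>C n\<^esub> w')) l x = hom_val (\<delta> n w \<otimes>\<^bsub>C (Suc n)\<^esub> \<delta> n w') l x" .
    qed (use w coboundary_closed in auto)
  qed
  have "\<delta> (Suc n) (\<delta> n w) = \<one>\<^bsub>C (Suc (Suc n))\<^esub>" if w: "w \<in> carrier (C n)" for n w
  proof (rule hom_val_eqI)
    interpret Cn: comm_group "C (Suc (Suc n))" by (rule C_comm_group)
    show "\<one>\<^bsub>C (Suc (Suc n))\<^esub> \<in> carrier (C (Suc (Suc n)))" by simp
    fix l x assume l: "l \<in> vertices G (Suc (Suc (Suc n)))" and x: "x \<in> points"
    have "hom_val (\<delta> (Suc n) (\<delta> n w)) l x =
        eval_chain B (\<lambda>m. eval_chain B (\<lambda>k. hom_val w k x) (simplex_boundary m)) (simplex_boundary l)"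
      unfolding hom_val_coboundary[OF coboundary_closed[OF w] l x]
      by (rule B.eval_chain_cong)
        (use hom_val_coboundary[OF w boundary_vertices[OF l] x] B.eval_chain_closed[OF boundary_funcset[OF w boundary_vertices[OF l] x]] in auto)
    also have "\<dots> = eval_chain B (\<lambda>k. hom_val w k x) (frag_extend simplex_boundary (simplex_boundary l))"
      by (rule B.eval_chain_frag_extend[symmetric, where S = "vertices G (Suc n)"])
        (use boundary_vertices[OF boundary_vertices[OF l]] hom_val_closed[OF w _ x] in auto)
    also have "\<dots> = hom_val \<one>\<^bsub>C (Suc (Suc n))\<^esub> l x"
      by (simp add: boundary_boundary hom_val_one[OF l x])
    finally show "hom_val (\<delta> (Suc n) (\<delta> n w)) l x = hom_val \<one>\<^bsub>C (Suc (Suc n))\<^esub> l x" .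
  qed (use w coboundary_closed in auto)
  with hom C_comm_group show ?thesis by (simp add: cochain_complex_def)
qed

end

section \<open>Homomorphisms out of the simplicial resolution in coordinates\<close>

context point_coordinates
begin

abbreviation "N \<equiv> rep_module K S A \<rho>"
abbreviation "P n \<equiv> simplex_module K G (Suc n)"
abbreviation "D n \<equiv> simplex_diff K G (Suc n)"

lemma left_module_N: "left_module R N"
  by (rule A.left_module_rep)

lemma abelian_group_A: "abelian_group A"
  by (rule A.V.M.abelian_group_axioms)

lemma pA_carrier: "\<lbrakk>a \<in> carrier A; x \<in> points; \<one> \<in> star x\<rbrakk> \<Longrightarrow> pA a x \<in> carrier B"
  by (rule V_carrier[OF _ pA_V])

lemma pA_additive: "\<lbrakk>x \<in> points; \<one> \<in> star x\<rbrakk> \<Longrightarrow> additive_map A B (\<lambda>a. pA a x)"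
  by (rule additive_mapI) (auto simp: pA_carrier pA_add)

lemma linear_closed: "\<lbrakk>linear_map R (P n) N f; y \<in> simplices G (Suc n)\<rbrakk> \<Longrightarrow> f (basis_vector K y) \<in> carrier A"
  using linear_map_closed[of R "P n" N f] basis_F by simp

lemma linear_map_P_eqI:
  assumes "linear_map R (P n) N f" "linear_map R (P n) N g"
    and "\<And>X l x. \<lbrakk>(X, l) \<in> simplices G (Suc n); x \<in> points; \<one> \<in> star x\<rbrakk> \<Longrightarrow>
      pA (f (basis_vector K (X, l))) x = pA (g (basis_vector K (X, l))) x"
    and "v \<in> carrier (P n)"
  shows "f v = g v"
proof (rule Y.linear_map_perm_eq[OF left_module_N, where f = f and g = g])
  show "f (basis_vector K y) = g (basis_vector K y)" if y: "y \<in> simplices G (Suc n)" for y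
    using pA_inj[OF linear_closed[OF assms(1) y] linear_closed[OF assms(2) y]] assms(3)[of "fst y" "snd y"] y
    by simp
qed (use assms in \<open>simp_all add: simplex_module_def[symmetric]\<close>)

text \<open>Recovers the homogeneous cochain on \<open>star x\<close> from a cochain over the simplicial resolution, by evaluating
  the latter at the simplex with the smallest possible support.\<close>

definition cell_val :: "(('g set \<times> 'g list \<Rightarrow> 'k) \<Rightarrow> 'a) \<Rightarrow> 'g list \<Rightarrow> 'p \<Rightarrow> 'b" where
  "cell_val f l x = \<beta> (hd l) (pA (f (basis_vector K (set (root_translate l), root_translate l))) (\<tau> (inv hd l) x))"

lemma root_translate_simplex:
  "l \<in> vertices G (Suc n) \<Longrightarrow> (set (root_translate l), root_translate l) \<in> simplices G (Suc n)"
  using root_translate(1,3)[of l] by (cases l) (auto simp: vertices_def simplices_def)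

lemma star_hd:
  "\<lbrakk>l \<in> vertices G (Suc n); x \<in> points; set l \<subseteq> star x\<rbrakk> \<Longrightarrow>
    \<tau> (inv hd l) x \<in> points \<and> \<one> \<in> star (\<tau> (inv hd l) x)"
  using vertices_hd[of l n] star_one[of "hd l" x] \<tau>_closed by (cases l) (auto simp: vertices_def)

lemma cell_val_V:
  assumes f: "linear_map R (P n) N f" and l: "l \<in> vertices G (Suc n)" and x: "x \<in> points" "set l \<subseteq> star x"
  shows "cell_val f l x \<in> V x"
  unfolding cell_val_def
  using \<beta>_V[OF vertices_hd[OF l]] pA_V[OF linear_closed[OF f root_translate_simplex[OF l]]]
    star_hd[OF l x] \<tau>_inv(2)[OF vertices_hd[OF l] x(1)] by metis

lemma cell_val_closed:
  "\<lbrakk>linear_map R (P n) N f; l \<in> vertices G (Suc n); x \<in> points; set l \<subseteq> star x\<rbrakk> \<Longrightarrow> cell_val f l x \<in> carrier B"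
  by (rule V_carrier[OF _ cell_val_V])

lemma cell_val_mult:
  assumes f: "linear_map R (P n) N f" and l: "l \<in> vertices G (Suc n)" and x: "x \<in> points" "set l \<subseteq> star x"
    and g: "g \<in> carrier G"
  shows "cell_val f (map (\<lambda>y. g \<otimes> y) l) (\<tau> g x) = \<beta> g (cell_val f l x)"
proof -
  have l': "set l \<subseteq> carrier G" "l \<noteq> []" using l by (auto simp: vertices_def)
  have hd: "hd l \<in> carrier G" "hd (map (\<lambda>y. g \<otimes> y) l) = g \<otimes> hd l"
    using vertices_hd[OF l] l' by (auto simp: hd_map)
  have "\<tau> (inv (g \<otimes> hd l)) (\<tau> g x) = \<tau> (inv hd l) x"
    using hd g x \<tau>_mult[of "inv hd l" "inv g" "\<tau> g x"] \<tau>_inv \<tau>_closed by (simp add: inv_mult_group)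
  moreover have "pA (f (basis_vector K (set (root_translate l), root_translate l))) (\<tau> (inv hd l) x) \<in> carrier B"
    using pA_carrier[OF linear_closed[OF f root_translate_simplex[OF l]]] star_hd[OF l x] by blast
  ultimately show ?thesis
    unfolding cell_val_def root_translate_op[OF g l'] unfolding hd(2) using g hd(1) by (simp only: \<beta>_mult)
qed

text \<open>(X, l) is the translate by (X, hd l) of the rooted simplex with smallest support, and by
  \<open>pA_rep\<close> an element of S(G) acts at x as zero unless its support lies in the star.
  Hence X decides only whether the value is present, and the values \<open>cell_val\<close>
  determine the homomorphism.\<close>

lemma cell_val_simplex:
  assumes f: "linear_map R (P n) N f" and y: "(X, l) \<in> simplices G (Suc n)" and x: "x \<in> points" "\<one> \<in> star x"
  shows "pA (f (basis_vector K (X, l))) x = (if X \<subseteq> star x then cell_val f l x else \<zero>\<^bsub>B\<^esub>)"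
proof -
  have l: "l \<in> vertices G (Suc n)" "set l \<subseteq> carrier G" "l \<noteq> []"
    and X: "finite X" "X \<subseteq> carrier G" "\<one> \<in> X" "set l \<subseteq> X"
    using y by (auto simp: vertices_def simplices_def)
  then have "hd l \<in> X" using hd_in_set by blast
  note s = par_elem[OF X(1-3) this]
  note r = root_translate[OF l(2,3)]
  let ?s = "par_elem G X (hd l)" and ?y = "(set (root_translate l), root_translate l)"
  have "simplex_op G ?s ?y = (X, l)"
    using s r(4,5) X(4) by (auto simp: simplex_op_def)
  then have "basis_vector K (X, l) = basis_vector K ?s \<odot>\<^bsub>P n\<^esub> basis_vector K ?y"
    unfolding simplex_module_def using Y.perm_smult_basis[OF s(1) root_translate_simplex[OF l(1)]] by simp
  moreover have "basis_vector K ?s \<in> carrier R"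
    using Y.basis_F[OF s(1)] by (simp add: semigroup_algebra_simps(1))
  moreover have "basis_vector K ?y \<in> carrier (P n)" using basis_F[OF root_translate_simplex[OF l(1)]] by simp
  ultimately have "f (basis_vector K (X, l)) = basis_vector K ?s \<odot>\<^bsub>N\<^esub> f (basis_vector K ?y)"
    using linear_map_smult[OF f] by simp
  also have "\<dots> = \<rho> ?s (f (basis_vector K ?y))"
    by (rule A.rep_smult_basis[OF s(1) linear_closed[OF f root_translate_simplex[OF l(1)]]])
  finally show ?thesis
    using pA_rep[OF s(1) linear_closed[OF f root_translate_simplex[OF l(1)]] x] s by (simp add: cell_val_def)
qed

lemma linear_face:
  assumes f: "linear_map R (P n) N f" and y: "(X, l) \<in> simplices G (Suc (Suc n))" and x: "x \<in> points" "\<one> \<in> star x"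
  shows "pA (f (D n (basis_vector K (X, l)))) x =
    (if X \<subseteq> star x then eval_chain B (\<lambda>m. cell_val f m x) (simplex_boundary l) else \<zero>\<^bsub>B\<^esub>)"
proof -
  have m: "(X, m) \<in> simplices G (Suc n)" if "m \<in> Poly_Mapping.keys (simplex_boundary l)" for m
    by (rule simplex_face_mem[OF y that])
  have "f (D n (basis_vector K (X, l))) =
      f (eval_chain (F (Suc n)) (\<lambda>m. basis_vector K (X, m)) (simplex_boundary l))"
    by (simp add: simplex_diff_basis[OF y] simplex_face_def)
  also have "\<dots> = eval_chain A (\<lambda>m. f (basis_vector K (X, m))) (simplex_boundary l)"
    by (rule additive_map_eval_chain[OF abelian_group_F abelian_group_A])
      (use linear_map_additive[OF f] m basis_F in \<open>auto simp: additive_map_def\<close>)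
  finally have "pA (f (D n (basis_vector K (X, l)))) x =
      pA (eval_chain A (\<lambda>m. f (basis_vector K (X, m))) (simplex_boundary l)) x" by simp
  also have "\<dots> = eval_chain B (\<lambda>m. pA (f (basis_vector K (X, m))) x) (simplex_boundary l)"
    by (rule additive_map_eval_chain[OF abelian_group_A B.abelian_group_axioms pA_additive[OF x]])
      (use linear_closed[OF f m] in auto)
  also have "\<dots> = eval_chain B (\<lambda>m. if X \<subseteq> star x then cell_val f m x else \<zero>\<^bsub>B\<^esub>) (simplex_boundary l)"
  proof (rule B.eval_chain_cong)
    fix m assume "m \<in> Poly_Mapping.keys (simplex_boundary l)"
    from cell_val_simplex[OF f m[OF this] x]
    show "pA (f (basis_vector K (X, m))) x = (if X \<subseteq> star x then cell_val f m x else \<zero>\<^bsub>B\<^esub>)" .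
  next
    show "(\<lambda>m. if X \<subseteq> star x then cell_val f m x else \<zero>\<^bsub>B\<^esub>) \<in> Poly_Mapping.keys (simplex_boundary l) \<rightarrow> carrier B"
    proof
      fix m assume "m \<in> Poly_Mapping.keys (simplex_boundary l)"
      from m[OF this] show "(if X \<subseteq> star x then cell_val f m x else \<zero>\<^bsub>B\<^esub>) \<in> carrier B"
        using cell_val_closed[OF f _ x(1), of m] by (auto simp: simplices_def vertices_def)
    qed
  qed
  also have "\<dots> = (if X \<subseteq> star x then eval_chain B (\<lambda>m. cell_val f m x) (simplex_boundary l) else \<zero>\<^bsub>B\<^esub>)"
    by (simp add: B.eval_chain_zero_fun)
  finally show ?thesis .
qed

text \<open>l is translated to start at 1, where the value is read off from the simplex whose
  support is its own vertex set and \<open>linear_face\<close> applies; then everything is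
  translated back.\<close>

lemma cell_val_diff:
  assumes f: "linear_map R (P n) N f" and l: "l \<in> vertices G (Suc (Suc n))" and x: "x \<in> points" "set l \<subseteq> star x"
  shows "cell_val (\<lambda>v. f (D n v)) l x = eval_chain B (\<lambda>m. cell_val f m x) (simplex_boundary l)"
proof -
  let ?g = "hd l" and ?r = "root_translate l"
  let ?y = "\<tau> (inv hd l) x"
  have l': "set l \<subseteq> carrier G" "l \<noteq> []" using l by (auto simp: vertices_def)
  have g: "?g \<in> carrier G" by (rule vertices_hd[OF l])
  note r = root_translate[OF l']
  have y: "?y \<in> points" "\<one> \<in> star ?y" using star_hd[OF l x] by auto
  have ry: "set ?r \<subseteq> star ?y"
    using star_translate[OF g x(1) r(1)] r(5) x(2) by simp
  have m: "m \<in> vertices G (Suc n)" "set m \<subseteq> star ?y" if "m \<in> Poly_Mapping.keys (simplex_boundary ?r)" for m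
    using keys_simplex_boundary[OF that] ry r(1) l by (auto simp: vertices_def)
  have m': "m \<in> vertices G (Suc n) \<and> set m \<subseteq> star x" if "m \<in> Poly_Mapping.keys (simplex_boundary l)" for m
    using keys_simplex_boundary[OF that] l x(2) by (auto simp: vertices_def)
  have "cell_val (\<lambda>v. f (D n v)) l x = \<beta> ?g (eval_chain B (\<lambda>m. cell_val f m ?y) (simplex_boundary ?r))"
    using linear_face[OF f root_translate_simplex[OF l] y] ry by (simp add: cell_val_def)
  also have "\<dots> = eval_chain B (\<lambda>m. \<beta> ?g (cell_val f m ?y)) (simplex_boundary ?r)"
    by (rule additive_map_eval_chain[OF B.abelian_group_axioms B.abelian_group_axioms \<beta>_additive[OF g]])
      (use m cell_val_closed[OF f _ y(1)] in auto)
  \<comment> \<open>Each face is moved back by the first vertex. Writing its value as an evaluation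
    on a single simplex prepares the exchange of translation and boundary.\<close>
  also have "\<dots> = eval_chain B (\<lambda>m. eval_chain B (\<lambda>m. cell_val f m x) (frag_of (map (\<lambda>z. ?g \<otimes> z) m))) (simplex_boundary ?r)"
  proof -
    have *: "\<beta> ?g (cell_val f m ?y) = eval_chain B (\<lambda>m. cell_val f m x) (frag_of (map (\<lambda>z. ?g \<otimes> z) m)) \<and>
        eval_chain B (\<lambda>m. cell_val f m x) (frag_of (map (\<lambda>z. ?g \<otimes> z) m)) \<in> carrier B"
      if m_key: "m \<in> Poly_Mapping.keys (simplex_boundary ?r)" for m
    proof -
    note mm = m[OF m_key]
    have "cell_val f (map (\<lambda>z. ?g \<otimes> z) m) x = \<beta> ?g (cell_val f m ?y)"
      using cell_val_mult[OF f mm(1) y(1) mm(2) g] \<tau>_inv(2)[OF g x(1)] by simp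
    moreover have "\<beta> ?g (cell_val f m ?y) \<in> carrier B"
      using \<beta>_closed[OF g cell_val_closed[OF f mm(1) y(1) mm(2)]] .
    ultimately show ?thesis
      by (simp add: B.eval_chain_of)
    qed
    then show ?thesis by (intro B.eval_chain_cong) auto
  qed
  also have "\<dots> = eval_chain B (\<lambda>m. cell_val f m x) (chain_map (\<lambda>z. ?g \<otimes> z) (simplex_boundary ?r))"
    unfolding chain_map_def
  proof (rule B.eval_chain_frag_extend[symmetric, where S = "{m \<in> vertices G (Suc n). set m \<subseteq> star x}"])
    fix m assume "m \<in> Poly_Mapping.keys (simplex_boundary ?r)"
    note mm = m[OF this]
    have "set m \<subseteq> carrier G" using mm by (auto simp: vertices_def)
    then have "translate G ?g (set m) \<subseteq> star x" using star_translate[OF g x(1)] mm(2) by blast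
    then show "Poly_Mapping.keys (frag_of (map (\<lambda>z. ?g \<otimes> z) m)) \<subseteq> {m \<in> vertices G (Suc n). set m \<subseteq> star x}"
      using vertices_map[OF g mm(1)] by (simp add: translate_def)
  qed (use cell_val_closed[OF f _ x(1)] in auto)
  also have "chain_map (\<lambda>z. ?g \<otimes> z) (simplex_boundary ?r) = simplex_boundary l"
    using r(4) by (simp only: boundary_map[symmetric])
  finally show ?thesis .
qed

definition glue :: "('p \<Rightarrow> 'b) \<Rightarrow> 'a" where
  "glue f = (SOME a. a \<in> carrier A \<and> (\<forall>x\<in>points. \<one> \<in> star x \<longrightarrow> pA a x = f x))"

lemma glue:
  assumes "\<And>x. x \<in> points \<Longrightarrow> \<one> \<in> star x \<Longrightarrow> f x \<in> V x"
  shows "glue f \<in> carrier A" "\<lbrakk>x \<in> points; \<one> \<in> star x\<rbrakk> \<Longrightarrow> pA (glue f) x = f x"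
proof -
  have "\<exists>a. a \<in> carrier A \<and> (\<forall>x\<in>points. \<one> \<in> star x \<longrightarrow> pA a x = f x)"
    using pA_surj[of f] assms by blast
  from someI_ex[OF this] show "glue f \<in> carrier A" "\<lbrakk>x \<in> points; \<one> \<in> star x\<rbrakk> \<Longrightarrow> pA (glue f) x = f x"
    by (auto simp: glue_def)
qed

text \<open>The value zero away from X in the star is forced by
  \<open>cell_val_simplex\<close>.\<close>

definition restriction_cell :: "('g list \<Rightarrow> 'm) \<Rightarrow> 'g set \<times> 'g list \<Rightarrow> 'a" where
  "restriction_cell w = (\<lambda>(X, l). glue (\<lambda>x. if X \<subseteq> star x then hom_val w l x else \<zero>\<^bsub>B\<^esub>))"

definition restriction :: "('g list \<Rightarrow> 'm) \<Rightarrow> ('g set \<times> 'g list \<Rightarrow> 'k) \<Rightarrow> 'a" where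
  "restriction w = linear_extension K (restrict_scalars K S N) (restriction_cell w)"

lemma restriction_cell:
  assumes w: "w \<in> carrier (C n)" and y: "(X, l) \<in> simplices G (Suc n)"
  shows "restriction_cell w (X, l) \<in> carrier A"
    "\<lbrakk>x \<in> points; \<one> \<in> star x\<rbrakk> \<Longrightarrow> pA (restriction_cell w (X, l)) x = (if X \<subseteq> star x then hom_val w l x else \<zero>\<^bsub>B\<^esub>)"
proof -
  have l: "l \<in> vertices G (Suc n)" using y by (auto simp: simplices_def vertices_def)
  have V: "(if X \<subseteq> star x then hom_val w l x else \<zero>\<^bsub>B\<^esub>) \<in> V x" if "x \<in> points" for x
    using hom_val_V[OF w l that] V_zero[OF that] by simp
  show "restriction_cell w (X, l) \<in> carrier A"
    unfolding restriction_cell_def prod.case by (rule glue(1)[OF V])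
  show "pA (restriction_cell w (X, l)) x = (if X \<subseteq> star x then hom_val w l x else \<zero>\<^bsub>B\<^esub>)"
    if "x \<in> points" "\<one> \<in> star x"
    unfolding restriction_cell_def prod.case by (rule glue(2)[OF V that])
qed

text \<open>Equivariance is compared at each point x with 1 in its star. If the support of s leaves
  the star of x, both sides are zero; otherwise the condition on X at x is the one at the translated
  point, and \<open>hom_val_mult\<close> applies.\<close>

lemma restriction:
  assumes w: "w \<in> carrier (C n)"
  shows restriction_linear: "linear_map R (P n) N (restriction w)"
    and restriction_basis: "y \<in> simplices G (Suc n) \<Longrightarrow> restriction w (basis_vector K y) = restriction_cell w y"
proof -
  have t: "restriction_cell w \<in> simplices G (Suc n) \<rightarrow> carrier N"
    using restriction_cell(1)[OF w] by auto
  have equi: "restriction_cell w (simplex_op G s y) = basis_vector K s \<odot>\<^bsub>N\<^esub> restriction_cell w y"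
    if s: "s \<in> carrier S" and y: "y \<in> simplices G (Suc n)" for s y
  proof -
    obtain X l where Xl: "y = (X, l)" by (cases y)
    let ?g = "par_degree G s" and ?X = "par_support G s \<union> translate G (par_degree G s) X"
    have op: "simplex_op G s y = (?X, map (\<lambda>x. ?g \<otimes> x) l)" by (simp add: simplex_op_def Xl)
    have l: "l \<in> vertices G (Suc n)" and X: "X \<subseteq> carrier G" "\<one> \<in> X"
      using y by (auto simp: simplices_def vertices_def Xl)
    have g: "?g \<in> carrier G" using s by simp
    note cy = restriction_cell[OF w y[unfolded Xl]]
    note cop = restriction_cell[OF w Y.op_closed[OF s y, unfolded op]]
    have "restriction_cell w (simplex_op G s y) = \<rho> s (restriction_cell w y)"
    proof (rule pA_inj)
      show "restriction_cell w (simplex_op G s y) \<in> carrier A" unfolding op by (rule cop(1))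
      show "\<rho> s (restriction_cell w y) \<in> carrier A" unfolding Xl by (rule A.rep_closed[OF s cy(1)])
      fix x assume x: "x \<in> points" "\<one> \<in> star x"
      show "pA (restriction_cell w (simplex_op G s y)) x = pA (\<rho> s (restriction_cell w y)) x"
      proof (cases "par_support G s \<subseteq> star x")
        case True
        then have "?g \<in> star x" using par_degree_in_support[OF s] by blast
        then have x': "\<tau> (inv ?g) x \<in> points" "\<one> \<in> star (\<tau> (inv ?g) x)"
          using star_one[OF g x(1)] \<tau>_closed g x(1) by auto
        have "?X \<subseteq> star x \<longleftrightarrow> X \<subseteq> star (\<tau> (inv ?g) x)"
          using True star_translate[OF g x(1) X(1)] by simp
        moreover have "\<beta> ?g \<zero>\<^bsub>B\<^esub> = \<zero>\<^bsub>B\<^esub>"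
          by (rule additive_map_zero[OF B.abelian_group_axioms B.abelian_group_axioms \<beta>_additive[OF g]])
        ultimately show ?thesis
          unfolding op using cop(2)[OF x] cy(2)[OF x'] pA_rep[OF s cy(1) x] True
            hom_val_mult[OF w l g x'(1)] \<tau>_inv(2)[OF g x(1)] by (simp add: Xl)
      next
        case False
        then show ?thesis unfolding op using cop(2)[OF x] pA_rep[OF s cy(1) x] by (simp add: Xl)
      qed
    qed
    then show ?thesis using A.rep_smult_basis[OF s, of "restriction_cell w y"] cy(1) Xl by simp
  qed
  show "linear_map R (P n) N (restriction w)"
    unfolding restriction_def simplex_module_def by (rule Y.linear_map_from_perm(1)[OF left_module_N t equi])
  show "restriction w (basis_vector K y) = restriction_cell w y" if "y \<in> simplices G (Suc n)"
    unfolding restriction_def by (rule Y.linear_map_from_perm(2)[OF left_module_N t equi that])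
qed

text \<open>This justifies the name: the homogeneous cochain of \<open>restriction w\<close> at x is
  that of w, restricted to tuples in \<open>star x\<close>.\<close>

lemma cell_val_restriction:
  assumes w: "w \<in> carrier (C n)" and l: "l \<in> vertices G (Suc n)" and x: "x \<in> points" "set l \<subseteq> star x"
  shows "cell_val (restriction w) l x = hom_val w l x"
proof -
  let ?g = "hd l" and ?y = "\<tau> (inv hd l) x"
  have l': "set l \<subseteq> carrier G" "l \<noteq> []" using l by (auto simp: vertices_def)
  have g: "?g \<in> carrier G" by (rule vertices_hd[OF l])
  note r = root_translate[OF l']
  have y: "?y \<in> points" "\<one> \<in> star ?y" using star_hd[OF l x] by auto
  have "set (root_translate l) \<subseteq> star ?y"
    using star_translate[OF g x(1) r(1)] r(5) x(2) by simp
  then have "cell_val (restriction w) l x = \<beta> ?g (hom_val w (root_translate l) ?y)"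
    unfolding cell_val_def restriction_basis[OF w root_translate_simplex[OF l]]
    using restriction_cell(2)[OF w root_translate_simplex[OF l] y] by simp
  also have "\<dots> = hom_val w (map (\<lambda>z. ?g \<otimes> z) (root_translate l)) (\<tau> ?g ?y)"
    using r(1) l by (intro hom_val_mult[symmetric, OF w _ g y(1)]) (simp add: vertices_def)
  finally show ?thesis unfolding r(4) \<tau>_inv(2)[OF g x(1)] .
qed

lemma linear_map_eq_cell_val:
  assumes f: "linear_map R (P n) N f" and g: "linear_map R (P n) N g"
    and "\<And>l x. \<lbrakk>l \<in> vertices G (Suc n); x \<in> points; set l \<subseteq> star x\<rbrakk> \<Longrightarrow> cell_val f l x = cell_val g l x"
    and "v \<in> carrier (P n)"
  shows "f v = g v"
proof (rule linear_map_P_eqI[OF f g _ assms(4)])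
  fix X l x assume y: "(X, l) \<in> simplices G (Suc n)" and x: "x \<in> points" "\<one> \<in> star x"
  have "l \<in> vertices G (Suc n)" "set l \<subseteq> X" using y by (auto simp: simplices_def vertices_def)
  then show "pA (f (basis_vector K (X, l))) x = pA (g (basis_vector K (X, l))) x"
    using cell_val_simplex[OF f y x] cell_val_simplex[OF g y x] assms(3)[OF _ x(1)] by auto
qed

text \<open>On both sides the value at a tuple in the star is the evaluation of w on its boundary,
  whose faces stay in the star.\<close>

lemma restriction_coboundary:
  assumes w: "w \<in> carrier (C n)" and v: "v \<in> carrier (P (Suc n))"
  shows "restriction (\<delta> n w) v = restriction w (D n v)"
proof (rule linear_map_eq_cell_val[OF restriction_linear[OF coboundary_closed[OF w]]
      linear_map_comp[OF simplex_diff_linear restriction_linear[OF w]] _ v])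
  fix l x assume l: "l \<in> vertices G (Suc (Suc n))" and x: "x \<in> points" "set l \<subseteq> star x"
  have m: "m \<in> vertices G (Suc n)" "set m \<subseteq> star x" if "m \<in> Poly_Mapping.keys (simplex_boundary l)" for m
    using keys_simplex_boundary[OF that] l x(2) by (auto simp: vertices_def)
  have "cell_val (restriction (\<delta> n w)) l x = eval_chain B (\<lambda>m. hom_val w m x) (simplex_boundary l)"
    by (simp add: cell_val_restriction[OF coboundary_closed[OF w] l x] hom_val_coboundary[OF w l x(1)])
  also have "\<dots> = eval_chain B (\<lambda>m. cell_val (restriction w) m x) (simplex_boundary l)"
    by (rule B.eval_chain_cong)
      (use cell_val_restriction[OF w m(1) x(1) m(2)] hom_val_closed[OF w m(1) x(1)] in auto)
  finally show "cell_val (restriction (\<delta> n w)) l x = cell_val (\<lambda>v. restriction w (D n v)) l x"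
    by (simp add: cell_val_diff[OF restriction_linear[OF w] l x])
qed

end

text \<open>Needed to reverse the isomorphism that leads from group cohomology to the complex of
  homomorphisms.\<close>

lemma group_cohomology_group:
  assumes C: "cochain_complex C d" shows "group (cohomology C d n)"
proof -
  interpret C: comm_group "C n" using C by (simp add: cochain_complex_def)
  let ?Z = "(C n)\<lparr>carrier := cocycles C d n\<rparr>"
  interpret Z: comm_group ?Z
    using comm_group_subgroup[OF C.comm_group_axioms cocycles_subgroup[OF C]] .
  have "subgroup (coboundaries C d n) ?Z"
    using C.subgroup_incl[OF coboundaries_subgroup[OF C] cocycles_subgroup[OF C] coboundaries_cocycles[OF C]] .
  then interpret normal "coboundaries C d n" ?Z by (rule Z.subgroup_imp_normal)
  show ?thesis using factorgroup_is_group by (simp add: cohomology_def cocycles_def coboundaries_def)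
qed

section \<open>Retracting the simplices on G onto those on a star\<close>

context point_coordinates
begin

text \<open>The choice \<theta> depends on the point alone. This makes \<open>retract\<close>
  equivariant although nothing equivariant is chosen.\<close>

definition basepoint :: "'p \<Rightarrow> 'g" where
  "basepoint x = (if \<one> \<in> star x then \<one> else SOME h. h \<in> star x)"

definition retract :: "'p \<Rightarrow> 'g \<Rightarrow> 'g" where
  "retract x g = g \<otimes> basepoint (\<tau> (inv g) x)"

lemma basepoint_star: "x \<in> points \<Longrightarrow> basepoint x \<in> star x"
  using star_nonempty[of x] by (auto simp: basepoint_def some_in_eq)

lemma retract_star:
  assumes g: "g \<in> carrier G" and x: "x \<in> points" shows "retract x g \<in> star x"
proof -
  have x': "\<tau> (inv g) x \<in> points" using g x \<tau>_closed by simp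
  have b: "basepoint (\<tau> (inv g) x) \<in> carrier G" using basepoint_star[OF x'] star_closed[OF x'] by blast
  show ?thesis
    using star_mult[OF b g x'] basepoint_star[OF x'] \<tau>_inv(2)[OF g x] by (simp add: retract_def)
qed

text \<open>For g in the star of x, the translated point has 1 in its star, and there \<theta> is
  1.\<close>

lemma retract_id: "\<lbrakk>g \<in> star x; x \<in> points\<rbrakk> \<Longrightarrow> retract x g = g"
  using star_one[of g x] star_closed[of x] by (auto simp: retract_def basepoint_def subset_iff)

text \<open>Moving x by h and g to hg leads to the same point \<open>\<tau> (inv g) x\<close>, so
  the same base point is used on both sides.\<close>

lemma retract_mult:
  assumes "g \<in> carrier G" "h \<in> carrier G" and x: "x \<in> points"
  shows "retract (\<tau> h x) (h \<otimes> g) = h \<otimes> retract x g"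
proof -
  have x': "\<tau> (inv g) x \<in> points" using assms \<tau>_closed by simp
  have b: "basepoint (\<tau> (inv g) x) \<in> carrier G" using basepoint_star[OF x'] star_closed[OF x'] by blast
  have "\<tau> (inv (h \<otimes> g)) (\<tau> h x) = \<tau> (inv g) x"
    using assms \<tau>_mult[of "inv g" "inv h" "\<tau> h x"] \<tau>_inv \<tau>_closed by (simp add: inv_mult_group)
  then show ?thesis using assms b by (simp add: retract_def m_assoc)
qed

lemma retract_vertices:
  assumes "l \<in> vertices G n" "x \<in> points"
  shows "map (retract x) l \<in> vertices G n" "set (map (retract x) l) \<subseteq> star x"
  using assms retract_star[of _ x] star_closed[of x] by (auto simp: vertices_def subset_iff)

lemma retract_map_mult:
  assumes "g \<in> carrier G" "l \<in> vertices G n" "x \<in> points"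
  shows "map (retract (\<tau> g x)) (map (\<lambda>y. g \<otimes> y) l) = map (\<lambda>y. g \<otimes> y) (map (retract x) l)"
  using assms retract_mult[of _ g x] by (auto simp: vertices_def)

lemma retract_map_id: "\<lbrakk>set l \<subseteq> star x; x \<in> points\<rbrakk> \<Longrightarrow> map (retract x) l = l"
  by (intro map_idI retract_id) auto

lemma cell_val_retract:
  assumes f: "linear_map R (P n) N f" and l: "l \<in> vertices G (Suc n)" and x: "x \<in> points"
  shows "cell_val f (map (retract x) l) x \<in> V x"
  using cell_val_V[OF f retract_vertices(1)[OF l x] x retract_vertices(2)[OF l x]] .

lemma cell_val_retract_mult:
  assumes f: "linear_map R (P n) N f" and l: "l \<in> vertices G (Suc n)" and x: "x \<in> points" and g: "g \<in> carrier G"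
  shows "cell_val f (map (retract (\<tau> g x)) (map (\<lambda>y. g \<otimes> y) l)) (\<tau> g x) = \<beta> g (cell_val f (map (retract x) l) x)"
  unfolding retract_map_mult[OF g l x]
  using cell_val_mult[OF f retract_vertices(1)[OF l x] x retract_vertices(2)[OF l x] g] .

text \<open>The retraction acts vertex by vertex, so it commutes with the boundary, and it moves all
  faces into the star, where \<open>cell_val_diff\<close> applies.\<close>

lemma cell_val_retract_boundary:
  assumes f: "linear_map R (P n) N f" and l: "l \<in> vertices G (Suc (Suc n))" and x: "x \<in> points"
  shows "eval_chain B (\<lambda>m. cell_val f (map (retract x) m) x) (simplex_boundary l) =
    cell_val (\<lambda>v. f (D n v)) (map (retract x) l) x"
proof -
  have m: "m \<in> vertices G (Suc n)" if "m \<in> Poly_Mapping.keys (simplex_boundary l)" for m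
    by (rule boundary_vertices[OF l that])
  have cl: "cell_val f (map (retract x) m) x \<in> carrier B" if "m \<in> Poly_Mapping.keys (simplex_boundary l)" for m
    by (rule V_carrier[OF x cell_val_retract[OF f m[OF that] x]])
  have "eval_chain B (\<lambda>m. cell_val f (map (retract x) m) x) (simplex_boundary l) =
      eval_chain B (\<lambda>m. eval_chain B (\<lambda>m. cell_val f m x) (frag_of (map (retract x) m))) (simplex_boundary l)"
    by (rule B.eval_chain_cong) (use cl in \<open>auto simp: B.eval_chain_of\<close>)
  also have "\<dots> = eval_chain B (\<lambda>m. cell_val f m x) (chain_map (retract x) (simplex_boundary l))"
    unfolding chain_map_def
    by (rule B.eval_chain_frag_extend[symmetric, where S = "{m \<in> vertices G (Suc n). set m \<subseteq> star x}"])
      (use retract_vertices[OF m x] cell_val_closed[OF f _ x] in auto)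
  also have "\<dots> = cell_val (\<lambda>v. f (D n v)) (map (retract x) l) x"
    using cell_val_diff[OF f retract_vertices(1)[OF l x] x retract_vertices(2)[OF l x]]
    by (simp add: boundary_map)
  finally show ?thesis .
qed

text \<open>f is pulled back along the retraction. As the retraction is the identity on each star,
  restricting gives back f itself, and a cocycle pulls back to a cocycle.\<close>

lemma restriction_surj:
  assumes f: "linear_map R (P n) N f"
  obtains w where "w \<in> carrier (C n)" "\<And>v. v \<in> carrier (P n) \<Longrightarrow> restriction w v = f v"
    "(\<And>v. v \<in> carrier (P (Suc n)) \<Longrightarrow> f (D n v) = \<zero>\<^bsub>A\<^esub>) \<Longrightarrow> \<delta> n w = \<one>\<^bsub>C (Suc n)\<^esub>"
proof -
  obtain w where w: "w \<in> carrier (C n)"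
    and W: "\<And>l x. l \<in> vertices G (Suc n) \<Longrightarrow> x \<in> points \<Longrightarrow> hom_val w l x = cell_val f (map (retract x) l) x"
    by (rule ex_cochain[of n "\<lambda>l x. cell_val f (map (retract x) l) x"])
      (use cell_val_retract[OF f] cell_val_retract_mult[OF f] in auto)
  have "restriction w v = f v" if "v \<in> carrier (P n)" for v
  proof (rule linear_map_eq_cell_val[OF restriction_linear[OF w] f _ that])
    show "cell_val (restriction w) l x = cell_val f l x"
      if "l \<in> vertices G (Suc n)" "x \<in> points" "set l \<subseteq> star x" for l x
      using cell_val_restriction[OF w that] W[OF that(1,2)] retract_map_id[OF that(3,2)] by simp
  qed
  moreover have "\<delta> n w = \<one>\<^bsub>C (Suc n)\<^esub>" if zero: "\<And>v. v \<in> carrier (P (Suc n)) \<Longrightarrow> f (D n v) = \<zero>\<^bsub>A\<^esub>"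
  proof (rule hom_val_eqI[OF coboundary_closed[OF w]])
    interpret C1: comm_group "C (Suc n)" by (rule C_comm_group)
    show "\<one>\<^bsub>C (Suc n)\<^esub> \<in> carrier (C (Suc n))" by simp
    fix l x assume l: "l \<in> vertices G (Suc (Suc n))" and x: "x \<in> points"
    note rl = retract_vertices[OF l x]
    have "hom_val (\<delta> n w) l x = eval_chain B (\<lambda>m. cell_val f (map (retract x) m) x) (simplex_boundary l)"
      unfolding hom_val_coboundary[OF w l x]
      by (rule B.eval_chain_cong)
        (use W[OF boundary_vertices[OF l] x] V_carrier[OF x cell_val_retract[OF f boundary_vertices[OF l] x]] in auto)
    also have "\<dots> = cell_val (\<lambda>v. f (D n v)) (map (retract x) l) x"
      by (rule cell_val_retract_boundary[OF f l x])
    also have "\<dots> = \<beta> (hd (map (retract x) l)) (pA \<zero>\<^bsub>A\<^esub> (\<tau> (inv hd (map (retract x) l)) x))"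
      unfolding cell_val_def using zero basis_F[OF root_translate_simplex[OF rl(1)]] by simp
    also have "\<dots> = \<zero>\<^bsub>B\<^esub>"
      using additive_map_zero[OF abelian_group_A B.abelian_group_axioms pA_additive] star_hd[OF rl(1) x rl(2)]
        additive_map_zero[OF B.abelian_group_axioms B.abelian_group_axioms \<beta>_additive[OF vertices_hd[OF rl(1)]]]
      by simp
    finally show "hom_val (\<delta> n w) l x = hom_val \<one>\<^bsub>C (Suc n)\<^esub> l x" by (simp add: hom_val_one[OF l x])
  qed
  ultimately show ?thesis using that w by blast
qed

text \<open>The cochain homotopy between w and its pullback along the retraction.\<close>

definition prism_val :: "('g list \<Rightarrow> 'm) \<Rightarrow> 'g list \<Rightarrow> 'p \<Rightarrow> 'b" where
  "prism_val w l x = eval_chain B (\<lambda>m. hom_val w m x) (prism (retract x) l)"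

lemma prism_vertices:
  assumes "l \<in> vertices G n" "x \<in> points" "m \<in> Poly_Mapping.keys (prism (retract x) l)"
  shows "m \<in> vertices G (Suc n)"
proof -
  have "set m \<subseteq> set l \<union> set (map (retract x) l)" "length m = Suc (length l)"
    using keys_prism[OF assms(3)] by auto
  moreover have "set (map (retract x) l) \<subseteq> carrier G" "set l \<subseteq> carrier G" "length l = n"
    using retract_vertices(1)[OF assms(1,2)] assms(1) by (auto simp: vertices_def)
  ultimately show ?thesis unfolding vertices_def by blast
qed

lemma prism_val_V:
  assumes "w \<in> carrier (C n)" "l \<in> vertices G n" "x \<in> points"
  shows "prism_val w l x \<in> V x"
  unfolding prism_val_def
  using hom_val_V[OF assms(1) prism_vertices[OF assms(2,3)] assms(3)] by (intro V_eval_chain assms Pi_I)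

lemma prism_val_mult:
  assumes w: "w \<in> carrier (C n)" and l: "l \<in> vertices G n" and x: "x \<in> points" and g: "g \<in> carrier G"
  shows "prism_val w (map (\<lambda>y. g \<otimes> y) l) (\<tau> g x) = \<beta> g (prism_val w l x)"
proof -
  have gx: "\<tau> g x \<in> points" using \<tau>_closed g x by simp
  note pv = prism_vertices[OF l x]
  have "prism (retract (\<tau> g x)) (map (\<lambda>y. g \<otimes> y) l) = chain_map (\<lambda>y. g \<otimes> y) (prism (retract x) l)"
    using retract_mult[OF _ g x] l by (intro prism_map) (auto simp: vertices_def)
  then have "prism_val w (map (\<lambda>y. g \<otimes> y) l) (\<tau> g x) =
      eval_chain B (\<lambda>m. eval_chain B (\<lambda>m. hom_val w m (\<tau> g x)) (frag_of (map (\<lambda>y. g \<otimes> y) m))) (prism (retract x) l)"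
    unfolding prism_val_def
    by (simp only: chain_map_def)
      (rule B.eval_chain_frag_extend[where S = "vertices G (Suc n)"];
        use vertices_map[OF g pv] hom_val_closed[OF w _ gx] in auto)
  also have "\<dots> = eval_chain B (\<lambda>m. \<beta> g (hom_val w m x)) (prism (retract x) l)"
    by (rule B.eval_chain_cong)
      (use hom_val_mult[OF w pv g x] \<beta>_closed[OF g hom_val_closed[OF w pv x]] in \<open>auto simp: B.eval_chain_of\<close>)
  also have "\<dots> = \<beta> g (prism_val w l x)"
    unfolding prism_val_def
    by (rule additive_map_eval_chain[symmetric, OF B.abelian_group_axioms B.abelian_group_axioms \<beta>_additive[OF g]])
      (use hom_val_closed[OF w pv x] in auto)
  finally show ?thesis .
qed

text \<open>The prism identity evaluated by w: the part in which the boundary follows the prism is a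
  value of the coboundary of w and vanishes.\<close>

lemma prism_val_boundary:
  assumes w: "w \<in> carrier (C n)" and cocycle: "\<delta> n w = \<one>\<^bsub>C (Suc n)\<^esub>"
    and l: "l \<in> vertices G (Suc n)" and x: "x \<in> points"
  shows "eval_chain B (\<lambda>m. prism_val w m x) (simplex_boundary l) =
    hom_val w (map (retract x) l) x \<ominus>\<^bsub>B\<^esub> hom_val w l x"
proof -
  let ?W = "\<lambda>m. hom_val w m x"
  have Wc: "?W m \<in> carrier B" if "m \<in> vertices G (Suc n)" for m by (rule hom_val_closed[OF w that x])
  have bd: "Poly_Mapping.keys (simplex_boundary m) \<subseteq> vertices G (Suc n)" if "m \<in> vertices G (Suc (Suc n))" for m
    using boundary_vertices[OF that] by auto
  have pr: "Poly_Mapping.keys (prism (retract x) m) \<subseteq> vertices G (Suc k)" if "m \<in> vertices G k" for m k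
    using prism_vertices[OF that x] by auto
  have 1: "eval_chain B ?W (frag_extend (prism (retract x)) (simplex_boundary l)) =
      eval_chain B (\<lambda>m. prism_val w m x) (simplex_boundary l)"
    unfolding prism_val_def
    by (rule B.eval_chain_frag_extend[where S = "vertices G (Suc n)"])
      (use pr[OF boundary_vertices[OF l]] Wc in auto)
  have "eval_chain B ?W (frag_extend simplex_boundary (prism (retract x) l)) =
      eval_chain B (\<lambda>m. eval_chain B ?W (simplex_boundary m)) (prism (retract x) l)"
    by (rule B.eval_chain_frag_extend[where S = "vertices G (Suc n)"])
      (use bd pr[OF l] Wc in auto)
  also have "\<dots> = eval_chain B (\<lambda>_. \<zero>\<^bsub>B\<^esub>) (prism (retract x) l)"
  \<comment> \<open>A cocycle vanishes on the boundary of every simplex, in particular of those that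
    make up the prism.\<close>
  proof (rule B.eval_chain_cong)
    show "eval_chain B ?W (simplex_boundary m) = \<zero>\<^bsub>B\<^esub>" if "m \<in> Poly_Mapping.keys (prism (retract x) l)" for m
      using hom_val_coboundary[OF w _ x, of m] hom_val_one[OF _ x, of m "Suc n"] cocycle pr[OF l] that by auto
  qed simp
  finally have 2: "eval_chain B ?W (frag_extend simplex_boundary (prism (retract x) l)) = \<zero>\<^bsub>B\<^esub>"
    by (simp add: B.eval_chain_zero_fun)
  have keys1: "Poly_Mapping.keys (frag_extend simplex_boundary (prism (retract x) l)) \<subseteq> vertices G (Suc n)"
    using keys_frag_extend[of simplex_boundary "prism (retract x) l"] bd pr[OF l] by blast
  have keys2: "Poly_Mapping.keys (frag_extend (prism (retract x)) (simplex_boundary l)) \<subseteq> vertices G (Suc n)"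
    using keys_frag_extend[of "prism (retract x)" "simplex_boundary l"] pr[OF boundary_vertices[OF l]] by blast
  have "\<zero>\<^bsub>B\<^esub> \<oplus>\<^bsub>B\<^esub> eval_chain B (\<lambda>m. prism_val w m x) (simplex_boundary l) =
      eval_chain B ?W (frag_extend simplex_boundary (prism (retract x) l) +
        frag_extend (prism (retract x)) (simplex_boundary l))"
    unfolding 1[symmetric] 2[symmetric]
    by (rule B.eval_chain_add[symmetric]) (use keys1 keys2 Wc in auto)
  also have "\<dots> = eval_chain B ?W (frag_of (map (retract x) l) - frag_of l)"
    by (simp only: prism_homotopy)
  also have "\<dots> = hom_val w (map (retract x) l) x \<ominus>\<^bsub>B\<^esub> hom_val w l x"
    using B.eval_chain_diff[of ?W "frag_of (map (retract x) l)" "frag_of l"]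
      Wc[OF l] Wc[OF retract_vertices(1)[OF l x]] by (simp add: B.eval_chain_of)
  finally show ?thesis
    using B.eval_chain_closed[of "\<lambda>m. prism_val w m x" "simplex_boundary l"]
      V_carrier[OF x prism_val_V[OF w boundary_vertices[OF l] x]] by auto
qed

text \<open>In the lowest degree the homotopy term is absent, so a cocycle equals its pullback along
  the retraction, and this is given by the vanishing restriction.\<close>

lemma restriction_inj_0:
  assumes w: "w \<in> carrier (C 0)" and cocycle: "\<delta> 0 w = \<one>\<^bsub>C (Suc 0)\<^esub>"
    and zero: "\<And>v. v \<in> carrier (P 0) \<Longrightarrow> restriction w v = \<zero>\<^bsub>A\<^esub>"
  shows "w = \<one>\<^bsub>C 0\<^esub>"
proof (rule hom_val_eqI[OF w])
  interpret C0: comm_group "C 0" by (rule C_comm_group)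
  show "\<one>\<^bsub>C 0\<^esub> \<in> carrier (C 0)" by simp
  fix l x assume l: "l \<in> vertices G (Suc 0)" and x: "x \<in> points"
  note rl = retract_vertices[OF l x]
  obtain g where g: "l = [g]" using l by (cases l) (auto simp: vertices_def)
  have "hom_val w (map (retract x) l) x \<ominus>\<^bsub>B\<^esub> hom_val w l x = \<zero>\<^bsub>B\<^esub>"
    \<comment> \<open>The boundary of \<open>[g]\<close> is the empty simplex, whose prism is
      0.\<close>
    using prism_val_boundary[OF w cocycle l x] by (simp add: g cone_zero prism_val_def B.eval_chain_of)
  then have "hom_val w l x = hom_val w (map (retract x) l) x"
    using B.minus_zero_imp_eq hom_val_closed[OF w rl(1) x] hom_val_closed[OF w l x] by metis
  also have "\<dots> = cell_val (restriction w) (map (retract x) l) x"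
    by (rule cell_val_restriction[symmetric, OF w rl(1) x rl(2)])
  also have "\<dots> = \<beta> (hd (map (retract x) l)) (pA \<zero>\<^bsub>A\<^esub> (\<tau> (inv hd (map (retract x) l)) x))"
    unfolding cell_val_def using zero basis_F[OF root_translate_simplex[OF rl(1)]] by simp
  also have "\<dots> = \<zero>\<^bsub>B\<^esub>"
    using additive_map_zero[OF abelian_group_A B.abelian_group_axioms pA_additive] star_hd[OF rl(1) x rl(2)]
      additive_map_zero[OF B.abelian_group_axioms B.abelian_group_axioms \<beta>_additive[OF vertices_hd[OF rl(1)]]]
    by simp
  finally show "hom_val w l x = hom_val \<one>\<^bsub>C 0\<^esub> l x" by (simp add: hom_val_one[OF l x])
qed

text \<open>The cochain is the pullback of f minus the prism of w. Its coboundary is w, for the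
  coboundary of the first part is w along the retraction, and that of the second is the same minus
  w.\<close>

lemma restriction_inj_Suc:
  assumes w: "w \<in> carrier (C (Suc n))" and cocycle: "\<delta> (Suc n) w = \<one>\<^bsub>C (Suc (Suc n))\<^esub>"
    and f: "linear_map R (P n) N f" and eq: "\<And>v. v \<in> carrier (P (Suc n)) \<Longrightarrow> restriction w v = f (D n v)"
  shows "\<exists>v\<in>carrier (C n). w = \<delta> n v"
proof -
  let ?V = "\<lambda>l x. cell_val f (map (retract x) l) x \<ominus>\<^bsub>B\<^esub> prism_val w l x"
  have V: "?V l x \<in> V x" if "l \<in> vertices G (Suc n)" "x \<in> points" for l x
    by (rule V_minus[OF that(2) cell_val_retract[OF f that] prism_val_V[OF w that]])
  have mult: "?V (map (\<lambda>y. g \<otimes> y) l) (\<tau> g x) = \<beta> g (?V l x)"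
    if g: "g \<in> carrier G" and l: "l \<in> vertices G (Suc n)" and x: "x \<in> points" for g l x
    unfolding cell_val_retract_mult[OF f l x g] prism_val_mult[OF w l x g]
    using additive_map_minus[OF B.abelian_group_axioms B.abelian_group_axioms \<beta>_additive[OF g]]
      V_carrier[OF x cell_val_retract[OF f l x]] V_carrier[OF x prism_val_V[OF w l x]] by simp
  obtain v where v: "v \<in> carrier (C n)"
    and hv: "\<And>l x. l \<in> vertices G (Suc n) \<Longrightarrow> x \<in> points \<Longrightarrow> hom_val v l x = ?V l x"
    using ex_cochain[of n ?V, OF V mult] by blast
  have "w = \<delta> n v"
  proof (rule hom_val_eqI[OF w coboundary_closed[OF v]])
    fix l x assume l: "l \<in> vertices G (Suc (Suc n))" and x: "x \<in> points"
    note rl = retract_vertices[OF l x]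
    note c = V_carrier[OF x cell_val_retract[OF f boundary_vertices[OF l] x]]
      V_carrier[OF x prism_val_V[OF w boundary_vertices[OF l] x]]
    have "hom_val (\<delta> n v) l x = eval_chain B (\<lambda>m. ?V m x) (simplex_boundary l)"
      unfolding hom_val_coboundary[OF v l x]
      by (rule B.eval_chain_cong) (use hv[OF boundary_vertices[OF l] x] c in auto)
    also have "\<dots> = eval_chain B (\<lambda>m. cell_val f (map (retract x) m) x) (simplex_boundary l) \<ominus>\<^bsub>B\<^esub>
        eval_chain B (\<lambda>m. prism_val w m x) (simplex_boundary l)"
      by (rule B.eval_chain_minus_fun) (use c in auto)
    also have "eval_chain B (\<lambda>m. cell_val f (map (retract x) m) x) (simplex_boundary l) =
        cell_val (\<lambda>v. f (D n v)) (map (retract x) l) x"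
      by (rule cell_val_retract_boundary[OF f l x])
    also have "\<dots> = cell_val (restriction w) (map (retract x) l) x"
      unfolding cell_val_def using eq basis_F[OF root_translate_simplex[OF rl(1)]] by simp
    also have "\<dots> = hom_val w (map (retract x) l) x"
      by (rule cell_val_restriction[OF w rl(1) x rl(2)])
    also have "eval_chain B (\<lambda>m. prism_val w m x) (simplex_boundary l) =
        hom_val w (map (retract x) l) x \<ominus>\<^bsub>B\<^esub> hom_val w l x"
      by (rule prism_val_boundary[OF w cocycle l x])
    finally have "hom_val (\<delta> n v) l x =
        hom_val w (map (retract x) l) x \<ominus>\<^bsub>B\<^esub> (hom_val w (map (retract x) l) x \<ominus>\<^bsub>B\<^esub> hom_val w l x)" .
    then show "hom_val w l x = hom_val (\<delta> n v) l x"
      using hom_val_closed[OF w rl(1) x] hom_val_closed[OF w l x]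
      by (simp add: B.minus_eq B.minus_add B.r_neg2)
  qed
  with v show ?thesis by blast
qed

section \<open>The comparison isomorphism\<close>

abbreviation "H \<equiv> \<lambda>i. hom_group R (P i) N"
abbreviation "dH \<equiv> \<lambda>i f. \<lambda>x\<in>carrier (P (Suc i)). f (D i x)"

text \<open>Each cocycle over the resolution is itself the restriction of a group cocycle, so the
  correcting coboundary in the surjectivity condition is trivial. Injectivity is the pair of
  preceding lemmas, one for degree 0 and one for the others.\<close>

theorem cochain_hom_iso: "cohomology C \<delta> n \<cong> cohomology H dH n"
proof -
  note complex = cochain_complex_C cochain_complex_hom[OF simplex_resolution left_module_N]
  let ?\<Phi> = "\<lambda>w. restrict (restriction w) (carrier (P n))"
  have ext_eq: "f = g" if "f \<in> carrier (H i)" "g \<in> carrier (H i)" "\<And>v. v \<in> carrier (P i) \<Longrightarrow> f v = g v" for f g i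
    using that by (intro extensionalityI[of _ "carrier (P i)"]) (auto simp: hom_group_carrier)
  have closed: "restrict (restriction w) (carrier (P i)) \<in> carrier (H i)" if "w \<in> carrier (C i)" for w i
    by (rule linear_map_restrict[OF left_module_simplex restriction_linear[OF that]])
  have chain: "restrict (restriction (\<delta> i w)) (carrier (P (Suc i))) = dH i (restrict (restriction w) (carrier (P i)))"
    if "w \<in> carrier (C i)" for w i
    using restriction_coboundary[OF that] linear_map_closed[OF simplex_diff_linear]
    by (intro restrict_ext) (simp del: simplex_module_simps)
  have one: "restrict (restriction \<one>\<^bsub>C i\<^esub>) (carrier (P i)) = \<one>\<^bsub>H i\<^esub>" for i
  proof -
    interpret Ci: comm_group "C i" by (rule C_comm_group)
    have "restriction \<one>\<^bsub>C i\<^esub> v = \<zero>\<^bsub>N\<^esub>" if "v \<in> carrier (P i)" for v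
    proof (rule linear_map_P_eqI[OF restriction_linear[OF Ci.one_closed] left_module.zero_linear[OF left_module_N] _ that])
      fix X l x assume y: "(X, l) \<in> simplices G (Suc i)" and x: "x \<in> points" "\<one> \<in> star x"
      have l: "l \<in> vertices G (Suc i)" using y by (auto simp: simplices_def vertices_def)
      show "pA (restriction \<one>\<^bsub>C i\<^esub> (basis_vector K (X, l))) x = pA \<zero>\<^bsub>N\<^esub> x"
        using restriction_basis[OF Ci.one_closed y] restriction_cell(2)[OF Ci.one_closed y x] hom_val_one[OF l x(1)]
          additive_map_zero[OF abelian_group_A B.abelian_group_axioms pA_additive[OF x]] by simp
    qed
    then show ?thesis by (simp add: hom_group_simps cong: restrict_cong)
  qed
  have cocycle: "\<delta> n w = \<one>\<^bsub>C (Suc n)\<^esub>" "w \<in> carrier (C n)" if "w \<in> cocycles C \<delta> n" for w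
    using that by (auto simp: cocycles_iff)
  show ?thesis
  proof (rule cohomology_iso[OF complex, of ?\<Phi>])
    interpret Cn: comm_group "C n" by (rule C_comm_group)
    show "?\<Phi> \<in> hom (C n) (H n)"
    proof (rule homI[OF closed])
      fix w w' assume w: "w \<in> carrier (C n)" "w' \<in> carrier (C n)"
      note lin = restriction_linear[OF w(1)] restriction_linear[OF w(2)]
      have "restriction (w \<otimes>\<^bsub>C n\<^esub> w') v = restriction w v \<oplus>\<^bsub>N\<^esub> restriction w' v" if "v \<in> carrier (P n)" for v
      proof (rule linear_map_P_eqI[OF restriction_linear[OF Cn.m_closed[OF w]]
            left_module.linear_map_sum[OF left_module_N left_module_simplex lin] _ that])
        fix X l x assume y: "(X, l) \<in> simplices G (Suc n)" and x: "x \<in> points" "\<one> \<in> star x"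
        have l: "l \<in> vertices G (Suc n)" using y by (auto simp: simplices_def vertices_def)
        show "pA (restriction (w \<otimes>\<^bsub>C n\<^esub> w') (basis_vector K (X, l))) x =
            pA (restriction w (basis_vector K (X, l)) \<oplus>\<^bsub>N\<^esub> restriction w' (basis_vector K (X, l))) x"
          using restriction_cell[OF w(1) y] restriction_cell[OF w(2) y] x hom_val_add[OF w l x(1)]
            restriction_cell(2)[OF Cn.m_closed[OF w] y x]
          by (simp add: restriction_basis[OF _ y] w Cn.m_closed pA_add)
      qed
      then show "?\<Phi> (w \<otimes>\<^bsub>C n\<^esub> w') = ?\<Phi> w \<otimes>\<^bsub>H n\<^esub> ?\<Phi> w'"
        unfolding hom_group_simps by (intro restrict_ext) simp
    qed
    show "?\<Phi> w \<in> cocycles H dH n" if "w \<in> cocycles C \<delta> n" for w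
      using closed[OF cocycle(2)[OF that]] chain[OF cocycle(2)[OF that]] one[of "Suc n"]
      unfolding cocycle(1)[OF that] cocycles_iff by simp
    show "?\<Phi> w \<in> coboundaries H dH n" if w: "w \<in> coboundaries C \<delta> n" for w
    proof (cases n)
      case 0
      then show ?thesis using w one[of 0] by (simp add: coboundaries_def)
    next
      case (Suc m)
      then obtain v where "v \<in> carrier (C m)" "w = \<delta> m v" using w by (auto simp: coboundaries_def)
      then show ?thesis
        unfolding Suc coboundaries_def nat.case using imageI[OF closed, of v m "dH m"] chain[of v m] by simp
    qed
    show "w \<in> coboundaries C \<delta> n" if w: "w \<in> cocycles C \<delta> n" and cb: "?\<Phi> w \<in> coboundaries H dH n" for w
    proof (cases n)
      case 0
      have "restriction w v = \<zero>\<^bsub>A\<^esub>" if "v \<in> carrier (P 0)" for v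
        using cb 0 that
        by (auto simp: coboundaries_def hom_group_simps simp del: simplex_module_simps dest!: fun_cong[where x = v])
      then have "w = \<one>\<^bsub>C 0\<^esub>"
        using restriction_inj_0[of w] cocycle[OF w] 0 by simp
      then show ?thesis using 0 by (simp add: coboundaries_def)
    next
      case (Suc m)
      then obtain f where f: "f \<in> carrier (H m)" "?\<Phi> w = dH m f"
        using cb by (auto simp: coboundaries_def)
      have "restriction w v = f (D m v)" if "v \<in> carrier (P (Suc m))" for v
        using fun_cong[OF f(2), of v] that Suc by (simp del: simplex_module_simps)
      then have "\<exists>v\<in>carrier (C m). w = \<delta> m v"
        using restriction_inj_Suc[of w m f] cocycle[OF w] Suc f(1) by (simp add: hom_group_carrier)
      then show ?thesis using Suc by (auto simp: coboundaries_def)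
    qed
    show "\<exists>w\<in>cocycles C \<delta> n. \<exists>b\<in>coboundaries H dH n. f = b \<otimes>\<^bsub>H n\<^esub> ?\<Phi> w"
      if f: "f \<in> cocycles H dH n" for f
    proof -
      interpret Hn: comm_group "H n" by (rule hom_group_comm_group[OF left_module_simplex left_module_N])
      have fH: "f \<in> carrier (H n)" "dH n f = \<one>\<^bsub>H (Suc n)\<^esub>" using f by (auto simp: cocycles_iff)
      then have lin: "linear_map R (P n) N f" by (simp add: hom_group_carrier)
      have zero: "f (D n v) = \<zero>\<^bsub>A\<^esub>" if "v \<in> carrier (P (Suc n))" for v
        using fun_cong[OF fH(2), of v] that by (simp add: hom_group_simps del: simplex_module_simps)
      obtain w where w: "w \<in> carrier (C n)" "\<And>v. v \<in> carrier (P n) \<Longrightarrow> restriction w v = f v" "\<delta> n w = \<one>\<^bsub>C (Suc n)\<^esub>"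
        using restriction_surj[OF lin] zero by metis
      then have "w \<in> cocycles C \<delta> n" by (simp add: cocycles_iff)
      moreover have "f = ?\<Phi> w" by (rule ext_eq[OF fH(1) closed[OF w(1)]]) (simp add: w(2) del: simplex_module_simps)
      then have "f = \<one>\<^bsub>H n\<^esub> \<otimes>\<^bsub>H n\<^esub> ?\<Phi> w" using closed[OF w(1)] by simp
      moreover have "\<one>\<^bsub>H n\<^esub> \<in> coboundaries H dH n"
        by (rule subgroup.one_closed[OF coboundaries_subgroup[OF complex(2)]])
      ultimately show ?thesis by blast
    qed
  qed
qed

theorem partial_cohomology_group_cohomology:
  "partial_cohomology K G n N \<cong> group_cohomology G M act n"
  unfolding group_cohomology_def
  using iso_trans[OF partial_cohomology_iso[OF left_module_N]
      group.iso_sym[OF group_cohomology_group[OF cochain_complex_C] cochain_hom_iso]] .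

end

section \<open>The points of an enveloping action\<close>

text \<open>\<epsilon> j has coordinate 1 at j and 0 elsewhere. The coordinate at j of a central
  idempotent is a central idempotent of an indecomposable ring, hence 0 or 1; this is the
  minimality. Separation and gluing express that A is the full product.\<close>

lemma product_idempotents:
  fixes A :: "('a, 'x) ring_scheme" and A\<^sub>\<Lambda> :: "'i \<Rightarrow> 'r ring"
  assumes ind: "\<And>i. i \<in> \<Lambda> \<Longrightarrow> indecomposable_ring (A\<^sub>\<Lambda> i)" and iso: "A \<simeq> ring_product \<Lambda> A\<^sub>\<Lambda>" and A: "ring A"
  obtains \<epsilon> where "\<And>i. i \<in> \<Lambda> \<Longrightarrow> \<epsilon> i \<in> central_idempotents A"
    "\<And>i e. \<lbrakk>i \<in> \<Lambda>; e \<in> central_idempotents A\<rbrakk> \<Longrightarrow> \<epsilon> i \<otimes>\<^bsub>A\<^esub> e = \<epsilon> i \<or> \<epsilon> i \<otimes>\<^bsub>A\<^esub> e = \<zero>\<^bsub>A\<^esub>"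
    "\<And>a b. \<lbrakk>a \<in> carrier A; b \<in> carrier A; \<And>i. i \<in> \<Lambda> \<Longrightarrow> \<epsilon> i \<otimes>\<^bsub>A\<^esub> a = \<epsilon> i \<otimes>\<^bsub>A\<^esub> b\<rbrakk> \<Longrightarrow> a = b"
    "\<And>c. (\<And>i. i \<in> \<Lambda> \<Longrightarrow> c i \<in> carrier A) \<Longrightarrow> \<exists>a\<in>carrier A. \<forall>i\<in>\<Lambda>. \<epsilon> i \<otimes>\<^bsub>A\<^esub> a = \<epsilon> i \<otimes>\<^bsub>A\<^esub> c i"
proof -
  interpret A: ring A by (rule A)
  let ?P = "ring_product \<Lambda> A\<^sub>\<Lambda>"
  obtain h where h: "h \<in> ring_hom A ?P" and bij: "bij_betw h (carrier A) (carrier ?P)"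
    using iso by (auto simp: is_ring_iso_def ring_iso_def)
  have ring: "ring (A\<^sub>\<Lambda> i)" if "i \<in> \<Lambda>" for i using ind[OF that] by (simp add: indecomposable_ring_def)
  have P: "carrier ?P = (\<Pi>\<^sub>E i\<in>\<Lambda>. carrier (A\<^sub>\<Lambda> i))"
    "x \<otimes>\<^bsub>?P\<^esub> y = (\<lambda>i\<in>\<Lambda>. x i \<otimes>\<^bsub>A\<^sub>\<Lambda> i\<^esub> y i)" "x \<oplus>\<^bsub>?P\<^esub> y = (\<lambda>i\<in>\<Lambda>. x i \<oplus>\<^bsub>A\<^sub>\<Lambda> i\<^esub> y i)" for x y
    by (simp_all add: ring_product_def)
  have hc: "h a i \<in> carrier (A\<^sub>\<Lambda> i)" "h a \<in> carrier ?P" if "a \<in> carrier A" "i \<in> \<Lambda>" for a i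
    using ring_hom_closed[OF h that(1)] that(2) by (auto simp: P)
  have hm: "h (a \<otimes>\<^bsub>A\<^esub> b) i = h a i \<otimes>\<^bsub>A\<^sub>\<Lambda> i\<^esub> h b i" if "a \<in> carrier A" "b \<in> carrier A" "i \<in> \<Lambda>" for a b i
    using ring_hom_mult[OF h that(1,2)] that(3) by (simp add: P)
  \<comment> \<open>A ring homomorphism is required to preserve sums, products and the unit; the
    zero follows by cancelling in each coordinate ring.\<close>
  have hz: "h \<zero>\<^bsub>A\<^esub> i = \<zero>\<^bsub>A\<^sub>\<Lambda> i\<^esub>" if i: "i \<in> \<Lambda>" for i
  proof -
    interpret Ai: ring "A\<^sub>\<Lambda> i" by (rule ring[OF i])
    have "h (\<zero>\<^bsub>A\<^esub> \<oplus>\<^bsub>A\<^esub> \<zero>\<^bsub>A\<^esub>) i = h \<zero>\<^bsub>A\<^esub> i \<oplus>\<^bsub>A\<^sub>\<Lambda> i\<^esub> h \<zero>\<^bsub>A\<^esub> i"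
      by (simp only: ring_hom_add[OF h A.zero_closed A.zero_closed] P(3) restrict_apply'[OF i])
    then have "h \<zero>\<^bsub>A\<^esub> i = h \<zero>\<^bsub>A\<^esub> i \<oplus>\<^bsub>A\<^sub>\<Lambda> i\<^esub> h \<zero>\<^bsub>A\<^esub> i"
      by (simp only: A.l_zero[OF A.zero_closed])
    then show ?thesis using Ai.add.l_cancel_one'[OF hc(1)[OF A.zero_closed i] hc(1)[OF A.zero_closed i]] by blast
  qed
  have ext: "a = b" if "a \<in> carrier A" "b \<in> carrier A" "\<And>i. i \<in> \<Lambda> \<Longrightarrow> h a i = h b i" for a b
  proof -
    have "h a = h b"
      using ring_hom_closed[OF h that(1)] ring_hom_closed[OF h that(2)] that(3)
      by (intro extensionalityI[of _ \<Lambda>]) (auto simp: P PiE_def)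
    then show ?thesis using bij that by (auto simp: bij_betw_def inj_on_def)
  qed
  have lift: "\<exists>a\<in>carrier A. \<forall>i\<in>\<Lambda>. h a i = f i" if "\<And>i. i \<in> \<Lambda> \<Longrightarrow> f i \<in> carrier (A\<^sub>\<Lambda> i)" for f
  proof -
    have "restrict f \<Lambda> \<in> h ` carrier A" using bij that by (simp add: bij_betw_def P)
    then obtain a where "a \<in> carrier A" "restrict f \<Lambda> = h a" by blast
    then show ?thesis by (metis restrict_apply')
  qed
  have "\<exists>e\<in>carrier A. \<forall>i\<in>\<Lambda>. h e i = (if i = j then \<one>\<^bsub>A\<^sub>\<Lambda> i\<^esub> else \<zero>\<^bsub>A\<^sub>\<Lambda> i\<^esub>)" for j
    by (rule lift) (use ring in \<open>auto simp: ring.ring_simprules(2,6)\<close>)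
  then obtain \<epsilon> where \<epsilon>: "\<epsilon> j \<in> carrier A" "\<And>i. i \<in> \<Lambda> \<Longrightarrow> h (\<epsilon> j) i = (if i = j then \<one>\<^bsub>A\<^sub>\<Lambda> i\<^esub> else \<zero>\<^bsub>A\<^sub>\<Lambda> i\<^esub>)" for j
    by metis
  have \<epsilon>_mult: "h (\<epsilon> j \<otimes>\<^bsub>A\<^esub> a) i = (if i = j then h a i else \<zero>\<^bsub>A\<^sub>\<Lambda> i\<^esub>)"
    "h (a \<otimes>\<^bsub>A\<^esub> \<epsilon> j) i = (if i = j then h a i else \<zero>\<^bsub>A\<^sub>\<Lambda> i\<^esub>)" if "a \<in> carrier A" "i \<in> \<Lambda>" for a i j
  proof -
    have laws: "\<one>\<^bsub>A\<^sub>\<Lambda> i\<^esub> \<otimes>\<^bsub>A\<^sub>\<Lambda> i\<^esub> x = x" "x \<otimes>\<^bsub>A\<^sub>\<Lambda> i\<^esub> \<one>\<^bsub>A\<^sub>\<Lambda> i\<^esub> = x"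
      "\<zero>\<^bsub>A\<^sub>\<Lambda> i\<^esub> \<otimes>\<^bsub>A\<^sub>\<Lambda> i\<^esub> x = \<zero>\<^bsub>A\<^sub>\<Lambda> i\<^esub>" "x \<otimes>\<^bsub>A\<^sub>\<Lambda> i\<^esub> \<zero>\<^bsub>A\<^sub>\<Lambda> i\<^esub> = \<zero>\<^bsub>A\<^sub>\<Lambda> i\<^esub>"
      if "i \<in> \<Lambda>" "x \<in> carrier (A\<^sub>\<Lambda> i)" for i x
    proof -
      interpret Ai: ring "A\<^sub>\<Lambda> i" by (rule ring[OF that(1)])
      show "\<one>\<^bsub>A\<^sub>\<Lambda> i\<^esub> \<otimes>\<^bsub>A\<^sub>\<Lambda> i\<^esub> x = x" "x \<otimes>\<^bsub>A\<^sub>\<Lambda> i\<^esub> \<one>\<^bsub>A\<^sub>\<Lambda> i\<^esub> = x"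
        "\<zero>\<^bsub>A\<^sub>\<Lambda> i\<^esub> \<otimes>\<^bsub>A\<^sub>\<Lambda> i\<^esub> x = \<zero>\<^bsub>A\<^sub>\<Lambda> i\<^esub>" "x \<otimes>\<^bsub>A\<^sub>\<Lambda> i\<^esub> \<zero>\<^bsub>A\<^sub>\<Lambda> i\<^esub> = \<zero>\<^bsub>A\<^sub>\<Lambda> i\<^esub>"
        using that by simp_all
    qed
    show "h (\<epsilon> j \<otimes>\<^bsub>A\<^esub> a) i = (if i = j then h a i else \<zero>\<^bsub>A\<^sub>\<Lambda> i\<^esub>)"
      "h (a \<otimes>\<^bsub>A\<^esub> \<epsilon> j) i = (if i = j then h a i else \<zero>\<^bsub>A\<^sub>\<Lambda> i\<^esub>)"
      using that hc \<epsilon> by (auto simp: hm laws)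
  qed
  show ?thesis
  proof (rule that[of \<epsilon>])
    fix j assume j: "j \<in> \<Lambda>"
    show "\<epsilon> j \<in> central_idempotents A"
      unfolding central_idempotents_def
    proof (intro CollectI conjI ballI)
      show "\<epsilon> j \<otimes>\<^bsub>A\<^esub> \<epsilon> j = \<epsilon> j"
        by (rule ext) (use \<epsilon> j in \<open>simp_all add: \<epsilon>_mult\<close>)
      show "\<epsilon> j \<otimes>\<^bsub>A\<^esub> a = a \<otimes>\<^bsub>A\<^esub> \<epsilon> j" if "a \<in> carrier A" for a
        by (rule ext) (use \<epsilon>(1) that in \<open>simp_all add: \<epsilon>_mult\<close>)
    qed (rule \<epsilon>(1))
    fix e assume "e \<in> central_idempotents A"
    then have e: "e \<in> carrier A" "e \<otimes>\<^bsub>A\<^esub> e = e" "\<And>a. a \<in> carrier A \<Longrightarrow> e \<otimes>\<^bsub>A\<^esub> a = a \<otimes>\<^bsub>A\<^esub> e"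
      by (auto simp: central_idempotents_def)
    have "h e j \<in> central_idempotents (A\<^sub>\<Lambda> j)"
      unfolding central_idempotents_def
    proof (intro CollectI conjI ballI)
      show "h e j \<in> carrier (A\<^sub>\<Lambda> j)" using hc e(1) j by simp
      show "h e j \<otimes>\<^bsub>A\<^sub>\<Lambda> j\<^esub> h e j = h e j" using hm[OF e(1) e(1) j] e(2) by simp
      fix b assume b: "b \<in> carrier (A\<^sub>\<Lambda> j)"
      \<comment> \<open>Any b in the coordinate ring is the coordinate of some element of A, so
        centrality of e passes to its coordinate.\<close>
      have "\<exists>a\<in>carrier A. \<forall>i\<in>\<Lambda>. h a i = (if i = j then b else \<zero>\<^bsub>A\<^sub>\<Lambda> i\<^esub>)"
        by (rule lift) (use ring b in \<open>auto simp: ring.ring_simprules(2)\<close>)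
      then obtain a where "a \<in> carrier A" "h a j = b" using j by auto
      then show "h e j \<otimes>\<^bsub>A\<^sub>\<Lambda> j\<^esub> b = b \<otimes>\<^bsub>A\<^sub>\<Lambda> j\<^esub> h e j"
        using hm[OF e(1) _ j] hm[OF _ e(1) j] e(3) by metis
    qed
    then have "h e j = \<zero>\<^bsub>A\<^sub>\<Lambda> j\<^esub> \<or> h e j = \<one>\<^bsub>A\<^sub>\<Lambda> j\<^esub>"
      using ind[OF j] by (auto simp: indecomposable_ring_def)
    then show "\<epsilon> j \<otimes>\<^bsub>A\<^esub> e = \<epsilon> j \<or> \<epsilon> j \<otimes>\<^bsub>A\<^esub> e = \<zero>\<^bsub>A\<^esub>"
    proof
      assume "h e j = \<zero>\<^bsub>A\<^sub>\<Lambda> j\<^esub>"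
      then show ?thesis using e(1) \<epsilon> j by (intro disjI2, intro ext) (simp_all add: \<epsilon>_mult hz)
    next
      assume "h e j = \<one>\<^bsub>A\<^sub>\<Lambda> j\<^esub>"
      then show ?thesis using e(1) \<epsilon> j by (intro disjI1, intro ext) (simp_all add: \<epsilon>_mult)
    qed
  next
    fix a b assume ab: "a \<in> carrier A" "b \<in> carrier A" "\<And>i. i \<in> \<Lambda> \<Longrightarrow> \<epsilon> i \<otimes>\<^bsub>A\<^esub> a = \<epsilon> i \<otimes>\<^bsub>A\<^esub> b"
    show "a = b"
      by (rule ext[OF ab(1,2)]) (metis \<epsilon>_mult(1)[OF ab(1)] \<epsilon>_mult(1)[OF ab(2)] ab(3))
  next
    fix c assume c: "\<And>i. i \<in> \<Lambda> \<Longrightarrow> c i \<in> carrier A"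
    have "\<exists>a\<in>carrier A. \<forall>i\<in>\<Lambda>. h a i = h (c i) i"
      by (rule lift) (rule hc(1)[OF c])
    then obtain a where a: "a \<in> carrier A" "\<And>i. i \<in> \<Lambda> \<Longrightarrow> h a i = h (c i) i" by auto
    have "\<epsilon> i \<otimes>\<^bsub>A\<^esub> a = \<epsilon> i \<otimes>\<^bsub>A\<^esub> c i" if "i \<in> \<Lambda>" for i
      using a c[OF that] \<epsilon> that by (intro ext) (simp_all add: \<epsilon>_mult)
    with a show "\<exists>a\<in>carrier A. \<forall>i\<in>\<Lambda>. \<epsilon> i \<otimes>\<^bsub>A\<^esub> a = \<epsilon> i \<otimes>\<^bsub>A\<^esub> c i" by blast
  qed
qed

text \<open>Of the product decomposition only a separating and gluing family of minimal central
  idempotents is kept; the coordinate rings no longer appear.\<close>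

locale enveloped_product = U: unital_partial_action K A G D \<alpha> u + E: enveloping_action K A G D \<alpha> B \<beta> \<phi>
  for K :: "'k ring" and A :: "('k, 'a) module" and G :: "'g monoid"
    and D :: "'g \<Rightarrow> 'a set" and \<alpha> :: "'g \<Rightarrow> 'a \<Rightarrow> 'a" and u :: "'g \<Rightarrow> 'a"
    and B :: "('k, 'b) module" and \<beta> :: "'g \<Rightarrow> 'b \<Rightarrow> 'b" and \<phi> :: "'a \<Rightarrow> 'b" +
  fixes \<Lambda> :: "'i set" and \<epsilon> :: "'i \<Rightarrow> 'a"
  assumes \<epsilon>_central: "i \<in> \<Lambda> \<Longrightarrow> \<epsilon> i \<in> central_idempotents A"
    and \<epsilon>_minimal: "\<lbrakk>i \<in> \<Lambda>; e \<in> central_idempotents A\<rbrakk> \<Longrightarrow> \<epsilon> i \<otimes>\<^bsub>A\<^esub> e = \<epsilon> i \<or> \<epsilon> i \<otimes>\<^bsub>A\<^esub> e = \<zero>\<^bsub>A\<^esub>"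
    and \<epsilon>_separate: "\<lbrakk>a \<in> carrier A; b \<in> carrier A; \<And>i. i \<in> \<Lambda> \<Longrightarrow> \<epsilon> i \<otimes>\<^bsub>A\<^esub> a = \<epsilon> i \<otimes>\<^bsub>A\<^esub> b\<rbrakk> \<Longrightarrow> a = b"
    and \<epsilon>_glue: "(\<And>i. i \<in> \<Lambda> \<Longrightarrow> c i \<in> carrier A) \<Longrightarrow>
      \<exists>a\<in>carrier A. \<forall>i\<in>\<Lambda>. \<epsilon> i \<otimes>\<^bsub>A\<^esub> a = \<epsilon> i \<otimes>\<^bsub>A\<^esub> c i"
begin

sublocale G: word_group G by (rule word_group.intro, rule U.grp.group_axioms)

lemmas abelian_B = E.ga.alg.M.abelian_group_axioms

lemmas B_closed = E.ga.alg.alg_m_closed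
lemmas B_assoc = E.ga.alg.alg_m_assoc

lemma additive_left: "b \<in> carrier B \<Longrightarrow> additive_map B B (\<lambda>x. b \<otimes>\<^bsub>B\<^esub> x)"
  by (rule additive_mapI) (auto simp: B_closed E.ga.alg.alg_r_distr)

lemma additive_right: "b \<in> carrier B \<Longrightarrow> additive_map B B (\<lambda>x. x \<otimes>\<^bsub>B\<^esub> b)"
  by (rule additive_mapI) (auto simp: B_closed E.ga.alg.alg_l_distr)

lemma B_zero [simp]:
  "b \<in> carrier B \<Longrightarrow> b \<otimes>\<^bsub>B\<^esub> \<zero>\<^bsub>B\<^esub> = \<zero>\<^bsub>B\<^esub>" "b \<in> carrier B \<Longrightarrow> \<zero>\<^bsub>B\<^esub> \<otimes>\<^bsub>B\<^esub> b = \<zero>\<^bsub>B\<^esub>"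
  using additive_map_zero[OF abelian_B abelian_B additive_left, of b]
    additive_map_zero[OF abelian_B abelian_B additive_right, of b] by auto

lemma \<beta>_closed: "\<lbrakk>g \<in> carrier G; b \<in> carrier B\<rbrakk> \<Longrightarrow> \<beta> g b \<in> carrier B"
  and \<beta>_add: "\<lbrakk>g \<in> carrier G; b \<in> carrier B; c \<in> carrier B\<rbrakk> \<Longrightarrow> \<beta> g (b \<oplus>\<^bsub>B\<^esub> c) = \<beta> g b \<oplus>\<^bsub>B\<^esub> \<beta> g c"
  and \<beta>_prod: "\<lbrakk>g \<in> carrier G; b \<in> carrier B; c \<in> carrier B\<rbrakk> \<Longrightarrow> \<beta> g (b \<otimes>\<^bsub>B\<^esub> c) = \<beta> g b \<otimes>\<^bsub>B\<^esub> \<beta> g c"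
  and \<beta>_smult: "\<lbrakk>g \<in> carrier G; k \<in> carrier K; b \<in> carrier B\<rbrakk> \<Longrightarrow> \<beta> g (k \<odot>\<^bsub>B\<^esub> b) = k \<odot>\<^bsub>B\<^esub> \<beta> g b"
  using E.ga.hom_\<beta>[of g] by (auto simp: algebra_hom_on_def)

lemma \<beta>_additive: "g \<in> carrier G \<Longrightarrow> additive_map B B (\<beta> g)"
  by (rule additive_mapI) (auto simp: \<beta>_closed \<beta>_add)

lemma \<beta>_zero: "g \<in> carrier G \<Longrightarrow> \<beta> g \<zero>\<^bsub>B\<^esub> = \<zero>\<^bsub>B\<^esub>"
  by (rule additive_map_zero[OF abelian_B abelian_B \<beta>_additive])

lemma \<beta>_inv: "\<lbrakk>g \<in> carrier G; b \<in> carrier B\<rbrakk> \<Longrightarrow> \<beta> (inv\<^bsub>G\<^esub> g) (\<beta> g b) = b"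
  "\<lbrakk>g \<in> carrier G; b \<in> carrier B\<rbrakk> \<Longrightarrow> \<beta> g (\<beta> (inv\<^bsub>G\<^esub> g) b) = b"
  by (simp_all add: E.ga.\<beta>_comp E.ga.\<beta>_one)

lemma \<phi>_closed: "a \<in> carrier A \<Longrightarrow> \<phi> a \<in> carrier B"
  and \<phi>_add: "\<lbrakk>a \<in> carrier A; b \<in> carrier A\<rbrakk> \<Longrightarrow> \<phi> (a \<oplus>\<^bsub>A\<^esub> b) = \<phi> a \<oplus>\<^bsub>B\<^esub> \<phi> b"
  and \<phi>_prod: "\<lbrakk>a \<in> carrier A; b \<in> carrier A\<rbrakk> \<Longrightarrow> \<phi> (a \<otimes>\<^bsub>A\<^esub> b) = \<phi> a \<otimes>\<^bsub>B\<^esub> \<phi> b"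
  using E.hom_\<phi> by (auto simp: algebra_hom_on_def)

lemma \<phi>_zero: "\<phi> \<zero>\<^bsub>A\<^esub> = \<zero>\<^bsub>B\<^esub>"
  by (rule additive_map_zero[OF U.alg.is_abelian_group abelian_B])
    (auto intro!: additive_mapI simp: \<phi>_closed \<phi>_add)

lemma \<phi>_eq_iff: "\<lbrakk>a \<in> carrier A; b \<in> carrier A\<rbrakk> \<Longrightarrow> \<phi> a = \<phi> b \<longleftrightarrow> a = b"
  using E.inj_\<phi> by (auto simp: inj_on_def)

section \<open>The units of the translates of A in B\<close>

lemma central_idempotentsD:
  assumes "z \<in> central_idempotents B"
  shows "z \<in> carrier B" "z \<otimes>\<^bsub>B\<^esub> z = z" "b \<in> carrier B \<Longrightarrow> z \<otimes>\<^bsub>B\<^esub> b = b \<otimes>\<^bsub>B\<^esub> z"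
  using assms by (auto simp: central_idempotents_def)

text \<open>The unit of the ideal \<open>\<beta> g\<close> \<phi> \<open>carrier A\<close>, the
  translate of A by g. It is a central idempotent of B although B may have no unit.\<close>

definition unit_of :: "'g \<Rightarrow> 'b" where
  "unit_of g = \<beta> g (\<phi> \<one>\<^bsub>A\<^esub>)"

lemma \<phi>_ideal:
  "\<lbrakk>a \<in> carrier A; b \<in> carrier B\<rbrakk> \<Longrightarrow> \<phi> a \<otimes>\<^bsub>B\<^esub> b \<in> \<phi> ` carrier A"
  "\<lbrakk>a \<in> carrier A; b \<in> carrier B\<rbrakk> \<Longrightarrow> b \<otimes>\<^bsub>B\<^esub> \<phi> a \<in> \<phi> ` carrier A"
  using E.ideal_\<phi> unfolding two_sided_ideal_def by blast+

lemma image_\<phi>_iff: "b \<in> \<phi> ` carrier A \<longleftrightarrow> b \<in> carrier B \<and> \<phi> \<one>\<^bsub>A\<^esub> \<otimes>\<^bsub>B\<^esub> b = b"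
proof
  assume "b \<in> \<phi> ` carrier A"
  then show "b \<in> carrier B \<and> \<phi> \<one>\<^bsub>A\<^esub> \<otimes>\<^bsub>B\<^esub> b = b" by (auto simp: \<phi>_closed simp flip: \<phi>_prod)
next
  assume b: "b \<in> carrier B \<and> \<phi> \<one>\<^bsub>A\<^esub> \<otimes>\<^bsub>B\<^esub> b = b"
  then have "\<phi> \<one>\<^bsub>A\<^esub> \<otimes>\<^bsub>B\<^esub> b \<in> \<phi> ` carrier A" using \<phi>_ideal(1)[of "\<one>\<^bsub>A\<^esub>" b] by simp
  with b show "b \<in> \<phi> ` carrier A" by simp
qed

text \<open>With e the image of the unit of A, both e b and b e lie in the ideal e generates, where
  e is neutral; so both equal e b e.\<close>

lemma central_\<phi>_one: "\<phi> \<one>\<^bsub>A\<^esub> \<in> central_idempotents B"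
proof -
  have "\<phi> \<one>\<^bsub>A\<^esub> \<otimes>\<^bsub>B\<^esub> b = b \<otimes>\<^bsub>B\<^esub> \<phi> \<one>\<^bsub>A\<^esub>" if b: "b \<in> carrier B" for b
  proof -
    have "\<phi> \<one>\<^bsub>A\<^esub> \<otimes>\<^bsub>B\<^esub> b \<in> \<phi> ` carrier A" "b \<otimes>\<^bsub>B\<^esub> \<phi> \<one>\<^bsub>A\<^esub> \<in> \<phi> ` carrier A"
      using \<phi>_ideal[of "\<one>\<^bsub>A\<^esub>" b] b by auto
    then obtain a c where "a \<in> carrier A" "\<phi> \<one>\<^bsub>A\<^esub> \<otimes>\<^bsub>B\<^esub> b = \<phi> a" "c \<in> carrier A" "b \<otimes>\<^bsub>B\<^esub> \<phi> \<one>\<^bsub>A\<^esub> = \<phi> c" by blast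
    moreover have "(\<phi> \<one>\<^bsub>A\<^esub> \<otimes>\<^bsub>B\<^esub> b) \<otimes>\<^bsub>B\<^esub> \<phi> \<one>\<^bsub>A\<^esub> = \<phi> \<one>\<^bsub>A\<^esub> \<otimes>\<^bsub>B\<^esub> (b \<otimes>\<^bsub>B\<^esub> \<phi> \<one>\<^bsub>A\<^esub>)"
      using b by (simp add: B_assoc \<phi>_closed)
    ultimately show ?thesis by (simp flip: \<phi>_prod)
  qed
  then show ?thesis by (auto simp: central_idempotents_def \<phi>_closed simp flip: \<phi>_prod)
qed

lemma central_\<beta>:
  assumes z: "z \<in> central_idempotents B" and g: "g \<in> carrier G"
  shows "\<beta> g z \<in> central_idempotents B"
proof -
  note z' = central_idempotentsD[OF z]
  have "\<beta> g z \<otimes>\<^bsub>B\<^esub> b = b \<otimes>\<^bsub>B\<^esub> \<beta> g z" if b: "b \<in> carrier B" for b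
  proof -
    have c: "\<beta> (inv\<^bsub>G\<^esub> g) b \<in> carrier B" using b g by (simp add: \<beta>_closed)
    have "\<beta> g (z \<otimes>\<^bsub>B\<^esub> \<beta> (inv\<^bsub>G\<^esub> g) b) = \<beta> g (\<beta> (inv\<^bsub>G\<^esub> g) b \<otimes>\<^bsub>B\<^esub> z)" using z'(3)[OF c] by simp
    then show ?thesis using z'(1) c g b by (simp add: \<beta>_prod \<beta>_inv)
  qed
  then show ?thesis
    using z'(1,2) g by (auto simp: central_idempotents_def \<beta>_closed simp flip: \<beta>_prod)
qed

lemma central_unit_of: "g \<in> carrier G \<Longrightarrow> unit_of g \<in> central_idempotents B"
  unfolding unit_of_def by (rule central_\<beta>[OF central_\<phi>_one])

text \<open>The image of e absorbs the unit of the ideal, so commuting with b amounts to commuting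
  with its part in the ideal, which comes from A.\<close>

lemma central_\<phi>_iff:
  assumes e: "e \<in> carrier A"
  shows "\<phi> e \<in> central_idempotents B \<longleftrightarrow> e \<in> central_idempotents A"
proof
  assume "\<phi> e \<in> central_idempotents B"
  note z = central_idempotentsD[OF this]
  have "e \<otimes>\<^bsub>A\<^esub> e = e"
    using e z(2) by (intro \<phi>_eq_iff[THEN iffD1]) (auto simp: \<phi>_prod)
  moreover have "e \<otimes>\<^bsub>A\<^esub> a = a \<otimes>\<^bsub>A\<^esub> e" if "a \<in> carrier A" for a
    using e that z(3)[OF \<phi>_closed[OF that]] by (intro \<phi>_eq_iff[THEN iffD1]) (auto simp: \<phi>_prod)
  ultimately show "e \<in> central_idempotents A"
    unfolding central_idempotents_def using e by blast
next
  assume "e \<in> central_idempotents A"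
  then have e': "e \<otimes>\<^bsub>A\<^esub> e = e" "\<And>a. a \<in> carrier A \<Longrightarrow> e \<otimes>\<^bsub>A\<^esub> a = a \<otimes>\<^bsub>A\<^esub> e"
    by (auto simp: central_idempotents_def)
  have "\<phi> e \<otimes>\<^bsub>B\<^esub> b = b \<otimes>\<^bsub>B\<^esub> \<phi> e" if b: "b \<in> carrier B" for b
  proof -
    note one = central_idempotentsD[OF central_\<phi>_one]
    have "\<phi> \<one>\<^bsub>A\<^esub> \<otimes>\<^bsub>B\<^esub> b \<in> \<phi> ` carrier A" using \<phi>_ideal(1)[of "\<one>\<^bsub>A\<^esub>" b] b by simp
    then obtain a where a: "a \<in> carrier A" "\<phi> \<one>\<^bsub>A\<^esub> \<otimes>\<^bsub>B\<^esub> b = \<phi> a" by blast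
    have \<phi>e: "\<phi> e \<otimes>\<^bsub>B\<^esub> \<phi> \<one>\<^bsub>A\<^esub> = \<phi> e" "\<phi> \<one>\<^bsub>A\<^esub> \<otimes>\<^bsub>B\<^esub> \<phi> e = \<phi> e" using e by (simp_all flip: \<phi>_prod)
    have "\<phi> e \<otimes>\<^bsub>B\<^esub> b = \<phi> e \<otimes>\<^bsub>B\<^esub> (\<phi> \<one>\<^bsub>A\<^esub> \<otimes>\<^bsub>B\<^esub> b)"
      using \<phi>e(1) e b one(1) by (simp add: \<phi>_closed flip: B_assoc)
    also have "\<dots> = \<phi> (a \<otimes>\<^bsub>A\<^esub> e)" using a e e'(2)[OF a(1)] by (simp add: \<phi>_prod[symmetric])
    also have "\<dots> = (b \<otimes>\<^bsub>B\<^esub> \<phi> \<one>\<^bsub>A\<^esub>) \<otimes>\<^bsub>B\<^esub> \<phi> e" using a e one(3)[OF b] by (simp add: \<phi>_prod)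
    also have "\<dots> = b \<otimes>\<^bsub>B\<^esub> \<phi> e" using \<phi>e(2) e b one(1) by (simp add: B_assoc \<phi>_closed)
    finally show ?thesis .
  qed
  then show "\<phi> e \<in> central_idempotents B"
    using e e'(1) by (auto simp: central_idempotents_def \<phi>_closed simp flip: \<phi>_prod)
qed

text \<open>Both sides are neutral elements of the ideal that is the intersection of the image of A
  with its translate, which is the image of \<open>D g\<close>.\<close>

lemma \<phi>_u: assumes g: "g \<in> carrier G" shows "\<phi> (u g) = \<phi> \<one>\<^bsub>A\<^esub> \<otimes>\<^bsub>B\<^esub> unit_of g"
proof -
  have u: "u g \<in> carrier A" "u g \<otimes>\<^bsub>A\<^esub> u g = u g" using U.central_u[OF g] by (auto simp: central_idempotents_def)
  note one = central_idempotentsD[OF central_\<phi>_one] and eg = central_idempotentsD[OF central_unit_of[OF g]]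
  \<comment> \<open>The translate consists of the elements fixed by its unit, so the intersection is
    described by two equations.\<close>
  have mem: "b \<in> \<beta> g ` \<phi> ` carrier A \<longleftrightarrow> b \<in> carrier B \<and> unit_of g \<otimes>\<^bsub>B\<^esub> b = b" for b
  proof
    assume "b \<in> \<beta> g ` \<phi> ` carrier A"
    then obtain a where "b = \<beta> g (\<phi> a)" "a \<in> carrier A" by blast
    then show "b \<in> carrier B \<and> unit_of g \<otimes>\<^bsub>B\<^esub> b = b"
      using g by (simp add: unit_of_def \<beta>_closed \<phi>_closed flip: \<beta>_prod \<phi>_prod)
  next
    assume b: "b \<in> carrier B \<and> unit_of g \<otimes>\<^bsub>B\<^esub> b = b"
    let ?c = "\<beta> (inv\<^bsub>G\<^esub> g) b"
    have "\<beta> (inv\<^bsub>G\<^esub> g) (unit_of g \<otimes>\<^bsub>B\<^esub> b) = ?c" using b by simp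
    then have "\<phi> \<one>\<^bsub>A\<^esub> \<otimes>\<^bsub>B\<^esub> ?c = ?c" using b g one(1) by (simp add: unit_of_def \<beta>_prod \<beta>_closed \<beta>_inv)
    then have "?c \<in> \<phi> ` carrier A" using b g by (simp add: image_\<phi>_iff \<beta>_closed)
    then show "b \<in> \<beta> g ` \<phi> ` carrier A" using b g \<beta>_inv(2)[of g b] by (metis image_eqI)
  qed
  have im: "\<phi> ` D g = {b \<in> carrier B. \<phi> \<one>\<^bsub>A\<^esub> \<otimes>\<^bsub>B\<^esub> b = b \<and> unit_of g \<otimes>\<^bsub>B\<^esub> b = b}"
    unfolding E.image_D[OF g] using image_\<phi>_iff mem by blast
  have "u g \<in> D g" using U.D_eq[OF g] u by force
  then have 1: "\<phi> \<one>\<^bsub>A\<^esub> \<otimes>\<^bsub>B\<^esub> \<phi> (u g) = \<phi> (u g)" "unit_of g \<otimes>\<^bsub>B\<^esub> \<phi> (u g) = \<phi> (u g)" using im by auto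
  have "\<phi> \<one>\<^bsub>A\<^esub> \<otimes>\<^bsub>B\<^esub> unit_of g \<in> \<phi> ` D g"
    unfolding im
  proof (intro CollectI conjI)
    show "\<phi> \<one>\<^bsub>A\<^esub> \<otimes>\<^bsub>B\<^esub> (\<phi> \<one>\<^bsub>A\<^esub> \<otimes>\<^bsub>B\<^esub> unit_of g) = \<phi> \<one>\<^bsub>A\<^esub> \<otimes>\<^bsub>B\<^esub> unit_of g"
      using one(1,2) eg(1) by (simp flip: B_assoc)
    show "unit_of g \<otimes>\<^bsub>B\<^esub> (\<phi> \<one>\<^bsub>A\<^esub> \<otimes>\<^bsub>B\<^esub> unit_of g) = \<phi> \<one>\<^bsub>A\<^esub> \<otimes>\<^bsub>B\<^esub> unit_of g"
      using one(1) eg(1,2) by (simp add: eg(3)[OF B_closed[OF one(1) eg(1)]] B_assoc)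
  qed (rule B_closed[OF one(1) eg(1)])
  then obtain a where a: "a \<in> carrier A" "\<phi> \<one>\<^bsub>A\<^esub> \<otimes>\<^bsub>B\<^esub> unit_of g = \<phi> (u g \<otimes>\<^bsub>A\<^esub> a)" using U.D_eq[OF g] by auto
  have "\<phi> (u g) \<otimes>\<^bsub>B\<^esub> \<phi> (u g \<otimes>\<^bsub>A\<^esub> a) = \<phi> (u g \<otimes>\<^bsub>A\<^esub> a)"
    using a(1) u by (simp add: U.alg.m_assoc[symmetric] flip: \<phi>_prod)
  moreover have "\<phi> (u g) \<otimes>\<^bsub>B\<^esub> (\<phi> \<one>\<^bsub>A\<^esub> \<otimes>\<^bsub>B\<^esub> unit_of g) = \<phi> (u g)"
    using 1 one(3)[OF \<phi>_closed[OF u(1)]] eg(3)[OF \<phi>_closed[OF u(1)]] one(1) eg(1) u(1)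
    by (simp only: \<phi>_closed B_assoc[symmetric])
  ultimately show ?thesis using a(2) by simp
qed

end

section \<open>Points of B, their stars, and separation of elements\<close>

context enveloped_product
begin

text \<open>Points are elements of B rather than pairs (g, i), because different pairs may give the
  same idempotent.\<close>

definition points :: "'b set" where
  "points = {\<beta> g (\<phi> (\<epsilon> i)) | g i. g \<in> carrier G \<and> i \<in> \<Lambda>}"

definition star :: "'b \<Rightarrow> 'g set" where
  "star x = {g \<in> carrier G. x \<otimes>\<^bsub>B\<^esub> unit_of g = x}"

text \<open>The ideal x B, described as the set of elements on which the idempotent x is
  neutral.\<close>

definition V :: "'b \<Rightarrow> 'b set" where
  "V x = {b \<in> carrier B. x \<otimes>\<^bsub>B\<^esub> b = b}"

lemma \<epsilon>_closed: "i \<in> \<Lambda> \<Longrightarrow> \<epsilon> i \<in> carrier A"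
  using \<epsilon>_central by (auto simp: central_idempotents_def)

lemma points_central: "x \<in> points \<Longrightarrow> x \<in> central_idempotents B"
  unfolding points_def using central_\<beta> central_\<phi>_iff \<epsilon>_closed \<epsilon>_central by blast

lemmas pointD = central_idempotentsD[OF points_central]

lemma \<phi>\<epsilon>_point: "i \<in> \<Lambda> \<Longrightarrow> \<phi> (\<epsilon> i) \<in> points"
  unfolding points_def using E.ga.\<beta>_one[OF \<phi>_closed[OF \<epsilon>_closed]] by force

lemma \<beta>_point: "\<lbrakk>g \<in> carrier G; x \<in> points\<rbrakk> \<Longrightarrow> \<beta> g x \<in> points"
proof -
  assume g: "g \<in> carrier G" and "x \<in> points"
  then obtain h i where "h \<in> carrier G" "i \<in> \<Lambda>" "x = \<beta> h (\<phi> (\<epsilon> i))" by (auto simp: points_def)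
  then have "\<beta> g x = \<beta> (g \<otimes>\<^bsub>G\<^esub> h) (\<phi> (\<epsilon> i))" "g \<otimes>\<^bsub>G\<^esub> h \<in> carrier G" "i \<in> \<Lambda>"
    using g by (auto simp: E.ga.\<beta>_comp \<phi>_closed \<epsilon>_closed)
  then show "\<beta> g x \<in> points" unfolding points_def by blast
qed

lemma \<phi>_one_\<phi>: "a \<in> carrier A \<Longrightarrow> \<phi> \<one>\<^bsub>A\<^esub> \<otimes>\<^bsub>B\<^esub> \<phi> a = \<phi> a" "a \<in> carrier A \<Longrightarrow> \<phi> a \<otimes>\<^bsub>B\<^esub> \<phi> \<one>\<^bsub>A\<^esub> = \<phi> a"
  by (simp_all flip: \<phi>_prod)

text \<open>Translating back moves x to the image of some \<epsilon> i. Cutting the translated z by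
  the image of the unit of A gives a central idempotent coming from A, to which minimality of
  \<epsilon> i applies.\<close>

lemma point_minimal:
  assumes x: "x \<in> points" and z: "z \<in> central_idempotents B"
  shows "x \<otimes>\<^bsub>B\<^esub> z = x \<or> x \<otimes>\<^bsub>B\<^esub> z = \<zero>\<^bsub>B\<^esub>"
proof -
  obtain g i where g: "g \<in> carrier G" and i: "i \<in> \<Lambda>" and x': "x = \<beta> g (\<phi> (\<epsilon> i))"
    using x by (auto simp: points_def)
  let ?y = "\<beta> (inv\<^bsub>G\<^esub> g) z"
  have y: "?y \<in> central_idempotents B" using central_\<beta>[OF z] g by simp
  note y' = central_idempotentsD[OF y] and one = central_idempotentsD[OF central_\<phi>_one]
  note ei = \<phi>_closed[OF \<epsilon>_closed[OF i]]
  obtain e where e: "e \<in> carrier A" "\<phi> \<one>\<^bsub>A\<^esub> \<otimes>\<^bsub>B\<^esub> ?y = \<phi> e" using \<phi>_ideal(1)[of "\<one>\<^bsub>A\<^esub>" ?y] y'(1) by auto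
  have "(\<phi> \<one>\<^bsub>A\<^esub> \<otimes>\<^bsub>B\<^esub> ?y) \<otimes>\<^bsub>B\<^esub> (\<phi> \<one>\<^bsub>A\<^esub> \<otimes>\<^bsub>B\<^esub> ?y) = (\<phi> \<one>\<^bsub>A\<^esub> \<otimes>\<^bsub>B\<^esub> ?y) \<otimes>\<^bsub>B\<^esub> (?y \<otimes>\<^bsub>B\<^esub> \<phi> \<one>\<^bsub>A\<^esub>)"
    by (simp only: one(3)[OF y'(1)])
  also have "\<dots> = \<phi> \<one>\<^bsub>A\<^esub> \<otimes>\<^bsub>B\<^esub> ((?y \<otimes>\<^bsub>B\<^esub> ?y) \<otimes>\<^bsub>B\<^esub> \<phi> \<one>\<^bsub>A\<^esub>)"
    using y'(1) one(1) by (simp add: B_assoc B_closed)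
  also have "\<dots> = \<phi> \<one>\<^bsub>A\<^esub> \<otimes>\<^bsub>B\<^esub> (\<phi> \<one>\<^bsub>A\<^esub> \<otimes>\<^bsub>B\<^esub> ?y)" by (simp only: y'(2) one(3)[OF y'(1)])
  also have "\<dots> = (\<phi> \<one>\<^bsub>A\<^esub> \<otimes>\<^bsub>B\<^esub> \<phi> \<one>\<^bsub>A\<^esub>) \<otimes>\<^bsub>B\<^esub> ?y" using y'(1) one(1) by (simp add: B_assoc)
  also have "\<dots> = \<phi> e" by (simp only: one(2) e(2))
  finally have "\<phi> e \<otimes>\<^bsub>B\<^esub> \<phi> e = \<phi> e" by (simp only: e(2))
  moreover have "\<phi> e \<otimes>\<^bsub>B\<^esub> b = b \<otimes>\<^bsub>B\<^esub> \<phi> e" if b: "b \<in> carrier B" for b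
  proof -
    have "(\<phi> \<one>\<^bsub>A\<^esub> \<otimes>\<^bsub>B\<^esub> ?y) \<otimes>\<^bsub>B\<^esub> b = \<phi> \<one>\<^bsub>A\<^esub> \<otimes>\<^bsub>B\<^esub> (?y \<otimes>\<^bsub>B\<^esub> b)" using b one(1) y'(1) by (simp add: B_assoc)
    also have "\<dots> = \<phi> \<one>\<^bsub>A\<^esub> \<otimes>\<^bsub>B\<^esub> (b \<otimes>\<^bsub>B\<^esub> ?y)" by (simp only: y'(3)[OF b])
    also have "\<dots> = (\<phi> \<one>\<^bsub>A\<^esub> \<otimes>\<^bsub>B\<^esub> b) \<otimes>\<^bsub>B\<^esub> ?y" using b one(1) y'(1) by (simp add: B_assoc)
    also have "\<dots> = (b \<otimes>\<^bsub>B\<^esub> \<phi> \<one>\<^bsub>A\<^esub>) \<otimes>\<^bsub>B\<^esub> ?y" by (simp only: one(3)[OF b])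
    also have "\<dots> = b \<otimes>\<^bsub>B\<^esub> (\<phi> \<one>\<^bsub>A\<^esub> \<otimes>\<^bsub>B\<^esub> ?y)" using b one(1) y'(1) by (simp add: B_assoc)
    finally show ?thesis by (simp only: e(2))
  qed
  ultimately have "\<phi> e \<in> central_idempotents B"
    unfolding central_idempotents_def using \<phi>_closed[OF e(1)] by blast
  then have "e \<in> central_idempotents A" using central_\<phi>_iff[OF e(1)] by blast
  then have "\<epsilon> i \<otimes>\<^bsub>A\<^esub> e = \<epsilon> i \<or> \<epsilon> i \<otimes>\<^bsub>A\<^esub> e = \<zero>\<^bsub>A\<^esub>" by (rule \<epsilon>_minimal[OF i])
  then have "\<phi> (\<epsilon> i) \<otimes>\<^bsub>B\<^esub> \<phi> e = \<phi> (\<epsilon> i) \<or> \<phi> (\<epsilon> i) \<otimes>\<^bsub>B\<^esub> \<phi> e = \<zero>\<^bsub>B\<^esub>"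
    using e(1) \<epsilon>_closed[OF i] \<phi>_zero by (metis \<phi>_prod)
  moreover have "\<phi> (\<epsilon> i) \<otimes>\<^bsub>B\<^esub> \<phi> e = \<phi> (\<epsilon> i) \<otimes>\<^bsub>B\<^esub> ?y"
    unfolding e(2)[symmetric] using ei one(1) y'(1) \<phi>_one_\<phi>(2)[OF \<epsilon>_closed[OF i]] by (simp flip: B_assoc)
  moreover have "x \<otimes>\<^bsub>B\<^esub> z = \<beta> g (\<phi> (\<epsilon> i) \<otimes>\<^bsub>B\<^esub> ?y)"
    using x' g ei y'(1) central_idempotentsD(1)[OF z] by (simp add: \<beta>_prod \<beta>_inv)
  ultimately show ?thesis using x' \<beta>_zero[OF g] by auto
qed

text \<open>If x y is not zero, minimality of each of x and y gives x y = x and y x = y, and the two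
  products agree.\<close>

lemma point_eq_or_disjoint:
  assumes "x \<in> points" "y \<in> points" "x \<noteq> y" shows "x \<otimes>\<^bsub>B\<^esub> y = \<zero>\<^bsub>B\<^esub>"
proof (rule ccontr)
  assume "x \<otimes>\<^bsub>B\<^esub> y \<noteq> \<zero>\<^bsub>B\<^esub>"
  then have "x \<otimes>\<^bsub>B\<^esub> y = x" "y \<otimes>\<^bsub>B\<^esub> x = y"
    using point_minimal[OF assms(1) points_central[OF assms(2)]] point_minimal[OF assms(2) points_central[OF assms(1)]]
      pointD(3)[OF assms(1) pointD(1)[OF assms(2)]] by auto
  with assms(3) show False using pointD(3)[OF assms(1) pointD(1)[OF assms(2)]] by simp
qed

lemma unit_of_one: "unit_of \<one>\<^bsub>G\<^esub> = \<phi> \<one>\<^bsub>A\<^esub>"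
  by (simp add: unit_of_def E.ga.\<beta>_one \<phi>_closed)

lemma \<beta>_unit_of: "\<lbrakk>g \<in> carrier G; h \<in> carrier G\<rbrakk> \<Longrightarrow> \<beta> g (unit_of h) = unit_of (g \<otimes>\<^bsub>G\<^esub> h)"
  by (simp add: unit_of_def E.ga.\<beta>_comp \<phi>_closed)

lemma unit_of_closed: "g \<in> carrier G \<Longrightarrow> unit_of g \<in> carrier B"
  by (rule central_idempotentsD(1)[OF central_unit_of])

lemma not_star: "\<lbrakk>x \<in> points; g \<in> carrier G; g \<notin> star x\<rbrakk> \<Longrightarrow> x \<otimes>\<^bsub>B\<^esub> unit_of g = \<zero>\<^bsub>B\<^esub>"
  using point_minimal[OF _ central_unit_of] by (auto simp: star_def)

lemma star_nonempty: assumes "x \<in> points" shows "star x \<noteq> {}"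
proof -
  obtain g i where g: "g \<in> carrier G" and i: "i \<in> \<Lambda>" and x': "x = \<beta> g (\<phi> (\<epsilon> i))"
    using assms by (auto simp: points_def)
  have "x \<otimes>\<^bsub>B\<^esub> unit_of g = x"
    unfolding x' unit_of_def using g \<epsilon>_closed[OF i] by (simp add: \<phi>_closed flip: \<beta>_prod \<phi>_prod)
  then show ?thesis using g by (auto simp: star_def)
qed

lemma star_mult:
  assumes "g \<in> carrier G" "h \<in> carrier G" "x \<in> points"
  shows "h \<otimes>\<^bsub>G\<^esub> g \<in> star (\<beta> h x) \<longleftrightarrow> g \<in> star x"
proof -
  note x = pointD(1)[OF assms(3)] and ug = unit_of_closed[OF assms(1)]
  have "\<beta> h x \<otimes>\<^bsub>B\<^esub> unit_of (h \<otimes>\<^bsub>G\<^esub> g) = \<beta> h (x \<otimes>\<^bsub>B\<^esub> unit_of g)"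
    using assms x ug by (simp add: \<beta>_prod \<beta>_unit_of)
  moreover have "\<beta> h (x \<otimes>\<^bsub>B\<^esub> unit_of g) = \<beta> h x \<longleftrightarrow> x \<otimes>\<^bsub>B\<^esub> unit_of g = x"
    using \<beta>_inv(1)[OF assms(2) B_closed[OF x ug]] \<beta>_inv(1)[OF assms(2) x] by metis
  ultimately show ?thesis using assms by (simp add: star_def)
qed

lemma V_minus:
  assumes "x \<in> points" "v \<in> V x" "v' \<in> V x" shows "v \<ominus>\<^bsub>B\<^esub> v' \<in> V x"
proof -
  have "v \<in> carrier B" "v' \<in> carrier B" "x \<otimes>\<^bsub>B\<^esub> v = v" "x \<otimes>\<^bsub>B\<^esub> v' = v'" using assms by (auto simp: V_def)
  then show ?thesis
    using additive_map_minus[OF abelian_B abelian_B additive_left[OF pointD(1)[OF assms(1)]]]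
    by (simp add: V_def E.ga.alg.M.minus_closed)
qed

lemma \<beta>_V: "\<lbrakk>g \<in> carrier G; x \<in> points; v \<in> V x\<rbrakk> \<Longrightarrow> \<beta> g v \<in> V (\<beta> g x)"
  by (auto simp: V_def \<beta>_closed pointD(1) simp flip: \<beta>_prod)

lemma mult_point_V: "\<lbrakk>x \<in> points; b \<in> carrier B\<rbrakk> \<Longrightarrow> x \<otimes>\<^bsub>B\<^esub> b \<in> V x"
  using pointD(1,2) by (simp add: V_def B_closed flip: B_assoc)

lemma star_one_\<phi>\<epsilon>: "i \<in> \<Lambda> \<Longrightarrow> \<one>\<^bsub>G\<^esub> \<in> star (\<phi> (\<epsilon> i))"
  by (simp add: star_def unit_of_one \<phi>_one_\<phi> \<epsilon>_closed)

text \<open>The images of the \<epsilon> i are among the points with 1 in their star, and they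
  already separate the elements of A.\<close>

lemma coordinates_inj:
  assumes a: "a \<in> carrier A" "b \<in> carrier A"
    and eq: "\<And>x. x \<in> points \<Longrightarrow> \<one>\<^bsub>G\<^esub> \<in> star x \<Longrightarrow> x \<otimes>\<^bsub>B\<^esub> \<phi> a = x \<otimes>\<^bsub>B\<^esub> \<phi> b"
  shows "a = b"
proof (rule \<epsilon>_separate[OF a])
  fix i assume i: "i \<in> \<Lambda>"
  have "\<phi> (\<epsilon> i \<otimes>\<^bsub>A\<^esub> a) = \<phi> (\<epsilon> i \<otimes>\<^bsub>A\<^esub> b)"
    using eq[OF \<phi>\<epsilon>_point[OF i] star_one_\<phi>\<epsilon>[OF i]] a \<epsilon>_closed[OF i] by (simp add: \<phi>_prod)
  then show "\<epsilon> i \<otimes>\<^bsub>A\<^esub> a = \<epsilon> i \<otimes>\<^bsub>A\<^esub> b" using \<phi>_eq_iff a \<epsilon>_closed[OF i] by simp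
qed

text \<open>The values at the images of the \<epsilon> i can be prescribed by gluing in A. There are
  no further conditions, because every nonzero point with 1 in its star is one of these
  images.\<close>

lemma coordinates_surj:
  assumes f: "\<And>x. x \<in> points \<Longrightarrow> \<one>\<^bsub>G\<^esub> \<in> star x \<Longrightarrow> f x \<in> V x"
  shows "\<exists>a\<in>carrier A. \<forall>x\<in>points. \<one>\<^bsub>G\<^esub> \<in> star x \<longrightarrow> x \<otimes>\<^bsub>B\<^esub> \<phi> a = f x"
proof -
  note one = central_idempotentsD[OF central_\<phi>_one]
  have "\<exists>c\<in>carrier A. \<phi> c = f (\<phi> (\<epsilon> i))" if i: "i \<in> \<Lambda>" for i
  proof -
    have "f (\<phi> (\<epsilon> i)) \<in> carrier B" "\<phi> (\<epsilon> i) \<otimes>\<^bsub>B\<^esub> f (\<phi> (\<epsilon> i)) = f (\<phi> (\<epsilon> i))"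
      using f[OF \<phi>\<epsilon>_point[OF i] star_one_\<phi>\<epsilon>[OF i]] by (auto simp: V_def)
    then have "f (\<phi> (\<epsilon> i)) \<in> \<phi> ` carrier A" using \<phi>_ideal(1)[OF \<epsilon>_closed[OF i], of "f (\<phi> (\<epsilon> i))"] by simp
    then show ?thesis by force
  qed
  then obtain c where c: "\<And>i. i \<in> \<Lambda> \<Longrightarrow> c i \<in> carrier A \<and> \<phi> (c i) = f (\<phi> (\<epsilon> i))" by metis
  have "\<exists>a\<in>carrier A. \<forall>i\<in>\<Lambda>. \<epsilon> i \<otimes>\<^bsub>A\<^esub> a = \<epsilon> i \<otimes>\<^bsub>A\<^esub> c i"
    by (rule \<epsilon>_glue) (simp add: c)
  then obtain a where a: "a \<in> carrier A" "\<And>i. i \<in> \<Lambda> \<Longrightarrow> \<epsilon> i \<otimes>\<^bsub>A\<^esub> a = \<epsilon> i \<otimes>\<^bsub>A\<^esub> c i" by auto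
  have *: "\<phi> (\<epsilon> i) \<otimes>\<^bsub>B\<^esub> \<phi> a = f (\<phi> (\<epsilon> i))" if i: "i \<in> \<Lambda>" for i
  proof -
    have "\<phi> (\<epsilon> i) \<otimes>\<^bsub>B\<^esub> \<phi> a = \<phi> (\<epsilon> i \<otimes>\<^bsub>A\<^esub> c i)" using a(1) a(2)[OF i] \<epsilon>_closed[OF i] by (simp flip: \<phi>_prod)
    also have "\<dots> = \<phi> (\<epsilon> i) \<otimes>\<^bsub>B\<^esub> f (\<phi> (\<epsilon> i))" using c[OF i] \<epsilon>_closed[OF i] by (simp add: \<phi>_prod)
    finally show ?thesis using f[OF \<phi>\<epsilon>_point[OF i] star_one_\<phi>\<epsilon>[OF i]] by (simp add: V_def)
  qed
  have "x \<otimes>\<^bsub>B\<^esub> \<phi> a = f x" if x: "x \<in> points" "\<one>\<^bsub>G\<^esub> \<in> star x" for x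
  proof (cases "x = \<zero>\<^bsub>B\<^esub>")
    \<comment> \<open>The locale does not exclude zero as a point; there both sides vanish.\<close>
    case True
    have "f x \<in> carrier B" "x \<otimes>\<^bsub>B\<^esub> f x = f x" using f[OF x] by (auto simp: V_def)
    then show ?thesis using True a(1) by (simp add: \<phi>_closed)
  next
    case False
    note xD = pointD[OF x(1)]
    have "x \<otimes>\<^bsub>B\<^esub> \<phi> \<one>\<^bsub>A\<^esub> = x" using x(2) by (simp add: star_def unit_of_one)
    then obtain e where e: "e \<in> carrier A" "x = \<phi> e" using \<phi>_ideal(2)[of "\<one>\<^bsub>A\<^esub>" x] xD(1) by auto
    \<comment> \<open>x comes from A and is not zero, so some \<epsilon> i does not annihilate it;
      distinct points annihilate each other, so x is the image of that \<epsilon> i.\<close>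
    have "\<exists>i\<in>\<Lambda>. \<epsilon> i \<otimes>\<^bsub>A\<^esub> e \<noteq> \<zero>\<^bsub>A\<^esub>"
    proof (rule ccontr)
      assume "\<not> (\<exists>i\<in>\<Lambda>. \<epsilon> i \<otimes>\<^bsub>A\<^esub> e \<noteq> \<zero>\<^bsub>A\<^esub>)"
      then have "e = \<zero>\<^bsub>A\<^esub>"
        by (intro \<epsilon>_separate[OF e(1) U.alg.zero_closed]) (simp add: \<epsilon>_closed)
      with False e(2) \<phi>_zero show False by simp
    qed
    then obtain i where i: "i \<in> \<Lambda>" "\<epsilon> i \<otimes>\<^bsub>A\<^esub> e \<noteq> \<zero>\<^bsub>A\<^esub>" by blast
    have "\<phi> (\<epsilon> i) \<otimes>\<^bsub>B\<^esub> x = \<phi> (\<epsilon> i \<otimes>\<^bsub>A\<^esub> e)" using e \<epsilon>_closed[OF i(1)] by (simp add: \<phi>_prod)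
    moreover have "\<phi> (\<epsilon> i \<otimes>\<^bsub>A\<^esub> e) \<noteq> \<zero>\<^bsub>B\<^esub>"
      using i(2) \<phi>_eq_iff[of "\<epsilon> i \<otimes>\<^bsub>A\<^esub> e" "\<zero>\<^bsub>A\<^esub>"] e \<epsilon>_closed[OF i(1)] \<phi>_zero by simp
    ultimately have "x = \<phi> (\<epsilon> i)" using point_eq_or_disjoint[OF \<phi>\<epsilon>_point[OF i(1)] x(1)] by metis
    then show ?thesis using *[OF i(1)] by simp
  qed
  with a(1) show ?thesis by blast
qed

lemma unit_of_range:
  assumes "g \<in> carrier G" "b \<in> carrier B" "unit_of g \<otimes>\<^bsub>B\<^esub> b = b"
  obtains a where "a \<in> carrier A" "b = \<beta> g (\<phi> a)"
proof -
  let ?c = "\<beta> (inv\<^bsub>G\<^esub> g) b"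
  have c: "?c \<in> carrier B" using assms by (simp add: \<beta>_closed)
  have "\<beta> (inv\<^bsub>G\<^esub> g) (unit_of g \<otimes>\<^bsub>B\<^esub> b) = \<phi> \<one>\<^bsub>A\<^esub> \<otimes>\<^bsub>B\<^esub> ?c"
    using assms(1,2) by (simp add: \<beta>_prod unit_of_closed \<beta>_unit_of unit_of_one)
  then have "?c \<in> \<phi> ` carrier A" using assms(3) c by (simp add: image_\<phi>_iff)
  then obtain a where "a \<in> carrier A" "?c = \<phi> a" by blast
  then show ?thesis using that \<beta>_inv(2)[OF assms(1,2)] by metis
qed

text \<open>An element of one translate is moved back into A, where points separate.\<close>

lemma local_separation:
  assumes g: "g \<in> carrier G" and b: "b \<in> carrier B" "unit_of g \<otimes>\<^bsub>B\<^esub> b = b"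
    and zero: "\<And>x. x \<in> points \<Longrightarrow> x \<otimes>\<^bsub>B\<^esub> b = \<zero>\<^bsub>B\<^esub>"
  shows "b = \<zero>\<^bsub>B\<^esub>"
proof -
  obtain a where a: "a \<in> carrier A" "b = \<beta> g (\<phi> a)" using unit_of_range[OF g b] .
  have "a = \<zero>\<^bsub>A\<^esub>"
  proof (rule coordinates_inj[OF a(1)])
    fix x assume x: "x \<in> points"
    note xc = pointD(1)[OF x]
    have "\<beta> g (x \<otimes>\<^bsub>B\<^esub> \<phi> a) = \<zero>\<^bsub>B\<^esub>"
      using zero[OF \<beta>_point[OF g x]] a g xc by (simp add: \<beta>_prod \<phi>_closed)
    then have "x \<otimes>\<^bsub>B\<^esub> \<phi> a = \<beta> (inv\<^bsub>G\<^esub> g) \<zero>\<^bsub>B\<^esub>"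
      using \<beta>_inv(1)[OF g B_closed[OF xc \<phi>_closed[OF a(1)]]] by simp
    then show "x \<otimes>\<^bsub>B\<^esub> \<phi> a = x \<otimes>\<^bsub>B\<^esub> \<phi> \<zero>\<^bsub>A\<^esub>" using g xc by (simp add: \<beta>_zero \<phi>_zero)
  qed simp
  then show ?thesis using a(2) \<phi>_zero \<beta>_zero[OF g] by simp
qed

text \<open>The equation for the unit of h expresses \<open>c h\<close> through the remaining
  summands, so the sum equals the sum of the terms
  \<open>c g \<ominus> unit_of h \<otimes> c g\<close>. These are again fixed by their units, and
  the index set has become smaller.\<close>

lemma finite_sum_separation:
  assumes "finite S" "S \<subseteq> carrier G"
    and "\<And>g. g \<in> S \<Longrightarrow> c g \<in> carrier B \<and> unit_of g \<otimes>\<^bsub>B\<^esub> c g = c g"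
    and "\<And>g. g \<in> S \<Longrightarrow> unit_of g \<otimes>\<^bsub>B\<^esub> finsum B c S = \<zero>\<^bsub>B\<^esub>"
  shows "finsum B c S = \<zero>\<^bsub>B\<^esub>"
  using assms
proof (induction S arbitrary: c rule: finite_induct)
  case empty
  show ?case by simp
next
  case (insert h S)
  let ?b = "finsum B c S"
  have h: "h \<in> carrier G" "c h \<in> carrier B" "unit_of h \<otimes>\<^bsub>B\<^esub> c h = c h" using insert.prems by auto
  note uh = central_idempotentsD[OF central_unit_of[OF h(1)]]
  have cS: "c \<in> S \<rightarrow> carrier B" using insert.prems by auto
  then have b: "?b \<in> carrier B" by (rule E.ga.alg.M.finsum_closed)
  have ins: "finsum B c (insert h S) = c h \<oplus>\<^bsub>B\<^esub> ?b" using insert.hyps cS h by simp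
  let ?f = "\<lambda>v. v \<ominus>\<^bsub>B\<^esub> unit_of h \<otimes>\<^bsub>B\<^esub> v"
  have "unit_of h \<otimes>\<^bsub>B\<^esub> (c h \<oplus>\<^bsub>B\<^esub> ?b) = \<zero>\<^bsub>B\<^esub>" using insert.prems(3)[of h] ins by simp
  then have "c h \<oplus>\<^bsub>B\<^esub> unit_of h \<otimes>\<^bsub>B\<^esub> ?b = \<zero>\<^bsub>B\<^esub>"
    using additive_map_add[OF additive_left[OF uh(1)] h(2) b] h(3) by simp
  then have ch: "c h = \<ominus>\<^bsub>B\<^esub> (unit_of h \<otimes>\<^bsub>B\<^esub> ?b)"
    using E.ga.alg.M.minus_equality[OF _ B_closed[OF uh(1) b] h(2)] by simp
  have f: "additive_map B B ?f"
  proof (rule additive_mapI)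
    fix v w assume v: "v \<in> carrier B" and w: "w \<in> carrier B"
    show "?f (v \<oplus>\<^bsub>B\<^esub> w) = ?f v \<oplus>\<^bsub>B\<^esub> ?f w"
      using v w uh(1) B_closed[OF uh(1) v] B_closed[OF uh(1) w]
      by (simp add: additive_map_add[OF additive_left[OF uh(1)]] E.ga.alg.M.minus_eq E.ga.alg.M.minus_add E.ga.alg.M.a_ac)
  qed (use uh(1) in \<open>auto intro!: E.ga.alg.M.minus_closed B_closed\<close>)
  have "finsum B c (insert h S) = ?f ?b"
    using ins ch b B_closed[OF uh(1) b] by (simp add: E.ga.alg.M.minus_eq E.ga.alg.M.a_comm)
  also have "?f ?b = finsum B (\<lambda>g. ?f (c g)) S"
    by (rule additive_map_finsum[OF abelian_B abelian_B f cS])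
  finally have eq: "finsum B c (insert h S) = finsum B (\<lambda>g. ?f (c g)) S" .
  have "finsum B (\<lambda>g. ?f (c g)) S = \<zero>\<^bsub>B\<^esub>"
  proof (rule insert.IH)
    fix g assume g: "g \<in> S"
    then have gc: "g \<in> carrier G" "c g \<in> carrier B" "unit_of g \<otimes>\<^bsub>B\<^esub> c g = c g" using insert.prems by auto
    note ug = central_idempotentsD[OF central_unit_of[OF gc(1)]]
    have "unit_of g \<otimes>\<^bsub>B\<^esub> (unit_of h \<otimes>\<^bsub>B\<^esub> c g) = (unit_of g \<otimes>\<^bsub>B\<^esub> unit_of h) \<otimes>\<^bsub>B\<^esub> c g"
      using ug(1) uh(1) gc by (simp add: B_assoc)
    also have "\<dots> = unit_of h \<otimes>\<^bsub>B\<^esub> c g"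
      unfolding ug(3)[OF uh(1)] using ug(1) uh(1) gc by (simp add: B_assoc)
    finally have "unit_of g \<otimes>\<^bsub>B\<^esub> ?f (c g) = ?f (c g)"
      using additive_map_minus[OF abelian_B abelian_B additive_left[OF ug(1)] gc(2) B_closed[OF uh(1) gc(2)]] gc(3)
      by simp
    then show "?f (c g) \<in> carrier B \<and> unit_of g \<otimes>\<^bsub>B\<^esub> ?f (c g) = ?f (c g)"
      using additive_map_closed[OF f gc(2)] by simp
    show "unit_of g \<otimes>\<^bsub>B\<^esub> finsum B (\<lambda>g. ?f (c g)) S = \<zero>\<^bsub>B\<^esub>"
      using insert.prems(3)[of g] g eq by simp
  qed (use insert.prems in auto)
  then show ?case using eq by simp
qed

text \<open>If all components of b vanish, so does its product with the unit of each translate.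
  Since B may have no unit, this becomes b = 0 only by writing b as a finite sum over
  translates.\<close>

lemma separation:
  assumes b: "b \<in> carrier B" and zero: "\<And>x. x \<in> points \<Longrightarrow> x \<otimes>\<^bsub>B\<^esub> b = \<zero>\<^bsub>B\<^esub>"
  shows "b = \<zero>\<^bsub>B\<^esub>"
proof -
  obtain S c where S: "finite S" "S \<subseteq> carrier G" "c \<in> S \<rightarrow> carrier A" "b = finsum B (\<lambda>g. \<beta> g (\<phi> (c g))) S"
    using E.sum_\<phi>[OF b] by blast
  have "unit_of g \<otimes>\<^bsub>B\<^esub> b = \<zero>\<^bsub>B\<^esub>" if g: "g \<in> carrier G" for g
  proof (rule local_separation[OF g])
    note ug = central_idempotentsD[OF central_unit_of[OF g]]
    show "unit_of g \<otimes>\<^bsub>B\<^esub> b \<in> carrier B" by (rule B_closed[OF ug(1) b])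
    show "unit_of g \<otimes>\<^bsub>B\<^esub> (unit_of g \<otimes>\<^bsub>B\<^esub> b) = unit_of g \<otimes>\<^bsub>B\<^esub> b" using ug(1,2) b by (simp flip: B_assoc)
    fix x assume x: "x \<in> points"
    note xc = pointD(1)[OF x]
    have "x \<otimes>\<^bsub>B\<^esub> (unit_of g \<otimes>\<^bsub>B\<^esub> b) = (unit_of g \<otimes>\<^bsub>B\<^esub> x) \<otimes>\<^bsub>B\<^esub> b"
      unfolding ug(3)[OF xc] using xc ug(1) b by (simp add: B_assoc)
    also have "\<dots> = unit_of g \<otimes>\<^bsub>B\<^esub> (x \<otimes>\<^bsub>B\<^esub> b)" using xc ug(1) b by (simp add: B_assoc)
    finally show "x \<otimes>\<^bsub>B\<^esub> (unit_of g \<otimes>\<^bsub>B\<^esub> b) = \<zero>\<^bsub>B\<^esub>" using zero[OF x] ug(1) by simp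
  qed
  moreover have "\<beta> g (\<phi> (c g)) \<in> carrier B \<and> unit_of g \<otimes>\<^bsub>B\<^esub> \<beta> g (\<phi> (c g)) = \<beta> g (\<phi> (c g))" if "g \<in> S" for g
  proof -
    have "g \<in> carrier G" "c g \<in> carrier A" using that S by auto
    then show ?thesis by (simp add: unit_of_def \<beta>_closed \<phi>_closed flip: \<beta>_prod \<phi>_prod)
  qed
  ultimately show ?thesis
    using finite_sum_separation[OF S(1,2), of "\<lambda>g. \<beta> g (\<phi> (c g))"] S(2,4) by auto
qed

lemma separation_eq:
  assumes b: "b \<in> carrier B" "c \<in> carrier B" and eq: "\<And>x. x \<in> points \<Longrightarrow> x \<otimes>\<^bsub>B\<^esub> b = x \<otimes>\<^bsub>B\<^esub> c"
  shows "b = c"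
proof (rule E.ga.alg.M.minus_zero_imp_eq[OF b separation])
  show "b \<ominus>\<^bsub>B\<^esub> c \<in> carrier B" using b by simp
  fix x assume x: "x \<in> points"
  then have "x \<otimes>\<^bsub>B\<^esub> (b \<ominus>\<^bsub>B\<^esub> c) = x \<otimes>\<^bsub>B\<^esub> c \<ominus>\<^bsub>B\<^esub> x \<otimes>\<^bsub>B\<^esub> c"
    using additive_map_minus[OF abelian_B abelian_B additive_left[OF pointD(1)[OF x]] b] eq by simp
  then show "x \<otimes>\<^bsub>B\<^esub> (b \<ominus>\<^bsub>B\<^esub> c) = \<zero>\<^bsub>B\<^esub>"
    using B_closed[OF pointD(1)[OF x] b(2)] by (simp add: E.ga.alg.M.minus_eq E.ga.alg.M.r_neg)
qed

end

section \<open>Multipliers of B as families of components at the points\<close>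

context enveloped_product
begin

lemma left_module_B: "left_module K B"
  by (rule left_module_of_module) (rule E.ga.alg.module_axioms)

text \<open>Lets the additive group laws of multipliers be taken from \<open>hom_group\<close>,
  component by component.\<close>

lemma linear_endos_eq: "linear_endos K B = carrier (hom_group K B B)"
  by (simp add: linear_endos_def hom_group_def)

abbreviation "\<M> \<equiv> multiplier_algebra K B"

lemma multiplier_iff:
  "(R, L) \<in> carrier \<M> \<longleftrightarrow> R \<in> carrier (hom_group K B B) \<and> L \<in> carrier (hom_group K B B) \<and>
     (\<forall>a\<in>carrier B. \<forall>b\<in>carrier B. R (a \<otimes>\<^bsub>B\<^esub> b) = a \<otimes>\<^bsub>B\<^esub> R b) \<and>
     (\<forall>a\<in>carrier B. \<forall>b\<in>carrier B. L (a \<otimes>\<^bsub>B\<^esub> b) = L a \<otimes>\<^bsub>B\<^esub> b) \<and>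
     (\<forall>a\<in>carrier B. \<forall>b\<in>carrier B. R a \<otimes>\<^bsub>B\<^esub> b = a \<otimes>\<^bsub>B\<^esub> L b)"
  by (simp add: multiplier_algebra_def linear_endos_eq)

lemma multiplier_simps:
  "(R, L) \<oplus>\<^bsub>\<M>\<^esub> (R', L') = (R \<otimes>\<^bsub>hom_group K B B\<^esub> R', L \<otimes>\<^bsub>hom_group K B B\<^esub> L')"
  "\<zero>\<^bsub>\<M>\<^esub> = (\<one>\<^bsub>hom_group K B B\<^esub>, \<one>\<^bsub>hom_group K B B\<^esub>)"
  by (simp_all add: multiplier_algebra_def hom_group_simps)

lemma multiplierD:
  assumes "(R, L) \<in> carrier \<M>"
  shows "linear_map K B B R" "linear_map K B B L"
    "\<lbrakk>a \<in> carrier B; b \<in> carrier B\<rbrakk> \<Longrightarrow> R (a \<otimes>\<^bsub>B\<^esub> b) = a \<otimes>\<^bsub>B\<^esub> R b"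
    "\<lbrakk>a \<in> carrier B; b \<in> carrier B\<rbrakk> \<Longrightarrow> L (a \<otimes>\<^bsub>B\<^esub> b) = L a \<otimes>\<^bsub>B\<^esub> b"
    "\<lbrakk>a \<in> carrier B; b \<in> carrier B\<rbrakk> \<Longrightarrow> R a \<otimes>\<^bsub>B\<^esub> b = a \<otimes>\<^bsub>B\<^esub> L b"
    "b \<in> carrier B \<Longrightarrow> R b \<in> carrier B" "b \<in> carrier B \<Longrightarrow> L b \<in> carrier B"
  using assms by (auto simp: multiplier_iff hom_group_carrier intro: linear_map_closed)

lemma multiplierI:
  assumes "linear_map K B B R" "linear_map K B B L"
    and "\<And>a b. \<lbrakk>a \<in> carrier B; b \<in> carrier B\<rbrakk> \<Longrightarrow> R (a \<otimes>\<^bsub>B\<^esub> b) = a \<otimes>\<^bsub>B\<^esub> R b"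
    and "\<And>a b. \<lbrakk>a \<in> carrier B; b \<in> carrier B\<rbrakk> \<Longrightarrow> L (a \<otimes>\<^bsub>B\<^esub> b) = L a \<otimes>\<^bsub>B\<^esub> b"
    and "\<And>a b. \<lbrakk>a \<in> carrier B; b \<in> carrier B\<rbrakk> \<Longrightarrow> R a \<otimes>\<^bsub>B\<^esub> b = a \<otimes>\<^bsub>B\<^esub> L b"
  shows "(restrict R (carrier B), restrict L (carrier B)) \<in> carrier \<M>"
  unfolding multiplier_iff
  using assms(3-) linear_map_restrict[OF left_module_B assms(1)] linear_map_restrict[OF left_module_B assms(2)]
    linear_map_closed[OF assms(1)] linear_map_closed[OF assms(2)]
  by (simp add: B_closed)

lemma multiplier_add_closed:
  assumes m: "(R, L) \<in> carrier \<M>" "(R', L') \<in> carrier \<M>"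
  shows "(R, L) \<oplus>\<^bsub>\<M>\<^esub> (R', L') \<in> carrier \<M>"
proof -
  note 1 = multiplierD[OF m(1)] and 2 = multiplierD[OF m(2)]
  interpret BK: left_module K B by (rule left_module_B)
  show ?thesis
    unfolding multiplier_simps hom_group_simps
    by (rule multiplierI)
      (use 1 2 in \<open>simp_all add: BK.linear_map_sum[OF left_module_B] E.ga.alg.alg_r_distr E.ga.alg.alg_l_distr B_closed\<close>)
qed

lemma abelian_group_multiplier: "abelian_group \<M>"
proof (rule abelian_groupI)
  interpret H: comm_group "hom_group K B B" by (rule hom_group_comm_group[OF left_module_B left_module_B])
  interpret BK: left_module K B by (rule left_module_B)
  show "\<zero>\<^bsub>\<M>\<^esub> \<in> carrier \<M>"
    unfolding multiplier_simps hom_group_simps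
    by (rule multiplierI) (simp_all add: BK.zero_linear)
  fix m assume m: "m \<in> carrier \<M>"
  obtain R L where mRL: "m = (R, L)" by (cases m)
  note 1 = multiplierD[OF m[unfolded mRL]]
  have H1: "R \<in> carrier (hom_group K B B)" "L \<in> carrier (hom_group K B B)"
    using m by (auto simp: mRL multiplier_iff)
  then show "\<zero>\<^bsub>\<M>\<^esub> \<oplus>\<^bsub>\<M>\<^esub> m = m" by (simp add: mRL multiplier_simps)
  let ?neg = "\<lambda>f. restrict (\<lambda>b. \<zero>\<^bsub>B\<^esub> \<ominus>\<^bsub>B\<^esub> f b) (carrier B)"
  have "(?neg R, ?neg L) \<in> carrier \<M>"
  proof (rule multiplierI)
    fix a b assume ab: "a \<in> carrier B" "b \<in> carrier B"
    show "\<zero>\<^bsub>B\<^esub> \<ominus>\<^bsub>B\<^esub> R (a \<otimes>\<^bsub>B\<^esub> b) = a \<otimes>\<^bsub>B\<^esub> (\<zero>\<^bsub>B\<^esub> \<ominus>\<^bsub>B\<^esub> R b)"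
      using additive_map_minus[OF abelian_B abelian_B additive_left[OF ab(1)], of "\<zero>\<^bsub>B\<^esub>" "R b"] 1 ab by simp
    show "\<zero>\<^bsub>B\<^esub> \<ominus>\<^bsub>B\<^esub> L (a \<otimes>\<^bsub>B\<^esub> b) = (\<zero>\<^bsub>B\<^esub> \<ominus>\<^bsub>B\<^esub> L a) \<otimes>\<^bsub>B\<^esub> b"
      using additive_map_minus[OF abelian_B abelian_B additive_right[OF ab(2)], of "\<zero>\<^bsub>B\<^esub>" "L a"] 1 ab by simp
    show "(\<zero>\<^bsub>B\<^esub> \<ominus>\<^bsub>B\<^esub> R a) \<otimes>\<^bsub>B\<^esub> b = a \<otimes>\<^bsub>B\<^esub> (\<zero>\<^bsub>B\<^esub> \<ominus>\<^bsub>B\<^esub> L b)"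
      using additive_map_minus[OF abelian_B abelian_B additive_right[OF ab(2)], of "\<zero>\<^bsub>B\<^esub>" "R a"]
        additive_map_minus[OF abelian_B abelian_B additive_left[OF ab(1)], of "\<zero>\<^bsub>B\<^esub>" "L b"] 1 ab by simp
  qed (use BK.linear_map_diff[OF left_module_B BK.zero_linear] 1 in auto)
  moreover have "?neg f \<otimes>\<^bsub>hom_group K B B\<^esub> f = \<one>\<^bsub>hom_group K B B\<^esub>" if "linear_map K B B f" for f
    unfolding hom_group_simps
    by (intro restrict_ext) (simp add: linear_map_closed[OF that] E.ga.alg.M.minus_eq E.ga.alg.M.l_neg)
  then have "(?neg R, ?neg L) \<oplus>\<^bsub>\<M>\<^esub> m = \<zero>\<^bsub>\<M>\<^esub>" using 1(1,2) by (simp add: mRL multiplier_simps)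
  ultimately show "\<exists>n\<in>carrier \<M>. n \<oplus>\<^bsub>\<M>\<^esub> m = \<zero>\<^bsub>\<M>\<^esub>" by blast
next
  interpret H: comm_group "hom_group K B B" by (rule hom_group_comm_group[OF left_module_B left_module_B])
  fix m n assume mn: "m \<in> carrier \<M>" "n \<in> carrier \<M>"
  obtain R L where m: "m = (R, L)" by (cases m)
  obtain R' L' where n: "n = (R', L')" by (cases n)
  show "m \<oplus>\<^bsub>\<M>\<^esub> n \<in> carrier \<M>" using mn unfolding m n by (rule multiplier_add_closed)
  show "m \<oplus>\<^bsub>\<M>\<^esub> n = n \<oplus>\<^bsub>\<M>\<^esub> m" using mn unfolding m n by (simp add: multiplier_simps multiplier_iff H.m_comm)
  fix p assume p: "p \<in> carrier \<M>"
  obtain R'' L'' where p': "p = (R'', L'')" by (cases p)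
  show "m \<oplus>\<^bsub>\<M>\<^esub> n \<oplus>\<^bsub>\<M>\<^esub> p = m \<oplus>\<^bsub>\<M>\<^esub> (n \<oplus>\<^bsub>\<M>\<^esub> p)"
    using mn p unfolding m n p' by (simp add: multiplier_simps multiplier_iff H.m_assoc)
qed

text \<open>As x is a central idempotent, x L(b) = L(b) x = L(b x) = L(x b) = L(x) b, and similarly
  for R; moreover R x = L x. Both components of a multiplier are thus governed by the single family
  of the elements L x.\<close>

lemma multiplier_point:
  assumes m: "(R, L) \<in> carrier \<M>" and x: "x \<in> points" and b: "b \<in> carrier B"
  shows "L x \<in> V x" "x \<otimes>\<^bsub>B\<^esub> L b = L x \<otimes>\<^bsub>B\<^esub> b" "x \<otimes>\<^bsub>B\<^esub> R b = b \<otimes>\<^bsub>B\<^esub> L x"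
proof -
  note 1 = multiplierD[OF m] and xD = pointD[OF x]
  have "L x = L (x \<otimes>\<^bsub>B\<^esub> x)" by (simp only: xD(2))
  also have "\<dots> = L x \<otimes>\<^bsub>B\<^esub> x" by (rule 1(4)[OF xD(1) xD(1)])
  also have "\<dots> = x \<otimes>\<^bsub>B\<^esub> L x" by (simp only: xD(3)[OF 1(7)[OF xD(1)]])
  finally have Lx: "L x = x \<otimes>\<^bsub>B\<^esub> L x" .
  then show "L x \<in> V x" using 1(7)[OF xD(1)] by (simp add: V_def)
  have "x \<otimes>\<^bsub>B\<^esub> L b = L b \<otimes>\<^bsub>B\<^esub> x" by (rule xD(3)[OF 1(7)[OF b]])
  also have "\<dots> = L (b \<otimes>\<^bsub>B\<^esub> x)" by (rule 1(4)[symmetric, OF b xD(1)])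
  also have "\<dots> = L (x \<otimes>\<^bsub>B\<^esub> b)" by (simp only: xD(3)[OF b])
  also have "\<dots> = L x \<otimes>\<^bsub>B\<^esub> b" by (rule 1(4)[OF xD(1) b])
  finally show "x \<otimes>\<^bsub>B\<^esub> L b = L x \<otimes>\<^bsub>B\<^esub> b" .
  have "R x = R (x \<otimes>\<^bsub>B\<^esub> x)" by (simp only: xD(2))
  also have "\<dots> = x \<otimes>\<^bsub>B\<^esub> R x" by (rule 1(3)[OF xD(1) xD(1)])
  also have "\<dots> = R x \<otimes>\<^bsub>B\<^esub> x" by (rule xD(3)[OF 1(6)[OF xD(1)]])
  also have "\<dots> = x \<otimes>\<^bsub>B\<^esub> L x" by (rule 1(5)[OF xD(1) xD(1)])
  finally have Rx: "R x = L x" by (simp only: Lx[symmetric])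
  have "x \<otimes>\<^bsub>B\<^esub> R b = R (x \<otimes>\<^bsub>B\<^esub> b)" by (rule 1(3)[symmetric, OF xD(1) b])
  also have "\<dots> = R (b \<otimes>\<^bsub>B\<^esub> x)" by (simp only: xD(3)[OF b])
  also have "\<dots> = b \<otimes>\<^bsub>B\<^esub> R x" by (rule 1(3)[OF b xD(1)])
  finally show "x \<otimes>\<^bsub>B\<^esub> R b = b \<otimes>\<^bsub>B\<^esub> L x" by (simp only: Rx)
qed

lemma multiplier_inj:
  assumes m: "m \<in> carrier \<M>" "m' \<in> carrier \<M>" and eq: "\<And>x. x \<in> points \<Longrightarrow> snd m x = snd m' x"
  shows "m = m'"
proof -
  obtain R L where RL: "m = (R, L)" by (cases m)
  obtain R' L' where RL': "m' = (R', L')" by (cases m')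
  note mm = m[unfolded RL RL']
  have "L b = L' b" "R b = R' b" if b: "b \<in> carrier B" for b
  proof -
    show "L b = L' b"
      by (rule separation_eq[OF multiplierD(7)[OF mm(1) b] multiplierD(7)[OF mm(2) b]])
        (use eq RL RL' multiplier_point(2)[OF mm(1) _ b] multiplier_point(2)[OF mm(2) _ b] in auto)
    show "R b = R' b"
      by (rule separation_eq[OF multiplierD(6)[OF mm(1) b] multiplierD(6)[OF mm(2) b]])
        (use eq RL RL' multiplier_point(3)[OF mm(1) _ b] multiplier_point(3)[OF mm(2) _ b] in auto)
  qed
  moreover have "R \<in> extensional (carrier B)" "L \<in> extensional (carrier B)"
    "R' \<in> extensional (carrier B)" "L' \<in> extensional (carrier B)"
    using mm by (auto simp: multiplier_iff hom_group_carrier)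
  ultimately show ?thesis unfolding RL RL' by (auto intro: extensionalityI)
qed

text \<open>The family f is translated back by g, realised by an element of A at the points with 1
  in their star, and this element is translated forward again.\<close>

lemma local_multiplier:
  assumes f: "\<And>x. x \<in> points \<Longrightarrow> f x \<in> V x" and g: "g \<in> carrier G"
  shows "\<exists>m\<in>carrier B. unit_of g \<otimes>\<^bsub>B\<^esub> m = m \<and> (\<forall>x\<in>points. g \<in> star x \<longrightarrow> x \<otimes>\<^bsub>B\<^esub> m = f x)"
proof -
  let ?g' = "inv\<^bsub>G\<^esub> g"
  have g': "?g' \<in> carrier G" using g by simp
  have "\<beta> ?g' (f (\<beta> g y)) \<in> V y" if y: "y \<in> points" for y
    using \<beta>_V[OF g' \<beta>_point[OF g y] f[OF \<beta>_point[OF g y]]] \<beta>_inv(1)[OF g pointD(1)[OF y]] by simp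
  then have "\<exists>a\<in>carrier A. \<forall>x\<in>points. \<one>\<^bsub>G\<^esub> \<in> star x \<longrightarrow> x \<otimes>\<^bsub>B\<^esub> \<phi> a = \<beta> ?g' (f (\<beta> g x))"
    by (intro coordinates_surj)
  then obtain a where a: "a \<in> carrier A"
    "\<And>x. \<lbrakk>x \<in> points; \<one>\<^bsub>G\<^esub> \<in> star x\<rbrakk> \<Longrightarrow> x \<otimes>\<^bsub>B\<^esub> \<phi> a = \<beta> ?g' (f (\<beta> g x))" by blast
  show ?thesis
  proof (intro bexI[of _ "\<beta> g (\<phi> a)"] conjI ballI impI)
    show "\<beta> g (\<phi> a) \<in> carrier B" using g a by (simp add: \<beta>_closed \<phi>_closed)
    show "unit_of g \<otimes>\<^bsub>B\<^esub> \<beta> g (\<phi> a) = \<beta> g (\<phi> a)"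
      using g a(1) by (simp add: unit_of_def \<phi>_closed flip: \<beta>_prod \<phi>_prod)
    fix x assume x: "x \<in> points" "g \<in> star x"
    note xc = pointD(1)[OF x(1)]
    have y: "\<beta> ?g' x \<in> points" by (rule \<beta>_point[OF g' x(1)])
    have "\<one>\<^bsub>G\<^esub> \<in> star (\<beta> ?g' x)" using star_mult[OF g g' x(1)] x(2) g by simp
    then have "\<beta> g (\<beta> ?g' x \<otimes>\<^bsub>B\<^esub> \<phi> a) = \<beta> g (\<beta> ?g' (f x))"
      using a(2)[OF y] \<beta>_inv(2)[OF g xc] by simp
    moreover have "f x \<in> carrier B" using f[OF x(1)] by (simp add: V_def)
    ultimately show "x \<otimes>\<^bsub>B\<^esub> \<beta> g (\<phi> a) = f x"
      using g a(1) xc by (simp add: \<beta>_prod \<beta>_closed \<phi>_closed \<beta>_inv(2))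
  qed
qed

lemma V_central:
  assumes "x \<in> points" "v \<in> V x"
  shows "v \<in> carrier B" "x \<otimes>\<^bsub>B\<^esub> v = v" "v \<otimes>\<^bsub>B\<^esub> x = v"
  using assms pointD(3)[OF assms(1), of v] by (auto simp: V_def)

text \<open>For b in the translate by g, the products m b and b m with the local element m have the
  required components, also outside the star, where all products vanish. A general b is a finite sum
  of such elements.\<close>

lemma ex_products:
  assumes f: "\<And>x. x \<in> points \<Longrightarrow> f x \<in> V x" and b: "b \<in> carrier B"
  shows "\<exists>c\<in>carrier B. \<forall>x\<in>points. x \<otimes>\<^bsub>B\<^esub> c = f x \<otimes>\<^bsub>B\<^esub> b"
    and "\<exists>c\<in>carrier B. \<forall>x\<in>points. x \<otimes>\<^bsub>B\<^esub> c = b \<otimes>\<^bsub>B\<^esub> f x"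
proof -
  let ?P = "\<lambda>b. (\<exists>c\<in>carrier B. \<forall>x\<in>points. x \<otimes>\<^bsub>B\<^esub> c = f x \<otimes>\<^bsub>B\<^esub> b) \<and>
    (\<exists>c\<in>carrier B. \<forall>x\<in>points. x \<otimes>\<^bsub>B\<^esub> c = b \<otimes>\<^bsub>B\<^esub> f x)"
  have fV: "f x \<in> carrier B" "x \<otimes>\<^bsub>B\<^esub> f x = f x" "f x \<otimes>\<^bsub>B\<^esub> x = f x" if "x \<in> points" for x
    using V_central[OF that f[OF that]] by auto
  have add: "?P (b \<oplus>\<^bsub>B\<^esub> b')" if b: "b \<in> carrier B" "b' \<in> carrier B" and P: "?P b" "?P b'" for b b'
  proof
    obtain c c' where c: "c \<in> carrier B" "c' \<in> carrier B" "\<And>x. x \<in> points \<Longrightarrow> x \<otimes>\<^bsub>B\<^esub> c = f x \<otimes>\<^bsub>B\<^esub> b"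
      "\<And>x. x \<in> points \<Longrightarrow> x \<otimes>\<^bsub>B\<^esub> c' = f x \<otimes>\<^bsub>B\<^esub> b'"
      using P(1)[THEN conjunct1] P(2)[THEN conjunct1] by (elim bexE) blast
    have "x \<otimes>\<^bsub>B\<^esub> (c \<oplus>\<^bsub>B\<^esub> c') = f x \<otimes>\<^bsub>B\<^esub> (b \<oplus>\<^bsub>B\<^esub> b')" if x: "x \<in> points" for x
      using c b fV(1)[OF x] pointD(1)[OF x] x by (simp add: E.ga.alg.alg_r_distr)
    then show "\<exists>c\<in>carrier B. \<forall>x\<in>points. x \<otimes>\<^bsub>B\<^esub> c = f x \<otimes>\<^bsub>B\<^esub> (b \<oplus>\<^bsub>B\<^esub> b')"
      by (intro bexI[OF _ E.ga.alg.M.a_closed[OF c(1,2)]] ballI)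
    obtain c c' where c: "c \<in> carrier B" "c' \<in> carrier B" "\<And>x. x \<in> points \<Longrightarrow> x \<otimes>\<^bsub>B\<^esub> c = b \<otimes>\<^bsub>B\<^esub> f x"
      "\<And>x. x \<in> points \<Longrightarrow> x \<otimes>\<^bsub>B\<^esub> c' = b' \<otimes>\<^bsub>B\<^esub> f x"
      using P(1)[THEN conjunct2] P(2)[THEN conjunct2] by (elim bexE) blast
    have "x \<otimes>\<^bsub>B\<^esub> (c \<oplus>\<^bsub>B\<^esub> c') = (b \<oplus>\<^bsub>B\<^esub> b') \<otimes>\<^bsub>B\<^esub> f x" if x: "x \<in> points" for x
      using c b fV(1)[OF x] pointD(1)[OF x] x by (simp add: E.ga.alg.alg_r_distr E.ga.alg.alg_l_distr)
    then show "\<exists>c\<in>carrier B. \<forall>x\<in>points. x \<otimes>\<^bsub>B\<^esub> c = (b \<oplus>\<^bsub>B\<^esub> b') \<otimes>\<^bsub>B\<^esub> f x"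
      by (intro bexI[OF _ E.ga.alg.M.a_closed[OF c(1,2)]] ballI)
  qed
  have local: "?P b" if g: "g \<in> carrier G" and b: "b \<in> carrier B" "unit_of g \<otimes>\<^bsub>B\<^esub> b = b" for g b
  proof -
    obtain m where m: "m \<in> carrier B" "unit_of g \<otimes>\<^bsub>B\<^esub> m = m" "\<And>x. \<lbrakk>x \<in> points; g \<in> star x\<rbrakk> \<Longrightarrow> x \<otimes>\<^bsub>B\<^esub> m = f x"
      using local_multiplier[OF f g] by auto
    note ug = central_idempotentsD[OF central_unit_of[OF g]]
    have "x \<otimes>\<^bsub>B\<^esub> (m \<otimes>\<^bsub>B\<^esub> b) = f x \<otimes>\<^bsub>B\<^esub> b \<and> x \<otimes>\<^bsub>B\<^esub> (b \<otimes>\<^bsub>B\<^esub> m) = b \<otimes>\<^bsub>B\<^esub> f x" if x: "x \<in> points" for x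
    proof -
      note xD = pointD[OF x]
      have 1: "x \<otimes>\<^bsub>B\<^esub> (m \<otimes>\<^bsub>B\<^esub> b) = (x \<otimes>\<^bsub>B\<^esub> m) \<otimes>\<^bsub>B\<^esub> b" using xD(1) m(1) b(1) by (simp add: B_assoc)
      have "x \<otimes>\<^bsub>B\<^esub> (b \<otimes>\<^bsub>B\<^esub> m) = (x \<otimes>\<^bsub>B\<^esub> b) \<otimes>\<^bsub>B\<^esub> m" using xD(1) m(1) b(1) by (simp add: B_assoc)
      also have "\<dots> = (b \<otimes>\<^bsub>B\<^esub> x) \<otimes>\<^bsub>B\<^esub> m" by (simp only: xD(3)[OF b(1)])
      also have "\<dots> = b \<otimes>\<^bsub>B\<^esub> (x \<otimes>\<^bsub>B\<^esub> m)" using xD(1) m(1) b(1) by (simp add: B_assoc)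
      finally have 2: "x \<otimes>\<^bsub>B\<^esub> (b \<otimes>\<^bsub>B\<^esub> m) = b \<otimes>\<^bsub>B\<^esub> (x \<otimes>\<^bsub>B\<^esub> m)" .
      show ?thesis
      proof (cases "g \<in> star x")
        case True
        then show ?thesis using 1 2 m(3)[OF x] by simp
      next
        case False
        then have xu: "x \<otimes>\<^bsub>B\<^esub> unit_of g = \<zero>\<^bsub>B\<^esub>" by (rule not_star[OF x g])
        \<comment> \<open>An element of the translate by g absorbs \<open>unit_of g\<close>, which x
          annihilates; so it has no component at x.\<close>
        have kill: "x \<otimes>\<^bsub>B\<^esub> c = \<zero>\<^bsub>B\<^esub>" if "c \<in> carrier B" "unit_of g \<otimes>\<^bsub>B\<^esub> c = c" for c
        proof -
          have "x \<otimes>\<^bsub>B\<^esub> (unit_of g \<otimes>\<^bsub>B\<^esub> c) = (x \<otimes>\<^bsub>B\<^esub> unit_of g) \<otimes>\<^bsub>B\<^esub> c"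
            using xD(1) ug(1) that(1) by (simp add: B_assoc)
          then show ?thesis using that xu by simp
        qed
        have "f x \<otimes>\<^bsub>B\<^esub> b = f x \<otimes>\<^bsub>B\<^esub> (x \<otimes>\<^bsub>B\<^esub> b)" using fV[OF x] xD(1) b(1) by (simp flip: B_assoc)
        then have fb: "f x \<otimes>\<^bsub>B\<^esub> b = \<zero>\<^bsub>B\<^esub>" using kill[OF b] fV(1)[OF x] by simp
        have "b \<otimes>\<^bsub>B\<^esub> f x = b \<otimes>\<^bsub>B\<^esub> (x \<otimes>\<^bsub>B\<^esub> f x)" by (simp only: fV(2)[OF x])
        also have "\<dots> = (b \<otimes>\<^bsub>B\<^esub> x) \<otimes>\<^bsub>B\<^esub> f x" using fV(1)[OF x] xD(1) b(1) by (simp add: B_assoc)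
        also have "\<dots> = (x \<otimes>\<^bsub>B\<^esub> b) \<otimes>\<^bsub>B\<^esub> f x" by (simp only: xD(3)[OF b(1)])
        also have "\<dots> = \<zero>\<^bsub>B\<^esub>" using kill[OF b] fV(1)[OF x] by simp
        finally have bf: "b \<otimes>\<^bsub>B\<^esub> f x = \<zero>\<^bsub>B\<^esub>" .
        show ?thesis unfolding 1 2 fb bf kill[OF m(1,2)] using b(1) by simp
      qed
    qed
    then show ?thesis by (intro conjI bexI[OF _ B_closed[OF m(1) b(1)]] bexI[OF _ B_closed[OF b(1) m(1)]] ballI) auto
  qed
  have zero: "?P \<zero>\<^bsub>B\<^esub>"
    by (intro conjI bexI[of _ "\<zero>\<^bsub>B\<^esub>"]) (auto simp: fV(1) pointD(1))
  obtain S c where S: "finite S" "S \<subseteq> carrier G" "c \<in> S \<rightarrow> carrier A" "b = finsum B (\<lambda>g. \<beta> g (\<phi> (c g))) S"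
    using E.sum_\<phi>[OF b] by blast
  have "?P (finsum B (\<lambda>g. \<beta> g (\<phi> (c g))) S)"
    using S(1-3)
  proof (induction S rule: finite_induct)
    case empty
    then show ?case using zero by simp
  next
    case (insert g S)
    have g: "g \<in> carrier G" "c g \<in> carrier A" using insert.prems by auto
    have gc: "\<beta> g (\<phi> (c g)) \<in> carrier B" using g by (simp add: \<beta>_closed \<phi>_closed)
    have Sc: "(\<lambda>g. \<beta> g (\<phi> (c g))) \<in> S \<rightarrow> carrier B"
      using insert.prems by (auto simp: subset_iff intro!: \<beta>_closed \<phi>_closed)
    have "?P (\<beta> g (\<phi> (c g)))"
      by (rule local[OF g(1) gc]) (use g in \<open>simp add: unit_of_def \<phi>_closed flip: \<beta>_prod \<phi>_prod\<close>)
    moreover have "?P (finsum B (\<lambda>g. \<beta> g (\<phi> (c g))) S)" using insert by auto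
    ultimately have "?P (\<beta> g (\<phi> (c g)) \<oplus>\<^bsub>B\<^esub> finsum B (\<lambda>g. \<beta> g (\<phi> (c g))) S)"
      by (rule add[OF gc E.ga.alg.M.finsum_closed[OF Sc]])
    then show ?case using insert.hyps gc Sc by simp
  qed
  then have "?P b" using S(4) by simp
  then show "\<exists>c\<in>carrier B. \<forall>x\<in>points. x \<otimes>\<^bsub>B\<^esub> c = f x \<otimes>\<^bsub>B\<^esub> b"
    "\<exists>c\<in>carrier B. \<forall>x\<in>points. x \<otimes>\<^bsub>B\<^esub> c = b \<otimes>\<^bsub>B\<^esub> f x" by auto
qed

text \<open>L b and R b are chosen with the components f(x) b and b f(x). By separation they are
  unique, so linearity and the multiplier identities may be checked at each point.\<close>

lemma multiplier_surj:
  assumes f: "\<And>x. x \<in> points \<Longrightarrow> f x \<in> V x"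
  shows "\<exists>m\<in>carrier \<M>. \<forall>x\<in>points. snd m x = f x"
proof -
  have fV: "f x \<in> carrier B" "x \<otimes>\<^bsub>B\<^esub> f x = f x" "f x \<otimes>\<^bsub>B\<^esub> x = f x" if "x \<in> points" for x
    using V_central[OF that f[OF that]] by auto
  have "\<exists>c\<in>carrier B. \<forall>x\<in>points. x \<otimes>\<^bsub>B\<^esub> c = f x \<otimes>\<^bsub>B\<^esub> b"
    "\<exists>c\<in>carrier B. \<forall>x\<in>points. x \<otimes>\<^bsub>B\<^esub> c = b \<otimes>\<^bsub>B\<^esub> f x" if "b \<in> carrier B" for b
    using ex_products[of f b, OF f that] by simp_all
  then obtain L R where L: "\<And>b. b \<in> carrier B \<Longrightarrow> L b \<in> carrier B"
      "\<And>b x. \<lbrakk>b \<in> carrier B; x \<in> points\<rbrakk> \<Longrightarrow> x \<otimes>\<^bsub>B\<^esub> L b = f x \<otimes>\<^bsub>B\<^esub> b"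
    and R: "\<And>b. b \<in> carrier B \<Longrightarrow> R b \<in> carrier B"
      "\<And>b x. \<lbrakk>b \<in> carrier B; x \<in> points\<rbrakk> \<Longrightarrow> x \<otimes>\<^bsub>B\<^esub> R b = b \<otimes>\<^bsub>B\<^esub> f x"
    by (metis (no_types, lifting))
  note xc = pointD(1)
  have "linear_map K B B L"
    unfolding linear_map_def
  proof (intro conjI additive_mapI ballI L(1))
    fix a b assume ab: "a \<in> carrier B" "b \<in> carrier B"
    show "L (a \<oplus>\<^bsub>B\<^esub> b) = L a \<oplus>\<^bsub>B\<^esub> L b"
      by (rule separation_eq) (use ab L fV(1) xc in \<open>simp_all add: E.ga.alg.alg_r_distr\<close>)
  next
    fix k b assume kb: "k \<in> carrier K" "b \<in> carrier B"
    show "L (k \<odot>\<^bsub>B\<^esub> b) = k \<odot>\<^bsub>B\<^esub> L b"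
      by (rule separation_eq) (use kb L fV(1) xc in \<open>simp_all add: E.ga.alg.alg_smult_right\<close>)
  qed
  moreover have "linear_map K B B R"
    unfolding linear_map_def
  proof (intro conjI additive_mapI ballI R(1))
    fix a b assume ab: "a \<in> carrier B" "b \<in> carrier B"
    show "R (a \<oplus>\<^bsub>B\<^esub> b) = R a \<oplus>\<^bsub>B\<^esub> R b"
      by (rule separation_eq) (use ab R fV(1) xc in \<open>simp_all add: E.ga.alg.alg_r_distr E.ga.alg.alg_l_distr\<close>)
  next
    fix k b assume kb: "k \<in> carrier K" "b \<in> carrier B"
    show "R (k \<odot>\<^bsub>B\<^esub> b) = k \<odot>\<^bsub>B\<^esub> R b"
      by (rule separation_eq) (use kb R fV(1) xc in \<open>simp_all add: E.ga.alg.alg_smult_right E.ga.alg.alg_smult_left\<close>)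
  qed
  ultimately have m: "(restrict R (carrier B), restrict L (carrier B)) \<in> carrier \<M>"
  proof (intro multiplierI)
    fix a b assume ab: "a \<in> carrier B" "b \<in> carrier B"
    \<comment> \<open>Points are central, so they can be moved past a.\<close>
    have swap: "x \<otimes>\<^bsub>B\<^esub> (a \<otimes>\<^bsub>B\<^esub> c) = a \<otimes>\<^bsub>B\<^esub> (x \<otimes>\<^bsub>B\<^esub> c)" if "x \<in> points" "c \<in> carrier B" for x c
    proof -
      have "x \<otimes>\<^bsub>B\<^esub> (a \<otimes>\<^bsub>B\<^esub> c) = (x \<otimes>\<^bsub>B\<^esub> a) \<otimes>\<^bsub>B\<^esub> c" using that ab xc by (simp add: B_assoc)
      also have "\<dots> = (a \<otimes>\<^bsub>B\<^esub> x) \<otimes>\<^bsub>B\<^esub> c" by (simp only: pointD(3)[OF that(1) ab(1)])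
      finally show ?thesis using that ab xc by (simp add: B_assoc)
    qed
    show "R (a \<otimes>\<^bsub>B\<^esub> b) = a \<otimes>\<^bsub>B\<^esub> R b"
    proof (rule separation_eq)
      fix x assume x: "x \<in> points"
      have "x \<otimes>\<^bsub>B\<^esub> R (a \<otimes>\<^bsub>B\<^esub> b) = (a \<otimes>\<^bsub>B\<^esub> b) \<otimes>\<^bsub>B\<^esub> f x" by (rule R(2)[OF B_closed[OF ab] x])
      also have "\<dots> = a \<otimes>\<^bsub>B\<^esub> (x \<otimes>\<^bsub>B\<^esub> R b)" using ab fV(1)[OF x] R(2)[OF ab(2) x] by (simp add: B_assoc)
      also have "\<dots> = x \<otimes>\<^bsub>B\<^esub> (a \<otimes>\<^bsub>B\<^esub> R b)" by (rule swap[OF x R(1)[OF ab(2)], symmetric])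
      finally show "x \<otimes>\<^bsub>B\<^esub> R (a \<otimes>\<^bsub>B\<^esub> b) = x \<otimes>\<^bsub>B\<^esub> (a \<otimes>\<^bsub>B\<^esub> R b)" .
    qed (use ab R B_closed in auto)
    show "L (a \<otimes>\<^bsub>B\<^esub> b) = L a \<otimes>\<^bsub>B\<^esub> b"
    proof (rule separation_eq)
      fix x assume x: "x \<in> points"
      have "x \<otimes>\<^bsub>B\<^esub> L (a \<otimes>\<^bsub>B\<^esub> b) = f x \<otimes>\<^bsub>B\<^esub> (a \<otimes>\<^bsub>B\<^esub> b)" by (rule L(2)[OF B_closed[OF ab] x])
      also have "\<dots> = (x \<otimes>\<^bsub>B\<^esub> L a) \<otimes>\<^bsub>B\<^esub> b" using ab fV(1)[OF x] L(2)[OF ab(1) x] by (simp add: B_assoc)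
      also have "\<dots> = x \<otimes>\<^bsub>B\<^esub> (L a \<otimes>\<^bsub>B\<^esub> b)" using ab L(1) xc[OF x] by (simp add: B_assoc)
      finally show "x \<otimes>\<^bsub>B\<^esub> L (a \<otimes>\<^bsub>B\<^esub> b) = x \<otimes>\<^bsub>B\<^esub> (L a \<otimes>\<^bsub>B\<^esub> b)" .
    qed (use ab L B_closed in auto)
    show "R a \<otimes>\<^bsub>B\<^esub> b = a \<otimes>\<^bsub>B\<^esub> L b"
    proof (rule separation_eq)
      fix x assume x: "x \<in> points"
      have "x \<otimes>\<^bsub>B\<^esub> (R a \<otimes>\<^bsub>B\<^esub> b) = (x \<otimes>\<^bsub>B\<^esub> R a) \<otimes>\<^bsub>B\<^esub> b" using ab R(1) xc[OF x] by (simp add: B_assoc)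
      also have "\<dots> = a \<otimes>\<^bsub>B\<^esub> (x \<otimes>\<^bsub>B\<^esub> L b)"
        using ab fV(1)[OF x] R(2)[OF ab(1) x] L(2)[OF ab(2) x] by (simp add: B_assoc)
      also have "\<dots> = x \<otimes>\<^bsub>B\<^esub> (a \<otimes>\<^bsub>B\<^esub> L b)" by (rule swap[OF x L(1)[OF ab(2)], symmetric])
      finally show "x \<otimes>\<^bsub>B\<^esub> (R a \<otimes>\<^bsub>B\<^esub> b) = x \<otimes>\<^bsub>B\<^esub> (a \<otimes>\<^bsub>B\<^esub> L b)" .
    qed (use ab L R B_closed in auto)
  qed
  \<comment> \<open>At x itself both sides have component f x; at any other point both components
    vanish because distinct points annihilate each other.\<close>
  have "L x = f x" if x: "x \<in> points" for x
  proof (rule separation_eq[OF L(1)[OF xc[OF x]] fV(1)[OF x]])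
    fix y assume y: "y \<in> points"
    show "y \<otimes>\<^bsub>B\<^esub> L x = y \<otimes>\<^bsub>B\<^esub> f x"
    proof (cases "y = x")
      case True
      then show ?thesis using L(2)[OF xc[OF x] x] fV[OF x] by simp
    next
      case False
      have "y \<otimes>\<^bsub>B\<^esub> L x = (f y \<otimes>\<^bsub>B\<^esub> y) \<otimes>\<^bsub>B\<^esub> x" using L(2)[OF xc[OF x] y] fV(3)[OF y] by simp
      also have "\<dots> = f y \<otimes>\<^bsub>B\<^esub> (y \<otimes>\<^bsub>B\<^esub> x)" using fV(1)[OF y] xc[OF x] xc[OF y] by (simp add: B_assoc)
      also have "\<dots> = (y \<otimes>\<^bsub>B\<^esub> x) \<otimes>\<^bsub>B\<^esub> f x"
        using point_eq_or_disjoint[OF y x False] fV(1)[OF x] fV(1)[OF y] by simp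
      also have "\<dots> = y \<otimes>\<^bsub>B\<^esub> f x" using fV(1,2)[OF x] xc[OF x] xc[OF y] by (simp add: B_assoc)
      finally show ?thesis .
    qed
  qed
  then show ?thesis using m xc by (intro bexI[OF _ m]) simp
qed

lemma linear_\<beta>: "g \<in> carrier G \<Longrightarrow> linear_map K B B (\<beta> g)"
  using \<beta>_additive \<beta>_smult by (simp add: linear_map_def)

lemma multiplier_action_eq:
  assumes g: "g \<in> carrier G"
  shows "multiplier_action B \<beta> g (R, L) =
    (restrict (\<lambda>b. \<beta> g (R (\<beta> (inv\<^bsub>G\<^esub> g) b))) (carrier B), restrict (\<lambda>b. \<beta> g (L (\<beta> (inv\<^bsub>G\<^esub> g) b))) (carrier B))"
proof -
  have "inv_into (carrier B) (\<beta> g) b = \<beta> (inv\<^bsub>G\<^esub> g) b" if b: "b \<in> carrier B" for b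
  proof (rule inv_into_f_eq)
    show "inj_on (\<beta> g) (carrier B)" using E.ga.bij_\<beta>[OF g] by (simp add: bij_betw_def)
  qed (use b g \<beta>_closed \<beta>_inv(2) in auto)
  then show ?thesis by (auto simp: multiplier_action_def intro!: restrict_ext)
qed

lemma multiplier_action_closed:
  assumes g: "g \<in> carrier G" and m: "(R, L) \<in> carrier \<M>"
  shows "multiplier_action B \<beta> g (R, L) \<in> carrier \<M>"
  unfolding multiplier_action_eq[OF g]
proof (rule multiplierI)
  have g': "inv\<^bsub>G\<^esub> g \<in> carrier G" using g by simp
  note 1 = multiplierD[OF m]
  show "linear_map K B B (\<lambda>b. \<beta> g (R (\<beta> (inv\<^bsub>G\<^esub> g) b)))" "linear_map K B B (\<lambda>b. \<beta> g (L (\<beta> (inv\<^bsub>G\<^esub> g) b)))"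
    using linear_map_comp[OF linear_map_comp[OF linear_\<beta>[OF g'] 1(1)] linear_\<beta>[OF g]]
      linear_map_comp[OF linear_map_comp[OF linear_\<beta>[OF g'] 1(2)] linear_\<beta>[OF g]] .
  fix a b assume ab: "a \<in> carrier B" "b \<in> carrier B"
  define a' b' where "a' = \<beta> (inv\<^bsub>G\<^esub> g) a" and "b' = \<beta> (inv\<^bsub>G\<^esub> g) b"
  have ab': "a' \<in> carrier B" "b' \<in> carrier B" "a = \<beta> g a'" "b = \<beta> g b'" "\<beta> (inv\<^bsub>G\<^esub> g) (a \<otimes>\<^bsub>B\<^esub> b) = a' \<otimes>\<^bsub>B\<^esub> b'"
    using ab g g' by (auto simp: a'_def b'_def \<beta>_closed \<beta>_inv \<beta>_prod)
  show "\<beta> g (R (\<beta> (inv\<^bsub>G\<^esub> g) (a \<otimes>\<^bsub>B\<^esub> b))) = a \<otimes>\<^bsub>B\<^esub> \<beta> g (R (\<beta> (inv\<^bsub>G\<^esub> g) b))"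
    unfolding ab'(5) b'_def[symmetric] using ab' 1 g by (simp add: \<beta>_prod)
  show "\<beta> g (L (\<beta> (inv\<^bsub>G\<^esub> g) (a \<otimes>\<^bsub>B\<^esub> b))) = \<beta> g (L (\<beta> (inv\<^bsub>G\<^esub> g) a)) \<otimes>\<^bsub>B\<^esub> b"
    unfolding ab'(5) a'_def[symmetric] using ab' 1 g by (simp add: \<beta>_prod)
  show "\<beta> g (R (\<beta> (inv\<^bsub>G\<^esub> g) a)) \<otimes>\<^bsub>B\<^esub> b = a \<otimes>\<^bsub>B\<^esub> \<beta> g (L (\<beta> (inv\<^bsub>G\<^esub> g) b))"
    unfolding a'_def[symmetric] b'_def[symmetric] using ab'(1,2) 1(5)[OF ab'(1,2)] 1(6)[OF ab'(1)] 1(7)[OF ab'(2)] g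
    by (simp only: ab'(3,4) \<beta>_prod[symmetric])
qed

lemma multiplier_action_additive:
  assumes g: "g \<in> carrier G" shows "additive_map \<M> \<M> (multiplier_action B \<beta> g)"
proof (rule additive_mapI)
  fix m n assume mn: "m \<in> carrier \<M>" "n \<in> carrier \<M>"
  obtain R L where m: "m = (R, L)" by (cases m)
  obtain R' L' where n: "n = (R', L')" by (cases n)
  have g': "inv\<^bsub>G\<^esub> g \<in> carrier G" using g by simp
  note 1 = multiplierD(6,7)[OF mn(1)[unfolded m]] and 2 = multiplierD(6,7)[OF mn(2)[unfolded n]]
  show "multiplier_action B \<beta> g m \<in> carrier \<M>" using multiplier_action_closed[OF g] mn(1) by (simp add: m)
  show "multiplier_action B \<beta> g (m \<oplus>\<^bsub>\<M>\<^esub> n) = multiplier_action B \<beta> g m \<oplus>\<^bsub>\<M>\<^esub> multiplier_action B \<beta> g n"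
    unfolding m n multiplier_simps hom_group_simps multiplier_action_eq[OF g]
    using 1 2 g g' by (intro arg_cong2[where f = Pair] restrict_ext) (simp_all add: \<beta>_closed \<beta>_add)
qed

end

section \<open>The representation of S(G) on A in coordinates\<close>

context enveloped_product
begin

abbreviation "step g a \<equiv> \<alpha> g (u (inv\<^bsub>G\<^esub> g) \<otimes>\<^bsub>A\<^esub> a)"

lemma u_closed: "g \<in> carrier G \<Longrightarrow> u g \<in> carrier A"
  using U.central_u[of g] by (simp add: central_idempotents_def)

lemma u_mult_D: "\<lbrakk>g \<in> carrier G; a \<in> carrier A\<rbrakk> \<Longrightarrow> u g \<otimes>\<^bsub>A\<^esub> a \<in> D g"
  using U.D_eq by auto

lemma linear_step:
  assumes g: "g \<in> carrier G" shows "linear_map K A A (step g)"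
proof -
  have g': "inv\<^bsub>G\<^esub> g \<in> carrier G" using g by simp
  have \<alpha>: "\<And>a. a \<in> D (inv\<^bsub>G\<^esub> g) \<Longrightarrow> \<alpha> g a \<in> carrier A"
    "\<And>a b. \<lbrakk>a \<in> D (inv\<^bsub>G\<^esub> g); b \<in> D (inv\<^bsub>G\<^esub> g)\<rbrakk> \<Longrightarrow> \<alpha> g (a \<oplus>\<^bsub>A\<^esub> b) = \<alpha> g a \<oplus>\<^bsub>A\<^esub> \<alpha> g b"
    "\<And>k a. \<lbrakk>k \<in> carrier K; a \<in> D (inv\<^bsub>G\<^esub> g)\<rbrakk> \<Longrightarrow> \<alpha> g (k \<odot>\<^bsub>A\<^esub> a) = k \<odot>\<^bsub>A\<^esub> \<alpha> g a"
    using U.hom_\<alpha>[OF g] by (auto simp: algebra_hom_on_def)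
  note D = u_mult_D[OF g'] and u = u_closed[OF g']
  show ?thesis
    unfolding linear_map_def
    by (intro conjI additive_mapI ballI)
      (simp_all add: \<alpha> D u U.alg.r_distr U.alg.alg_smult_right)
qed

text \<open>The image of the unit of the domain ideal is the product of the units of A and of its
  translate by \<open>inv g\<close>; applying \<open>\<beta> g\<close> turns them into the units of
  the translate by g and of A.\<close>

lemma \<phi>_step:
  assumes g: "g \<in> carrier G" and a: "a \<in> carrier A"
  shows "\<phi> (step g a) = unit_of g \<otimes>\<^bsub>B\<^esub> \<phi> \<one>\<^bsub>A\<^esub> \<otimes>\<^bsub>B\<^esub> \<beta> g (\<phi> a)"
proof -
  have g': "inv\<^bsub>G\<^esub> g \<in> carrier G" using g by simp
  have one: "\<phi> \<one>\<^bsub>A\<^esub> \<in> carrier B" by (simp add: \<phi>_closed)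
  have "\<phi> (step g a) = \<beta> g (\<phi> (u (inv\<^bsub>G\<^esub> g) \<otimes>\<^bsub>A\<^esub> a))"
    by (rule E.equivariant[OF g u_mult_D[OF g' a]])
  also have "\<dots> = \<beta> g (\<phi> \<one>\<^bsub>A\<^esub>) \<otimes>\<^bsub>B\<^esub> \<beta> g (unit_of (inv\<^bsub>G\<^esub> g)) \<otimes>\<^bsub>B\<^esub> \<beta> g (\<phi> a)"
    using g g' a one u_closed[OF g'] unit_of_closed[OF g']
    by (simp add: \<phi>_prod \<phi>_u \<beta>_prod \<beta>_closed B_closed \<phi>_closed)
  also have "\<beta> g (unit_of (inv\<^bsub>G\<^esub> g)) = \<phi> \<one>\<^bsub>A\<^esub>" using g g' by (simp add: \<beta>_unit_of unit_of_one)
  finally show ?thesis by (simp only: unit_of_def)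
qed

text \<open>By minimality the point x either absorbs the unit of the translate by g or annihilates
  it, according to whether g is in the star.\<close>

lemma coordinate_step:
  assumes g: "g \<in> carrier G" and a: "a \<in> carrier A" and x: "x \<in> points" "\<one>\<^bsub>G\<^esub> \<in> star x"
  shows "x \<otimes>\<^bsub>B\<^esub> \<phi> (step g a) =
    (if g \<in> star x then \<beta> g (\<beta> (inv\<^bsub>G\<^esub> g) x \<otimes>\<^bsub>B\<^esub> \<phi> a) else \<zero>\<^bsub>B\<^esub>)"
proof -
  note xc = pointD(1)[OF x(1)] and ug = unit_of_closed[OF g]
  have one: "\<phi> \<one>\<^bsub>A\<^esub> \<in> carrier B" by (simp add: \<phi>_closed)
  have ba: "\<beta> g (\<phi> a) \<in> carrier B" using g a by (simp add: \<beta>_closed \<phi>_closed)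
  have eq: "x \<otimes>\<^bsub>B\<^esub> \<phi> (step g a) = ((x \<otimes>\<^bsub>B\<^esub> unit_of g) \<otimes>\<^bsub>B\<^esub> \<phi> \<one>\<^bsub>A\<^esub>) \<otimes>\<^bsub>B\<^esub> \<beta> g (\<phi> a)"
    using xc ug one ba by (simp add: \<phi>_step[OF g a] B_assoc B_closed)
  show ?thesis
  proof (cases "g \<in> star x")
    case True
    have "x \<otimes>\<^bsub>B\<^esub> unit_of g = x" "x \<otimes>\<^bsub>B\<^esub> \<phi> \<one>\<^bsub>A\<^esub> = x" using True x(2) by (auto simp: star_def unit_of_one)
    moreover have "\<beta> g (\<beta> (inv\<^bsub>G\<^esub> g) x \<otimes>\<^bsub>B\<^esub> \<phi> a) = x \<otimes>\<^bsub>B\<^esub> \<beta> g (\<phi> a)"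
      using g a xc by (simp add: \<beta>_prod \<beta>_closed \<phi>_closed \<beta>_inv(2))
    ultimately show ?thesis using True by (simp add: eq)
  next
    case False
    then have "x \<otimes>\<^bsub>B\<^esub> unit_of g = \<zero>\<^bsub>B\<^esub>" by (rule not_star[OF x(1) g])
    then show ?thesis using False one ba by (simp add: eq)
  qed
qed

abbreviation "wact \<equiv> word_action A G \<alpha> u"

lemma wact_simps [simp]: "wact [] a = a" "wact (g # w) a = step g (wact w a)"
  by (simp_all add: word_action_def)

lemma wact_append: "wact (v @ w) a = wact v (wact w a)"
  by (induction v) simp_all

lemma linear_wact: "w \<in> lists (carrier G) \<Longrightarrow> linear_map K A A (wact w)"
proof (induction w)
  case Nil
  then show ?case using linear_map_id[of K A] by simp
next
  case (Cons g w)
  then show ?case using linear_map_comp[of K A A "wact w" A "step g"] linear_step[of g] by simp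
qed

lemma wact_closed: "\<lbrakk>w \<in> lists (carrier G); a \<in> carrier A\<rbrakk> \<Longrightarrow> wact w a \<in> carrier A"
  by (rule linear_map_closed[OF linear_wact])

text \<open>The prefix products of \<open>g # w\<close> are 1 and the g-translates of those of w.
  Since 1 is in the star of x, the condition at x becomes the condition on w at the point translated
  back by g.\<close>

lemma coordinate_wact:
  assumes "w \<in> lists (carrier G)" and a: "a \<in> carrier A" and "x \<in> points" "\<one>\<^bsub>G\<^esub> \<in> star x"
  shows "x \<otimes>\<^bsub>B\<^esub> \<phi> (wact w a) =
    (if word_support G w \<subseteq> star x
     then \<beta> (word_deg G w) (\<beta> (inv\<^bsub>G\<^esub> word_deg G w) x \<otimes>\<^bsub>B\<^esub> \<phi> a) else \<zero>\<^bsub>B\<^esub>)"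
  using assms(1,3,4)
proof (induction w arbitrary: x)
  case Nil
  then have "\<beta> (inv\<^bsub>G\<^esub> \<one>\<^bsub>G\<^esub>) x = x" using pointD(1) by (simp add: E.ga.\<beta>_one)
  then show ?case using Nil a pointD(1) by (simp add: E.ga.\<beta>_one B_closed \<phi>_closed)
next
  case (Cons g w)
  have g: "g \<in> carrier G" and w: "w \<in> lists (carrier G)" using Cons.hyps by auto
  have g': "inv\<^bsub>G\<^esub> g \<in> carrier G" using g by simp
  note x = Cons.prems
  define y where "y = \<beta> (inv\<^bsub>G\<^esub> g) x"
  have y: "y \<in> points" unfolding y_def by (rule \<beta>_point[OF g' x(1)])
  have xy: "x = \<beta> g y" unfolding y_def using \<beta>_inv(2)[OF g pointD(1)[OF x(1)]] by simp
  have sub: "translate G g (word_support G w) \<subseteq> star x \<longleftrightarrow> word_support G w \<subseteq> star y"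
    using star_mult[OF _ g y] G.word_support_closed[OF w] unfolding xy translate_def by auto
  have gx: "g \<in> star x \<longleftrightarrow> \<one>\<^bsub>G\<^esub> \<in> star y" using star_mult[OF _ g y, of "\<one>\<^bsub>G\<^esub>"] g unfolding xy by simp
  show ?case
  proof (cases "g \<in> star x")
    case True
    let ?d = "word_deg G w"
    have d: "?d \<in> carrier G" using w by (rule G.word_deg_closed)
    note IH = Cons.IH[OF y gx[THEN iffD1, OF True]]
    have inv: "\<beta> (inv\<^bsub>G\<^esub> (g \<otimes>\<^bsub>G\<^esub> ?d)) x = \<beta> (inv\<^bsub>G\<^esub> ?d) y"
      unfolding y_def using g d pointD(1)[OF x(1)] by (simp add: E.ga.\<beta>_comp U.grp.inv_mult_group)
    have closed: "\<beta> (inv\<^bsub>G\<^esub> ?d) y \<otimes>\<^bsub>B\<^esub> \<phi> a \<in> carrier B"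
      using d a pointD(1)[OF y] by (simp add: B_closed \<beta>_closed \<phi>_closed)
    have "x \<otimes>\<^bsub>B\<^esub> \<phi> (wact (g # w) a) = \<beta> g (y \<otimes>\<^bsub>B\<^esub> \<phi> (wact w a))"
      using coordinate_step[OF g wact_closed[OF w a] x] True by (simp add: y_def)
    also have "\<dots> = (if word_support G w \<subseteq> star y
        then \<beta> (g \<otimes>\<^bsub>G\<^esub> ?d) (\<beta> (inv\<^bsub>G\<^esub> (g \<otimes>\<^bsub>G\<^esub> ?d)) x \<otimes>\<^bsub>B\<^esub> \<phi> a) else \<zero>\<^bsub>B\<^esub>)"
      unfolding IH inv using g d closed by (simp add: E.ga.\<beta>_comp \<beta>_zero)
    finally show ?thesis using x(2) by (simp add: sub)
  next
    case False
    \<comment> \<open>The support of w contains 1, and 1 is in the star of y exactly if g is in that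
      of x. So the condition fails on the right while the first step vanishes on the left.\<close>
    then have "\<not> word_support G w \<subseteq> star y" using gx G.one_in_word_support by blast
    then show ?thesis
      using coordinate_step[OF g wact_closed[OF w a] x] False by (simp add: sub)
  qed
qed

definition rep :: "'g list set \<Rightarrow> 'a \<Rightarrow> 'a" where
  "rep s a = the_elem ((\<lambda>w. wact w a) ` s)"

text \<open>Components of the action of a word depend only on its support and degree, which
  determine its class. This shows well-definedness without going through the defining
  relations.\<close>

lemma rep_class:
  assumes w: "w \<in> lists (carrier G)" and a: "a \<in> carrier A"
  shows "rep (par_class G w) a = wact w a"
proof -
  have "wact v a = wact w a" if "v \<in> par_class G w" for v
  proof -
    have v: "v \<in> lists (carrier G)" "word_support G v = word_support G w" "word_deg G v = word_deg G w"
      using that w by (auto simp: G.par_class_eq)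
    show ?thesis
    proof (rule coordinates_inj[OF wact_closed[OF v(1) a] wact_closed[OF w a]])
      fix x assume x: "x \<in> points" "\<one>\<^bsub>G\<^esub> \<in> star x"
      show "x \<otimes>\<^bsub>B\<^esub> \<phi> (wact v a) = x \<otimes>\<^bsub>B\<^esub> \<phi> (wact w a)"
        by (simp only: coordinate_wact[OF v(1) a x] coordinate_wact[OF w a x] v(2,3))
    qed
  qed
  moreover have "w \<in> par_class G w" using w by (simp add: G.par_class_eq)
  ultimately have "(\<lambda>w. wact w a) ` par_class G w = {wact w a}" by blast
  then show ?thesis by (simp add: rep_def)
qed

lemma partial_action_module_eq: "partial_action_module K A G \<alpha> u = rep_module K G.S A rep"
  by (simp add: partial_action_module_def rep_module_def rep_def)

lemma monoid_rep_A: "monoid_rep K G.S A rep"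
proof (intro monoid_rep.intro monoid_rep_axioms.intro G.monoid_S U.alg.R.is_cring)
  show "left_module K A" by (rule left_module_of_module) (rule U.alg.module_axioms)
next
  fix s assume "s \<in> carrier G.S"
  then obtain w where w: "w \<in> lists (carrier G)" and s: "s = par_class G w" by (rule G.par_class_cases)
  have lin: "linear_map K A A (wact w)" using w by (rule linear_wact)
  then show "linear_map K A A (rep s)"
    unfolding linear_map_def additive_map_def s Pi_iff using w by (simp add: rep_class)
next
  fix a assume "a \<in> carrier A"
  then show "rep \<one>\<^bsub>G.S\<^esub> a = a" by (simp add: G.par_one rep_class)
next
  fix s t a assume s: "s \<in> carrier G.S" and t: "t \<in> carrier G.S" and a: "a \<in> carrier A"
  obtain v where v: "v \<in> lists (carrier G)" and s: "s = par_class G v" using s by (rule G.par_class_cases)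
  obtain w where w: "w \<in> lists (carrier G)" and t: "t = par_class G w" using t by (rule G.par_class_cases)
  show "rep (s \<otimes>\<^bsub>G.S\<^esub> t) a = rep s (rep t a)"
    using v w a by (simp add: s t G.par_class_mult rep_class wact_append wact_closed)
qed

lemma coordinate_rep:
  assumes "s \<in> carrier G.S" and a: "a \<in> carrier A" and x: "x \<in> points" "\<one>\<^bsub>G\<^esub> \<in> star x"
  shows "x \<otimes>\<^bsub>B\<^esub> \<phi> (rep s a) =
    (if par_support G s \<subseteq> star x
     then \<beta> (par_degree G s) (\<beta> (inv\<^bsub>G\<^esub> par_degree G s) x \<otimes>\<^bsub>B\<^esub> \<phi> a) else \<zero>\<^bsub>B\<^esub>)"
proof -
  obtain w where w: "w \<in> lists (carrier G)" and s: "s = par_class G w" using assms(1) by (rule G.par_class_cases)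
  show ?thesis
    unfolding s G.par_support_class[OF w] G.par_degree_class[OF w] rep_class[OF w a]
    by (rule coordinate_wact[OF w a x])
qed

text \<open>G moves the points and the values by the same map \<beta>. The component of a multiplier
  (R, L) at x is L x, hence \<open>snd\<close>.\<close>

lemma point_coordinates:
  "point_coordinates G K B A rep \<M> points V \<beta> \<beta> star (\<lambda>a x. x \<otimes>\<^bsub>B\<^esub> \<phi> a) (multiplier_action B \<beta>) snd"
proof (intro point_coordinates.intro point_coordinates_axioms.intro partial_group_ring.intro
    G.word_group_axioms U.alg.R.is_cring abelian_B monoid_rep_A abelian_group_multiplier)
  show "\<exists>a\<in>carrier A. \<forall>x\<in>points. \<one>\<^bsub>G\<^esub> \<in> star x \<longrightarrow> x \<otimes>\<^bsub>B\<^esub> \<phi> a = f x"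
    if "\<And>x. \<lbrakk>x \<in> points; \<one>\<^bsub>G\<^esub> \<in> star x\<rbrakk> \<Longrightarrow> f x \<in> V x" for f
    by (rule coordinates_surj) (rule that)
  show "\<exists>m\<in>carrier \<M>. \<forall>x\<in>points. snd m x = f x" if "\<And>x. x \<in> points \<Longrightarrow> f x \<in> V x" for f
    by (rule multiplier_surj) (rule that)
  show "snd m x \<in> V x" if "m \<in> carrier \<M>" "x \<in> points" for m x
    using multiplier_point(1)[of "fst m" "snd m" x "\<zero>\<^bsub>B\<^esub>"] that by simp
  show "snd (m \<oplus>\<^bsub>\<M>\<^esub> m') x = snd m x \<oplus>\<^bsub>B\<^esub> snd m' x" if "x \<in> points" for m m' x
    using pointD(1)[OF that] by (cases m; cases m') (simp add: multiplier_simps hom_group_simps)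
  show "snd (multiplier_action B \<beta> g m) x = \<beta> g (snd m (\<beta> (inv\<^bsub>G\<^esub> g) x))"
    if "g \<in> carrier G" "x \<in> points" for g m x
    using pointD(1)[OF that(2)] by (cases m) (simp add: multiplier_action_eq[OF that(1)])
  show "m = m'" if "m \<in> carrier \<M>" "m' \<in> carrier \<M>" "\<And>x. x \<in> points \<Longrightarrow> snd m x = snd m' x" for m m'
    by (rule multiplier_inj[OF that])
  show "a = b" if "a \<in> carrier A" "b \<in> carrier A"
    "\<And>x. \<lbrakk>x \<in> points; \<one>\<^bsub>G\<^esub> \<in> star x\<rbrakk> \<Longrightarrow> x \<otimes>\<^bsub>B\<^esub> \<phi> a = x \<otimes>\<^bsub>B\<^esub> \<phi> b" for a b
    by (rule coordinates_inj[OF that])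
  show "V x \<subseteq> carrier B" for x by (auto simp: V_def)
  show "\<zero>\<^bsub>B\<^esub> \<in> V x" if "x \<in> points" for x using pointD(1)[OF that] by (simp add: V_def)
  show "star x \<subseteq> carrier G" for x by (auto simp: star_def)
  show "x \<otimes>\<^bsub>B\<^esub> \<phi> (a \<oplus>\<^bsub>A\<^esub> b) = x \<otimes>\<^bsub>B\<^esub> \<phi> a \<oplus>\<^bsub>B\<^esub> x \<otimes>\<^bsub>B\<^esub> \<phi> b"
    if "a \<in> carrier A" "b \<in> carrier A" "x \<in> points" for a b x
    using that pointD(1) by (simp add: \<phi>_add \<phi>_closed E.ga.alg.alg_r_distr)
qed (simp_all add: pointD(1) V_minus \<beta>_point E.ga.\<beta>_one E.ga.\<beta>_comp \<beta>_additive \<beta>_V star_nonempty star_mult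
    mult_point_V \<phi>_closed coordinate_rep multiplier_action_additive)

lemma partial_cohomology_multiplier:
  "partial_cohomology K G n (partial_action_module K A G \<alpha> u) \<cong>
   group_cohomology G \<M> (multiplier_action B \<beta>) n"
  unfolding partial_action_module_eq
  by (rule point_coordinates.partial_cohomology_group_cohomology[OF point_coordinates])

end

theorem corollary3p23:
  fixes K :: "'k ring" and A :: "('k, 'a) module" and B :: "('k, 'b) module"
    and G :: "'g monoid"
    and \<Lambda> :: "'i set" and A\<^sub>\<Lambda> :: "'i \<Rightarrow> 'r ring"
    and D :: "'g \<Rightarrow> 'a set" and \<alpha> :: "'g \<Rightarrow> 'a \<Rightarrow> 'a" and u :: "'g \<Rightarrow> 'a"
    and \<beta> :: "'g \<Rightarrow> 'b \<Rightarrow> 'b" and \<phi> :: "'a \<Rightarrow> 'b" and n :: nat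
  assumes "\<And>i. i \<in> \<Lambda> \<Longrightarrow> indecomposable_ring (A\<^sub>\<Lambda> i)"
    and "A \<simeq> ring_product \<Lambda> A\<^sub>\<Lambda>"
    and "unital_partial_action K A G D \<alpha> u"
    and "enveloping_action K A G D \<alpha> B \<beta> \<phi>"
  shows "partial_cohomology K G n (partial_action_module K A G \<alpha> u) \<cong>
         group_cohomology G (multiplier_algebra K B) (multiplier_action B \<beta>) n"
proof -
  interpret U: unital_partial_action K A G D \<alpha> u by fact
  obtain \<epsilon> where \<epsilon>: "\<And>i. i \<in> \<Lambda> \<Longrightarrow> \<epsilon> i \<in> central_idempotents A"
    "\<And>i e. \<lbrakk>i \<in> \<Lambda>; e \<in> central_idempotents A\<rbrakk> \<Longrightarrow> \<epsilon> i \<otimes>\<^bsub>A\<^esub> e = \<epsilon> i \<or> \<epsilon> i \<otimes>\<^bsub>A\<^esub> e = \<zero>\<^bsub>A\<^esub>"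
    "\<And>a b. \<lbrakk>a \<in> carrier A; b \<in> carrier A; \<And>i. i \<in> \<Lambda> \<Longrightarrow> \<epsilon> i \<otimes>\<^bsub>A\<^esub> a = \<epsilon> i \<otimes>\<^bsub>A\<^esub> b\<rbrakk> \<Longrightarrow> a = b"
    "\<And>c. (\<And>i. i \<in> \<Lambda> \<Longrightarrow> c i \<in> carrier A) \<Longrightarrow> \<exists>a\<in>carrier A. \<forall>i\<in>\<Lambda>. \<epsilon> i \<otimes>\<^bsub>A\<^esub> a = \<epsilon> i \<otimes>\<^bsub>A\<^esub> c i"
    using product_idempotents[of \<Lambda> A\<^sub>\<Lambda> A, OF assms(1) assms(2) U.alg.ring_axioms] by blast
  have "enveloped_product K A G D \<alpha> u B \<beta> \<phi> \<Lambda> \<epsilon>"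
  proof (intro enveloped_product.intro enveloped_product_axioms.intro assms(3,4))
    show "a = b" if "a \<in> carrier A" "b \<in> carrier A" "\<And>i. i \<in> \<Lambda> \<Longrightarrow> \<epsilon> i \<otimes>\<^bsub>A\<^esub> a = \<epsilon> i \<otimes>\<^bsub>A\<^esub> b" for a b
      by (rule \<epsilon>(3)[OF that])
    show "\<exists>a\<in>carrier A. \<forall>i\<in>\<Lambda>. \<epsilon> i \<otimes>\<^bsub>A\<^esub> a = \<epsilon> i \<otimes>\<^bsub>A\<^esub> c i" if "\<And>i. i \<in> \<Lambda> \<Longrightarrow> c i \<in> carrier A" for c
      by (rule \<epsilon>(4)[OF that])
  qed (rule \<epsilon>(1,2), assumption+)+
  then show ?thesis by (rule enveloped_product.partial_cohomology_multiplier)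
qed

end
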